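(* Let $k=0$. Let $(\mathbf u,p)\in[H^2(\Omega)\cap H^1_0(\Omega)]^2\times(H^1(\Omega)\cap L^2_0(\Omega))$ solve the Stokes problem $-\Delta\mathbf u+\nabla p=\mathbf f$, $\operatorname{div}\mathbf u=0$ in $\Omega$, $\mathbf u=\mathbf 0$ on $\partial\Omega$, with $\mathbf f\in[L^2(\Omega)]^2$. Let $(\mathbf u_h,p_h)\in V_h\times M_h$ solve the weak Galerkin scheme $$(\nabla_w\mathbf u_h,\nabla_w\mathbf v)_h-(p_h,\operatorname{div}_w\mathbf v)_h=(\mathbf f,\mathbf v^0)\quad\forall\,\mathbf v\in V_h,$$ $$(\operatorname{div}_w\mathbf u_h,q_h)_h=0\quad\forall\,q_h\in M_h.$$ Then there is a constant $C$ independent of $h$ such that $$\|\nabla\mathbf u-\nabla_w\mathbf u_h\|_h+\|p-p_h\|\le Ch(\|\mathbf u\|_2+\|p\|_1).$$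
   Context: Let $\Omega\subset\mathbb R^2$ be a convex polygonal domain. Let $T_h$ be a shape-regular triangulation into triangles $K$, with $h=\max_K\operatorname{diam}K$. For $k=0$ the local space is $W_{0,1}(K)=\{\{v^0,v^b\}: v^0\in P_0(K),\ v^b\in P_1(\partial K)\}$, where $P_1(\partial K)$ means degree at most 1 on each edge. The weak gradient $\nabla_wv\in[P_1(K)]^2$ is defined by $\int_K\nabla_wv\cdot\mathbf q=-\int_Kv^0\operatorname{div}\mathbf q+\int_{\partial K}v^b\mathbf q\cdot\mathbf n$ for all $\mathbf q\in[P_1(K)]^2$, taken row-wise for vectors. The weak divergence $\operatorname{div}_w\mathbf v\in P_1(K)$ is defined by $\int_K\operatorname{div}_w\mathbf v\,q=-\int_K\mathbf v^0\cdot\nabla q+\int_{\partial K}\mathbf v^b\cdot\mathbf n\,q$ for all $q\in P_1(K)$. Both are applied elementwise. $S_h^0$ is the set of weak functions with $v|_K\in W_{0,1}(K)$, $v^b$ single-valued on interior edges, and $v^b=0$ on $\partial\Omega$. $V_h=[S_h^0]^2$ and $M_h=\{q\in L^2_0(\Omega): q|_K\in P_0(K)\}$. $(u,v)_h=\sum_K\int_Kuv$ (summed over entries), $\|u\|_h^2=(u,u)_h$, and $\|\cdot\|$, $\|\cdot\|_m$ are the $L^2(\Omega)$ and $H^m(\Omega)$ norms. *)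

theory Defs
  imports "HOL-Analysis.Analysis"
begin

type_synonym pt = "real^2"

definition pd :: "2 \<Rightarrow> (pt \<Rightarrow> real) \<Rightarrow> pt \<Rightarrow> real" where
  "pd i \<phi> = (\<lambda>x. frechet_derivative \<phi> (at x) (axis i 1))"

fun pds :: "2 list \<Rightarrow> (pt \<Rightarrow> real) \<Rightarrow> pt \<Rightarrow> real" where
  "pds [] \<phi> = \<phi>"
| "pds (i # is) \<phi> = pd i (pds is \<phi>)"

definition smooth_fun :: "(pt \<Rightarrow> real) \<Rightarrow> bool" where
  "smooth_fun \<phi> \<longleftrightarrow> (\<forall>is x. pds is \<phi> differentiable (at x))"

definition test_fun :: "pt set \<Rightarrow> (pt \<Rightarrow> real) \<Rightarrow> bool" where
  "test_fun \<Omega> \<phi> \<longleftrightarrow> smooth_fun \<phi> \<and> compact (closure {x. \<phi> x \<noteq> 0})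
     \<and> closure {x. \<phi> x \<noteq> 0} \<subseteq> \<Omega>"

definition L2 :: "pt set \<Rightarrow> (pt \<Rightarrow> real) \<Rightarrow> bool" where
  "L2 \<Omega> u \<longleftrightarrow> u \<in> borel_measurable (lebesgue_on \<Omega>)
     \<and> integrable (lebesgue_on \<Omega>) (\<lambda>x. (u x)\<^sup>2)"

definition is_wderiv :: "pt set \<Rightarrow> 2 \<Rightarrow> (pt \<Rightarrow> real) \<Rightarrow> (pt \<Rightarrow> real) \<Rightarrow> bool" where
  "is_wderiv \<Omega> i u g \<longleftrightarrow> (\<forall>\<phi>. test_fun \<Omega> \<phi> \<longrightarrow>
     integral\<^sup>L (lebesgue_on \<Omega>) (\<lambda>x. u x * pd i \<phi> x)
       = - integral\<^sup>L (lebesgue_on \<Omega>) (\<lambda>x. g x * \<phi> x))"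

text \<open>The weak partial derivative (determined up to null sets).\<close>
definition wd :: "pt set \<Rightarrow> 2 \<Rightarrow> (pt \<Rightarrow> real) \<Rightarrow> pt \<Rightarrow> real" where
  "wd \<Omega> i u = (SOME g. L2 \<Omega> g \<and> is_wderiv \<Omega> i u g)"

definition H1 :: "pt set \<Rightarrow> (pt \<Rightarrow> real) \<Rightarrow> bool" where
  "H1 \<Omega> u \<longleftrightarrow> L2 \<Omega> u \<and> (\<forall>i. \<exists>g. L2 \<Omega> g \<and> is_wderiv \<Omega> i u g)"

definition H2 :: "pt set \<Rightarrow> (pt \<Rightarrow> real) \<Rightarrow> bool" where
  "H2 \<Omega> u \<longleftrightarrow> H1 \<Omega> u \<and> (\<forall>i. H1 \<Omega> (wd \<Omega> i u))"

definition L2norm :: "pt set \<Rightarrow> (pt \<Rightarrow> real) \<Rightarrow> real" where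
  "L2norm \<Omega> u = sqrt (integral\<^sup>L (lebesgue_on \<Omega>) (\<lambda>x. (u x)\<^sup>2))"

definition H1norm :: "pt set \<Rightarrow> (pt \<Rightarrow> real) \<Rightarrow> real" where
  "H1norm \<Omega> u = sqrt (integral\<^sup>L (lebesgue_on \<Omega>) (\<lambda>x. (u x)\<^sup>2)
     + (\<Sum>i\<in>UNIV. integral\<^sup>L (lebesgue_on \<Omega>) (\<lambda>x. (wd \<Omega> i u x)\<^sup>2)))"

definition H2norm :: "pt set \<Rightarrow> (pt \<Rightarrow> real) \<Rightarrow> real" where
  "H2norm \<Omega> u = sqrt (integral\<^sup>L (lebesgue_on \<Omega>) (\<lambda>x. (u x)\<^sup>2)
     + (\<Sum>i\<in>UNIV. integral\<^sup>L (lebesgue_on \<Omega>) (\<lambda>x. (wd \<Omega> i u x)\<^sup>2))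
     + (\<Sum>i\<in>UNIV. \<Sum>j\<in>UNIV. integral\<^sup>L (lebesgue_on \<Omega>) (\<lambda>x. (wd \<Omega> j (wd \<Omega> i u) x)\<^sup>2)))"

definition H10 :: "pt set \<Rightarrow> (pt \<Rightarrow> real) \<Rightarrow> bool" where
  "H10 \<Omega> u \<longleftrightarrow> H1 \<Omega> u \<and> (\<exists>\<phi>. (\<forall>n. test_fun \<Omega> (\<phi> n))
     \<and> (\<lambda>n. H1norm \<Omega> (\<lambda>x. \<phi> n x - u x)) \<longlonglongrightarrow> 0)"

definition vcomp :: "(pt \<Rightarrow> real^2) \<Rightarrow> 2 \<Rightarrow> pt \<Rightarrow> real" where
  "vcomp u j = (\<lambda>x. u x $ j)"

definition vH2norm :: "pt set \<Rightarrow> (pt \<Rightarrow> real^2) \<Rightarrow> real" where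
  "vH2norm \<Omega> u = sqrt (\<Sum>j\<in>UNIV. (H2norm \<Omega> (vcomp u j))\<^sup>2)"

definition stokes_solution :: "pt set \<Rightarrow> (pt \<Rightarrow> real^2) \<Rightarrow> (pt \<Rightarrow> real^2) \<Rightarrow> (pt \<Rightarrow> real) \<Rightarrow> bool" where
  "stokes_solution \<Omega> f u p \<longleftrightarrow>
     (\<forall>j. H2 \<Omega> (vcomp u j) \<and> H10 \<Omega> (vcomp u j))
     \<and> H1 \<Omega> p \<and> integral\<^sup>L (lebesgue_on \<Omega>) p = 0
     \<and> (\<forall>j. AE x in lebesgue_on \<Omega>.
           - (\<Sum>i\<in>UNIV. wd \<Omega> i (wd \<Omega> i (vcomp u j)) x) + wd \<Omega> j p x = f x $ j)
     \<and> (AE x in lebesgue_on \<Omega>. (\<Sum>i\<in>UNIV. wd \<Omega> i (vcomp u i) x) = 0)"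

definition convex_polygon :: "pt set \<Rightarrow> bool" where
  "convex_polygon \<Omega> \<longleftrightarrow> (\<exists>P. finite P \<and> \<Omega> = interior (convex hull P)) \<and> \<Omega> \<noteq> {}"

definition is_triangle :: "pt set \<Rightarrow> bool" where
  "is_triangle K \<longleftrightarrow> (\<exists>a b c. \<not> collinear {a, b, c} \<and> K = convex hull {a, b, c})"

definition tri_verts :: "pt set \<Rightarrow> pt set" where
  "tri_verts K = {x. x extreme_point_of K}"

definition tri_edges :: "pt set \<Rightarrow> pt set set" where
  "tri_edges K = {closed_segment a b | a b. a \<in> tri_verts K \<and> b \<in> tri_verts K \<and> a \<noteq> b}"

definition mesh_edges :: "pt set set \<Rightarrow> pt set set" where
  "mesh_edges T = \<Union> (tri_edges ` T)"

definition conf_triangulation :: "pt set \<Rightarrow> pt set set \<Rightarrow> bool" where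
  "conf_triangulation \<Omega> T \<longleftrightarrow> finite T \<and> T \<noteq> {} \<and> (\<forall>K\<in>T. is_triangle K)
     \<and> \<Union> T = closure \<Omega>
     \<and> (\<forall>K\<in>T. \<forall>K'\<in>T. K \<noteq> K' \<longrightarrow>
          K \<inter> K' = {}
        \<or> (\<exists>v. v \<in> tri_verts K \<and> v \<in> tri_verts K' \<and> K \<inter> K' = {v})
        \<or> (\<exists>e. e \<in> tri_edges K \<and> e \<in> tri_edges K' \<and> K \<inter> K' = e))"

definition inradius :: "pt set \<Rightarrow> real" where
  "inradius K = Sup {r. \<exists>x. ball x r \<subseteq> K}"

definition shape_regular :: "real \<Rightarrow> pt set set \<Rightarrow> bool" where
  "shape_regular \<sigma> T \<longleftrightarrow> (\<forall>K\<in>T. diameter K \<le> \<sigma> * inradius K)"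

definition meshsize :: "pt set set \<Rightarrow> real" where
  "meshsize T = Max (diameter ` T)"

definition kint :: "pt set \<Rightarrow> (pt \<Rightarrow> real) \<Rightarrow> real" where
  "kint K g = integral\<^sup>L (lebesgue_on K) g"

definition edge_int :: "pt set \<Rightarrow> (pt \<Rightarrow> real) \<Rightarrow> real" where
  "edge_int e g = (let ab = (SOME (a, b). a \<noteq> b \<and> e = closed_segment a b)
     in dist (fst ab) (snd ab) * integral {0..1} (\<lambda>t. g ((1 - t) *\<^sub>R fst ab + t *\<^sub>R snd ab)))"

definition outer_normal :: "pt set \<Rightarrow> pt set \<Rightarrow> pt" where
  "outer_normal K e = (SOME n. norm n = 1 \<and> (\<forall>x\<in>e. \<forall>y\<in>e. n \<bullet> (x - y) = 0)
      \<and> (\<forall>x\<in>K. \<forall>y\<in>e. n \<bullet> (x - y) \<le> 0))"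

text \<open>Scalar weak gradient in [P_1(K)]^2 of {v0, vb}; vb is indexed by edges
  (so that it is automatically single valued on interior edges).
  Test fields q(x) = c + A x range over [P_1(K)]^2, with div q = trace A.\<close>
definition is_wgrad :: "pt set \<Rightarrow> real \<Rightarrow> (pt set \<Rightarrow> pt \<Rightarrow> real) \<Rightarrow> (pt \<Rightarrow> pt) \<Rightarrow> bool" where
  "is_wgrad K v0 vb G \<longleftrightarrow> (\<exists>c A. G = (\<lambda>x. c + A *v x))
     \<and> (\<forall>(c::pt) (A::real^2^2). kint K (\<lambda>x. G x \<bullet> (c + A *v x))
          = - kint K (\<lambda>x. v0 * (\<Sum>i\<in>UNIV. A $ i $ i))
            + (\<Sum>e\<in>tri_edges K. edge_int e (\<lambda>x. vb e x * ((c + A *v x) \<bullet> outer_normal K e))))"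

definition wgrad :: "pt set \<Rightarrow> real \<Rightarrow> (pt set \<Rightarrow> pt \<Rightarrow> real) \<Rightarrow> pt \<Rightarrow> pt" where
  "wgrad K v0 vb = (THE G. is_wgrad K v0 vb G)"

definition wgradv :: "pt set \<Rightarrow> real^2 \<Rightarrow> (pt set \<Rightarrow> pt \<Rightarrow> real^2) \<Rightarrow> pt \<Rightarrow> real^2^2" where
  "wgradv K v0 vb = (\<lambda>x. \<chi> i. wgrad K (v0 $ i) (\<lambda>e y. vb e y $ i) x)"

text \<open>Weak divergence in P_1(K); test functions q(x) = c + a.x, grad q = a.\<close>
definition is_wdiv :: "pt set \<Rightarrow> real^2 \<Rightarrow> (pt set \<Rightarrow> pt \<Rightarrow> real^2) \<Rightarrow> (pt \<Rightarrow> real) \<Rightarrow> bool" where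
  "is_wdiv K v0 vb d \<longleftrightarrow> (\<exists>c a. d = (\<lambda>x. c + a \<bullet> x))
     \<and> (\<forall>(c::real) (a::pt). kint K (\<lambda>x. d x * (c + a \<bullet> x))
          = - kint K (\<lambda>x. v0 \<bullet> a)
            + (\<Sum>e\<in>tri_edges K. edge_int e (\<lambda>x. (vb e x \<bullet> outer_normal K e) * (c + a \<bullet> x))))"

definition wdiv :: "pt set \<Rightarrow> real^2 \<Rightarrow> (pt set \<Rightarrow> pt \<Rightarrow> real^2) \<Rightarrow> pt \<Rightarrow> real" where
  "wdiv K v0 vb = (THE d. is_wdiv K v0 vb d)"

text \<open>V_h = [S_h^0]^2: v0 constant per triangle (value v0 K), vb affine on each
  mesh edge, zero on boundary edges.\<close>
definition in_Vh :: "pt set \<Rightarrow> pt set set \<Rightarrow> (pt set \<Rightarrow> real^2) \<Rightarrow> (pt set \<Rightarrow> pt \<Rightarrow> real^2) \<Rightarrow> bool" where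
  "in_Vh \<Omega> T v0 vb \<longleftrightarrow> (\<forall>e\<in>mesh_edges T.
      (\<exists>(c::real^2) (A::real^2^2). \<forall>x\<in>e. vb e x = c + A *v x)
    \<and> (e \<subseteq> frontier \<Omega> \<longrightarrow> (\<forall>x\<in>e. vb e x = 0)))"

text \<open>M_h: piecewise constants (value q K on K) with zero mean.\<close>
definition in_Mh :: "pt set set \<Rightarrow> (pt set \<Rightarrow> real) \<Rightarrow> bool" where
  "in_Mh T q \<longleftrightarrow> (\<Sum>K\<in>T. measure lebesgue K * q K) = 0"

definition wg_scheme :: "pt set \<Rightarrow> pt set set \<Rightarrow> (pt \<Rightarrow> real^2) \<Rightarrow> (pt set \<Rightarrow> real^2)
    \<Rightarrow> (pt set \<Rightarrow> pt \<Rightarrow> real^2) \<Rightarrow> (pt set \<Rightarrow> real) \<Rightarrow> bool" where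
  "wg_scheme \<Omega> T f uh0 uhb ph \<longleftrightarrow>
     (\<forall>v0 vb. in_Vh \<Omega> T v0 vb \<longrightarrow>
        (\<Sum>K\<in>T. kint K (\<lambda>x. \<Sum>i\<in>UNIV. wgradv K (uh0 K) uhb x $ i \<bullet> wgradv K (v0 K) vb x $ i))
        - (\<Sum>K\<in>T. kint K (\<lambda>x. ph K * wdiv K (v0 K) vb x))
        = (\<Sum>K\<in>T. kint K (\<lambda>x. f x \<bullet> v0 K)))
   \<and> (\<forall>q. in_Mh T q \<longrightarrow> (\<Sum>K\<in>T. kint K (\<lambda>x. wdiv K (uh0 K) uhb x * q K)) = 0)"

definition err_grad :: "pt set \<Rightarrow> pt set set \<Rightarrow> (pt \<Rightarrow> real^2) \<Rightarrow> (pt set \<Rightarrow> real^2)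
    \<Rightarrow> (pt set \<Rightarrow> pt \<Rightarrow> real^2) \<Rightarrow> real" where
  "err_grad \<Omega> T u uh0 uhb = sqrt (\<Sum>K\<in>T. kint K (\<lambda>x. \<Sum>i\<in>UNIV. \<Sum>j\<in>UNIV.
      (wd \<Omega> j (vcomp u i) x - wgradv K (uh0 K) uhb x $ i $ j)\<^sup>2))"

definition err_p :: "pt set set \<Rightarrow> (pt \<Rightarrow> real) \<Rightarrow> (pt set \<Rightarrow> real) \<Rightarrow> real" where
  "err_p T p ph = sqrt (\<Sum>K\<in>T. kint K (\<lambda>x. (p x - ph K)\<^sup>2))"

end

theory Submission
  imports Defs
begin

text \<open>Write \<open>D\<close> for the broken \<open>L\<^sup>2\<close> difference between the weak gradient of the discrete velocity and the
  gradient of the exact one, and \<open>\<rho>\<close> for the discrete pressure minus the cell averages of the exact one.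
  On a triangle the pairing of a smooth field with the trace of a weak function, minus its interior
  terms, is controlled by \<open>h\<close>, the gradient of the field and the weak gradient alone: after subtracting the
  constant cell value, the trace is recovered from the weak gradient by a Brezzi--Douglas--Marini
  lifting. Summing over the mesh, where the traces cancel along interior edges, and passing to Sobolev
  fields by mollification shows that \<open>(D, \<nabla>\<^sub>w v) - (\<rho>, div\<^sub>w v)\<close> is bounded by
  \<open>E = C h (\<parallel>u\<parallel>\<^sub>2 + \<parallel>p\<parallel>\<^sub>1)\<close> times the norm of \<open>\<nabla>\<^sub>w v\<close>. Let \<open>Q\<^sub>h \<phi>\<close> consist of the cell averages of \<open>\<phi>\<close> and
  its edgewise affine projections; its weak gradient is the projection of \<open>\<nabla>\<phi>\<close>.
  Testing with \<open>u\<^sub>h - Q\<^sub>h \<phi>\<^sub>n\<close>, where \<open>\<phi>\<^sub>n \<rightarrow> u\<close> are test functions, gives \<open>\<parallel>D\<parallel> \<le> 3 E\<close>. Testing with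
  \<open>Q\<^sub>h \<phi>\<close> and the continuous inf-sup condition then bounds \<open>\<rho>\<close>. The inf-sup condition follows from the
  Horgan--Payne inequality for conjugate harmonic functions on a convex domain.\<close>

section \<open>Square integrable families\<close>

text \<open>The scheme has no stabiliser, so every bound must be expressed by the weak gradient
  alone. This is possible because degrees of freedom match: edgewise affine normal traces are those
  of the lowest Brezzi--Douglas--Marini fields, and these are exactly the test fields of the weak
  gradient. Traces of Sobolev functions are never formed: edge integrals have continuous integrands,
  and limits are taken only in integrals over cells or the domain. This is why the interpolant is
  applied to test functions and not to \<open>u\<close>. The price is that \<open>Q_h \<phi>\<close>
  is only asymptotically divergence free; its pairing with \<open>\<rho>\<close> tends to zero.
  \<open>Q_h\<close> is also a Fortin operator: it preserves cell integrals of the divergence and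
  does not increase the gradient norm, so the continuous inf-sup condition acts directly on
  piecewise constants. The pressure enters the residual through the stress
  \<open>grad u - p I\<close>, whose row-wise divergence is \<open>- f\<close>. The mesh enters the
  constants only through \<open>diam(K)^2 / D\<close>, with \<open>D\<close> twice the area of
  \<open>K\<close>, which shape regularity bounds by \<open>\<sigma>^2\<close>; the domain enters
  only through the inf-sup constant.\<close>

definition sq_int :: "'a measure \<Rightarrow> ('a \<Rightarrow> real) \<Rightarrow> bool" where
  "sq_int M f \<longleftrightarrow> f \<in> borel_measurable M \<and> integrable M (\<lambda>x. (f x)\<^sup>2)"

lemma L2_iff_sq_int: "L2 S f \<longleftrightarrow> sq_int (lebesgue_on S) f" by (simp add: L2_def sq_int_def)

lemma sq_int_measurable: "sq_int M f \<Longrightarrow> f \<in> borel_measurable M" by (simp add: sq_int_def)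

lemma sq_int_integrable_mult:
  assumes "sq_int M f" "sq_int M g"
  shows "integrable M (\<lambda>x. f x * g x)"
proof (rule Bochner_Integration.integrable_bound)
  show "integrable M (\<lambda>x. (f x)\<^sup>2 + (g x)\<^sup>2)" using assms by (auto simp: sq_int_def)
  show "(\<lambda>x. f x * g x) \<in> borel_measurable M" using assms by (auto simp: sq_int_def)
  have "\<bar>a * b\<bar> \<le> a\<^sup>2 + b\<^sup>2" for a b :: real
  proof -
    have "2 * (\<bar>a\<bar> * \<bar>b\<bar>) \<le> a\<^sup>2 + b\<^sup>2" using sum_squares_bound[of "\<bar>a\<bar>" "\<bar>b\<bar>"] by simp
    moreover have "0 \<le> \<bar>a\<bar> * \<bar>b\<bar>" by simp
    ultimately show ?thesis unfolding abs_mult by linarith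
  qed
  then show "AE x in M. norm (f x * g x) \<le> norm ((f x)\<^sup>2 + (g x)\<^sup>2)" by simp
qed

lemma sq_int_add:
  assumes "sq_int M f" "sq_int M g"
  shows "sq_int M (\<lambda>x. f x + g x)"
proof -
  have "integrable M (\<lambda>x. (f x)\<^sup>2 + (g x)\<^sup>2 + 2 * (f x * g x))"
    using assms sq_int_integrable_mult[OF assms] by (auto simp: sq_int_def)
  moreover have "(\<lambda>x. (f x + g x)\<^sup>2) = (\<lambda>x. (f x)\<^sup>2 + (g x)\<^sup>2 + 2 * (f x * g x))" by (simp add: power2_sum mult.assoc)
  moreover have "(\<lambda>x. f x + g x) \<in> borel_measurable M"
    using assms by (intro borel_measurable_add) (auto simp: sq_int_def)
  ultimately show ?thesis by (simp add: sq_int_def)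
qed

lemma sq_int_cmult: "sq_int M f \<Longrightarrow> sq_int M (\<lambda>x. c * f x)" by (auto simp: sq_int_def power_mult_distrib)

lemma sq_int_uminus: "sq_int M f \<Longrightarrow> sq_int M (\<lambda>x. - f x)" by (auto simp: sq_int_def)

lemma sq_int_diff:
  assumes "sq_int M f" "sq_int M g"
  shows "sq_int M (\<lambda>x. f x - g x)"
  using sq_int_add[OF assms(1) sq_int_uminus[OF assms(2)]] by simp

lemma sq_int_zero [simp]: "sq_int M (\<lambda>x. 0)" by (simp add: sq_int_def)

lemma sq_int_sum:
  assumes "\<And>i. i \<in> I \<Longrightarrow> sq_int M (f i)"
  shows "sq_int M (\<lambda>x. \<Sum>i\<in>I. f i x)"
  using assms by (induction I rule: infinite_finite_induct) (auto intro: sq_int_add)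

lemma sq_int_bounded:
  assumes "finite_measure M" "f \<in> borel_measurable M" "\<And>x. x \<in> space M \<Longrightarrow> \<bar>f x\<bar> \<le> B"
  shows "sq_int M f"
proof -
  interpret finite_measure M by fact
  have "(f x)\<^sup>2 \<le> B\<^sup>2" if "x \<in> space M" for x using assms(3)[OF that] by (metis abs_ge_zero power2_abs power_mono)
  then have "integrable M (\<lambda>x. (f x)\<^sup>2)" using assms(2) by (intro integrable_const_bound[where B="B\<^sup>2"]) auto
  then show ?thesis using assms by (simp add: sq_int_def)
qed

lemma sq_int_imp_integrable:
  assumes "finite_measure M" "sq_int M f"
  shows "integrable M f"
proof -
  interpret finite_measure M by fact
  have "sq_int M (\<lambda>x. 1)" by (auto simp: sq_int_def)
  from sq_int_integrable_mult[OF assms(2) this] show ?thesis by simp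
qed

text \<open>A family of functions indexed by components and mesh cells is treated as one vector of a
  single semi-inner product space, so that all broken norms are instances of one notion.\<close>

definition sqs :: "'i set \<Rightarrow> ('i \<Rightarrow> 'a measure) \<Rightarrow> ('i \<Rightarrow> 'a \<Rightarrow> real) \<Rightarrow> bool" where
  "sqs I M F \<longleftrightarrow> (\<forall>i\<in>I. sq_int (M i) (F i))"

definition ip :: "'i set \<Rightarrow> ('i \<Rightarrow> 'a measure) \<Rightarrow> ('i \<Rightarrow> 'a \<Rightarrow> real) \<Rightarrow> ('i \<Rightarrow> 'a \<Rightarrow> real) \<Rightarrow> real" where
  "ip I M F G = (\<Sum>i\<in>I. \<integral>x. F i x * G i x \<partial>M i)"

definition nm :: "'i set \<Rightarrow> ('i \<Rightarrow> 'a measure) \<Rightarrow> ('i \<Rightarrow> 'a \<Rightarrow> real) \<Rightarrow> real" where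
  "nm I M F = sqrt (ip I M F F)"

lemma sqs_add: "sqs I M F \<Longrightarrow> sqs I M G \<Longrightarrow> sqs I M (\<lambda>i x. F i x + G i x)" by (simp add: sqs_def sq_int_add)

lemma sqs_diff: "sqs I M F \<Longrightarrow> sqs I M G \<Longrightarrow> sqs I M (\<lambda>i x. F i x - G i x)" by (simp add: sqs_def sq_int_diff)

lemma sqs_cmult: "sqs I M F \<Longrightarrow> sqs I M (\<lambda>i x. c * F i x)" by (simp add: sqs_def sq_int_cmult)

lemma ip_sym: "ip I M F G = ip I M G F" by (simp add: ip_def mult.commute)

lemma ip_nonneg: "0 \<le> ip I M F F" by (auto simp: ip_def intro!: sum_nonneg integral_nonneg)

lemma ip_add_left:
  assumes "sqs I M F" "sqs I M G" "sqs I M E"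
  shows "ip I M (\<lambda>i x. F i x + G i x) E = ip I M F E + ip I M G E"
proof -
  have "(\<integral>x. (F i x + G i x) * E i x \<partial>M i) = (\<integral>x. F i x * E i x \<partial>M i) + (\<integral>x. G i x * E i x \<partial>M i)"
    if "i \<in> I" for i using assms that by (simp add: sqs_def distrib_right sq_int_integrable_mult)
  then show ?thesis by (simp add: ip_def sum.distrib)
qed

lemma ip_diff_left:
  assumes "sqs I M F" "sqs I M G" "sqs I M E"
  shows "ip I M (\<lambda>i x. F i x - G i x) E = ip I M F E - ip I M G E"
proof -
  have "(\<integral>x. (F i x - G i x) * E i x \<partial>M i) = (\<integral>x. F i x * E i x \<partial>M i) - (\<integral>x. G i x * E i x \<partial>M i)"
    if "i \<in> I" for i using assms that by (simp add: sqs_def left_diff_distrib sq_int_integrable_mult)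
  then show ?thesis by (simp add: ip_def sum_subtractf)
qed

lemma ip_cmult_left: "ip I M (\<lambda>i x. c * F i x) G = c * ip I M F G" by (simp add: ip_def mult.assoc sum_distrib_left)

lemma ip_add_right:
  assumes "sqs I M F" "sqs I M G" "sqs I M E"
  shows "ip I M E (\<lambda>i x. F i x + G i x) = ip I M E F + ip I M E G"
  using ip_add_left[OF assms] by (simp add: ip_sym)

lemma ip_diff_right:
  assumes "sqs I M F" "sqs I M G" "sqs I M E"
  shows "ip I M E (\<lambda>i x. F i x - G i x) = ip I M E F - ip I M E G"
  using ip_diff_left[OF assms] by (simp add: ip_sym)

lemma ip_cmult_right: "ip I M G (\<lambda>i x. c * F i x) = c * ip I M G F" using ip_cmult_left by (metis ip_sym)

lemma nm_nonneg [simp]: "0 \<le> nm I M F" by (simp add: nm_def ip_nonneg)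

lemma nm_sq: "(nm I M F)\<^sup>2 = ip I M F F" by (simp add: nm_def ip_nonneg)

lemma ip_add_self:
  assumes "sqs I M F" "sqs I M G"
  shows "ip I M (\<lambda>i x. F i x + c * G i x) (\<lambda>i x. F i x + c * G i x)
    = ip I M F F + 2 * c * ip I M F G + c\<^sup>2 * ip I M G G"
proof -
  note * = sqs_cmult[OF assms(2), of c]
  have "ip I M (\<lambda>i x. F i x + c * G i x) (\<lambda>i x. F i x + c * G i x)
    = (ip I M F F + c * ip I M F G) + (c * ip I M G F + c * (c * ip I M G G))"
    by (subst ip_add_left[OF assms(1) * sqs_add[OF assms(1) *]])
      (simp only: ip_add_right[OF assms(1) * assms(1)] ip_add_right[OF assms(1) * assms(2)] ip_cmult_left ip_cmult_right distrib_left)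
  then show ?thesis by (simp add: ip_sym[of I M G F] power2_eq_square algebra_simps)
qed

text \<open>For \<open>c > 0\<close> the quadratic is evaluated at its minimiser
  \<open>t = - b / c\<close>; for \<open>c = 0\<close> an affine function bounded below has no
  slope. Besides Cauchy--Schwarz this yields approximate stationarity of a minimising sequence, with
  the gap to the infimum as \<open>a\<close>.\<close>

lemma quadratic_nonneg_discr:
  fixes a b c :: real
  assumes "\<And>t. 0 \<le> a + 2 * t * b + t\<^sup>2 * c" "0 \<le> c"
  shows "b\<^sup>2 \<le> a * c"
proof (cases "c = 0")
  case True
  have "b = 0"
  proof (rule ccontr)
    assume "b \<noteq> 0"
    have "0 \<le> a + 2 * (- (a + 1) / (2 * b)) * b" using assms(1)[of "- (a + 1) / (2 * b)"] True by simp
    then show False using \<open>b \<noteq> 0\<close> by (simp add: field_simps)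
  qed
  then show ?thesis using True by simp
next
  case False
  then have "0 < c" using assms by simp
  have "0 \<le> a + 2 * (- b / c) * b + (- b / c)\<^sup>2 * c" by (rule assms(1))
  also have "\<dots> = (a * c - b\<^sup>2) / c" using \<open>0 < c\<close> by (simp add: field_simps power2_eq_square)
  finally show ?thesis using \<open>0 < c\<close> by (simp add: zero_le_divide_iff)
qed

lemma ip_CS:
  assumes "sqs I M F" "sqs I M G"
  shows "\<bar>ip I M F G\<bar> \<le> nm I M F * nm I M G"
proof -
  have "(ip I M F G)\<^sup>2 \<le> ip I M F F * ip I M G G"
  proof (rule quadratic_nonneg_discr)
    show "0 \<le> ip I M F F + 2 * t * ip I M F G + t\<^sup>2 * ip I M G G" for t
      using ip_nonneg[of I M "\<lambda>i x. F i x + t * G i x"] unfolding ip_add_self[OF assms] .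
  qed (rule ip_nonneg)
  then show ?thesis by (metis nm_def real_sqrt_abs real_sqrt_le_mono real_sqrt_mult)
qed

lemma nm_triangle:
  assumes "sqs I M F" "sqs I M G"
  shows "nm I M (\<lambda>i x. F i x + G i x) \<le> nm I M F + nm I M G"
proof (rule power2_le_imp_le)
  have "(nm I M (\<lambda>i x. F i x + G i x))\<^sup>2 = ip I M F F + 2 * ip I M F G + ip I M G G"
    using ip_add_self[OF assms, of 1] by (simp add: nm_sq)
  also have "\<dots> \<le> ip I M F F + 2 * (nm I M F * nm I M G) + ip I M G G" using ip_CS[OF assms] by simp
  also have "\<dots> = (nm I M F + nm I M G)\<^sup>2" by (simp add: power2_sum nm_sq)
  finally show "(nm I M (\<lambda>i x. F i x + G i x))\<^sup>2 \<le> (nm I M F + nm I M G)\<^sup>2" .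
qed simp

lemma nm_cmult: "nm I M (\<lambda>i x. c * F i x) = \<bar>c\<bar> * nm I M F"
proof -
  have "ip I M (\<lambda>i x. c * F i x) (\<lambda>i x. c * F i x) = c\<^sup>2 * ip I M F F"
    by (simp only: ip_cmult_left ip_cmult_right power2_eq_square mult.assoc)
  then show ?thesis by (simp add: nm_def real_sqrt_mult)
qed

lemma nm_minus_commute: "nm I M (\<lambda>i x. F i x - G i x) = nm I M (\<lambda>i x. G i x - F i x)"
  using nm_cmult[of I M "-1" "\<lambda>i x. G i x - F i x"] by simp

lemma nm_triangle_diff:
  assumes "sqs I M F" "sqs I M G"
  shows "nm I M (\<lambda>i x. F i x - G i x) \<le> nm I M F + nm I M G"
  using nm_triangle[OF assms(1) sqs_cmult[OF assms(2), of "-1"]] nm_cmult[of I M "-1" G] by simp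

lemma nm_triangle3:
  assumes "sqs I M F" "sqs I M G" "sqs I M E"
  shows "nm I M (\<lambda>i x. F i x - E i x) \<le> nm I M (\<lambda>i x. F i x - G i x) + nm I M (\<lambda>i x. G i x - E i x)"
  using nm_triangle[OF sqs_diff[OF assms(1,2)] sqs_diff[OF assms(2,3)]] by simp

section \<open>The norm of a single function\<close>

definition n2 :: "'a measure \<Rightarrow> ('a \<Rightarrow> real) \<Rightarrow> real" where
  "n2 M f = sqrt (\<integral>x. (f x)\<^sup>2 \<partial>M)"

lemma n2_nm: "n2 M f = nm {()} (\<lambda>_. M) (\<lambda>_. f)" by (simp add: n2_def nm_def ip_def power2_eq_square)

lemma sq_int_sqs: "sq_int M f = sqs {()} (\<lambda>_. M) (\<lambda>_. f)" by (simp add: sqs_def)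

lemma n2_nonneg [simp]: "0 \<le> n2 M f" by (simp add: n2_nm)

lemma n2_sq: "(n2 M f)\<^sup>2 = (\<integral>x. (f x)\<^sup>2 \<partial>M)" by (simp add: n2_def)

lemma n2_CS: "sq_int M f \<Longrightarrow> sq_int M g \<Longrightarrow> \<bar>\<integral>x. f x * g x \<partial>M\<bar> \<le> n2 M f * n2 M g"
  using ip_CS[of "{()}" "\<lambda>_. M" "\<lambda>_. f" "\<lambda>_. g"] by (simp add: n2_nm sq_int_sqs ip_def)

lemma n2_triangle: "sq_int M f \<Longrightarrow> sq_int M g \<Longrightarrow> n2 M (\<lambda>x. f x + g x) \<le> n2 M f + n2 M g"
  using nm_triangle[of "{()}" "\<lambda>_. M" "\<lambda>_. f" "\<lambda>_. g"] by (simp add: n2_nm sq_int_sqs)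

lemma n2_triangle_diff: "sq_int M f \<Longrightarrow> sq_int M g \<Longrightarrow> n2 M (\<lambda>x. f x - g x) \<le> n2 M f + n2 M g"
  using nm_triangle_diff[of "{()}" "\<lambda>_. M" "\<lambda>_. f" "\<lambda>_. g"] by (simp add: n2_nm sq_int_sqs)

lemma n2_cmult: "n2 M (\<lambda>x. c * f x) = \<bar>c\<bar> * n2 M f" by (simp add: n2_nm nm_cmult)

lemma n2_minus_commute: "n2 M (\<lambda>x. f x - g x) = n2 M (\<lambda>x. g x - f x)" by (simp add: n2_def power2_commute)

lemma n2_triangle3:
  "sq_int M f \<Longrightarrow> sq_int M g \<Longrightarrow> sq_int M k \<Longrightarrow>
    n2 M (\<lambda>x. f x - k x) \<le> n2 M (\<lambda>x. f x - g x) + n2 M (\<lambda>x. g x - k x)"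
  using n2_triangle[OF sq_int_diff sq_int_diff, of M f g g k] by simp

lemma n2_eq_0_AE:
  assumes "sq_int M f" "n2 M f = 0"
  shows "AE x in M. f x = 0"
proof -
  have "(\<integral>x. (f x)\<^sup>2 \<partial>M) = 0" using assms(2) by (simp add: n2_def)
  then have "AE x in M. (f x)\<^sup>2 = 0"
    using assms(1) by (subst (asm) integral_nonneg_eq_0_iff_AE) (auto simp: sq_int_def)
  then show ?thesis by simp
qed

text \<open>Strong convergence of one factor passes to the pairing by Cauchy--Schwarz.
  Euler--Lagrange equations and consistency bounds reach their limits in this way.\<close>

lemma integral_n2_tendsto:
  assumes "\<And>n. sq_int M (f n)" "sq_int M g" "sq_int M k" "(\<lambda>n. n2 M (\<lambda>x. f n x - g x)) \<longlonglongrightarrow> 0"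
  shows "(\<lambda>n. \<integral>x. f n x * k x \<partial>M) \<longlonglongrightarrow> (\<integral>x. g x * k x \<partial>M)"
proof -
  have "(\<lambda>n. (\<integral>x. f n x * k x \<partial>M) - (\<integral>x. g x * k x \<partial>M)) \<longlonglongrightarrow> 0"
  proof (rule Lim_null_comparison)
    show "(\<lambda>n. n2 M (\<lambda>x. f n x - g x) * n2 M k) \<longlonglongrightarrow> 0" using tendsto_mult_right[OF assms(4), of "n2 M k"] by simp
    show "\<forall>\<^sub>F n in sequentially. norm ((\<integral>x. f n x * k x \<partial>M) - (\<integral>x. g x * k x \<partial>M))
        \<le> n2 M (\<lambda>x. f n x - g x) * n2 M k"
    proof (rule always_eventually, rule allI)
      fix n
      have "(\<integral>x. f n x * k x \<partial>M) - (\<integral>x. g x * k x \<partial>M) = (\<integral>x. (f n x - g x) * k x \<partial>M)"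
        using assms by (simp add: left_diff_distrib sq_int_integrable_mult)
      then show "norm ((\<integral>x. f n x * k x \<partial>M) - (\<integral>x. g x * k x \<partial>M)) \<le> n2 M (\<lambda>x. f n x - g x) * n2 M k"
        using n2_CS[OF sq_int_diff[OF assms(1,2)] assms(3)] by simp
    qed
  qed
  then show ?thesis by (simp add: LIM_zero_iff)
qed

lemma n2_tendsto:
  assumes "\<And>n. sq_int M (f n)" "sq_int M g" "(\<lambda>n. n2 M (\<lambda>x. f n x - g x)) \<longlonglongrightarrow> 0"
  shows "(\<lambda>n. n2 M (f n)) \<longlonglongrightarrow> n2 M g"
proof -
  have "\<bar>n2 M (f n) - n2 M g\<bar> \<le> n2 M (\<lambda>x. f n x - g x)" for n
  proof -
    have "n2 M (f n) \<le> n2 M (\<lambda>x. f n x - g x) + n2 M g"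
      using n2_triangle[OF sq_int_diff[OF assms(1,2)] assms(2), of n] by simp
    moreover have "n2 M g \<le> n2 M (\<lambda>x. g x - f n x) + n2 M (f n)"
      using n2_triangle[OF sq_int_diff[OF assms(2,1)] assms(1), of n n] by simp
    ultimately show ?thesis by (simp add: n2_minus_commute[of M g])
  qed
  then have "(\<lambda>n. n2 M (f n) - n2 M g) \<longlonglongrightarrow> 0" by (intro Lim_null_comparison[OF _ assms(3)]) simp
  then show ?thesis by (simp add: LIM_zero_iff)
qed

section \<open>Slices of the plane and calculus with partial derivatives\<close>

definition oth :: "2 \<Rightarrow> 2" where "oth i = (if i = 1 then 2 else 1)"

text \<open>Coordinate \<open>i\<close> comes first, the other one second: with the direction as a
  parameter, one argument along lines serves both partial derivatives.\<close>

definition mk :: "2 \<Rightarrow> real \<Rightarrow> real \<Rightarrow> pt" where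
  "mk i t c = t *\<^sub>R axis i 1 + c *\<^sub>R axis (oth i) 1"

lemma two_cases: "(i::2) = 1 \<or> i = 2" by (rule exhaust_2)

lemma oth_neq [simp]: "oth i \<noteq> i" "i \<noteq> oth i" by (auto simp: oth_def split: if_splits)

lemma oth_oth [simp]: "oth (oth i) = i" using two_cases[of i] by (auto simp: oth_def)

lemma UNIV2_oth: "(UNIV::2 set) = {i, oth i}" using two_cases[of i] by (auto simp: oth_def UNIV_2)

lemma sum_oth: "(\<Sum>j\<in>UNIV. f j) = f i + f (oth i)" for f :: "2 \<Rightarrow> 'a::comm_monoid_add" by (subst UNIV2_oth[of i]) simp

lemma all2_oth: "(\<forall>j. P j) \<longleftrightarrow> P i \<and> P (oth i)" using UNIV2_oth[of i] by (metis UNIV_I insertE singletonD)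

lemma mk_nth [simp]: "mk i t c $ i = t" "mk i t c $ oth i = c" by (simp_all add: mk_def axis_def)

lemma inner_oth: "(x::pt) \<bullet> y = x $ i * y $ i + x $ oth i * y $ oth i" by (simp add: inner_vec_def sum_oth[of _ i])

lemma inner_pt: "(x::pt) \<bullet> y = x $ 1 * y $ 1 + x $ 2 * y $ 2" by (simp add: inner_vec_def sum_2)

lemma continuous_mk [continuous_intros]:
  "continuous_on S f \<Longrightarrow> continuous_on S g \<Longrightarrow> continuous_on S (\<lambda>x. mk i (f x) (g x))"
  unfolding mk_def by (intro continuous_intros)

lemma measurable_mk [measurable]:
  "(\<lambda>(t, c). mk i t c) \<in> borel_measurable (lborel \<Otimes>\<^sub>M lborel)" unfolding mk_def by measurable

text \<open>Lebesgue measure is determined by the volumes of boxes, and the image of the product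
  measure gives a box the product of its side lengths. Fubini along lines in direction
  \<open>i\<close> follows.\<close>

lemma lborel_mk: "(lborel :: pt measure) = distr (lborel \<Otimes>\<^sub>M lborel) borel (\<lambda>(t, c). mk i t c)"
proof (rule lborel_eqI)
  fix l u :: pt assume lu: "\<And>b. b \<in> Basis \<Longrightarrow> l \<bullet> b \<le> u \<bullet> b"
  then have le: "l $ j \<le> u $ j" for j by (simp add: cart_eq_inner_axis)
  have pre: "(\<lambda>(t, c). mk i t c) -` box l u \<inter> space (lborel \<Otimes>\<^sub>M lborel)
      = box (l $ i) (u $ i) \<times> box (l $ oth i) (u $ oth i)"
    by (auto simp: mem_box_cart space_pair_measure all2_oth[of _ i])
  have inj: "inj (\<lambda>j::2. axis j (1::real))" by (auto simp: inj_def axis_eq_axis)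
  have Bs: "(Basis :: pt set) = range (\<lambda>j. axis j 1)" by (auto simp: Basis_vec_def)
  have "(\<Prod>b\<in>Basis. (u - l) \<bullet> b) = (\<Prod>j\<in>UNIV. (u - l) $ j)"
    unfolding Bs by (subst prod.reindex[OF inj]) (simp add: cart_eq_inner_axis)
  also have "\<dots> = (u $ i - l $ i) * (u $ oth i - l $ oth i)" by (subst UNIV2_oth[of i]) simp
  finally have P: "(\<Prod>b\<in>Basis. (u - l) \<bullet> b) = (u $ i - l $ i) * (u $ oth i - l $ oth i)" .
  have "emeasure (distr (lborel \<Otimes>\<^sub>M lborel) borel (\<lambda>(t, c). mk i t c)) (box l u)
      = emeasure (lborel \<Otimes>\<^sub>M lborel) (box (l $ i) (u $ i) \<times> box (l $ oth i) (u $ oth i))"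
    by (subst emeasure_distr) (simp_all only: pre measurable_mk, simp)
  also have "\<dots> = emeasure lborel (box (l $ i) (u $ i)) * emeasure lborel (box (l $ oth i) (u $ oth i))"
    by (subst lborel.emeasure_pair_measure_Times) auto
  also have "\<dots> = ennreal ((u $ i - l $ i) * (u $ oth i - l $ oth i))"
    using le[of i] le[of "oth i"] by (simp add: ennreal_mult)
  finally show "emeasure (distr (lborel \<Otimes>\<^sub>M lborel) borel (\<lambda>(t, c). mk i t c)) (box l u)
      = (\<Prod>b\<in>Basis. (u - l) \<bullet> b)" by (simp add: P)
qed simp

lemma
  fixes f :: "pt \<Rightarrow> real"
  assumes "integrable lborel f"
  shows slice_integral: "integral\<^sup>L lborel f = (\<integral>c. (\<integral>t. f (mk i t c) \<partial>lborel) \<partial>lborel)"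
    and slice_AE_integrable: "AE c in lborel. integrable lborel (\<lambda>t. f (mk i t c))"
proof -
  have m: "f \<in> borel_measurable borel" using assms by (auto dest: borel_measurable_integrable)
  have *: "integrable (lborel \<Otimes>\<^sub>M lborel) (\<lambda>(t, c). f (mk i t c))" using assms unfolding lborel_mk[of i]
    by (subst (asm) integrable_distr_eq) (use m in \<open>auto simp: case_prod_unfold\<close>)
  have "integral\<^sup>L lborel f = (\<integral>(t, c). f (mk i t c) \<partial>(lborel \<Otimes>\<^sub>M lborel))" unfolding lborel_mk[of i]
    by (subst integral_distr) (use m in \<open>auto simp: case_prod_unfold\<close>)
  also have "\<dots> = (\<integral>c. (\<integral>t. f (mk i t c) \<partial>lborel) \<partial>lborel)" by (rule lborel_pair.integral_snd[OF *, symmetric])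
  finally show "integral\<^sup>L lborel f = (\<integral>c. (\<integral>t. f (mk i t c) \<partial>lborel) \<partial>lborel)" .
  show "AE c in lborel. integrable lborel (\<lambda>t. f (mk i t c))" by (rule lborel_pair.AE_integrable_snd[OF *])
qed

text \<open>Finitely many lines form a null set of slices and may be discarded; the Horgan--Payne
  argument discards those through its pole and those that may run along a side of the
  polygon.\<close>

lemma slice_integral_eq_0:
  fixes f :: "pt \<Rightarrow> real"
  assumes "integrable lborel f"
    "\<And>c. c \<notin> N \<Longrightarrow> integrable lborel (\<lambda>t. f (mk i t c)) \<Longrightarrow> (\<integral>t. f (mk i t c) \<partial>lborel) = 0"
    "finite N"
  shows "integral\<^sup>L lborel f = 0"
proof -
  have "AE c in lborel. c \<notin> N" using assms(3) by (intro AE_not_in finite_imp_null_set_lborel)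
  then have "AE c in lborel. (\<integral>t. f (mk i t c) \<partial>lborel) = 0"
    using slice_AE_integrable[OF assms(1), of i] by eventually_elim (use assms(2) in auto)
  then have "(\<integral>c. (\<integral>t. f (mk i t c) \<partial>lborel) \<partial>lborel) = 0" by (rule integral_eq_zero_AE)
  then show ?thesis by (simp add: slice_integral[OF assms(1), of i])
qed

text \<open>The finite set \<open>S\<close> admits kinks, as they occur for functions built from a
  polygonal gauge. Vanishing outside the interval turns the integral over the line into an increment
  of \<open>f\<close>.\<close>

lemma FTC_lborel:
  fixes f f' :: "real \<Rightarrow> real"
  assumes "a \<le> b" "finite S" "continuous_on {a..b} f"
    "\<And>t. t \<in> {a<..<b} - S \<Longrightarrow> (f has_real_derivative f' t) (at t)"
    "integrable lborel g" "\<And>t. t \<in> {a<..<b} \<Longrightarrow> g t = f' t" "\<And>t. t \<notin> {a..b} \<Longrightarrow> g t = 0"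
  shows "(\<integral>t. g t \<partial>lborel) = f b - f a"
proof -
  have "(f' has_integral (f b - f a)) {a..b}" by (rule fundamental_theorem_of_calculus_interior_strong[OF assms(2,1)])
      (use assms(3,4) in \<open>auto simp: has_real_derivative_iff_has_vector_derivative\<close>)
  then have "(g has_integral (f b - f a)) {a..b}"
    by (rule has_integral_spike_finite[of "{a, b}", rotated 2]) (use assms(6) in auto)
  then have "(g has_integral (f b - f a)) UNIV" by (rule has_integral_on_superset) (use assms(7) in auto)
  moreover have "(g has_integral (\<integral>t. g t \<partial>lborel)) UNIV" by (rule has_integral_integral_lborel[OF assms(5)])
  ultimately show ?thesis by (rule has_integral_unique[rotated])
qed

text \<open>Regularity is asked on the whole plane. Mollified functions have it, and continuity up
  to the boundary of a cell or of the domain then comes for free.\<close>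

definition C1 :: "(pt \<Rightarrow> real) \<Rightarrow> bool" where
  "C1 f \<longleftrightarrow> (\<forall>x. f differentiable (at x)) \<and> (\<forall>i. continuous_on UNIV (pd i f))"

section \<open>Calculus of continuously differentiable functions\<close>

lemma frechet_pd:
  assumes "f differentiable (at x)"
  shows "(f has_derivative (\<lambda>h. \<Sum>i\<in>UNIV. h $ i * pd i f x)) (at x)"
proof -
  let ?D = "frechet_derivative f (at x)"
  have D: "(f has_derivative ?D) (at x)" using assms by (simp add: frechet_derivative_works)
  then interpret bounded_linear ?D by (rule has_derivative_bounded_linear)
  have "?D h = (\<Sum>i\<in>UNIV. h $ i * pd i f x)" for h
  proof -
    have "h = (\<Sum>i\<in>UNIV. h $ i *\<^sub>R axis i 1)" by (simp add: vec_eq_iff axis_def if_distrib sum.delta' cong: if_cong)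
    then have "?D h = (\<Sum>i\<in>UNIV. h $ i *\<^sub>R ?D (axis i 1))" by (metis (no_types, lifting) sum scaleR sum.cong)
    then show ?thesis by (simp add: pd_def)
  qed
  then have "?D = (\<lambda>h. \<Sum>i\<in>UNIV. h $ i * pd i f x)" by auto
  with D show ?thesis by simp
qed

lemma pd_eqI:
  assumes "(f has_derivative D) (at x)"
  shows "pd i f x = D (axis i 1)"
  using frechet_derivative_at[OF assms] by (simp add: pd_def)

lemma pd_eqI':
  assumes "(f has_derivative (\<lambda>h. \<Sum>i\<in>UNIV. h $ i * d i)) (at x)"
  shows "pd i f x = d i"
proof -
  have "pd i f x = (\<Sum>j\<in>UNIV. (axis i 1 :: pt) $ j * d j)" by (rule pd_eqI[OF assms])
  then show ?thesis by (simp add: sum_oth[of _ i] axis_def)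
qed

lemma C1I:
  assumes "\<And>x. (f has_derivative (\<lambda>h. \<Sum>i\<in>UNIV. h $ i * d i x)) (at x)"
    "\<And>i. continuous_on UNIV (d i)"
  shows "C1 f" "pd i f = d i"
proof -
  have *: "pd i f = d i" for i by (rule ext) (rule pd_eqI'[OF assms(1)])
  then show "pd i f = d i" .
  show "C1 f" unfolding C1_def using assms * by (auto intro: differentiableI)
qed

lemma C1_has_derivative:
  "C1 f \<Longrightarrow> (f has_derivative (\<lambda>h. \<Sum>i\<in>UNIV. h $ i * pd i f x)) (at x)" by (simp add: C1_def frechet_pd)

lemma C1_continuous: "C1 f \<Longrightarrow> continuous_on S f"
  by (meson C1_def continuous_at_imp_continuous_on differentiable_imp_continuous_within)

lemma C1_continuous_pd: "C1 f \<Longrightarrow> continuous_on S (pd i f)" by (meson C1_def continuous_on_subset subset_UNIV)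

lemma C1_const: "C1 (\<lambda>x. c)" and pd_const: "pd i (\<lambda>x. c) = (\<lambda>x. 0)"
proof -
  have *: "((\<lambda>x. c) has_derivative (\<lambda>h. \<Sum>i\<in>UNIV. h $ i * 0)) (at x)" for x :: pt by simp
  show "C1 (\<lambda>x. c)" by (rule C1I(1)[where d="\<lambda>i x. 0"]) (use * in auto)
  show "pd i (\<lambda>x. c) = (\<lambda>x. 0)" by (rule C1I(2)[where d="\<lambda>i x. 0"]) (use * in auto)
qed

lemma
  assumes "f differentiable (at x)" "g differentiable (at x)"
  shows pd_add_at: "pd i (\<lambda>x. f x + g x) x = pd i f x + pd i g x"
    and pd_diff_at: "pd i (\<lambda>x. f x - g x) x = pd i f x - pd i g x"
    and pd_mult_at: "pd i (\<lambda>x. f x * g x) x = pd i f x * g x + f x * pd i g x"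
proof -
  note f = frechet_pd[OF assms(1)] and g = frechet_pd[OF assms(2)]
  show "pd i (\<lambda>x. f x + g x) x = pd i f x + pd i g x"
    by (rule pd_eqI') (use has_derivative_add[OF f g] in \<open>simp add: sum.distrib distrib_left\<close>)
  show "pd i (\<lambda>x. f x - g x) x = pd i f x - pd i g x"
    by (rule pd_eqI') (use has_derivative_diff[OF f g] in \<open>simp add: sum_subtractf right_diff_distrib\<close>)
  have "(\<lambda>h. f x * (\<Sum>i\<in>UNIV. h $ i * pd i g x) + (\<Sum>i\<in>UNIV. h $ i * pd i f x) * g x)
     = (\<lambda>h. \<Sum>i\<in>UNIV. h $ i * (pd i f x * g x + f x * pd i g x))" by (auto simp: sum_2 algebra_simps)
  with has_derivative_mult[OF f g]
  show "pd i (\<lambda>x. f x * g x) x = pd i f x * g x + f x * pd i g x" by (intro pd_eqI') simp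
qed

lemma C1_diff': "C1 f \<Longrightarrow> f differentiable (at x)" by (simp add: C1_def)

lemma
  assumes "C1 f" "C1 g"
  shows C1_add: "C1 (\<lambda>x. f x + g x)" and C1_diff: "C1 (\<lambda>x. f x - g x)" and C1_mult: "C1 (\<lambda>x. f x * g x)"
    and pd_add: "pd i (\<lambda>x. f x + g x) = (\<lambda>x. pd i f x + pd i g x)"
    and pd_diff: "pd i (\<lambda>x. f x - g x) = (\<lambda>x. pd i f x - pd i g x)"
    and pd_mult: "pd i (\<lambda>x. f x * g x) = (\<lambda>x. pd i f x * g x + f x * pd i g x)"
proof -
  have *: "pd i (\<lambda>x. f x + g x) = (\<lambda>x. pd i f x + pd i g x)"
      "pd i (\<lambda>x. f x - g x) = (\<lambda>x. pd i f x - pd i g x)"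
      "pd i (\<lambda>x. f x * g x) = (\<lambda>x. pd i f x * g x + f x * pd i g x)" for i
    using assms by (auto simp: pd_add_at pd_diff_at pd_mult_at C1_diff')
  then show "pd i (\<lambda>x. f x + g x) = (\<lambda>x. pd i f x + pd i g x)"
      "pd i (\<lambda>x. f x - g x) = (\<lambda>x. pd i f x - pd i g x)"
      "pd i (\<lambda>x. f x * g x) = (\<lambda>x. pd i f x * g x + f x * pd i g x)" by auto
  note c = C1_continuous[OF assms(1)] C1_continuous[OF assms(2)] C1_continuous_pd[OF assms(1)] C1_continuous_pd[OF assms(2)]
  show "C1 (\<lambda>x. f x + g x)" "C1 (\<lambda>x. f x - g x)" "C1 (\<lambda>x. f x * g x)"
    unfolding C1_def * using assms by (auto simp: C1_diff' intro!: continuous_intros c)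
qed

lemma C1_cmult: "C1 f \<Longrightarrow> C1 (\<lambda>x. c * f x)"
  and pd_cmult: "C1 f \<Longrightarrow> pd i (\<lambda>x. c * f x) = (\<lambda>x. c * pd i f x)"
  using C1_mult[OF C1_const] pd_mult[OF C1_const] by (auto simp: pd_const)

lemma C1_nth: "C1 (\<lambda>x. x $ j)" and pd_nth: "pd i (\<lambda>x. x $ j) = (\<lambda>x. if i = j then 1 else 0)"
proof -
  have *: "((\<lambda>x. x $ j) has_derivative (\<lambda>h. \<Sum>i\<in>UNIV. h $ i * (if i = j then 1 else 0))) (at x)" for x :: pt
    by (auto intro!: derivative_eq_intros simp: sum_oth[of _ j] bounded_linear_imp_has_derivative bounded_linear_vec_nth)
  show "C1 (\<lambda>x. x $ j)" by (rule C1I(1)[where d="\<lambda>i x. if i = j then 1 else 0"]) (use * in auto)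
  show "pd i (\<lambda>x. x $ j) = (\<lambda>x. if i = j then 1 else 0)"
    by (rule C1I(2)[where d="\<lambda>i x. if i = j then 1 else 0"]) (use * in auto)
qed

lemma has_real_derivative_line:
  assumes "f differentiable (at (a + t *\<^sub>R v))"
  shows "((\<lambda>t. f (a + t *\<^sub>R v)) has_real_derivative (\<Sum>i\<in>UNIV. v $ i * pd i f (a + t *\<^sub>R v))) (at t)"
proof -
  have 1: "((\<lambda>t. a + t *\<^sub>R v) has_derivative (\<lambda>s. s *\<^sub>R v)) (at t)" by (auto intro!: derivative_eq_intros)
  have "((\<lambda>t. f (a + t *\<^sub>R v)) has_derivative (\<lambda>s. \<Sum>i\<in>UNIV. (s *\<^sub>R v) $ i * pd i f (a + t *\<^sub>R v))) (at t)"
    by (rule has_derivative_compose[where g=f and f="\<lambda>t. a + t *\<^sub>R v", OF 1 frechet_pd[OF assms]])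
  moreover have "(\<lambda>s. \<Sum>i\<in>UNIV. (s *\<^sub>R v) $ i * pd i f (a + t *\<^sub>R v))
      = (*) (\<Sum>i\<in>UNIV. v $ i * pd i f (a + t *\<^sub>R v))" by (auto simp: sum_2 algebra_simps)
  ultimately show ?thesis by (simp add: has_field_derivative_def)
qed

lemma has_real_derivative_mk:
  assumes "f differentiable (at (mk i t c))"
  shows "((\<lambda>t. f (mk i t c)) has_real_derivative pd i f (mk i t c)) (at t)"
proof -
  have *: "mk i t c = c *\<^sub>R axis (oth i) 1 + t *\<^sub>R axis i 1" for t by (simp add: mk_def)
  moreover have "(\<Sum>j\<in>UNIV. (axis i 1 :: pt) $ j * pd j f x) = pd i f x" for x by (simp add: sum_oth[of _ i] axis_def)
  ultimately show ?thesis
    using has_real_derivative_line[of f "c *\<^sub>R axis (oth i) 1" t "axis i 1"] assms unfolding * by simp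
qed

lemma abs_mk_le: "\<bar>t\<bar> \<le> norm (mk i t c)" using component_le_norm_cart[of "mk i t c" i] by simp

text \<open>Every line leaves the support at both ends of \<open>{- R - 1..R + 1}\<close>, so the
  fundamental theorem of calculus makes each slice integrate to zero.\<close>

lemma integral_pd_compact_support:
  assumes "C1 f" "bounded {x. f x \<noteq> 0}"
  shows "integral\<^sup>L lborel (pd i f) = 0" "integrable lborel (pd i f)"
proof -
  obtain R where R: "R > 0" "\<And>x. f x \<noteq> 0 \<Longrightarrow> norm x < R" using assms(2) unfolding bounded_pos_less by auto
  have f0: "f x = 0" if "norm x \<ge> R" for x using R(2)[of x] that by fastforce
  have out: "pd i f x = 0" if "norm x > R" for x
  proof -
    have "((\<lambda>x. 0) has_derivative (\<lambda>h. 0)) (at x)" by simp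
    moreover have "open {x::pt. norm x > R}" by (intro open_Collect_less continuous_intros)
    ultimately have "(f has_derivative (\<lambda>h. 0)) (at x)"
      using that f0 by (auto intro: has_derivative_transform_within_open[of "\<lambda>x. 0" _ _ _ "{x. norm x > R}"])
    then show ?thesis by (simp add: pd_eqI)
  qed
  have "integrable lborel (\<lambda>x. indicator (cball 0 R) x *\<^sub>R pd i f x)"
    by (rule borel_integrable_compact) (auto intro: C1_continuous_pd[OF assms(1)])
  moreover have "(\<lambda>x. indicator (cball 0 R) x *\<^sub>R pd i f x) = pd i f"
    using out by (auto simp: indicator_def fun_eq_iff)
  ultimately show int: "integrable lborel (pd i f)" by simp
  show "integral\<^sup>L lborel (pd i f) = 0"
  proof (rule slice_integral_eq_0[OF int, where N="{}" and i=i])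
    fix c assume ic: "integrable lborel (\<lambda>t. pd i f (mk i t c))"
    have "(\<integral>t. pd i f (mk i t c) \<partial>lborel) = f (mk i (R+1) c) - f (mk i (-R-1) c)"
    proof (rule FTC_lborel[where S="{}" and f="\<lambda>t. f (mk i t c)"])
      show "continuous_on {- R - 1..R + 1} (\<lambda>t. f (mk i t c))"
        by (intro continuous_on_compose2[OF C1_continuous[OF assms(1), of UNIV]] continuous_intros) auto
      show "((\<lambda>t. f (mk i t c)) has_real_derivative pd i f (mk i t c)) (at t)" for t
        by (rule has_real_derivative_mk[OF C1_diff'[OF assms(1)]])
      show "pd i f (mk i t c) = 0" if "t \<notin> {- R - 1..R + 1}" for t using that abs_mk_le[of t i c] by (intro out) auto
    qed (use R ic in auto)
    also have "\<dots> = 0" using abs_mk_le[of "R+1" i c] abs_mk_le[of "-R-1" i c] R(1)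
      by (simp add: f0[of "mk i (R+1) c"] f0[of "mk i (-R-1) c"])
    finally show "(\<integral>t. pd i f (mk i t c) \<partial>lborel) = 0" .
  qed simp
qed

section \<open>Test functions\<close>

lemma pds_append: "pds (is @ js) \<phi> = pds is (pds js \<phi>)" by (induction "is") auto

lemma smooth_fun_pds: "smooth_fun \<phi> \<Longrightarrow> smooth_fun (pds is \<phi>)" unfolding smooth_fun_def by (metis pds_append)

lemma smooth_fun_pd: "smooth_fun \<phi> \<Longrightarrow> smooth_fun (pd i \<phi>)" using smooth_fun_pds[of \<phi> "[i]"] by simp

lemma smooth_fun_C1: "smooth_fun \<phi> \<Longrightarrow> C1 \<phi>" unfolding smooth_fun_def C1_def
  by (metis pds.simps differentiable_imp_continuous_within continuous_at_imp_continuous_on)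

lemma pd_zero_outside:
  assumes "x \<notin> closure {x. \<phi> x \<noteq> 0}"
  shows "pd i \<phi> x = 0"
proof -
  have "((\<lambda>x. 0) has_derivative (\<lambda>h. 0)) (at x)" by simp
  then have "(\<phi> has_derivative (\<lambda>h. 0)) (at x)"
  proof (rule has_derivative_transform_within_open[where s="- closure {x. \<phi> x \<noteq> 0}"])
    fix y assume "y \<in> - closure {x. \<phi> x \<noteq> 0}"
    then show "0 = \<phi> y" using closure_subset[of "{x. \<phi> x \<noteq> 0}"] by auto
  qed (use assms in auto)
  then show ?thesis by (simp add: pd_eqI)
qed

lemma support_pd: "closure {x. pd i \<phi> x \<noteq> 0} \<subseteq> closure {x. \<phi> x \<noteq> 0}"
  by (rule closure_minimal) (use pd_zero_outside in auto)

lemma compact_closed_subset: "compact T \<Longrightarrow> closed S \<Longrightarrow> S \<subseteq> T \<Longrightarrow> compact S" by (metis compact_Int_closed inf.absorb_iff2)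

lemma test_fun_pd:
  assumes "test_fun \<Omega> \<phi>" shows "test_fun \<Omega> (pd i \<phi>)" using assms support_pd[of i \<phi>] unfolding test_fun_def
  by (meson smooth_fun_pd closed_closure compact_closed_subset subset_trans)

lemma test_fun_C1: "test_fun \<Omega> \<phi> \<Longrightarrow> C1 \<phi>" by (simp add: test_fun_def smooth_fun_C1)

lemma test_fun_bounded_support: "test_fun \<Omega> \<phi> \<Longrightarrow> bounded {x. \<phi> x \<noteq> 0}"
  unfolding test_fun_def by (meson bounded_subset closure_subset compact_imp_bounded)

lemma test_fun_zero: "test_fun \<Omega> \<phi> \<Longrightarrow> x \<notin> \<Omega> \<Longrightarrow> \<phi> x = 0"
  unfolding test_fun_def using closure_subset[of "{x. \<phi> x \<noteq> 0}"] by auto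

lemma test_funI:
  assumes "smooth_fun \<phi>" "\<And>x. x \<notin> S \<Longrightarrow> \<phi> x = 0" "compact S" "S \<subseteq> \<Omega>"
  shows "test_fun \<Omega> \<phi>"
proof -
  have "closure {x. \<phi> x \<noteq> 0} \<subseteq> S" by (rule closure_minimal) (use assms in \<open>auto simp: compact_imp_closed\<close>)
  then show ?thesis unfolding test_fun_def using assms compact_closed_subset[OF assms(3) closed_closure] by blast
qed

lemma
  assumes "smooth_fun \<phi>" "smooth_fun \<psi>"
  shows pds_lin: "pds is (\<lambda>x. a * \<phi> x + b * \<psi> x) = (\<lambda>x. a * pds is \<phi> x + b * pds is \<psi> x)"
    and smooth_fun_lin: "smooth_fun (\<lambda>x. a * \<phi> x + b * \<psi> x)"
proof -
  have C: "C1 (pds is \<phi>)" "C1 (pds is \<psi>)" for "is" using assms smooth_fun_pds smooth_fun_C1 by blast+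
  show *: "pds is (\<lambda>x. a * \<phi> x + b * \<psi> x) = (\<lambda>x. a * pds is \<phi> x + b * pds is \<psi> x)" for "is"
  proof (induction "is")
    case (Cons i "is")
    then show ?case using C[of "is"] by (simp add: pd_add C1_cmult pd_cmult)
  qed simp
  show "smooth_fun (\<lambda>x. a * \<phi> x + b * \<psi> x)"
    unfolding smooth_fun_def * using C by (intro allI C1_diff' C1_add C1_cmult)
qed

lemma test_fun_lin:
  assumes "test_fun \<Omega> \<phi>" "test_fun \<Omega> \<psi>"
  shows "test_fun \<Omega> (\<lambda>x. a * \<phi> x + b * \<psi> x)"
proof (rule test_funI[where S="closure {x. \<phi> x \<noteq> 0} \<union> closure {x. \<psi> x \<noteq> 0}"])
  show "smooth_fun (\<lambda>x. a * \<phi> x + b * \<psi> x)" using assms by (intro smooth_fun_lin) (auto simp: test_fun_def)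
  show "a * \<phi> x + b * \<psi> x = 0" if "x \<notin> closure {x. \<phi> x \<noteq> 0} \<union> closure {x. \<psi> x \<noteq> 0}" for x
  proof -
    have "\<phi> x = 0" "\<psi> x = 0" using that closure_subset[of "{x. \<phi> x \<noteq> 0}"] closure_subset[of "{x. \<psi> x \<noteq> 0}"] by blast+
    then show ?thesis by simp
  qed
qed (use assms in \<open>auto simp: test_fun_def\<close>)

lemma test_fun_0: "test_fun \<Omega> (\<lambda>x. 0)"
proof -
  have "pds is (\<lambda>x. 0) = (\<lambda>x. 0)" for "is" by (induction "is") (auto simp: pd_const)
  then show ?thesis by (simp add: test_fun_def smooth_fun_def)
qed

text \<open>The flat function \<open>exp (- 1/t)\<close> times a polynomial in \<open>1/t\<close>,
  extended by zero. An arbitrary polynomial factor is carried along to make the family closed under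
  differentiation.\<close>

definition Gp :: "real poly \<Rightarrow> real \<Rightarrow> real" where
  "Gp p t = (if t > 0 then poly p (1 / t) * exp (- (1 / t)) else 0)"

lemma poly_exp_tendsto_0: "((\<lambda>s. poly p s * exp (- s)) \<longlongrightarrow> (0::real)) at_top"
proof -
  \<comment> \<open>The extra power \<open>s ^ k\<close> makes the induction go through: passing
    from \<open>p\<close> to \<open>pCons a p\<close> raises the exponent by one.\<close>
  have *: "((\<lambda>s. s ^ k * poly p s * exp (- s)) \<longlongrightarrow> (0::real)) at_top" for k
  proof (induction p arbitrary: k)
    case 0 then show ?case by simp
  next
    case (pCons a p)
    have "((\<lambda>s. s ^ k / exp s) \<longlongrightarrow> (0::real)) at_top" by (rule tendsto_power_div_exp_0)
    then have "((\<lambda>s. a * (s ^ k / exp s) + s ^ Suc k * poly p s * exp (- s)) \<longlongrightarrow> a * 0 + 0) at_top"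
      by (intro tendsto_add tendsto_mult tendsto_const pCons.IH)
    moreover have "(\<lambda>s. a * (s ^ k / exp s) + s ^ Suc k * poly p s * exp (- s))
        = (\<lambda>s. s ^ k * poly (pCons a p) s * exp (- s))" by (auto simp: exp_minus field_simps)
    ultimately show ?case by simp
  qed
  from *[of 0] show ?thesis by simp
qed

text \<open>For \<open>t > 0\<close> the chain rule gives \<open>(p - p')(1/t) / t^2\<close> times
  the exponential, and \<open>1 / t^2\<close> is the monomial. At \<open>0\<close> the right
  difference quotient tends to zero because the exponential beats every power.\<close>

lemma Gp_deriv: "(Gp p has_real_derivative Gp (monom 1 2 * (p - pderiv p)) t) (at t)"
proof -
  consider "t > 0" | "t < 0" | "t = 0" by linarith
  then show ?thesis
  proof cases
    case 1
    let ?q = "monom 1 2 * (p - pderiv p)"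
    have "((\<lambda>t. poly p (1 / t) * exp (- (1 / t))) has_real_derivative poly ?q (1 / t) * exp (- (1 / t))) (at t)"
      using 1 by (auto intro!: derivative_eq_intros DERIV_chain'[OF _ poly_DERIV]
          simp: poly_monom field_simps power2_eq_square)
    then have "(Gp p has_real_derivative poly ?q (1 / t) * exp (- (1 / t))) (at t)"
      by (rule has_field_derivative_transform_within_open[where S="{0<..}"]) (use 1 in \<open>auto simp: Gp_def\<close>)
    then show ?thesis using 1 by (simp add: Gp_def)
  next
    case 2
    have "((\<lambda>t. 0) has_real_derivative 0) (at t)" by simp
    then have "(Gp p has_real_derivative 0) (at t)"
      by (rule has_field_derivative_transform_within_open[where S="{..<0}"]) (use 2 in \<open>auto simp: Gp_def\<close>)
    then show ?thesis using 2 by (simp add: Gp_def)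
  next
    case 3
    have R: "((\<lambda>h. Gp p h / h) \<longlongrightarrow> 0) (at_right 0)"
    proof -
      have "((\<lambda>s. poly (pCons 0 p) s * exp (- s)) \<longlongrightarrow> (0::real)) at_top" by (rule poly_exp_tendsto_0)
      then have "((\<lambda>h. poly (pCons 0 p) (inverse h) * exp (- inverse h)) \<longlongrightarrow> (0::real)) (at_right 0)"
        by (rule filterlim_compose[OF _ filterlim_inverse_at_top_right])
      moreover have "\<forall>\<^sub>F h in at_right 0. poly (pCons 0 p) (inverse h) * exp (- inverse h) = Gp p h / h"
        unfolding eventually_at_filter by (intro always_eventually) (auto simp: Gp_def field_simps)
      ultimately show ?thesis by (rule Lim_transform_eventually)
    qed
    have L: "((\<lambda>h. Gp p h / h) \<longlongrightarrow> 0) (at_left 0)"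
    proof (rule Lim_transform_eventually[of "\<lambda>h. 0"])
      show "\<forall>\<^sub>F h in at_left 0. 0 = Gp p h / h"
        unfolding eventually_at_filter by (intro always_eventually) (auto simp: Gp_def)
    qed simp
    from R L have "((\<lambda>h. Gp p h / h) \<longlongrightarrow> 0) (at 0)" by (simp add: filterlim_split_at)
    then show ?thesis unfolding 3 DERIV_def by (simp add: Gp_def)
  qed
qed

text \<open>An algebra stable under partial derivatives, generated by flat functions of one affine
  coordinate. Its members are smooth because each derivative is again a member; no formula for
  iterated derivatives is involved.\<close>

inductive_set SM :: "(pt \<Rightarrow> real) set" where
  atom: "(\<lambda>x. Gp p (c + s * x $ j)) \<in> SM"
| const: "(\<lambda>x. c) \<in> SM"
| add: "f \<in> SM \<Longrightarrow> g \<in> SM \<Longrightarrow> (\<lambda>x. f x + g x) \<in> SM"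
| mult: "f \<in> SM \<Longrightarrow> g \<in> SM \<Longrightarrow> (\<lambda>x. f x * g x) \<in> SM"

lemma SM_step: "f \<in> SM \<Longrightarrow> (\<forall>x. f differentiable (at x)) \<and> (\<forall>i. pd i f \<in> SM)"
proof (induction rule: SM.induct)
  case (atom p c s j)
  let ?g = "\<lambda>x. Gp (monom 1 2 * (p - pderiv p)) (c + s * x $ j)"
  have D: "((\<lambda>x::pt. Gp p (c + s * x $ j)) has_derivative (\<lambda>h. \<Sum>i\<in>UNIV. h $ i * ((if i = j then s else 0) * ?g x))) (at x)" for x
  proof -
    have 1: "((\<lambda>x::pt. c + s * x $ j) has_derivative (\<lambda>h. s * h $ j)) (at x)"
      by (auto intro!: derivative_eq_intros bounded_linear_imp_has_derivative bounded_linear_vec_nth)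
    have 2: "(Gp p has_derivative (\<lambda>h. ?g x * h)) (at (c + s * x $ j))"
      using Gp_deriv by (simp add: has_field_derivative_def)
    have "((\<lambda>x::pt. Gp p (c + s * x $ j)) has_derivative (\<lambda>h. ?g x * (s * h $ j))) (at x)"
      by (rule has_derivative_compose[OF 1 2])
    moreover have "(\<lambda>h::pt. ?g x * (s * h $ j)) = (\<lambda>h. \<Sum>i\<in>UNIV. h $ i * ((if i = j then s else 0) * ?g x))"
      by (auto simp: sum_oth[of _ j])
    ultimately show ?thesis by simp
  qed
  have "pd i (\<lambda>x. Gp p (c + s * x $ j)) = (\<lambda>x. (if i = j then s else 0) * ?g x)" for i
    by (rule ext) (rule pd_eqI'[OF D])
  moreover have "(\<lambda>x. (if i = j then s else 0) * ?g x) \<in> SM" for i by (intro SM.mult SM.const SM.atom)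
  ultimately show ?case using D by (auto intro: differentiableI)
next
  case (const c)
  then show ?case by (auto simp: pd_const SM.const)
next
  case (add f g)
  then have "pd i (\<lambda>x. f x + g x) = (\<lambda>x. pd i f x + pd i g x)" for i by (auto simp: pd_add_at)
  then show ?case using add by (auto intro: SM.add)
next
  case (mult f g)
  then have "pd i (\<lambda>x. f x * g x) = (\<lambda>x. pd i f x * g x + f x * pd i g x)" for i by (auto simp: pd_mult_at)
  then show ?case using mult by (auto intro!: SM.add SM.mult)
qed

lemma SM_smooth: "f \<in> SM \<Longrightarrow> smooth_fun f"
proof -
  assume f: "f \<in> SM"
  have "pds is f \<in> SM" for "is" by (induction "is") (use f SM_step in auto)
  then show ?thesis using SM_step by (auto simp: smooth_fun_def)
qed

text \<open>The four factors confine both coordinates to absolute value below \<open>1/2\<close>, so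
  the function vanishes outside the unit disc.\<close>

definition eta0 :: "pt \<Rightarrow> real" where
  "eta0 y = (Gp 1 (1/2 + y $ 1) * Gp 1 (1/2 - y $ 1)) * (Gp 1 (1/2 + y $ 2) * Gp 1 (1/2 - y $ 2))"

lemma Gp1_nonneg: "0 \<le> Gp 1 t" by (simp add: Gp_def)

lemma eta0_nonneg: "0 \<le> eta0 y" by (simp add: eta0_def Gp1_nonneg)

lemma eta0_zero:
  assumes "norm y \<ge> 1" shows "eta0 y = 0"
proof -
  have "norm y \<le> \<bar>y $ 1\<bar> + \<bar>y $ 2\<bar>" using norm_le_l1_cart[of y] by (simp add: sum_2)
  then have "\<bar>y $ 1\<bar> \<ge> 1/2 \<or> \<bar>y $ 2\<bar> \<ge> 1/2" using assms by linarith
  then show ?thesis by (auto simp: eta0_def Gp_def)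
qed

lemma eta0_SM: "e \<noteq> 0 \<Longrightarrow> (\<lambda>z. eta0 ((1/e) *\<^sub>R (z - a))) \<in> SM"
proof -
  have *: "(\<lambda>z. Gp 1 (1/2 + (1/e) * (z - a) $ j)) \<in> SM" "(\<lambda>z. Gp 1 (1/2 - (1/e) * (z - a) $ j)) \<in> SM" for j
    using SM.atom[of 1 "1/2 - a $ j / e" "1/e" j] SM.atom[of 1 "1/2 + a $ j / e" "- 1/e" j]
    by (simp_all add: diff_divide_distrib algebra_simps)
  show ?thesis unfolding eta0_def vector_scaleR_component real_scaleR_def by (intro SM.mult *)
qed

lemma eta0_smooth: "smooth_fun eta0" using SM_smooth[OF eta0_SM[of 1 0]] by simp

lemma eta0_cont: "continuous_on S eta0" by (rule C1_continuous[OF smooth_fun_C1[OF eta0_smooth]])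

lemma test_fun_eta0: "test_fun UNIV eta0"
proof (rule test_funI[OF eta0_smooth, where S="cball 0 1"])
  show "eta0 x = 0" if "x \<notin> cball 0 1" for x using that by (intro eta0_zero) auto
qed auto

lemma integrable_compact_support:
  fixes f :: "pt \<Rightarrow> real"
  assumes "continuous_on UNIV f" "\<And>x. x \<notin> S \<Longrightarrow> f x = 0" "compact S"
  shows "integrable lborel f"
proof -
  have "integrable lborel (\<lambda>x. indicator S x *\<^sub>R f x)"
    by (rule borel_integrable_compact[OF assms(3)]) (use assms(1) continuous_on_subset in blast)
  moreover have "(\<lambda>x. indicator S x *\<^sub>R f x) = f" using assms(2) by (auto simp: indicator_def fun_eq_iff)
  ultimately show ?thesis by simp
qed

lemma eta0_integrable: "integrable lborel eta0" by (rule integrable_compact_support[where S="cball 0 1"])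
    (auto intro: eta0_cont eta0_zero)

lemma eta0_integral_pos: "integral\<^sup>L lborel eta0 > 0"
proof -
  have "integral\<^sup>L lborel eta0 \<noteq> 0"
  proof
    assume "integral\<^sup>L lborel eta0 = 0"
    then have "AE x in lborel. eta0 x = 0" using integral_nonneg_eq_0_iff_AE[OF eta0_integrable] eta0_nonneg by simp
    then have "AE x in lebesgue. x \<in> {x. eta0 x = 0}" by (simp add: AE_completion)
    moreover have "closed {x. eta0 x = 0}" by (intro closed_Collect_eq eta0_cont continuous_on_const)
    ultimately have "eta0 0 = 0" using mem_closed_if_AE_lebesgue by blast
    then show False by (simp add: eta0_def Gp_def)
  qed
  moreover have "integral\<^sup>L lborel eta0 \<ge> 0" using eta0_nonneg by (intro integral_nonneg_AE) auto
  ultimately show ?thesis by simp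
qed

section \<open>Mollification kernels\<close>

definition eta :: "pt \<Rightarrow> real" where
  "eta y = eta0 y / integral\<^sup>L lborel eta0"

lemma eta_eq: "eta = (\<lambda>y. (1 / integral\<^sup>L lborel eta0) * eta0 y + 0 * eta0 y)" by (auto simp: eta_def)

lemma test_fun_eta: "test_fun UNIV eta" unfolding eta_eq by (intro test_fun_lin test_fun_eta0)

lemma eta_cont: "continuous_on S eta" by (rule C1_continuous[OF test_fun_C1[OF test_fun_eta]])

lemma eta_nonneg: "0 \<le> eta y" using eta0_integral_pos by (simp add: eta_def eta0_nonneg)

lemma eta_zero: "norm y \<ge> 1 \<Longrightarrow> eta y = 0" by (simp add: eta_def eta0_zero)

lemma eta_integrable: "integrable lborel eta" unfolding eta_def using eta0_integrable by simp

lemma eta_integral: "integral\<^sup>L lborel eta = 1" unfolding eta_def using eta0_integral_pos by simp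

lemma eta_nn_integral: "(\<integral>\<^sup>+y. ennreal (eta y) \<partial>lborel) = 1"
  using nn_integral_eq_integral[OF eta_integrable] eta_nonneg by (simp add: eta_integral)

definition kern :: "real \<Rightarrow> pt \<Rightarrow> pt \<Rightarrow> real" where
  "kern e a z = eta ((1/e) *\<^sub>R (z - a)) / e\<^sup>2"

lemma kern_smooth: assumes "e > 0" shows "smooth_fun (kern e a)"
proof -
  have "kern e a = (\<lambda>z. (1 / (integral\<^sup>L lborel eta0 * e\<^sup>2)) * eta0 ((1/e) *\<^sub>R (z - a)))"
    by (auto simp: kern_def eta_def)
  also have "\<dots> \<in> SM" using assms by (intro SM.mult SM.const eta0_SM) auto
  finally show ?thesis by (rule SM_smooth)
qed

lemma kern_zero: "e > 0 \<Longrightarrow> e \<le> dist a z \<Longrightarrow> kern e a z = 0"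
proof -
  assume "e > 0" "e \<le> dist a z"
  then have "norm ((1/e) *\<^sub>R (z - a)) \<ge> 1" by (simp add: dist_norm norm_minus_commute)
  then show ?thesis unfolding kern_def by (simp only: eta_zero div_0)
qed

lemma kern_nonneg: "0 \<le> kern e a z" by (simp add: kern_def eta_nonneg)

lemma test_fun_kern: "e > 0 \<Longrightarrow> cball a e \<subseteq> \<Omega> \<Longrightarrow> test_fun \<Omega> (kern e a)"
  by (rule test_funI[OF kern_smooth, where S="cball a e"]) (auto intro: kern_zero)

lemma nn_integral_pt_affine:
  fixes f :: "pt \<Rightarrow> ennreal"
  assumes [measurable]: "f \<in> borel_measurable borel" and c: "c \<noteq> 0"
  shows "(\<integral>\<^sup>+x. f x \<partial>lborel) = ennreal (c\<^sup>2) * (\<integral>\<^sup>+x. f (t + c *\<^sub>R x) \<partial>lborel)"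
  by (subst lborel_affine[OF c, of t])
    (simp add: nn_integral_density nn_integral_distr nn_integral_cmult)

text \<open>This is the mass in the centre variable, whereas \<open>nn_integral_kern\<close> is the
  mass in the integration variable. A centre moving with speed \<open>s\<close> contributes the
  Jacobian \<open>1 / s^2\<close>. Both masses enter the bound for mollification.\<close>

lemma nn_integral_kern_affine:
  assumes "e > 0" "s > 0"
  shows "(\<integral>\<^sup>+x. ennreal (kern e (b + s *\<^sub>R x) z) \<partial>lborel) = ennreal (1 / s\<^sup>2)"
proof -
  have [measurable]: "eta \<in> borel_measurable borel" using eta_cont by (intro borel_measurable_continuous_onI)
  define c where "c = - (s / e)"
  have c: "c \<noteq> 0" "c\<^sup>2 = s\<^sup>2 / e\<^sup>2" using assms by (auto simp: c_def power_divide)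
  have K: "kern e (b + s *\<^sub>R x) z = eta ((1/e) *\<^sub>R (z - b) + c *\<^sub>R x) / e\<^sup>2" for x
    using assms by (auto simp: kern_def c_def scaleR_diff_right algebra_simps intro!: arg_cong[where f=eta])
  have "ennreal (c\<^sup>2) * (\<integral>\<^sup>+x. eta ((1/e) *\<^sub>R (z - b) + c *\<^sub>R x) \<partial>lborel) = 1"
    using nn_integral_pt_affine[of "\<lambda>y. ennreal (eta y)" c "(1/e) *\<^sub>R (z - b)"] c eta_nn_integral by simp
  then have I: "(\<integral>\<^sup>+x. eta ((1/e) *\<^sub>R (z - b) + c *\<^sub>R x) \<partial>lborel) = ennreal (1 / c\<^sup>2)"
    using c(1) by (metis (no_types, lifting) divide_ennreal ennreal_1 ennreal_mult_divide_eq
        ennreal_neq_top mult.commute ennreal_eq_0_iff linorder_not_less zero_less_power2 order_less_imp_le zero_le_one)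
  have "(\<integral>\<^sup>+x. ennreal (kern e (b + s *\<^sub>R x) z) \<partial>lborel)
      = (\<integral>\<^sup>+x. ennreal (1 / e\<^sup>2) * eta ((1/e) *\<^sub>R (z - b) + c *\<^sub>R x) \<partial>lborel)"
    unfolding K by (intro nn_integral_cong) (simp add: ennreal_mult'[symmetric] eta_nonneg)
  also have "\<dots> = ennreal (1 / e\<^sup>2) * ennreal (1 / c\<^sup>2)" by (subst nn_integral_cmult) (simp_all add: I)
  also have "\<dots> = ennreal (1 / s\<^sup>2)" using assms by (simp add: ennreal_mult[symmetric] c(2))
  finally show ?thesis .
qed

lemma nn_integral_kern:
  assumes "e > 0"
  shows "(\<integral>\<^sup>+z. ennreal (kern e a z) \<partial>lborel) = 1"
proof -
  have [measurable]: "eta \<in> borel_measurable borel" using eta_cont by (intro borel_measurable_continuous_onI)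
  have "(\<integral>\<^sup>+z. ennreal (kern e a z) \<partial>lborel)
      = ennreal (e\<^sup>2) * (\<integral>\<^sup>+y. ennreal (kern e a (a + e *\<^sub>R y)) \<partial>lborel)"
    by (rule nn_integral_pt_affine) (use assms in \<open>auto simp: kern_def[abs_def]\<close>)
  also have "(\<lambda>y. ennreal (kern e a (a + e *\<^sub>R y))) = (\<lambda>y. ennreal (1 / e\<^sup>2) * ennreal (eta y))"
    using assms by (auto simp: kern_def ennreal_mult'[symmetric] eta_nonneg)
  also have "ennreal (e\<^sup>2) * (\<integral>\<^sup>+y. ennreal (1 / e\<^sup>2) * ennreal (eta y) \<partial>lborel) = 1"
    using assms by (subst nn_integral_cmult) (auto simp: eta_nn_integral ennreal_mult[symmetric])
  finally show ?thesis .
qed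

section \<open>Mollification on a convex domain\<close>

lemma test_fun_pd_bounded:
  assumes "test_fun UNIV \<phi>"
  shows "\<exists>B\<ge>0. \<forall>x. \<bar>\<phi> x\<bar> \<le> B"
proof -
  have K: "compact (closure {x. \<phi> x \<noteq> 0})" using assms by (simp add: test_fun_def)
  have "compact (\<phi> ` closure {x. \<phi> x \<noteq> 0})" by (intro compact_continuous_image K C1_continuous test_fun_C1[OF assms])
  then obtain B where B: "B > 0" "\<forall>y\<in>\<phi> ` closure {x. \<phi> x \<noteq> 0}. norm y \<le> B"
    using compact_imp_bounded bounded_pos by metis
  have "\<bar>\<phi> x\<bar> \<le> B" for x
  proof (cases "\<phi> x = 0")
    case False
    then have "x \<in> closure {x. \<phi> x \<noteq> 0}" using closure_subset[of "{x. \<phi> x \<noteq> 0}"] by auto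
    then show ?thesis using B by auto
  qed (use B in auto)
  then show ?thesis using B(1) by (intro exI[of _ B]) auto
qed

lemma MVT_line:
  assumes "C1 f"
  shows "\<exists>s. 0 < s \<and> s < 1 \<and> f (x + h) - f x = (\<Sum>i\<in>UNIV. h $ i * pd i f (x + s *\<^sub>R h))"
proof -
  have "\<exists>s. s > 0 \<and> s < 1 \<and> f (x + 1 *\<^sub>R h) - f (x + 0 *\<^sub>R h) = (1 - 0) * (\<Sum>i\<in>UNIV. h $ i * pd i f (x + s *\<^sub>R h))"
    by (rule MVT2) (auto intro: has_real_derivative_line C1_diff'[OF assms])
  then show ?thesis by auto
qed

lemma sum2_abs_bound:
  fixes h :: pt
  assumes "\<And>i. \<bar>d i\<bar> \<le> B"
  shows "\<bar>\<Sum>i\<in>UNIV. h $ i * d i\<bar> \<le> 2 * B * norm h"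
proof -
  have "\<bar>\<Sum>i\<in>UNIV. h $ i * d i\<bar> \<le> (\<Sum>i\<in>UNIV. \<bar>h $ i * d i\<bar>)" by (rule sum_abs)
  also have "\<dots> \<le> (\<Sum>i\<in>(UNIV::2 set). norm h * B)"
    by (intro sum_mono) (auto simp: abs_mult intro!: mult_mono component_le_norm_cart assms)
  finally show ?thesis by (simp add: mult_ac)
qed

lemma test_fun_lipschitz:
  assumes "test_fun UNIV \<phi>"
  shows "\<exists>L\<ge>0. \<forall>x y. \<bar>\<phi> x - \<phi> y\<bar> \<le> L * norm (x - y)"
proof -
  have "\<exists>B\<ge>0. \<forall>x. \<bar>pd i \<phi> x\<bar> \<le> B" for i by (rule test_fun_pd_bounded[OF test_fun_pd[OF assms]])
  then obtain B where B: "\<And>i. B i \<ge> 0" "\<And>i x. \<bar>pd i \<phi> x\<bar> \<le> B i" by metis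
  define C where "C = B 1 + B 2"
  have C: "\<bar>pd i \<phi> x\<bar> \<le> C" for i x using B(2)[of i x] B(1)[of 1] B(1)[of 2] two_cases[of i] by (auto simp: C_def)
  have "\<bar>\<phi> x - \<phi> y\<bar> \<le> 2 * C * norm (x - y)" for x y
  proof -
    obtain s where "\<phi> (y + (x - y)) - \<phi> y = (\<Sum>i\<in>UNIV. (x - y) $ i * pd i \<phi> (y + s *\<^sub>R (x - y)))"
      using MVT_line[OF test_fun_C1[OF assms]] by blast
    then show ?thesis using sum2_abs_bound[of "\<lambda>i. pd i \<phi> (y + s *\<^sub>R (x - y))" C "x - y"] C by simp
  qed
  moreover have "2 * C \<ge> 0" using B(1)[of 1] B(1)[of 2] by (simp add: C_def)
  ultimately show ?thesis by blast
qed

lemma test_fun_taylor: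
  assumes "test_fun UNIV \<phi>"
  shows "\<exists>C\<ge>0. \<forall>x h. \<bar>\<phi> (x + h) - \<phi> x - (\<Sum>i\<in>UNIV. h $ i * pd i \<phi> x)\<bar> \<le> C * (norm h)\<^sup>2"
proof -
  have "\<exists>L\<ge>0. \<forall>x y. \<bar>pd i \<phi> x - pd i \<phi> y\<bar> \<le> L * norm (x - y)" for i
    by (rule test_fun_lipschitz[OF test_fun_pd[OF assms]])
  then obtain B where B: "\<And>i. B i \<ge> 0" "\<And>i x y. \<bar>pd i \<phi> x - pd i \<phi> y\<bar> \<le> B i * norm (x - y)" by metis
  define C where "C = B 1 + B 2"
  have C0: "C \<ge> 0" using B(1)[of 1] B(1)[of 2] by (simp add: C_def)
  have C: "\<bar>pd i \<phi> x - pd i \<phi> y\<bar> \<le> C * norm (x - y)" for i x y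
  proof -
    have "B i \<le> C" using B(1)[of 1] B(1)[of 2] two_cases[of i] by (auto simp: C_def)
    then show ?thesis using B(2)[of i x y] by (meson mult_right_mono norm_ge_zero order_trans)
  qed
  have "\<bar>\<phi> (x + h) - \<phi> x - (\<Sum>i\<in>UNIV. h $ i * pd i \<phi> x)\<bar> \<le> 2 * C * (norm h)\<^sup>2" for x h
  proof -
    obtain s where s: "0 < s" "s < 1" "\<phi> (x + h) - \<phi> x = (\<Sum>i\<in>UNIV. h $ i * pd i \<phi> (x + s *\<^sub>R h))"
      using MVT_line[OF test_fun_C1[OF assms]] by blast
    have "\<bar>pd i \<phi> (x + s *\<^sub>R h) - pd i \<phi> x\<bar> \<le> C * norm h" for i
    proof -
      have "\<bar>pd i \<phi> (x + s *\<^sub>R h) - pd i \<phi> x\<bar> \<le> C * (s * norm h)" using C[of i "x + s *\<^sub>R h" x] s by simp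
      also have "\<dots> \<le> C * (1 * norm h)" using s C0 by (intro mult_left_mono mult_right_mono) auto
      finally show ?thesis by simp
    qed
    then have "\<bar>\<Sum>i\<in>UNIV. h $ i * (pd i \<phi> (x + s *\<^sub>R h) - pd i \<phi> x)\<bar> \<le> 2 * (C * norm h) * norm h"
      by (rule sum2_abs_bound)
    then show ?thesis by (simp add: s(3) right_diff_distrib sum_subtractf power2_eq_square mult_ac)
  qed
  then show ?thesis using C0 by (intro exI[of _ "2 * C"]) auto
qed

text \<open>A uniform quadratic remainder survives integration against an integrable weight, so this
  criterion takes the place of dominated convergence for difference quotients.\<close>

lemma has_derivative_quadratic_remainder:
  fixes f :: "pt \<Rightarrow> real"
  assumes "\<And>h. \<bar>f (x + h) - f x - (\<Sum>i\<in>UNIV. h $ i * d i)\<bar> \<le> C * (norm h)\<^sup>2"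
  shows "(f has_derivative (\<lambda>h. \<Sum>i\<in>UNIV. h $ i * d i)) (at x)"
  unfolding has_derivative_at
proof
  show "bounded_linear (\<lambda>h::pt. \<Sum>i\<in>UNIV. h $ i * d i)"
    by (intro bounded_linear_sum bounded_linear_mult_left[THEN bounded_linear_compose] bounded_linear_vec_nth)
  show "(\<lambda>h. norm (f (x + h) - f x - (\<Sum>i\<in>UNIV. h $ i * d i)) / norm h) \<midarrow>0\<rightarrow> 0"
  proof (rule Lim_null_comparison)
    show "\<forall>\<^sub>F h in at 0. norm (norm (f (x + h) - f x - (\<Sum>i\<in>UNIV. h $ i * d i)) / norm h) \<le> C * norm h"
      unfolding eventually_at_filter
    proof (rule always_eventually, intro allI impI)
      fix h :: pt assume "h \<noteq> 0"
      then show "norm (norm (f (x + h) - f x - (\<Sum>i\<in>UNIV. h $ i * d i)) / norm h) \<le> C * norm h"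
        using assms[of h] by (simp add: divide_le_eq power2_eq_square mult_ac)
    qed
    show "((\<lambda>h. C * norm h) \<longlongrightarrow> 0) (at (0::pt))" by (auto intro!: tendsto_eq_intros)
  qed
qed

lemma integrable_mult_bounded:
  fixes g k :: "'a \<Rightarrow> real"
  assumes "integrable M g" "k \<in> borel_measurable M" "\<And>x. \<bar>k x\<bar> \<le> B"
  shows "integrable M (\<lambda>x. g x * k x)" "\<bar>\<integral>x. g x * k x \<partial>M\<bar> \<le> B * (\<integral>x. \<bar>g x\<bar> \<partial>M)"
proof -
  have le: "\<bar>g x * k x\<bar> \<le> \<bar>B * \<bar>g x\<bar>\<bar>" for x
  proof -
    have "\<bar>g x\<bar> * \<bar>k x\<bar> \<le> \<bar>g x\<bar> * \<bar>B\<bar>" using assms(3)[of x] by (intro mult_left_mono) auto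
    then show ?thesis by (simp add: abs_mult mult.commute)
  qed
  show *: "integrable M (\<lambda>x. g x * k x)"
    by (rule Bochner_Integration.integrable_bound[of M "\<lambda>x. B * \<bar>g x\<bar>"]) (use assms le in auto)
  have B: "B \<ge> 0" using assms(3) abs_ge_zero order_trans by blast
  have "\<bar>\<integral>x. g x * k x \<partial>M\<bar> \<le> (\<integral>x. \<bar>g x * k x\<bar> \<partial>M)" by (rule integral_abs_bound)
  also have "\<dots> \<le> (\<integral>x. B * \<bar>g x\<bar> \<partial>M)" by (rule integral_mono) (use assms(1) * le B in auto)
  finally show "\<bar>\<integral>x. g x * k x \<partial>M\<bar> \<le> B * (\<integral>x. \<bar>g x\<bar> \<partial>M)" by simp
qed

lemma continuous_borel_lebesgue_on [intro]:
  fixes f :: "pt \<Rightarrow> real"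
  assumes "continuous_on UNIV f" shows "f \<in> borel_measurable (lebesgue_on S)"
proof -
  have "f \<in> borel_measurable borel" using assms by (rule borel_measurable_continuous_onI)
  then have "f \<in> borel_measurable lebesgue" by (simp add: measurable_completion)
  then show ?thesis by (rule measurable_restrict_space1)
qed

lemma continuous_sq_int:
  fixes f :: "pt \<Rightarrow> real"
  assumes "continuous_on UNIV f" "bounded S" "S \<in> lmeasurable"
  shows "sq_int (lebesgue_on S) f"
proof -
  have "compact (f ` closure S)"
    using assms by (intro compact_continuous_image) (auto intro: continuous_on_subset simp: compact_closure)
  then obtain B where B: "\<forall>y\<in>f ` closure S. norm y \<le> B" using compact_imp_bounded bounded_iff by metis
  have "\<bar>f x\<bar> \<le> B" if "x \<in> S" for x
  proof -
    have "x \<in> closure S" using that closure_subset by auto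
    then show ?thesis using B by auto
  qed
  then show ?thesis by (intro sq_int_bounded[of _ _ B] finite_measure_lebesgue_on assms continuous_borel_lebesgue_on)
      (auto simp: space_restrict_space)
qed

lemma kern_shift: "kern e a = (\<lambda>z. kern e 0 (z - a))" by (auto simp: kern_def)

lemma pd_shift:
  assumes "C1 \<phi>" shows "pd i (\<lambda>z. \<phi> (z - a)) z = pd i \<phi> (z - a)"
proof (rule pd_eqI')
  have "((\<lambda>z. z - a) has_derivative (\<lambda>h. h)) (at z)" by (auto intro!: derivative_eq_intros)
  from has_derivative_compose[OF this C1_has_derivative[OF assms]]
  show "((\<lambda>z. \<phi> (z - a)) has_derivative (\<lambda>h. \<Sum>i\<in>UNIV. h $ i * pd i \<phi> (z - a))) (at z)" .
qed

lemma kern_cont: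
  assumes "continuous_on S a" "continuous_on S b"
  shows "continuous_on S (\<lambda>x. kern e (a x) (b x))"
  unfolding kern_def divide_inverse
  by (intro continuous_intros continuous_on_compose2[OF eta_cont[of UNIV]] assms) auto

text \<open>Mollification composed with a contraction towards the interior point \<open>x0\<close>, so that the
  mollified function is smooth up to the boundary and commutes with weak derivatives on all of
  the domain.\<close>

locale conv_dom =
  fixes \<Omega> :: "pt set" and x0 :: pt and r :: real
  assumes open_dom: "open \<Omega>" and bounded_dom: "bounded \<Omega>" and convex_dom: "convex \<Omega>"
    and r_pos: "r > 0" and ball_dom: "cball x0 r \<subseteq> \<Omega>"
begin

abbreviation "M \<equiv> lebesgue_on \<Omega>"

definition ctr :: "real \<Rightarrow> pt \<Rightarrow> pt" where
  "ctr d x = x0 + (1 - d) *\<^sub>R (x - x0)"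

definition moll :: "real \<Rightarrow> (pt \<Rightarrow> real) \<Rightarrow> pt \<Rightarrow> real" where
  "moll d g x = (\<integral>z. g z * kern (d * r) (ctr d x) z \<partial>M)"

lemma dom_lmeasurable: "\<Omega> \<in> lmeasurable" by (rule lmeasurable_open[OF bounded_dom open_dom])

lemma dom_sets [measurable]: "\<Omega> \<in> sets lebesgue" using dom_lmeasurable by (rule fmeasurableD)

lemma fin_M: "finite_measure M" by (rule finite_measure_lebesgue_on[OF dom_lmeasurable])

lemma space_M: "space M = \<Omega>" by (simp add: space_restrict_space)

lemma sq_int_integrable: "sq_int M g \<Longrightarrow> integrable M g" by (rule sq_int_imp_integrable[OF fin_M])

lemma sq_int_cont: "continuous_on UNIV f \<Longrightarrow> sq_int M f" by (rule continuous_sq_int[OF _ bounded_dom dom_lmeasurable])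

lemma sq_int_C1: "C1 f \<Longrightarrow> sq_int M f" and sq_int_C1_pd: "C1 f \<Longrightarrow> sq_int M (pd i f)"
  by (simp_all add: sq_int_cont C1_continuous C1_continuous_pd)

text \<open>A point of the small disc is the convex combination \<open>(1 - d) x + d u\<close> with
  \<open>u\<close> in the disc of radius \<open>r\<close> about \<open>x0\<close>, and convexity
  keeps it inside. The mollifier at any \<open>x\<close> of the domain therefore sees only values
  inside the domain.\<close>

lemma ctr_ball:
  assumes "x \<in> \<Omega>" "0 < d" "d \<le> 1"
  shows "cball (ctr d x) (d * r) \<subseteq> \<Omega>"
proof
  fix y assume y: "y \<in> cball (ctr d x) (d * r)"
  define u where "u = x0 + (1/d) *\<^sub>R (y - ctr d x)"
  have "norm (y - ctr d x) \<le> d * r" using y by (simp add: dist_norm norm_minus_commute)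
  moreover have "dist x0 u = norm (y - ctr d x) / d"
    using assms(2) by (simp add: u_def dist_norm del: scaleR_diff_right)
  ultimately have "u \<in> cball x0 r" using assms(2) by (simp add: divide_le_eq mult.commute)
  then have "u \<in> \<Omega>" using ball_dom by auto
  have "y = (1 - d) *\<^sub>R x + d *\<^sub>R u" using assms(2) by (simp add: u_def ctr_def algebra_simps)
  then show "y \<in> \<Omega>" using convexD[OF convex_dom \<open>x \<in> \<Omega>\<close> \<open>u \<in> \<Omega>\<close>, of "1 - d" d] assms by simp
qed

lemma kern_test: "x \<in> \<Omega> \<Longrightarrow> 0 < d \<Longrightarrow> d \<le> 1 \<Longrightarrow> test_fun \<Omega> (kern (d * r) (ctr d x))"
  using r_pos by (intro test_fun_kern ctr_ball) auto

lemma ctr_cont: "continuous_on S (ctr d)" unfolding ctr_def by (intro continuous_intros)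

lemma kern_meas: "kern e a \<in> borel_measurable M" by (intro continuous_borel_lebesgue_on kern_cont continuous_intros)

lemma kern_bounded: "\<exists>B. \<forall>a z. \<bar>kern e a z\<bar> \<le> B"
proof -
  obtain B where "\<forall>x. \<bar>eta x\<bar> \<le> B" using test_fun_pd_bounded[OF test_fun_eta] by blast
  then have "\<bar>kern e a z\<bar> \<le> B / e\<^sup>2" for a z by (auto simp: kern_def divide_right_mono)
  then show ?thesis by blast
qed

lemma integrable_kern: "integrable M g \<Longrightarrow> integrable M (\<lambda>z. g z * kern e a z)"
proof -
  assume g: "integrable M g"
  obtain B where "\<forall>a z. \<bar>kern e a z\<bar> \<le> B" using kern_bounded by blast
  then show ?thesis using integrable_mult_bounded(1)[OF g kern_meas] by blast
qed

text \<open>The Taylor remainder of the kernel is of second order uniformly in \<open>z\<close>,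
  hence so is its integral against \<open>g\<close>. The Lipschitz bound of the kernel derivatives
  gives continuity in the same manner.\<close>

lemma convolution_deriv:
  assumes g: "integrable M g" and k: "test_fun UNIV k"
  shows "C1 (\<lambda>y. \<integral>z. g z * k (z - y) \<partial>M)" (is "C1 ?W")
    "pd i (\<lambda>y. \<integral>z. g z * k (z - y) \<partial>M) y = - (\<integral>z. g z * pd i k (z - y) \<partial>M)"
proof -
  define D where "D i y = - (\<integral>z. g z * pd i k (z - y) \<partial>M)" for i y
  let ?I = "\<integral>z. \<bar>g z\<bar> \<partial>M"
  have m: "(\<lambda>z. \<phi> (z - y)) \<in> borel_measurable M" if "test_fun UNIV \<phi>" for \<phi> y
    by (intro continuous_borel_lebesgue_on continuous_on_compose2[OF C1_continuous[OF test_fun_C1[OF that], of UNIV]] continuous_intros) auto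
  have int: "integrable M (\<lambda>z. g z * \<phi> (z - y))" if t: "test_fun UNIV \<phi>" for \<phi> y
  proof -
    obtain B where "\<And>x. \<bar>\<phi> x\<bar> \<le> B" using test_fun_pd_bounded[OF t] by blast
    then show ?thesis by (intro integrable_mult_bounded(1)[OF g m[OF t]])
  qed
  note pk = test_fun_pd[OF k]
  obtain C where C: "\<And>x h. \<bar>k (x + h) - k x - (\<Sum>i\<in>UNIV. h $ i * pd i k x)\<bar> \<le> C * (norm h)\<^sup>2"
    using test_fun_taylor[OF k] by blast
  have der: "(?W has_derivative (\<lambda>h. \<Sum>i\<in>UNIV. h $ i * D i y)) (at y)" for y
  proof (rule has_derivative_quadratic_remainder[where C="C * ?I"])
    fix h :: pt
    define R where "R z = k (z - (y + h)) - k (z - y) + (\<Sum>i\<in>UNIV. h $ i * pd i k (z - y))" for z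
    have Rm: "R \<in> borel_measurable M"
      unfolding R_def by (intro borel_measurable_add borel_measurable_diff borel_measurable_sum borel_measurable_times
        borel_measurable_const m k pk)
    have Rb: "\<bar>R z\<bar> \<le> C * (norm h)\<^sup>2" for z using C[of "z - y" "- h"] by (simp add: R_def sum_negf diff_diff_eq)
    have "(\<integral>z. g z * R z \<partial>M) = (\<integral>z. g z * k (z - (y + h)) - g z * k (z - y) + (\<Sum>i\<in>UNIV. h $ i * (g z * pd i k (z - y))) \<partial>M)"
      by (simp add: R_def sum_2 algebra_simps)
    also have "\<dots> = ?W (y + h) - ?W y - (\<Sum>i\<in>UNIV. h $ i * D i y)"
      using int[OF k] int[OF pk] by (simp add: D_def sum_negf)
    finally show "\<bar>?W (y + h) - ?W y - (\<Sum>i\<in>UNIV. h $ i * D i y)\<bar> \<le> C * ?I * (norm h)\<^sup>2"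
      using integrable_mult_bounded(2)[OF g Rm Rb] by (simp add: mult_ac)
  qed
  have cont: "continuous_on UNIV (D i)" for i
  proof -
    obtain L where L: "L \<ge> 0" "\<And>x y. \<bar>pd i k x - pd i k y\<bar> \<le> L * norm (x - y)"
      using test_fun_lipschitz[OF pk] by blast
    have "\<bar>D i x - D i y\<bar> \<le> (L * ?I) * norm (x - y)" for x y
    proof -
      have "D i x - D i y = - (\<integral>z. g z * (pd i k (z - x) - pd i k (z - y)) \<partial>M)"
        using int[OF pk] by (simp add: D_def right_diff_distrib)
      moreover have "\<bar>pd i k (z - x) - pd i k (z - y)\<bar> \<le> L * norm (x - y)" for z
        using L(2)[of "z - x" "z - y"] by (simp add: norm_minus_commute)
      ultimately show ?thesis
        using integrable_mult_bounded(2)[OF g borel_measurable_diff[OF m[OF pk] m[OF pk]], of i x i y "L * norm (x - y)"]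
        by (simp add: mult_ac)
    qed
    then have "(L * ?I)-lipschitz_on UNIV (D i)" using L(1) by (intro lipschitz_onI) (auto simp: dist_norm)
    then show ?thesis by (rule lipschitz_on_continuous_on)
  qed
  from C1I[OF der cont] show "C1 ?W" "pd i ?W y = - (\<integral>z. g z * pd i k (z - y) \<partial>M)" by (simp_all add: D_def)
qed

lemma moll_deriv:
  assumes g: "integrable M g" and d: "0 < d" "d \<le> 1"
  shows "C1 (moll d g)" "pd i (moll d g) x = - (1 - d) * (\<integral>z. g z * pd i (kern (d * r) (ctr d x)) z \<partial>M)"
proof -
  let ?k = "kern (d * r) 0"
  define W where "W y = (\<integral>z. g z * ?k (z - y) \<partial>M)" for y
  have k: "test_fun UNIV ?k" using d r_pos by (intro test_fun_kern) auto
  have W: "C1 W" "pd i W y = - (\<integral>z. g z * pd i ?k (z - y) \<partial>M)" for i y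
    unfolding W_def[abs_def] by (rule convolution_deriv[OF g k])+
  have m: "moll d g = (\<lambda>x. W (ctr d x))" by (rule ext) (simp only: moll_def W_def kern_shift[of "d * r" "ctr d _"])
  have der: "(moll d g has_derivative (\<lambda>h. \<Sum>i\<in>UNIV. h $ i * ((1 - d) * pd i W (ctr d x)))) (at x)" for x
  proof -
    have "(ctr d has_derivative (\<lambda>h. (1 - d) *\<^sub>R h)) (at x)" unfolding ctr_def by (auto intro!: derivative_eq_intros)
    from has_derivative_compose[OF this C1_has_derivative[OF W(1)]] show ?thesis unfolding m by (simp add: mult_ac)
  qed
  have "continuous_on UNIV (\<lambda>x. (1 - d) * pd i W (ctr d x))" for i
    by (intro continuous_intros continuous_on_compose2[OF C1_continuous_pd[OF W(1)] ctr_cont]) auto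
  from C1I[OF der this] show "C1 (moll d g)"
    "pd i (moll d g) x = - (1 - d) * (\<integral>z. g z * pd i (kern (d * r) (ctr d x)) z \<partial>M)"
    by (simp_all add: W(2) kern_shift[of "d * r" "ctr d x"] pd_shift[OF test_fun_C1[OF k]] left_diff_distrib)
qed

text \<open>By \<open>ctr_ball\<close> the kernel centred at the contracted point is an admissible
  test function, so the derivative can be moved onto \<open>g\<close>. The factor
  \<open>1 - d\<close> is the derivative of the contraction.\<close>

lemma moll_wderiv:
  assumes "integrable M g" "0 < d" "d \<le> 1" "is_wderiv \<Omega> i g g'" "x \<in> \<Omega>"
  shows "pd i (moll d g) x = (1 - d) * moll d g' x"
proof -
  have "(\<integral>z. g z * pd i (kern (d * r) (ctr d x)) z \<partial>M) = - (\<integral>z. g' z * kern (d * r) (ctr d x) z \<partial>M)"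
    using assms(4) kern_test[OF assms(5,2,3)] by (simp add: is_wderiv_def)
  then show ?thesis unfolding moll_deriv(2)[OF assms(1-3)] moll_def by (simp only: minus_mult_minus)
qed

end

lemma continuous_measurable_lebesgue_on:
  fixes f :: "pt \<Rightarrow> 'b::topological_space"
  assumes "continuous_on UNIV f" shows "f \<in> lebesgue_on S \<rightarrow>\<^sub>M borel"
proof -
  have "f \<in> borel \<rightarrow>\<^sub>M borel" using assms by (rule borel_measurable_continuous_onI)
  then have "f \<in> lebesgue \<rightarrow>\<^sub>M borel" by (simp add: measurable_completion)
  then show ?thesis by (rule measurable_restrict_space1)
qed

lemma measurable_pair_continuous:
  fixes f :: "pt \<times> pt \<Rightarrow> real"
  assumes "continuous_on UNIV f"
  shows "f \<in> borel_measurable (lebesgue_on S \<Otimes>\<^sub>M lebesgue_on T)"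
proof -
  have [measurable]: "(\<lambda>x. x) \<in> lebesgue_on S \<rightarrow>\<^sub>M (borel :: pt measure)" for S
    by (rule continuous_measurable_lebesgue_on) (rule continuous_on_id)
  have "(\<lambda>p. (fst p, snd p)) \<in> lebesgue_on S \<Otimes>\<^sub>M lebesgue_on T \<rightarrow>\<^sub>M (borel :: pt measure) \<Otimes>\<^sub>M borel"
    by (intro measurable_Pair measurable_compose[OF measurable_fst] measurable_compose[OF measurable_snd]) measurable
  then have "(\<lambda>p. (fst p, snd p)) \<in> lebesgue_on S \<Otimes>\<^sub>M lebesgue_on T \<rightarrow>\<^sub>M (borel :: (pt \<times> pt) measure)"
    by (simp add: borel_prod)
  then have "(\<lambda>p. f (fst p, snd p)) \<in> borel_measurable (lebesgue_on S \<Otimes>\<^sub>M lebesgue_on T)"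
    by (rule measurable_compose) (rule borel_measurable_continuous_onI[OF assms])
  then show ?thesis by simp
qed

lemma nn_integral_lebesgue_on_le:
  fixes f :: "pt \<Rightarrow> ennreal"
  assumes "S \<in> sets lebesgue"
  shows "(\<integral>\<^sup>+x. f x \<partial>lebesgue_on S) \<le> (\<integral>\<^sup>+x. f x \<partial>lborel)"
proof -
  have "(\<integral>\<^sup>+x. f x \<partial>lebesgue_on S) = (\<integral>\<^sup>+x. f x * indicator S x \<partial>lebesgue)"
    using assms by (simp add: nn_integral_restrict_space)
  also have "\<dots> \<le> (\<integral>\<^sup>+x. f x \<partial>lebesgue)" by (intro nn_integral_mono) (auto simp: indicator_def)
  finally show ?thesis by (simp add: nn_integral_completion)
qed

context conv_dom
begin

lemma moll_diff:
  assumes "integrable M f" "integrable M g"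
  shows "moll d (\<lambda>x. f x - g x) x = moll d f x - moll d g x"
  unfolding moll_def using integrable_kern assms by (simp add: left_diff_distrib)

lemma kern_integral:
  assumes "x \<in> \<Omega>" "0 < d" "d \<le> 1"
  shows "(\<integral>z. kern (d * r) (ctr d x) z \<partial>M) = 1" "integrable M (kern (d * r) (ctr d x))"
proof -
  let ?k = "kern (d * r) (ctr d x)"
  have e: "d * r > 0" using assms r_pos by simp
  interpret finite_measure M by (rule fin_M)
  have "integrable M (\<lambda>z. 1 * ?k z)" by (rule integrable_kern) simp
  then show i: "integrable M ?k" by simp
  have "(\<integral>\<^sup>+z. ?k z \<partial>M) = (\<integral>\<^sup>+z. ennreal (?k z) * indicator \<Omega> z \<partial>lebesgue)" by (simp add: nn_integral_restrict_space)
  also have "\<dots> = (\<integral>\<^sup>+z. ?k z \<partial>lebesgue)"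
  proof (rule nn_integral_cong)
    fix z show "ennreal (?k z) * indicator \<Omega> z = ennreal (?k z)"
      using test_fun_zero[OF kern_test[OF assms], of z] by (auto simp: indicator_def)
  qed
  also have "\<dots> = 1" by (simp add: nn_integral_completion nn_integral_kern[OF e])
  finally show "(\<integral>z. ?k z \<partial>M) = 1" by (subst integral_eq_nn_integral) (use i kern_nonneg in auto)
qed

text \<open>A Schur test: Cauchy--Schwarz with the square root of the kernel as weight uses its unit
  mass in \<open>z\<close>; after exchanging the integrals the mass in \<open>x\<close> is at most
  \<open>1 / (1 - d)^2\<close>, by the Jacobian of the contraction.\<close>

lemma moll_L2:
  assumes g: "sq_int M g" and d: "0 < d" "d < 1"
  shows "sq_int M (moll d g)" "n2 M (moll d g) \<le> (1 / (1 - d)) * n2 M g"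
proof -
  let ?k = "\<lambda>x. kern (d * r) (ctr d x)"
  have e: "d * r > 0" using d r_pos by simp
  have gi: "integrable M g" by (rule sq_int_integrable[OF g])
  show s: "sq_int M (moll d g)" by (intro sq_int_C1 moll_deriv(1) gi) (use d in auto)
  interpret finite_measure M by (rule fin_M)
  interpret MM: pair_sigma_finite M M ..
  have g2: "integrable M (\<lambda>z. (g z)\<^sup>2)" using g by (simp add: sq_int_def)
  have [measurable]: "g \<in> borel_measurable M" using g by (simp add: sq_int_def)
  have le: "ennreal ((moll d g x)\<^sup>2) \<le> (\<integral>\<^sup>+z. ennreal ((g z)\<^sup>2 * ?k x z) \<partial>M)" if "x \<in> \<Omega>" for x
  proof -
    note ki = kern_integral[OF that d(1) less_imp_le[OF d(2)]]
    have [measurable]: "?k x \<in> borel_measurable M" by (rule kern_meas)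
    have sq: "(\<lambda>z. (g z * sqrt (?k x z))\<^sup>2) = (\<lambda>z. (g z)\<^sup>2 * ?k x z)"
      "(\<lambda>z. (sqrt (?k x z))\<^sup>2) = ?k x" by (auto simp: power_mult_distrib kern_nonneg)
    have 1: "sq_int M (\<lambda>z. g z * sqrt (?k x z))" unfolding sq_int_def sq using integrable_kern[OF g2] by auto
    have 2: "sq_int M (\<lambda>z. sqrt (?k x z))" unfolding sq_int_def sq using ki(2) by auto
    have "moll d g x = (\<integral>z. (g z * sqrt (?k x z)) * sqrt (?k x z) \<partial>M)"
      unfolding moll_def by (simp add: mult.assoc kern_nonneg)
    then have "\<bar>moll d g x\<bar> \<le> n2 M (\<lambda>z. g z * sqrt (?k x z)) * n2 M (\<lambda>z. sqrt (?k x z))" using n2_CS[OF 1 2] by simp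
    also have "n2 M (\<lambda>z. sqrt (?k x z)) = 1" unfolding n2_def sq ki(1) by simp
    finally have "\<bar>moll d g x\<bar>\<^sup>2 \<le> (n2 M (\<lambda>z. g z * sqrt (?k x z)))\<^sup>2" by (intro power_mono) auto
    then have "(moll d g x)\<^sup>2 \<le> (\<integral>z. (g z)\<^sup>2 * ?k x z \<partial>M)" by (simp add: n2_sq sq)
    then show ?thesis using nn_integral_eq_integral[OF integrable_kern[OF g2]] kern_nonneg by (simp add: ennreal_leI)
  qed
  have meas: "(\<lambda>(x, z). ennreal ((g z)\<^sup>2 * ?k x z)) \<in> borel_measurable (M \<Otimes>\<^sub>M M)"
  proof -
    have c: "continuous_on UNIV (\<lambda>p. ?k (fst p) (snd p))"
      by (intro kern_cont continuous_on_compose2[OF ctr_cont[of UNIV]] continuous_intros) auto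
    have [measurable]: "(\<lambda>p. ?k (fst p) (snd p)) \<in> borel_measurable (M \<Otimes>\<^sub>M M)"
      by (rule measurable_pair_continuous[OF c])
    show ?thesis unfolding case_prod_unfold by measurable
  qed
  have "ennreal ((n2 M (moll d g))\<^sup>2) = (\<integral>\<^sup>+x. ennreal ((moll d g x)\<^sup>2) \<partial>M)"
    using nn_integral_eq_integral[of M "\<lambda>x. (moll d g x)\<^sup>2"] s by (simp add: n2_sq sq_int_def)
  also have "\<dots> \<le> (\<integral>\<^sup>+x. \<integral>\<^sup>+z. ennreal ((g z)\<^sup>2 * ?k x z) \<partial>M \<partial>M)" by (rule nn_integral_mono) (use le space_M in auto)
  also have "\<dots> = (\<integral>\<^sup>+z. \<integral>\<^sup>+x. ennreal ((g z)\<^sup>2 * ?k x z) \<partial>M \<partial>M)" by (rule MM.Fubini'[OF meas, symmetric])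
  also have "\<dots> \<le> (\<integral>\<^sup>+z. ennreal ((g z)\<^sup>2) * ennreal (1 / (1 - d)\<^sup>2) \<partial>M)"
  proof (rule nn_integral_mono)
    fix z
    have km: "(\<lambda>x. ?k x z) \<in> borel_measurable M"
      by (intro continuous_borel_lebesgue_on kern_cont ctr_cont continuous_intros)
    have "(\<integral>\<^sup>+x. ?k x z \<partial>M) \<le> (\<integral>\<^sup>+x. ?k x z \<partial>lborel)" by (rule nn_integral_lebesgue_on_le[OF dom_sets])
    also have "\<dots> = (\<integral>\<^sup>+x. kern (d * r) ((x0 - (1 - d) *\<^sub>R x0) + (1 - d) *\<^sub>R x) z \<partial>lborel)"
      by (simp add: ctr_def algebra_simps)
    also have "\<dots> = ennreal (1 / (1 - d)\<^sup>2)" by (rule nn_integral_kern_affine) (use e d in auto)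
    finally have le: "(\<integral>\<^sup>+x. ?k x z \<partial>M) \<le> ennreal (1 / (1 - d)\<^sup>2)" .
    have "(\<integral>\<^sup>+x. ennreal ((g z)\<^sup>2 * ?k x z) \<partial>M) = ennreal ((g z)\<^sup>2) * (\<integral>\<^sup>+x. ?k x z \<partial>M)"
      using km by (subst nn_integral_cmult[symmetric]) (auto simp: ennreal_mult' intro!: nn_integral_cong)
    then show "(\<integral>\<^sup>+x. ennreal ((g z)\<^sup>2 * ?k x z) \<partial>M) \<le> ennreal ((g z)\<^sup>2) * ennreal (1 / (1 - d)\<^sup>2)"
      using le by (simp add: mult_left_mono)
  qed
  also have "\<dots> = ennreal (((1 / (1 - d)) * n2 M g)\<^sup>2)"
  proof -
    have "(\<integral>\<^sup>+z. ennreal ((g z)\<^sup>2) * ennreal (1 / (1 - d)\<^sup>2) \<partial>M) = (\<integral>\<^sup>+z. ennreal ((g z)\<^sup>2) \<partial>M) * ennreal (1 / (1 - d)\<^sup>2)"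
      by (rule nn_integral_multc) auto
    also have "\<dots> = ennreal ((n2 M g)\<^sup>2) * ennreal (1 / (1 - d)\<^sup>2)"
      using nn_integral_eq_integral[OF g2] by (simp add: n2_sq)
    finally show ?thesis by (simp add: ennreal_mult[symmetric] power_divide)
  qed
  finally have "(n2 M (moll d g))\<^sup>2 \<le> ((1 / (1 - d)) * n2 M g)\<^sup>2" by (simp add: ennreal_le_iff)
  then show "n2 M (moll d g) \<le> (1 / (1 - d)) * n2 M g" by (rule power2_le_imp_le) (use d in auto)
qed

section \<open>Convergence of the mollified functions\<close>

lemma n2_le_const:
  assumes "f \<in> borel_measurable M" "\<And>x. x \<in> \<Omega> \<Longrightarrow> \<bar>f x\<bar> \<le> c" "0 \<le> c"
  shows "n2 M f \<le> c * sqrt (measure lebesgue \<Omega>)"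
proof -
  interpret finite_measure M by (rule fin_M)
  have "sq_int M f" by (rule sq_int_bounded[OF fin_M assms(1)]) (use assms(2) space_M in auto)
  then have "(\<integral>x. (f x)\<^sup>2 \<partial>M) \<le> (\<integral>x. c\<^sup>2 \<partial>M)"
    using assms(2) space_M by (intro integral_mono) (auto simp: sq_int_def abs_le_square_iff[symmetric] assms(3))
  also have "\<dots> = c\<^sup>2 * measure lebesgue \<Omega>" by (simp add: space_M measure_restrict_space mult.commute)
  finally have "n2 M f \<le> sqrt (c\<^sup>2 * measure lebesgue \<Omega>)" by (simp add: n2_def)
  then show ?thesis using assms(3) by (simp add: real_sqrt_mult)
qed

lemma moll_uniform:
  assumes "continuous_on UNIV f" "\<epsilon> > 0"
  shows "\<exists>d0>0. \<forall>d x. 0 < d \<and> d \<le> 1 \<and> d < d0 \<and> x \<in> \<Omega> \<longrightarrow> \<bar>moll d f x - f x\<bar> \<le> \<epsilon>"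
proof -
  have fi: "integrable M f" by (intro sq_int_integrable sq_int_cont assms)
  have "uniformly_continuous_on (closure \<Omega>) f"
    using bounded_dom assms(1) by (intro compact_uniformly_continuous) (auto simp: compact_closure intro: continuous_on_subset)
  then obtain \<delta> where \<delta>: "\<delta> > 0" "\<And>x y. x \<in> closure \<Omega> \<Longrightarrow> y \<in> closure \<Omega> \<Longrightarrow> dist y x < \<delta> \<Longrightarrow> dist (f y) (f x) < \<epsilon>"
    using assms(2) unfolding uniformly_continuous_on_def by metis
  obtain R where R: "R > 0" "\<And>x. x \<in> \<Omega> \<Longrightarrow> norm (x - x0) \<le> R"
  proof -
    have "bounded ((\<lambda>x. x - x0) ` \<Omega>)" using bounded_translation_minus[OF bounded_dom] .
    then show ?thesis using that unfolding bounded_pos by auto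
  qed
  \<comment> \<open>The kernel lives within \<open>d * r\<close> of the contracted point, which
    itself lies within \<open>d * R\<close> of \<open>x\<close>; hence the threshold
    \<open>\<delta> / (r + R)\<close>.\<close>
  have "\<bar>moll d f x - f x\<bar> \<le> \<epsilon>" if d: "0 < d" "d \<le> 1" "d < \<delta> / (r + R)" and x: "x \<in> \<Omega>" for d x
  proof -
    let ?k = "kern (d * r) (ctr d x)"
    note ki = kern_integral[OF x d(1,2)]
    have "moll d f x - f x = (\<integral>z. f z * ?k z \<partial>M) - f x * (\<integral>z. ?k z \<partial>M)" by (simp add: moll_def ki(1))
    also have "\<dots> = (\<integral>z. (f z - f x) * ?k z \<partial>M)" using integrable_kern[OF fi] ki(2) by (simp add: left_diff_distrib)
    also have "\<bar>\<dots>\<bar> \<le> (\<integral>z. \<epsilon> * ?k z \<partial>M)"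
    proof (rule order_trans[OF integral_abs_bound integral_mono])
      have "integrable M (\<lambda>z. f z * ?k z - f x * ?k z)" using integrable_kern[OF fi] ki(2) by auto
      then show "integrable M (\<lambda>z. \<bar>(f z - f x) * ?k z\<bar>)" by (simp add: left_diff_distrib)
      show "integrable M (\<lambda>z. \<epsilon> * ?k z)" using ki(2) by auto
      fix z assume z: "z \<in> space M"
      show "\<bar>(f z - f x) * ?k z\<bar> \<le> \<epsilon> * ?k z"
      proof (cases "dist (ctr d x) z < d * r")
        case True
        have "dist z x \<le> dist (ctr d x) z + dist (ctr d x) x" by (metis dist_commute dist_triangle)
        also have "dist (ctr d x) x = d * norm (x - x0)"
        proof -
          have "ctr d x - x = - d *\<^sub>R (x - x0)" by (simp add: ctr_def algebra_simps)
          then have "norm (ctr d x - x) = \<bar>- d\<bar> * norm (x - x0)" by (simp only: norm_scaleR)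
          also have "\<dots> = d * norm (x - x0)" using d by simp
          finally show ?thesis by (simp add: dist_norm)
        qed
        also have "\<dots> \<le> d * R" using R(2)[OF x] d by simp
        finally have "dist z x < d * (r + R)" using True by (simp add: algebra_simps)
        also have "\<dots> < \<delta>" using d(3) R(1) r_pos by (simp add: pos_less_divide_eq)
        finally have "dist (f z) (f x) < \<epsilon>" using x z space_M closure_subset[of \<Omega>] by (intro \<delta>(2)) auto
        then show ?thesis by (auto simp: abs_mult dist_real_def kern_nonneg intro!: mult_right_mono)
      next
        case False
        then have "?k z = 0" using d r_pos by (intro kern_zero) auto
        then show ?thesis by simp
      qed
    qed
    also have "\<dots> = \<epsilon>" by (simp add: ki(1))
    finally show ?thesis .
  qed
  then show ?thesis using \<delta>(1) R(1) r_pos by (intro exI[of _ "\<delta> / (r + R)"]) auto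
qed

text \<open>Measurable functions are almost everywhere limits of continuous ones. Clipping these at
  the bound \<open>B\<close> supplies a dominating constant, so the convergence holds in
  \<open>L^2\<close>.\<close>

lemma dense_continuous_bounded:
  assumes f: "f \<in> borel_measurable M" and B: "\<And>x. \<bar>f x\<bar> \<le> B" and "\<epsilon> > 0"
  shows "\<exists>g. continuous_on UNIV g \<and> n2 M (\<lambda>x. f x - g x) < \<epsilon>"
proof -
  interpret finite_measure M by (rule fin_M)
  have B0: "B \<ge> 0" using B[of 0] by simp
  have "(\<lambda>x. if x \<in> \<Omega> then f x else 0) \<in> borel_measurable lebesgue" by (rule borel_measurable_if_I[OF f dom_sets])
  then have "(\<lambda>x. if x \<in> \<Omega> then f x else 0) measurable_on UNIV"
    by (rule lebesgue_measurable_imp_measurable_on_real) simp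
  then obtain N g where N: "negligible N" and gc: "\<And>n::nat. continuous_on UNIV (g n)"
    and lim: "\<And>x. x \<notin> N \<Longrightarrow> (\<lambda>n. g n x) \<longlonglongrightarrow> (if x \<in> \<Omega> then f x else 0)"
    unfolding measurable_on_def by auto
  define h where "h n x = max (- B) (min B (g n x))" for n x
  have hc: "continuous_on UNIV (h n)" for n unfolding h_def by (intro continuous_intros gc)
  have hB: "\<bar>h n x\<bar> \<le> B" for n x using B0 by (auto simp: h_def)
  have "(\<lambda>n. \<integral>x. (f x - h n x)\<^sup>2 \<partial>M) \<longlonglongrightarrow> (\<integral>x. 0 \<partial>M)"
  proof (rule integral_dominated_convergence[where w="\<lambda>x. (2 * B)\<^sup>2"])
    show "(\<lambda>x. (f x - h n x)\<^sup>2) \<in> borel_measurable M" for n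
      using f hc by (intro borel_measurable_power borel_measurable_diff) auto
    have "AE x in lebesgue. x \<notin> N" using N by (intro AE_not_in) (simp add: negligible_iff_null_sets)
    then have "AE x in M. x \<notin> N" by (simp add: AE_restrict_space_iff) (auto elim: eventually_mono)
    then show "AE x in M. (\<lambda>n. (f x - h n x)\<^sup>2) \<longlonglongrightarrow> 0" using AE_space
    proof eventually_elim
      case (elim x)
      then have "(\<lambda>n. g n x) \<longlonglongrightarrow> f x" using lim[of x] space_M by auto
      then have "(\<lambda>n. h n x) \<longlonglongrightarrow> max (- B) (min B (f x))" unfolding h_def by (intro tendsto_intros)
      moreover have "max (- B) (min B (f x)) = f x" using B[of x] by auto
      ultimately have "(\<lambda>n. (f x - h n x)\<^sup>2) \<longlonglongrightarrow> (f x - f x)\<^sup>2" by (intro tendsto_intros) simp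
      then show ?case by simp
    qed
    show "AE x in M. norm ((f x - h n x)\<^sup>2) \<le> (2 * B)\<^sup>2" for n
    proof (rule AE_I2)
      fix x
      have "\<bar>f x - h n x\<bar> \<le> 2 * B" using B[of x] hB[of n x] by linarith
      then have "\<bar>f x - h n x\<bar> \<le> \<bar>2 * B\<bar>" using B0 by simp
      then show "norm ((f x - h n x)\<^sup>2) \<le> (2 * B)\<^sup>2" unfolding abs_le_square_iff by simp
    qed
  qed auto
  then have "(\<lambda>n. n2 M (\<lambda>x. f x - h n x)) \<longlonglongrightarrow> sqrt 0" unfolding n2_def by (intro tendsto_real_sqrt) simp
  then have "\<forall>\<^sub>F n in sequentially. n2 M (\<lambda>x. f x - h n x) < \<epsilon>" using \<open>\<epsilon> > 0\<close> by (intro order_tendstoD(2)) auto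
  then obtain n where "n2 M (\<lambda>x. f x - h n x) < \<epsilon>" by (auto simp: eventually_sequentially)
  then show ?thesis using hc by blast
qed

lemma dense_continuous:
  assumes f: "sq_int M f" and "\<epsilon> > 0"
  shows "\<exists>g. continuous_on UNIV g \<and> n2 M (\<lambda>x. f x - g x) < \<epsilon>"
proof -
  define t where "t n x = max (- real n) (min (real n) (f x))" for n x
  have fm: "f \<in> borel_measurable M" using f by (rule sq_int_measurable)
  have tm: "t n \<in> borel_measurable M" for n unfolding t_def using fm by measurable
  have "(\<lambda>n. \<integral>x. (f x - t n x)\<^sup>2 \<partial>M) \<longlonglongrightarrow> (\<integral>x. 0 \<partial>M)"
  proof (rule integral_dominated_convergence[where w="\<lambda>x. (f x)\<^sup>2"])
    show "(\<lambda>x. (f x - t n x)\<^sup>2) \<in> borel_measurable M" for n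
      using fm tm by (intro borel_measurable_power borel_measurable_diff) auto
    show "integrable M (\<lambda>x. (f x)\<^sup>2)" using f by (simp add: sq_int_def)
    show "AE x in M. (\<lambda>n. (f x - t n x)\<^sup>2) \<longlonglongrightarrow> 0"
    proof (rule AE_I2)
      fix x
      obtain m where m: "\<bar>f x\<bar> \<le> real m" using real_arch_simple by blast
      have "\<forall>\<^sub>F n in sequentially. (f x - t n x)\<^sup>2 = 0"
        using eventually_ge_at_top[of m] by eventually_elim (use m in \<open>auto simp: t_def\<close>)
      then show "(\<lambda>n. (f x - t n x)\<^sup>2) \<longlonglongrightarrow> 0" by (rule tendsto_eventually)
    qed
    show "AE x in M. norm ((f x - t n x)\<^sup>2) \<le> (f x)\<^sup>2" for n
    proof (rule AE_I2)
      fix x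
      have "\<bar>f x - t n x\<bar> \<le> \<bar>f x\<bar>" by (auto simp: t_def)
      then show "norm ((f x - t n x)\<^sup>2) \<le> (f x)\<^sup>2" by (simp add: abs_le_square_iff)
    qed
  qed auto
  then have "(\<lambda>n. n2 M (\<lambda>x. f x - t n x)) \<longlonglongrightarrow> sqrt 0" unfolding n2_def by (intro tendsto_real_sqrt) simp
  then have "\<forall>\<^sub>F n in sequentially. n2 M (\<lambda>x. f x - t n x) < \<epsilon> / 2" using \<open>\<epsilon> > 0\<close> by (intro order_tendstoD(2)) auto
  then obtain n where n: "n2 M (\<lambda>x. f x - t n x) < \<epsilon> / 2" by (auto simp: eventually_sequentially)
  have tb: "\<bar>t n x\<bar> \<le> real n" for x by (auto simp: t_def)
  obtain g where g: "continuous_on UNIV g" "n2 M (\<lambda>x. t n x - g x) < \<epsilon> / 2"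
    using dense_continuous_bounded[OF tm tb, of "\<epsilon> / 2"] \<open>\<epsilon> > 0\<close> by auto
  have "n2 M (\<lambda>x. f x - g x) \<le> n2 M (\<lambda>x. f x - t n x) + n2 M (\<lambda>x. t n x - g x)"
    by (intro n2_triangle3 f sq_int_cont g sq_int_bounded[OF fin_M tm tb])
  then show ?thesis using n g by (intro exI[of _ g]) auto
qed

text \<open>Starting at \<open>1/2\<close> keeps the factor \<open>1 / (1 - d)\<close> of
  \<open>moll_L2\<close> at most \<open>2\<close>.\<close>

definition dn :: "nat \<Rightarrow> real" where "dn n = 1 / (real n + 2)"

lemma dn: "0 < dn n" "dn n < 1" "dn n \<le> 1" "dn n \<le> 1/2" by (auto simp: dn_def field_simps)

lemma dn_tendsto: "dn \<longlonglongrightarrow> 0" unfolding dn_def by real_asymp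

lemma moll_tendsto:
  assumes g: "sq_int M g"
  shows "(\<lambda>n. n2 M (\<lambda>x. moll (dn n) g x - g x)) \<longlonglongrightarrow> 0"
proof (rule LIMSEQ_I)
  fix \<epsilon> :: real assume "\<epsilon> > 0"
  \<comment> \<open>The distance of \<open>g\<close> from \<open>f\<close> is counted three times,
    with factor \<open>2\<close> for the mollified difference and once more directly;
    \<open>\<epsilon> / 6\<close> thus leaves \<open>\<epsilon> / 2\<close> for the uniform
    estimate.\<close>
  then obtain f where f: "continuous_on UNIV f" "n2 M (\<lambda>x. g x - f x) < \<epsilon> / 6"
    using dense_continuous[OF g, of "\<epsilon> / 6"] by auto
  note sf = sq_int_cont[OF f(1)]
  define c where "c = \<epsilon> / (4 * (sqrt (measure lebesgue \<Omega>) + 1))"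
  have s0: "sqrt (measure lebesgue \<Omega>) \<ge> 0" by simp
  have c: "c > 0" "c * sqrt (measure lebesgue \<Omega>) < \<epsilon> / 2"
  proof -
    define s where "s = sqrt (measure lebesgue \<Omega>)"
    have s: "s + 1 > 0" unfolding s_def using s0 by linarith
    have c': "c = \<epsilon> / (4 * (s + 1))" by (simp add: c_def s_def)
    show "c > 0" using \<open>\<epsilon> > 0\<close> s by (simp add: c')
    have "\<epsilon> * s < \<epsilon> * (2 * (s + 1))" using \<open>\<epsilon> > 0\<close> s by (intro mult_strict_left_mono) auto
    then have "c * s < \<epsilon> / 2" using s by (simp add: c' divide_less_eq algebra_simps)
    then show "c * sqrt (measure lebesgue \<Omega>) < \<epsilon> / 2" by (simp add: s_def)
  qed
  obtain d0 where d0: "d0 > 0" "\<And>d x. 0 < d \<Longrightarrow> d \<le> 1 \<Longrightarrow> d < d0 \<Longrightarrow> x \<in> \<Omega> \<Longrightarrow> \<bar>moll d f x - f x\<bar> \<le> c"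
    using moll_uniform[OF f(1) c(1)] by metis
  have "\<forall>\<^sub>F n in sequentially. dn n < d0" using order_tendstoD(2)[OF dn_tendsto d0(1)] .
  then obtain N where N: "\<And>n. n \<ge> N \<Longrightarrow> dn n < d0" by (auto simp: eventually_sequentially)
  have "n2 M (\<lambda>x. moll (dn n) g x - g x) < \<epsilon>" if "n \<ge> N" for n
  proof -
    let ?T = "moll (dn n)"
    have sm: "sq_int M (?T g)" "sq_int M (?T f)" using moll_L2(1)[OF _ dn(1,2)] g sf by auto
    have "n2 M (\<lambda>x. ?T g x - ?T f x) = n2 M (?T (\<lambda>x. g x - f x))"
      using moll_diff[OF sq_int_integrable[OF g] sq_int_integrable[OF sf]] by (simp add: n2_def)
    also have "\<dots> \<le> (1 / (1 - dn n)) * n2 M (\<lambda>x. g x - f x)" by (rule moll_L2(2)[OF sq_int_diff[OF g sf] dn(1,2)])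
    also have "\<dots> \<le> 2 * n2 M (\<lambda>x. g x - f x)" using dn[of n] by (intro mult_right_mono) (auto simp: field_simps)
    finally have 1: "n2 M (\<lambda>x. ?T g x - ?T f x) \<le> 2 * n2 M (\<lambda>x. g x - f x)" .
    have 2: "n2 M (\<lambda>x. ?T f x - f x) \<le> c * sqrt (measure lebesgue \<Omega>)"
    proof (rule n2_le_const)
      show "(\<lambda>x. ?T f x - f x) \<in> borel_measurable M" using sq_int_diff[OF sm(2) sf] by (rule sq_int_measurable)
      show "\<bar>?T f x - f x\<bar> \<le> c" if "x \<in> \<Omega>" for x using that N[OF \<open>n \<ge> N\<close>] dn[of n] by (intro d0(2)) auto
    qed (use c in simp)
    have "n2 M (\<lambda>x. ?T g x - g x) \<le> n2 M (\<lambda>x. ?T g x - ?T f x) + n2 M (\<lambda>x. ?T f x - g x)"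
      by (rule n2_triangle3[OF sm g])
    also have "n2 M (\<lambda>x. ?T f x - g x) \<le> n2 M (\<lambda>x. ?T f x - f x) + n2 M (\<lambda>x. f x - g x)"
      by (rule n2_triangle3[OF sm(2) sf g])
    also have "n2 M (\<lambda>x. f x - g x) = n2 M (\<lambda>x. g x - f x)" by (rule n2_minus_commute)
    finally show ?thesis using 1 2 c(2) f(2) by linarith
  qed
  then show "\<exists>no. \<forall>n\<ge>no. norm (n2 M (\<lambda>x. moll (dn n) g x - g x) - 0) < \<epsilon>" by auto
qed

lemma n2_cong: "(\<And>x. x \<in> \<Omega> \<Longrightarrow> f x = g x) \<Longrightarrow> n2 M f = n2 M g"
  unfolding n2_def by (intro arg_cong[where f=sqrt] Bochner_Integration.integral_cong) (auto simp: space_M)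

text \<open>The derivative of the mollification is \<open>1 - d\<close> times the mollified weak
  derivative. The defect is \<open>d\<close> times a bounded quantity, so the contraction does no
  harm in the limit.\<close>

lemma moll_pd_tendsto:
  assumes g: "sq_int M g" and g': "sq_int M g'" and w: "is_wderiv \<Omega> i g g'"
  shows "(\<lambda>n. n2 M (\<lambda>x. pd i (moll (dn n) g) x - g' x)) \<longlonglongrightarrow> 0"
proof (rule Lim_null_comparison)
  have lim: "(\<lambda>n. n2 M (\<lambda>x. moll (dn n) g' x - g' x) + dn n * (2 * n2 M g')) \<longlonglongrightarrow> 0 + 0 * (2 * n2 M g')"
    by (intro tendsto_intros moll_tendsto g' dn_tendsto)
  then show "(\<lambda>n. n2 M (\<lambda>x. moll (dn n) g' x - g' x) + dn n * (2 * n2 M g')) \<longlonglongrightarrow> 0" by simp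
  show "\<forall>\<^sub>F n in sequentially. norm (n2 M (\<lambda>x. pd i (moll (dn n) g) x - g' x))
      \<le> n2 M (\<lambda>x. moll (dn n) g' x - g' x) + dn n * (2 * n2 M g')"
  proof (rule always_eventually, rule allI)
    fix n
    let ?T = "moll (dn n) g'"
    have sm: "sq_int M ?T" using moll_L2(1)[OF g' dn(1,2)] .
    have "n2 M (\<lambda>x. pd i (moll (dn n) g) x - g' x) = n2 M (\<lambda>x. (?T x - g' x) - dn n * ?T x)"
      using moll_wderiv[OF sq_int_integrable[OF g] dn(1,3) w] by (intro n2_cong) (simp add: algebra_simps)
    also have "\<dots> \<le> n2 M (\<lambda>x. ?T x - g' x) + n2 M (\<lambda>x. dn n * ?T x)"
      by (intro n2_triangle_diff sq_int_diff sq_int_cmult sm g')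
    also have "n2 M (\<lambda>x. dn n * ?T x) = dn n * n2 M ?T" using dn(1)[of n] by (simp add: n2_cmult)
    also have "\<dots> \<le> dn n * (2 * n2 M g')"
    proof (rule mult_left_mono)
      have "n2 M ?T \<le> (1 / (1 - dn n)) * n2 M g'" by (rule moll_L2(2)[OF g' dn(1,2)])
      also have "\<dots> \<le> 2 * n2 M g'" using dn[of n] by (intro mult_right_mono) (auto simp: field_simps)
      finally show "n2 M ?T \<le> 2 * n2 M g'" .
    qed (use dn(1)[of n] in simp)
    finally show "norm (n2 M (\<lambda>x. pd i (moll (dn n) g) x - g' x))
      \<le> n2 M (\<lambda>x. moll (dn n) g' x - g' x) + dn n * (2 * n2 M g')" by simp
  qed
qed

text \<open>The kernels are test functions, so both candidates have the same mollification, and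
  their difference is an \<open>L^2\<close> limit of zero functions. Identities between the chosen
  derivatives \<open>wd\<close> rest on this.\<close>

lemma wderiv_unique:
  assumes "sq_int M g1" "sq_int M g2" "is_wderiv \<Omega> i u g1" "is_wderiv \<Omega> i u g2"
  shows "AE x in M. g1 x = g2 x"
proof -
  define g where "g x = g1 x - g2 x" for x
  have g: "sq_int M g" unfolding g_def by (rule sq_int_diff[OF assms(1,2)])
  have i12: "integrable M g1" "integrable M g2" using assms sq_int_integrable by auto
  have "moll d g x = 0" if "x \<in> \<Omega>" "0 < d" "d \<le> 1" for x d
  proof -
    have "moll d g1 x = moll d g2 x"
    proof -
      have "(\<integral>z. u z * pd i (kern (d * r) (ctr d x)) z \<partial>M) = - moll d g1 x"
        "(\<integral>z. u z * pd i (kern (d * r) (ctr d x)) z \<partial>M) = - moll d g2 x"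
        using assms(3,4) kern_test[OF that] unfolding is_wderiv_def moll_def by blast+
      then show ?thesis by simp
    qed
    then show ?thesis unfolding g_def by (simp add: moll_diff[OF i12])
  qed
  then have "n2 M (\<lambda>x. moll (dn n) g x - g x) = n2 M (\<lambda>x. - 1 * g x)" for n using dn[of n] by (intro n2_cong) simp
  then have "(\<lambda>n. n2 M (\<lambda>x. - 1 * g x)) \<longlonglongrightarrow> 0" using moll_tendsto[OF g] by simp
  then have "n2 M (\<lambda>x. - 1 * g x) = 0" by (simp add: LIMSEQ_const_iff)
  then have "n2 M g = 0" using n2_cmult[of M "-1" g] by simp
  from n2_eq_0_AE[OF g this] show ?thesis by (simp add: g_def)
qed

end

section \<open>The Horgan--Payne inequality on a convex polygon\<close>

lemma nn_integral_inverse_sqrt: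
  "(\<integral>\<^sup>+t. ennreal (indicator {-R..R} t * \<bar>t\<bar> powr (-1/2)) \<partial>lborel) < \<infinity>" (is "?I < \<infinity>")
proof -
  let ?w = "\<lambda>t::real. ennreal (indicator {0..\<bar>R\<bar>} t * t powr (-1/2))"
  have "((\<lambda>t. t powr (-1/2)) has_integral (\<bar>R\<bar> powr (-1/2 + 1) / (-1/2 + 1))) {0..\<bar>R\<bar>}"
    by (rule has_integral_powr_from_0) auto
  then have w: "integral\<^sup>N lborel ?w = ennreal (\<bar>R\<bar> powr (-1/2 + 1) / (-1/2 + 1))"
    by (intro nn_integral_has_integral_lebesgue) auto
  have w': "(\<integral>\<^sup>+t. ?w (- t) \<partial>lborel) = integral\<^sup>N lborel ?w" using nn_integral_real_affine[of ?w "-1" 0] by simp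
  have "?I \<le> (\<integral>\<^sup>+t. ?w t + ?w (- t) \<partial>lborel)" by (rule nn_integral_mono) (auto simp: indicator_def)
  also have "\<dots> = integral\<^sup>N lborel ?w + (\<integral>\<^sup>+t. ?w (- t) \<partial>lborel)" by (rule nn_integral_add) auto
  also have "\<dots> < \<infinity>" unfolding w' w by simp
  finally show ?thesis .
qed

lemma norm_sq_oth: "(norm (x::pt))\<^sup>2 = (x $ i)\<^sup>2 + (x $ oth i)\<^sup>2"
  unfolding power2_norm_eq_inner inner_oth[of x x i] by (simp add: power2_eq_square)

text \<open>\<open>1/|x| \<le> |x\<^sub>1|\<^sup>-\<^sup>1\<^sup>/\<^sup>2 |x\<^sub>2|\<^sup>-\<^sup>1\<^sup>/\<^sup>2\<close> off the axes, which makes the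
  singularity integrable in the plane without polar coordinates.\<close>

lemma inverse_norm_integrable:
  assumes "bounded S" "S \<in> sets borel"
  shows "integrable lborel (\<lambda>x::pt. indicator S x / norm x)"
proof -
  obtain R where R: "\<And>x. x \<in> S \<Longrightarrow> norm x \<le> R" using assms(1) by (auto simp: bounded_iff)
  define w where "w t = ennreal (indicator {-R..R} t * \<bar>t\<bar> powr (-1/2))" for t :: real
  have [measurable]: "w \<in> borel_measurable borel" unfolding w_def by measurable
  have meas: "(\<lambda>x::pt. indicator S x / norm x) \<in> borel_measurable borel" using assms(2) by measurable
  have key: "ennreal (norm (indicator S x / norm x :: real)) \<le> w (x $ 1) * w (x $ 2)"
    if "x $ 1 \<noteq> 0" "x $ 2 \<noteq> 0" for x :: pt
  proof (cases "x \<in> S")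
    case True
    have x: "\<bar>x $ 1\<bar> \<le> R" "\<bar>x $ 2\<bar> \<le> R" using R[OF True] component_le_norm_cart[of x] order_trans by blast+
    let ?p = "\<bar>x $ 1\<bar> * \<bar>x $ 2\<bar>"
    have p: "?p > 0" using that by simp
    have "?p \<le> (norm x)\<^sup>2"
    proof -
      have "2 * (\<bar>x $ 1\<bar> * \<bar>x $ 2\<bar>) \<le> \<bar>x $ 1\<bar>\<^sup>2 + \<bar>x $ 2\<bar>\<^sup>2"
        using sum_squares_bound[of "\<bar>x $ 1\<bar>" "\<bar>x $ 2\<bar>"] by (simp add: mult.assoc)
      then show ?thesis using p norm_sq_oth[of x 1] by (simp add: oth_def)
    qed
    then have s: "sqrt ?p \<le> norm x" by (simp add: real_le_lsqrt)
    have "1 / norm x \<le> 1 / sqrt ?p"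
    proof (rule divide_left_mono[OF s])
      have "sqrt ?p > 0" using p by (simp only: real_sqrt_gt_zero)
      then show "0 < norm x * sqrt ?p" using s by (intro mult_pos_pos) auto
    qed simp
    also have "\<dots> = \<bar>x $ 1\<bar> powr (-1/2) * \<bar>x $ 2\<bar> powr (-1/2)"
    proof -
      have "y powr (-1/2) = 1 / sqrt y" if "y > 0" for y :: real
        using that powr_minus_divide[of y "1/2"] by (simp add: powr_half_sqrt)
      then show ?thesis using that by (simp add: real_sqrt_mult)
    qed
    finally have "1 / norm x \<le> \<bar>x $ 1\<bar> powr (-1/2) * \<bar>x $ 2\<bar> powr (-1/2)" .
    moreover have "indicator {-R..R} (x $ 1) = (1::real)" "indicator {-R..R} (x $ 2) = (1::real)"
      using x by (auto simp: indicator_def abs_le_iff)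
    ultimately show ?thesis using True unfolding w_def by (simp add: ennreal_mult[symmetric] ennreal_leI)
  qed simp
  have "(\<integral>\<^sup>+x. ennreal (norm (indicator S x / norm x :: real)) \<partial>(lborel :: pt measure)) \<le> (\<integral>\<^sup>+x. w (x $ 1) * w (x $ 2) \<partial>(lborel :: pt measure))"
  proof (rule nn_integral_mono_AE)
    have nz: "AE x in (lborel :: pt measure). x $ i \<noteq> 0" for i
    proof -
      have "negligible {x::pt. axis i 1 \<bullet> x = 0}" by (rule negligible_hyperplane) (simp add: axis_eq_0_iff)
      then have "AE x in lebesgue. x \<notin> {x::pt. axis i 1 \<bullet> x = 0}"
        by (intro AE_not_in) (simp add: negligible_iff_null_sets)
      then show ?thesis by (simp add: AE_completion_iff inner_axis' )
    qed
    show "AE x in (lborel :: pt measure). ennreal (norm (indicator S x / norm x :: real)) \<le> w (x $ 1) * w (x $ 2)"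
      using nz[of 1] nz[of 2] by eventually_elim (rule key)
  qed
  also have "\<dots> = (\<integral>\<^sup>+p. w (fst p) * w (snd p) \<partial>(lborel \<Otimes>\<^sub>M lborel))"
  proof -
    have 1: "mk 1 t c $ 1 = t" "mk 1 t c $ 2 = c" for t c using mk_nth[of 1 t c] by (simp_all add: oth_def)
    show ?thesis unfolding lborel_mk[of 1] by (subst nn_integral_distr) (auto simp: case_prod_unfold 1)
  qed
  also have "\<dots> = (\<integral>\<^sup>+t. \<integral>\<^sup>+c. w t * w c \<partial>lborel \<partial>lborel)" by (subst lborel.nn_integral_fst[symmetric]) auto
  also have "\<dots> = (\<integral>\<^sup>+t. w t \<partial>lborel) * (\<integral>\<^sup>+c. w c \<partial>lborel)" by (simp add: nn_integral_cmult nn_integral_multc)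
  also have "\<dots> < \<infinity>" using nn_integral_inverse_sqrt[of R] unfolding w_def by (simp add: ennreal_mult_less_top)
  finally show ?thesis using meas by (intro integrableI_bounded) auto
qed

lemma continuous_on_Max:
  fixes f :: "'i \<Rightarrow> 'a::topological_space \<Rightarrow> real"
  assumes "finite I" "I \<noteq> {}" "\<And>i. i \<in> I \<Longrightarrow> continuous_on S (f i)"
  shows "continuous_on S (\<lambda>x. Max ((\<lambda>i. f i x) ` I))"
  using assms
proof (induction I rule: finite_ne_induct)
  case (insert i I)
  then have "continuous_on S (\<lambda>x. max (f i x) (Max ((\<lambda>i. f i x) ` I)))" by (intro continuous_on_max) auto
  then show ?case using insert by simp
qed simp

text \<open>A bounded polygon around the origin, each side normalised to
  \<open>a k \<bullet> x < 1\<close>. In this form the Minkowski gauge is a maximum of linear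
  functions, and injectivity of \<open>a\<close> confines ties between two sides to lines.\<close>

locale polyg =
  fixes n :: nat and a :: "nat \<Rightarrow> pt" and R :: real
  assumes n: "n > 0" and inj: "inj_on a {..<n}"
    and bd: "\<And>x. (\<forall>k<n. a k \<bullet> x < 1) \<Longrightarrow> norm x < R"
begin

definition W :: "pt set" where "W = {x. \<forall>k<n. a k \<bullet> x < 1}"

text \<open>The Minkowski gauge of \<open>W\<close>.\<close>

definition G :: "pt \<Rightarrow> real" where "G x = Max ((\<lambda>k. a k \<bullet> x) ` {..<n})"

text \<open>The sector in which side \<open>k\<close> attains the gauge. Giving ties to the smallest
  index makes the sectors a partition of the plane.\<close>

definition cell :: "nat \<Rightarrow> pt set" where
  "cell k = {x. \<forall>j<n. a j \<bullet> x \<le> a k \<bullet> x \<and> (j < k \<longrightarrow> a j \<bullet> x < a k \<bullet> x)}"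

text \<open>The gradient of \<open>G\<close> away from ties, extended to a Borel function on the
  plane. Homogeneity of degree one appears as the Euler identity \<open>P_inner\<close>.\<close>

definition P :: "2 \<Rightarrow> pt \<Rightarrow> real" where
  "P i x = (\<Sum>k<n. indicator (cell k) x * a k $ i)"

lemma R: "R > 0" using bd[of 0] by simp

lemma G_ge: "k < n \<Longrightarrow> a k \<bullet> x \<le> G x" unfolding G_def by (intro Max_ge) auto

lemma G_attained: "\<exists>k<n. G x = a k \<bullet> x"
proof -
  have "G x \<in> (\<lambda>k. a k \<bullet> x) ` {..<n}" unfolding G_def using n by (intro Max_in) auto
  then show ?thesis by auto
qed

lemma G_cont: "continuous_on S G" unfolding G_def using n by (intro continuous_on_Max continuous_intros) auto

lemma W_G: "x \<in> W \<longleftrightarrow> G x < 1" unfolding W_def using G_attained[of x] G_ge[of _ x] by force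

lemma open_W: "open W"
proof -
  have "W = {x. G x < 1}" using W_G by auto
  then show ?thesis by (simp add: open_Collect_less G_cont)
qed

lemma bounded_W: "bounded W" unfolding bounded_iff using bd by (auto simp: W_def intro!: exI[of _ R] less_imp_le)

lemma convex_W: "convex W"
proof -
  have "W = (\<Inter>k\<in>{..<n}. {x. a k \<bullet> x < 1})" by (auto simp: W_def)
  then show ?thesis by (auto intro!: convex_INT convex_halfspace_lt)
qed

lemma zero_W: "0 \<in> W" by (simp add: W_def)

lemma G_scale: "c > 0 \<Longrightarrow> G (c *\<^sub>R x) = c * G x"
proof -
  assume c: "c > 0"
  obtain k where k: "k < n" "G x = a k \<bullet> x" using G_attained by blast
  obtain j where j: "j < n" "G (c *\<^sub>R x) = a j \<bullet> (c *\<^sub>R x)" using G_attained by blast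
  have "G (c *\<^sub>R x) \<le> c * G x" using j G_ge[OF j(1), of x] c by simp
  moreover have "c * G x \<le> G (c *\<^sub>R x)" using k G_ge[OF k(1), of "c *\<^sub>R x"] by simp
  ultimately show ?thesis by simp
qed

text \<open>\<open>W\<close> lies in the disc of radius \<open>R\<close>, so the point at distance
  \<open>2 * R\<close> in any direction has gauge at least one; homogeneity turns this into the
  lower bound \<open>G_lower\<close>.\<close>

definition m :: real where "m = 1 / (2 * R)"

lemma m_pos: "m > 0" using R by (simp add: m_def)

lemma G_lower: "m * norm x \<le> G x"
proof (cases "x = 0")
  case True then show ?thesis using G_ge[of 0 0] n by simp
next
  case False
  define c where "c = 2 * R / norm x"
  have c: "c > 0" using False R by (simp add: c_def)
  have "norm (c *\<^sub>R x) = 2 * R" using False R by (simp add: c_def)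
  then have "c *\<^sub>R x \<notin> W" using bd[of "c *\<^sub>R x"] R by (auto simp: W_def)
  then have "c * G x \<ge> 1" using W_G G_scale[OF c] by (metis not_less)
  then show ?thesis using False R by (simp add: c_def m_def field_simps)
qed

definition A :: real where "A = (\<Sum>k<n. norm (a k))"

lemma A_ge: "k < n \<Longrightarrow> norm (a k) \<le> A" unfolding A_def by (intro member_le_sum) auto

lemma A_nonneg: "A \<ge> 0" unfolding A_def by (intro sum_nonneg) auto

lemma G_upper: "\<bar>G x\<bar> \<le> A * norm x"
proof -
  obtain k where k: "k < n" "G x = a k \<bullet> x" using G_attained by blast
  have "\<bar>a k \<bullet> x\<bar> \<le> norm (a k) * norm x" by (rule Cauchy_Schwarz_ineq2)
  also have "\<dots> \<le> A * norm x" using A_ge[OF k(1)] by (intro mult_right_mono) auto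
  finally show ?thesis by (simp add: k)
qed

lemma G_nonneg: "0 \<le> G x" using G_lower[of x] m_pos by (meson mult_nonneg_nonneg norm_ge_zero less_imp_le order_trans)

lemma cell_ex: "\<exists>k<n. x \<in> cell k"
proof -
  define k where "k = (LEAST k. k < n \<and> G x = a k \<bullet> x)"
  have k: "k < n \<and> G x = a k \<bullet> x" unfolding k_def using G_attained[of x] by (rule LeastI_ex)
  have "a j \<bullet> x < a k \<bullet> x" if "j < n" "j < k" for j
  proof -
    have "\<not> (j < n \<and> G x = a j \<bullet> x)" using not_less_Least[of j] that(2) unfolding k_def by blast
    then show ?thesis using G_ge[OF that(1), of x] k that by auto
  qed
  then have "x \<in> cell k" using k G_ge[of _ x] by (auto simp: cell_def)
  then show ?thesis using k by blast
qed

lemma cell_unique: "x \<in> cell k \<Longrightarrow> x \<in> cell j \<Longrightarrow> k < n \<Longrightarrow> j < n \<Longrightarrow> k = j"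
  unfolding cell_def by (metis (mono_tags, lifting) linorder_neqE_nat mem_Collect_eq not_less)

lemma P_cell:
  assumes "x \<in> cell k" "k < n" shows "P i x = a k $ i" "G x = a k \<bullet> x"
proof -
  have "P i x = (\<Sum>j<n. if j = k then a k $ i else 0)"
    unfolding P_def by (rule sum.cong) (use assms cell_unique in \<open>auto simp: indicator_def\<close>)
  then show "P i x = a k $ i" using assms by simp
  obtain j where "j < n" "G x = a j \<bullet> x" using G_attained by blast
  then show "G x = a k \<bullet> x" using assms G_ge[of k x] by (auto simp: cell_def intro: antisym)
qed

lemma P_inner: "P i x * x $ i + P (oth i) x * x $ oth i = G x"
proof -
  obtain k where "k < n" "x \<in> cell k" using cell_ex by blast
  then show ?thesis using P_cell[of x k] by (simp add: inner_oth[of _ _ i])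
qed

lemma P_bound: "\<bar>P i x\<bar> \<le> A"
proof -
  obtain k where "k < n" "x \<in> cell k" using cell_ex by blast
  then show ?thesis using P_cell[of x k] A_ge[of k] component_le_norm_cart[of "a k" i] by auto
qed

lemma cell_borel [measurable]: "cell k \<in> sets borel" unfolding cell_def by measurable

lemma P_borel [measurable]: "P i \<in> borel_measurable borel" unfolding P_def by measurable

lemma G_borel [measurable]: "G \<in> borel_measurable borel" using G_cont by (rule borel_measurable_continuous_onI)

lemma W_borel [measurable]: "W \<in> sets borel" using open_W by simp

end

text \<open>The signs of a rotation by a right angle; with them the Cauchy--Riemann equations become
  one statement for both indices.\<close>

definition sg :: "2 \<Rightarrow> real" where "sg i = (if i = 1 then 1 else - 1)"

lemma sg_oth [simp]: "sg (oth i) = - sg i" "sg i * sg i = 1" "\<bar>sg i\<bar> = 1"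
  using two_cases[of i] by (auto simp: sg_def oth_def)

text \<open>With \<open>Phi = u + i v\<close> these are the numerators of
  \<open>Re (Phi / z)\<close> and \<open>- Im (Phi / z)\<close>, the components of
  \<open>Bf\<close>. For holomorphic \<open>Phi\<close> this field is divergence free off the
  origin; \<open>Bd\<close> is the derivative of component \<open>i\<close> in direction
  \<open>i\<close>.\<close>

definition Nf :: "(pt \<Rightarrow> real) \<Rightarrow> (pt \<Rightarrow> real) \<Rightarrow> 2 \<Rightarrow> pt \<Rightarrow> real" where
  "Nf u v i x = u x * x $ i + sg i * v x * x $ oth i"

definition Bf :: "(pt \<Rightarrow> real) \<Rightarrow> (pt \<Rightarrow> real) \<Rightarrow> 2 \<Rightarrow> pt \<Rightarrow> real" where
  "Bf u v i x = Nf u v i x / (norm x)\<^sup>2"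

definition Bd :: "(pt \<Rightarrow> real) \<Rightarrow> (pt \<Rightarrow> real) \<Rightarrow> 2 \<Rightarrow> pt \<Rightarrow> real" where
  "Bd u v i x = (pd i u x * x $ i + u x + sg i * pd i v x * x $ oth i) / (norm x)\<^sup>2
      - Nf u v i x * (2 * x $ i) / ((norm x)\<^sup>2)\<^sup>2"

lemma Bd_sum:
  assumes "pd i u x = sg i * pd (oth i) v x" "pd (oth i) u x = - sg i * pd i v x" "x \<noteq> 0"
  shows "Bd u v i x + Bd u v (oth i) x = 0"
proof -
  define q where "q = (norm x)\<^sup>2"
  have q: "q \<noteq> 0" using assms(3) by (simp add: q_def)
  have q2: "q = (x $ i)\<^sup>2 + (x $ oth i)\<^sup>2" unfolding q_def by (rule norm_sq_oth)
  have "Bd u v i x + Bd u v (oth i) x = (2 * u x) / q - 2 * (u x * ((x $ i)\<^sup>2 + (x $ oth i)\<^sup>2)) / q\<^sup>2"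
    unfolding Bd_def q_def[symmetric] Nf_def assms(1,2)
    by (simp add: diff_divide_distrib add_divide_distrib algebra_simps power2_eq_square)
  also have "\<dots> = 0" unfolding q2[symmetric] using q by (simp add: power2_eq_square)
  finally show ?thesis .
qed

lemma Bf_slice_deriv:
  assumes "C1 u" "C1 v" "mk i t c \<noteq> 0"
  shows "((\<lambda>t. Bf u v i (mk i t c)) has_real_derivative Bd u v i (mk i t c)) (at t)"
proof -
  have "(norm (mk i t c))\<^sup>2 \<noteq> 0" using assms(3) by simp
  then have n0: "t\<^sup>2 + c\<^sup>2 \<noteq> 0" unfolding norm_sq_oth[of "mk i t c" i] mk_nth .
  note d = has_real_derivative_mk[OF C1_diff'[OF assms(1)], where i=i and t=t and c=c]
    has_real_derivative_mk[OF C1_diff'[OF assms(2)], where i=i and t=t and c=c]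
  have dn: "((\<lambda>t. u (mk i t c) * t + sg i * v (mk i t c) * c) has_real_derivative
      (pd i u (mk i t c) * t + u (mk i t c) + sg i * pd i v (mk i t c) * c)) (at t)"
    by (rule DERIV_cong[OF DERIV_add[OF DERIV_mult[OF d(1) DERIV_ident]
          DERIV_mult[OF DERIV_mult[OF DERIV_const d(2)] DERIV_const]]]) simp
  have dd: "((\<lambda>t. t\<^sup>2 + c\<^sup>2) has_real_derivative 2 * t) (at t)" by (auto intro!: derivative_eq_intros)
  note DERIV_divide[OF dn dd n0]
  moreover have "(\<lambda>t. Bf u v i (mk i t c)) = (\<lambda>t. (u (mk i t c) * t + sg i * v (mk i t c) * c) / (t\<^sup>2 + c\<^sup>2))"
    by (simp add: Bf_def Nf_def norm_sq_oth[of _ i] mult_ac)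
  moreover have "Bd u v i (mk i t c) = ((pd i u (mk i t c) * t + u (mk i t c) + sg i * pd i v (mk i t c) * c) * (t\<^sup>2 + c\<^sup>2)
       - (u (mk i t c) * t + sg i * v (mk i t c) * c) * (2 * t)) / ((t\<^sup>2 + c\<^sup>2) * (t\<^sup>2 + c\<^sup>2))"
    using n0 unfolding Bd_def Nf_def norm_sq_oth[of _ i] by (simp add: diff_divide_distrib power2_eq_square)
  ultimately show ?thesis by simp
qed

lemma finite_affine_zero: "\<alpha> \<noteq> 0 \<or> \<beta> \<noteq> 0 \<Longrightarrow> finite {t::real. \<alpha> * t + \<beta> = 0}"
proof (cases "\<alpha> = 0")
  case False
  then have "{t. \<alpha> * t + \<beta> = 0} \<subseteq> {- \<beta> / \<alpha>}" by (auto simp: field_simps add_eq_0_iff)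
  then show ?thesis by (rule finite_subset) simp
qed simp

lemma inner_mk: "b \<bullet> mk i t c = b $ i * t + b $ oth i * c" by (simp add: inner_oth[of _ _ i])

text \<open>The mean value theorem on the segment from the origin, where the function vanishes,
  gives linear growth. Dividing by the pole then leaves a bounded field whose derivatives grow like
  \<open>1 / |x|\<close>, which is integrable in the plane.\<close>

lemma (in polyg) CR_bounds:
  assumes "C1 u" "u 0 = 0"
  shows "\<exists>L\<ge>0. \<forall>x\<in>W. (\<forall>i. \<bar>pd i u x\<bar> \<le> L) \<and> \<bar>u x\<bar> \<le> 2 * L * norm x"
proof -
  have "\<exists>B. \<forall>x\<in>W. \<bar>pd i u x\<bar> \<le> B" for i
  proof -
    have "compact (pd i u ` closure W)"
      using bounded_W by (intro compact_continuous_image C1_continuous_pd[OF assms(1)]) (simp add: compact_closure)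
    then obtain B where "\<forall>y\<in>pd i u ` closure W. norm y \<le> B" using compact_imp_bounded bounded_iff by metis
    then show ?thesis using closure_subset[of W] by (intro exI[of _ B]) auto
  qed
  then obtain B where B: "\<And>i x. x \<in> W \<Longrightarrow> \<bar>pd i u x\<bar> \<le> B i" by metis
  define L where "L = max 0 (max (B 1) (B 2))"
  have L: "\<bar>pd i u x\<bar> \<le> L" if "x \<in> W" for i x using B[OF that, of i] two_cases[of i] by (auto simp: L_def)
  have "\<bar>u x\<bar> \<le> 2 * L * norm x" if x: "x \<in> W" for x
  proof -
    obtain s where s: "0 < s" "s < 1" "u (0 + x) - u 0 = (\<Sum>i\<in>UNIV. x $ i * pd i u (0 + s *\<^sub>R x))"
      using MVT_line[OF assms(1)] by blast
    have "s *\<^sub>R x \<in> W" using convexD[OF convex_W x zero_W, of s "1 - s"] s by simp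
    then show ?thesis using s(3) assms(2) sum2_abs_bound[of "\<lambda>i. pd i u (s *\<^sub>R x)" L x] L by simp
  qed
  then show ?thesis using L by (intro exI[of _ L]) (auto simp: L_def)
qed

locale polyg_CR = polyg +
  fixes u v :: "pt \<Rightarrow> real"
  assumes u: "C1 u" "u 0 = 0" and v: "C1 v" "v 0 = 0"
    and CR: "\<And>x i. x \<in> W \<Longrightarrow> pd i u x = sg i * pd (oth i) v x"
begin

text \<open>The summand with index \<open>i\<close> in the divergence of
  \<open>(1 - G^2) Bf\<close>. The cut-off vanishes on the boundary of \<open>W\<close>, so no
  boundary term arises, and its gradient \<open>- 2 G P\<close> brings in the gauge.\<close>

definition fi :: "2 \<Rightarrow> pt \<Rightarrow> real" where
  "fi i x = indicator W x * ((1 - (G x)\<^sup>2) * Bd u v i x - 2 * G x * P i x * Bf u v i x)"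

lemma borel_uv [measurable]:
  "u \<in> borel_measurable borel" "v \<in> borel_measurable borel"
  "pd i u \<in> borel_measurable borel" "pd i v \<in> borel_measurable borel"
  using u v C1_continuous C1_continuous_pd by (auto intro!: borel_measurable_continuous_onI)

lemma fi_borel [measurable]: "fi i \<in> borel_measurable borel" unfolding fi_def Bd_def Bf_def Nf_def by measurable

lemma fi_integrable: "integrable lborel (fi i)"
proof -
  obtain L1 where L1: "L1 \<ge> 0" "\<And>x i. x \<in> W \<Longrightarrow> \<bar>pd i u x\<bar> \<le> L1" "\<And>x. x \<in> W \<Longrightarrow> \<bar>u x\<bar> \<le> 2 * L1 * norm x"
    using CR_bounds[OF u] by blast
  obtain L2 where L2: "L2 \<ge> 0" "\<And>x i. x \<in> W \<Longrightarrow> \<bar>pd i v x\<bar> \<le> L2" "\<And>x. x \<in> W \<Longrightarrow> \<bar>v x\<bar> \<le> 2 * L2 * norm x"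
    using CR_bounds[OF v] by blast
  define L where "L = L1 + L2"
  have L0: "L \<ge> 0" using L1 L2 by (simp add: L_def)
  have L: "\<bar>pd i u x\<bar> \<le> L" "\<bar>pd i v x\<bar> \<le> L" "\<bar>u x\<bar> \<le> 2 * L * norm x" "\<bar>v x\<bar> \<le> 2 * L * norm x" if "x \<in> W" for x i
  proof -
    show "\<bar>pd i u x\<bar> \<le> L" "\<bar>pd i v x\<bar> \<le> L" using L1 L2 that by (auto simp: L_def intro: add_increasing add_increasing2)
    have "2 * L1 * norm x \<le> 2 * L * norm x" "2 * L2 * norm x \<le> 2 * L * norm x"
      using L1(1) L2(1) by (auto simp: L_def intro!: mult_right_mono)
    then show "\<bar>u x\<bar> \<le> 2 * L * norm x" "\<bar>v x\<bar> \<le> 2 * L * norm x" using L1(3)[OF that] L2(3)[OF that] by linarith+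
  qed
  have bound: "\<bar>fi i x\<bar> \<le> 12 * L * (indicator W x / norm x) + 8 * L * A * indicator W x" for x
  proof (cases "x \<in> W \<and> x \<noteq> 0")
    case False
    then have "fi i x = 0" by (auto simp: fi_def Bd_def Bf_def)
    then show ?thesis using L0 A_nonneg by simp
  next
    case True
    define q where "q = norm x"
    have q: "q > 0" using True by (simp add: q_def)
    have xi: "\<bar>x $ j\<bar> \<le> q" for j unfolding q_def by (rule component_le_norm_cart)
    note Lx = L[of x, folded q_def]
    have N: "\<bar>Nf u v i x\<bar> \<le> 4 * L * q\<^sup>2"
    proof -
      have "\<bar>Nf u v i x\<bar> \<le> \<bar>u x\<bar> * \<bar>x $ i\<bar> + \<bar>v x\<bar> * \<bar>x $ oth i\<bar>"
        unfolding Nf_def by (rule order_trans[OF abs_triangle_ineq]) (simp add: abs_mult)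
      also have "\<dots> \<le> (2 * L * q) * q + (2 * L * q) * q" using Lx True xi L0 q by (intro add_mono mult_mono) auto
      finally show ?thesis by (simp add: power2_eq_square)
    qed
    then have Bfb: "\<bar>Bf u v i x\<bar> \<le> 4 * L" using q unfolding Bf_def q_def[symmetric] by (simp add: divide_le_eq)
    have Bdb: "\<bar>Bd u v i x\<bar> \<le> 12 * L / q"
    proof -
      have 1: "\<bar>pd i u x * x $ i + u x + sg i * pd i v x * x $ oth i\<bar> \<le> 4 * L * q"
      proof -
        have "\<bar>pd i u x * x $ i\<bar> \<le> L * q" "\<bar>sg i * pd i v x * x $ oth i\<bar> \<le> L * q"
          using Lx True xi L0 by (auto simp: abs_mult intro!: mult_mono)
        moreover have "\<bar>u x\<bar> \<le> 2 * L * q" using Lx True by simp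
        ultimately show ?thesis by linarith
      qed
      have 2: "\<bar>Nf u v i x * (2 * x $ i)\<bar> \<le> (4 * L * q\<^sup>2) * (2 * q)"
        unfolding abs_mult using N xi[of i] L0 q by (intro mult_mono) auto
      have "\<bar>Bd u v i x\<bar> \<le> \<bar>pd i u x * x $ i + u x + sg i * pd i v x * x $ oth i\<bar> / q\<^sup>2 + \<bar>Nf u v i x * (2 * x $ i)\<bar> / (q\<^sup>2)\<^sup>2"
        unfolding Bd_def q_def[symmetric] by (rule order_trans[OF abs_triangle_ineq4]) (simp add: abs_divide)
      also have "\<dots> \<le> (4 * L * q) / q\<^sup>2 + ((4 * L * q\<^sup>2) * (2 * q)) / (q\<^sup>2)\<^sup>2"
        using 1 2 by (intro add_mono divide_right_mono) auto
      also have "\<dots> = 12 * L / q" using q by (simp add: power2_eq_square field_simps)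
      finally show ?thesis .
    qed
    have G1: "0 \<le> G x" "G x < 1" using G_nonneg True W_G by auto
    have "(G x)\<^sup>2 \<le> 1" using G1 by (simp add: power_le_one)
    then have G2: "\<bar>1 - (G x)\<^sup>2\<bar> \<le> 1" by (simp add: abs_le_iff)
    have "\<bar>fi i x\<bar> \<le> \<bar>1 - (G x)\<^sup>2\<bar> * \<bar>Bd u v i x\<bar> + 2 * (\<bar>G x\<bar> * \<bar>P i x\<bar> * \<bar>Bf u v i x\<bar>)" unfolding fi_def using True
      by (simp, intro order_trans[OF abs_triangle_ineq4]) (simp add: abs_mult)
    also have "\<dots> \<le> 1 * (12 * L / q) + 2 * (1 * A * (4 * L))" using G2 Bdb Bfb G1 P_bound[of i x] A_nonneg
      by (intro add_mono mult_mono) auto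
    finally show ?thesis using True by (simp add: q_def algebra_simps)
  qed
  have "integrable lborel (\<lambda>x. 12 * L * (indicator W x / norm x) + 8 * L * A * indicator W x)"
    by (intro Bochner_Integration.integrable_add integrable_mult_right inverse_norm_integrable bounded_W W_borel
        integrable_real_indicator) (use emeasure_bounded_finite[OF bounded_W] in \<open>auto simp: top.not_eq_extremum\<close>)
  then show ?thesis
  proof (rule Bochner_Integration.integrable_bound)
    show "AE x in lborel. norm (fi i x) \<le> norm (12 * L * (indicator W x / norm x) + 8 * L * A * indicator W x)"
    proof (rule AE_I2)
      fix x show "norm (fi i x) \<le> norm (12 * L * (indicator W x / norm x) + 8 * L * A * indicator W x)"
        using bound[of x] by (simp del: times_divide_eq_right)
    qed
  qed simp
qed

text \<open>On all but finitely many lines in direction \<open>i\<close> the component of the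
  cut-off field is continuous, has finitely many kinks and vanishes outside \<open>W\<close>, so the
  fundamental theorem of calculus gives zero.\<close>

lemma fi_integral: "integral\<^sup>L lborel (fi i) = 0"
proof (rule slice_integral_eq_0[OF fi_integrable, where i=i and N="insert 0 ((\<lambda>k. 1 / a k $ oth i) ` {..<n})"])
  \<comment> \<open>Excluded are the line through the pole, \<open>c = 0\<close>, and the levels at
    which a side of the polygon may lie in the line. For a side with \<open>a k $ oth i = 0\<close>
    the entry \<open>1 / 0\<close> is \<open>0\<close>, which is excluded anyway.\<close>
  fix c assume c: "c \<notin> insert 0 ((\<lambda>k. 1 / a k $ oth i) ` {..<n})"
    and ic: "integrable lborel (\<lambda>t. fi i (mk i t c))"
  then have c0: "c \<noteq> 0" and ck: "\<And>k. k < n \<Longrightarrow> c \<noteq> 1 / a k $ oth i" by auto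
  have x0: "mk i t c \<noteq> 0" for t using c0 mk_nth(2)[of i t c] by (metis zero_index)
  \<comment> \<open>The parameters at which two sides tie for the gauge or some side equation takes
    the value one. On the lines that are kept each of these conditions is a nontrivial affine
    equation in \<open>t\<close>.\<close>
  define E where "E = (\<Union>j\<in>{..<n}. \<Union>k\<in>{..<n} - {j}. {t. (a j $ i - a k $ i) * t + (a j $ oth i - a k $ oth i) * c = 0})
      \<union> (\<Union>k\<in>{..<n}. {t. a k $ i * t + (a k $ oth i * c - 1) = 0})"
  have finE: "finite E" unfolding E_def
  proof (intro finite_UnI finite_UN_I finite_affine_zero)
    fix j k assume jk: "j \<in> {..<n}" "k \<in> {..<n} - {j}"
    show "a j $ i - a k $ i \<noteq> 0 \<or> (a j $ oth i - a k $ oth i) * c \<noteq> 0"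
    proof (rule ccontr)
      assume "\<not> ?thesis"
      then have "a j = a k" using c0 by (simp add: vec_eq_iff all2_oth[of _ i])
      then show False using inj jk by (auto simp: inj_on_def)
    qed
  next
    fix k assume k: "k \<in> {..<n}"
    show "a k $ i \<noteq> 0 \<or> a k $ oth i * c - 1 \<noteq> 0"
    proof (rule ccontr)
      assume "\<not> ?thesis"
      then have "a k $ oth i * c = 1" by simp
      then have "c = 1 / a k $ oth i" by (metis mult_zero_left nonzero_mult_div_cancel_left zero_neq_one)
      then show False using ck k by auto
    qed
  qed auto
  \<comment> \<open>The maximum with zero extends the cut-off continuously beyond \<open>W\<close>;
    the kinks this creates have gauge one and lie in \<open>E\<close>.\<close>
  define phi where "phi t = max 0 (1 - (G (mk i t c))\<^sup>2) * Bf u v i (mk i t c)" for t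
  have Gc: "continuous_on S (\<lambda>t. G (mk i t c))" for S
    by (intro continuous_on_compose2[OF G_cont[of UNIV]] continuous_intros) auto
  have Bc: "continuous_on S (\<lambda>t. Bf u v i (mk i t c))" for S
    using Bf_slice_deriv[OF u(1) v(1) x0] by (meson DERIV_isCont continuous_at_imp_continuous_on)
  have out: "phi t = 0 \<and> fi i (mk i t c) = 0" if "mk i t c \<notin> W" for t
  proof -
    have "G (mk i t c) \<ge> 1" using that W_G by (simp add: not_less)
    then have "(G (mk i t c))\<^sup>2 \<ge> 1" by simp
    then show ?thesis using that by (simp add: phi_def fi_def)
  qed
  have outR: "mk i t c \<notin> W" if "\<bar>t\<bar> \<ge> R" for t using that bd[of "mk i t c"] abs_mk_le[of t i c] by (auto simp: W_def)
  have "(\<integral>t. fi i (mk i t c) \<partial>lborel) = phi R - phi (- R)"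
  proof (rule FTC_lborel[where S=E and f=phi and f'="\<lambda>t. fi i (mk i t c)" and a="- R" and b=R])
    show "continuous_on {- R..R} phi" unfolding phi_def by (intro continuous_intros Gc Bc)
    show "fi i (mk i t c) = 0" if "t \<notin> {- R..R}" for t using out outR that by auto
    fix t assume t: "t \<in> {- R<..<R} - E"
    let ?x = "mk i t c"
    show "(phi has_real_derivative fi i ?x) (at t)"
    proof (cases "G ?x < 1")
      case False
      have "G ?x \<noteq> 1"
      proof
        assume "G ?x = 1"
        then obtain k where k: "k < n" "a k \<bullet> ?x = 1" using G_attained[of ?x] by auto
        then have "a k $ i * t + (a k $ oth i * c - 1) = 0" by (simp add: inner_mk)
        then have "t \<in> E" unfolding E_def using k(1) by blast
        then show False using t by simp
      qed
      then have G1: "G ?x > 1" using False by simp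
      have "((\<lambda>t. 0) has_real_derivative 0) (at t)" by simp
      then have "(phi has_real_derivative 0) (at t)"
      proof (rule has_field_derivative_transform_within_open[where S="{t. G (mk i t c) > 1}"])
        show "open {t. G (mk i t c) > 1}" by (intro open_Collect_less Gc continuous_on_const)
        show "0 = phi s" if "s \<in> {t. G (mk i t c) > 1}" for s
        proof -
          have "mk i s c \<notin> W" using that W_G by auto
          then show ?thesis using out by simp
        qed
      qed (use G1 in simp)
      moreover have "fi i ?x = 0" using out[of t] False W_G by auto
      ultimately show ?thesis by simp
    next
      case True
      obtain k where k: "k < n" "?x \<in> cell k" using cell_ex by blast
      have strict: "a j \<bullet> ?x < a k \<bullet> ?x" if "j \<in> {..<n} - {k}" for j
      proof -
        have "a j \<bullet> ?x \<noteq> a k \<bullet> ?x"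
        proof
          assume "a j \<bullet> ?x = a k \<bullet> ?x"
          then have "(a j $ i - a k $ i) * t + (a j $ oth i - a k $ oth i) * c = 0"
            by (simp add: inner_mk algebra_simps)
          then have "t \<in> E" unfolding E_def using that k by blast
          then show False using t by simp
        qed
        then show ?thesis using k that by (auto simp: cell_def less_le)
      qed
      define O' where "O' = {s. G (mk i s c) < 1} \<inter> (\<Inter>j\<in>{..<n} - {k}. {s. a j \<bullet> mk i s c < a k \<bullet> mk i s c})"
      have open_O: "open O'" unfolding O'_def
        by (intro open_Int open_INT ballI open_Collect_less Gc continuous_on_const) (auto intro!: continuous_intros)
      have tO: "t \<in> O'" using True strict by (simp add: O'_def)
      have GO: "G (mk i s c) = a k \<bullet> mk i s c" "G (mk i s c) < 1" if "s \<in> O'" for s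
      proof -
        obtain j where j: "j < n" "G (mk i s c) = a j \<bullet> mk i s c" using G_attained by blast
        have "j = k"
        proof (rule ccontr)
          assume "j \<noteq> k"
          then have "a j \<bullet> mk i s c < a k \<bullet> mk i s c" using that j by (auto simp: O'_def)
          then show False using j G_ge[OF k(1), of "mk i s c"] by simp
        qed
        then show "G (mk i s c) = a k \<bullet> mk i s c" using j by simp
        show "G (mk i s c) < 1" using that by (simp add: O'_def)
      qed
      have dl: "((\<lambda>s. 1 - (a k $ i * s + a k $ oth i * c)\<^sup>2) has_real_derivative - (2 * (a k $ i * t + a k $ oth i * c) * a k $ i)) (at t)"
        by (auto intro!: derivative_eq_intros)
      have "((\<lambda>s. (1 - (a k \<bullet> mk i s c)\<^sup>2) * Bf u v i (mk i s c)) has_real_derivative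
          - (2 * (a k \<bullet> ?x) * a k $ i) * Bf u v i ?x + Bd u v i ?x * (1 - (a k \<bullet> ?x)\<^sup>2)) (at t)"
        unfolding inner_mk by (rule DERIV_mult[OF dl Bf_slice_deriv[OF u(1) v(1) x0]])
      then have "(phi has_real_derivative - (2 * (a k \<bullet> ?x) * a k $ i) * Bf u v i ?x + Bd u v i ?x * (1 - (a k \<bullet> ?x)\<^sup>2)) (at t)"
      proof (rule has_field_derivative_transform_within_open[OF _ open_O tO])
        fix s assume s: "s \<in> O'"
        have "(G (mk i s c))\<^sup>2 \<le> 1" using GO(2)[OF s] G_nonneg[of "mk i s c"] by (simp add: power_le_one)
        then show "(1 - (a k \<bullet> mk i s c)\<^sup>2) * Bf u v i (mk i s c) = phi s"
          unfolding phi_def GO(1)[OF s, symmetric] by simp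
      qed
      moreover have "fi i ?x = - (2 * (a k \<bullet> ?x) * a k $ i) * Bf u v i ?x + Bd u v i ?x * (1 - (a k \<bullet> ?x)\<^sup>2)"
        using True W_G P_cell[OF k(2,1)] by (simp add: fi_def algebra_simps)
      ultimately show ?thesis by simp
    qed
  qed (use R ic finE in auto)
  also have "\<dots> = 0" using out[of R] out[of "-R"] outR[of R] outR[of "-R"] R by simp
  finally show "(\<integral>t. fi i (mk i t c) \<partial>lborel) = 0" .
qed simp

text \<open>In the sum of both \<open>fi\<close> the terms with \<open>1 - G^2\<close> cancel
  because the field is divergence free. What remains is \<open>- 2 G\<close> times the product of
  \<open>P\<close> and \<open>Bf\<close>, and the Euler identity produces the factor
  \<open>G^2\<close>.\<close>

lemma HP_identity:
  "integral\<^sup>L lborel (\<lambda>x. indicator W x * (u x * (G x)\<^sup>2 + v x * (G x * (P 1 x * x $ 2 - P 2 x * x $ 1))) / (norm x)\<^sup>2) = 0" (is "integral\<^sup>L lborel ?q = 0")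
  "integrable lborel (\<lambda>x. indicator W x * (u x * (G x)\<^sup>2 + v x * (G x * (P 1 x * x $ 2 - P 2 x * x $ 1))) / (norm x)\<^sup>2)"
proof -
  have eq: "?q x = (- 1 / 2) * (fi 1 x + fi 2 x)" for x
  proof (cases "x \<in> W \<and> x \<noteq> 0")
    case False then show ?thesis by (auto simp: fi_def Bd_def Bf_def)
  next
    case True
    have o: "oth 1 = 2" "oth 2 = 1" by (simp_all add: oth_def)
    have "Bd u v 1 x + Bd u v (oth 1) x = 0"
    proof (rule Bd_sum)
      show "pd 1 u x = sg 1 * pd (oth 1) v x" using CR True by blast
      show "pd (oth 1) u x = - sg 1 * pd 1 v x" using CR[of x "oth 1"] True by simp
    qed (use True in simp)
    then have B: "Bd u v 2 x = - Bd u v 1 x" by (simp add: o)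
    have "fi 1 x + fi 2 x = - 2 * G x * (P 1 x * Bf u v 1 x + P 2 x * Bf u v 2 x)"
      using True by (simp add: fi_def B algebra_simps)
    also have "P 1 x * Bf u v 1 x + P 2 x * Bf u v 2 x
        = (u x * (P 1 x * x $ 1 + P 2 x * x $ 2) + v x * (P 1 x * x $ 2 - P 2 x * x $ 1)) / (norm x)\<^sup>2"
      by (simp add: Bf_def Nf_def sg_def o add_divide_distrib[symmetric] diff_divide_distrib[symmetric] algebra_simps)
    also have "P 1 x * x $ 1 + P 2 x * x $ 2 = G x" using P_inner[of 1 x] by (simp add: o)
    finally show ?thesis using True by (simp add: power2_eq_square algebra_simps)
  qed
  show "integral\<^sup>L lborel ?q = 0" unfolding eq using fi_integrable fi_integral by simp
  show "integrable lborel ?q" unfolding eq using fi_integrable by simp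
qed

end

section \<open>Restriction and translation of integrals\<close>

lemma lebesgue_on_integral_lborel:
  fixes f :: "pt \<Rightarrow> real"
  assumes "f \<in> borel_measurable borel" "S \<in> sets borel"
  shows "integral\<^sup>L (lebesgue_on S) f = integral\<^sup>L lborel (\<lambda>x. indicator S x * f x)"
    "integrable (lebesgue_on S) f \<longleftrightarrow> integrable lborel (\<lambda>x. indicator S x * f x)"
proof -
  have S: "S \<inter> space lebesgue \<in> sets lebesgue" using assms(2) by simp
  have m: "(\<lambda>x. indicator S x * f x) \<in> borel_measurable lborel" using assms by measurable
  have "integral\<^sup>L (lebesgue_on S) f = integral\<^sup>L lebesgue (\<lambda>x. indicator S x * f x)"
    using integral_restrict_space[OF S, of f] by simp
  then show "integral\<^sup>L (lebesgue_on S) f = integral\<^sup>L lborel (\<lambda>x. indicator S x * f x)"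
    using m by (simp add: integral_completion)
  have "integrable (lebesgue_on S) f \<longleftrightarrow> integrable lebesgue (\<lambda>x. indicator S x * f x)"
    using integrable_restrict_space[OF S, of f] by simp
  then show "integrable (lebesgue_on S) f \<longleftrightarrow> integrable lborel (\<lambda>x. indicator S x * f x)"
    using m by (simp add: integrable_completion)
qed

lemma lebesgue_on_translate:
  fixes f :: "pt \<Rightarrow> real"
  assumes "f \<in> borel_measurable borel" "S \<in> sets borel"
  shows "integral\<^sup>L (lebesgue_on S) f = integral\<^sup>L (lebesgue_on {y. x0 + y \<in> S}) (\<lambda>y. f (x0 + y))"
proof -
  have [measurable]: "f \<in> borel_measurable borel" "S \<in> sets borel" by fact+
  have S': "{y. x0 + y \<in> S} \<in> sets borel"
  proof -
    have "(\<lambda>y. x0 + y) -` S \<inter> space borel \<in> sets borel" by measurable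
    then show ?thesis by (simp add: vimage_def)
  qed
  have "integral\<^sup>L (lebesgue_on S) f = integral\<^sup>L lborel (\<lambda>x. indicator S x * f x)"
    by (rule lebesgue_on_integral_lborel) fact+
  also have "\<dots> = integral\<^sup>L (distr lborel borel ((+) x0)) (\<lambda>x. indicator S x * f x)" by (simp add: lborel_distr_plus)
  also have "\<dots> = integral\<^sup>L lborel (\<lambda>y. indicator S (x0 + y) * f (x0 + y))" by (rule integral_distr) measurable
  also have "\<dots> = integral\<^sup>L lborel (\<lambda>y. indicator {y. x0 + y \<in> S} y * f (x0 + y))" by (simp add: indicator_def)
  also have "\<dots> = integral\<^sup>L (lebesgue_on {y. x0 + y \<in> S}) (\<lambda>y. f (x0 + y))"
    by (rule lebesgue_on_integral_lborel(1)[symmetric]) (use S' in measurable)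
  finally show ?thesis .
qed

context polyg
begin

text \<open>The coercive constant is \<open>m^2 / 2\<close>; the bracket gathers the upper bound of
  the weight on \<open>g^2\<close> and the remainder of Young's inequality.\<close>

definition CHP :: real where "CHP = 2 * (A\<^sup>2 + 8 * A ^ 4 / m\<^sup>2) / m\<^sup>2"

lemma CHP_nonneg: "CHP \<ge> 0" by (simp add: CHP_def)

lemma Horgan_Payne_0:
  assumes h: "C1 h" "h 0 = 0" and g: "C1 g"
    and cr: "\<And>x i. x \<in> W \<Longrightarrow> pd i h x = sg i * pd (oth i) g x"
  shows "(\<integral>x. (h x)\<^sup>2 \<partial>lebesgue_on W) \<le> CHP * (\<integral>x. (g x)\<^sup>2 \<partial>lebesgue_on W)"
proof -
  \<comment> \<open>\<open>u + i v\<close> is \<open>F^2 - F(0)^2\<close> for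
    \<open>F = h + i g\<close>. Since \<open>h 0 = 0\<close>, the value \<open>F(0)^2\<close> equals
    \<open>- (g 0)^2\<close>; subtracting it makes both functions vanish at the pole.\<close>
  define u where "u x = h x * h x - g x * g x + (g 0)\<^sup>2" for x
  define v where "v x = 2 * (h x * g x)" for x
  have hh: "C1 (\<lambda>x. h x * h x)" "C1 (\<lambda>x. g x * g x)" "C1 (\<lambda>x. h x * g x)" by (intro C1_mult h g)+
  have u: "C1 u" unfolding u_def by (intro C1_add C1_diff hh C1_const)
  have v: "C1 v" unfolding v_def by (intro C1_cmult hh)
  have pdu: "pd i u x = 2 * h x * pd i h x - 2 * g x * pd i g x" for i x
    unfolding u_def pd_add[OF C1_diff[OF hh(1,2)] C1_const] pd_diff[OF hh(1,2)] pd_mult[OF h(1) h(1)] pd_mult[OF g g] pd_const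
    by simp
  have pdv: "pd i v x = 2 * (pd i h x * g x + h x * pd i g x)" for i x
    unfolding v_def pd_cmult[OF hh(3)] pd_mult[OF h(1) g] by simp
  have CR: "pd i u x = sg i * pd (oth i) v x" if "x \<in> W" for x i
  proof -
    have e: "sg i * (sg i * z) = z" for z using sg_oth(2)[of i] by (metis mult.assoc mult_1)
    have "sg i * pd (oth i) v x = 2 * (sg i * pd (oth i) h x * g x + h x * (sg i * pd (oth i) g x))"
      by (simp add: pdv algebra_simps)
    also have "sg i * pd (oth i) h x = - pd i g x" using cr[OF that, of "oth i"] e[of "pd i g x"] by simp
    also have "sg i * pd (oth i) g x = pd i h x" using cr[OF that, of i] by simp
    finally show ?thesis by (simp add: pdu algebra_simps)
  qed
  interpret C: polyg_CR n a R u v by unfold_locales (use u v CR h in \<open>auto simp: u_def v_def power2_eq_square\<close>)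
  define q where "q x = (u x * (G x)\<^sup>2 + v x * (G x * (P 1 x * x $ 2 - P 2 x * x $ 1))) / (norm x)\<^sup>2" for x
  have q0: "(\<integral>x. indicator W x * q x \<partial>lborel) = 0" "integrable lborel (\<lambda>x. indicator W x * q x)"
    using C.HP_identity by (simp_all add: q_def)
  define K where "K = A\<^sup>2 + 8 * A ^ 4 / m\<^sup>2"
  have m: "m > 0" by (rule m_pos)
  have K0: "K \<ge> 0" by (simp add: K_def)
  \<comment> \<open>The weight \<open>G^2 / |x|^2\<close> lies between \<open>m^2\<close> and
    \<open>A^2\<close>, so the part with \<open>h^2\<close> is coercive, while the mixed term is
    split between \<open>h^2\<close> and \<open>g^2\<close>. As \<open>q\<close> has integral zero,
    integrating this bound compares the two norms.\<close>
  have low: "(m\<^sup>2 / 2) * (h x)\<^sup>2 - K * (g x)\<^sup>2 \<le> q x" for x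
  proof (cases "x = 0")
    case True then show ?thesis using K0 h by (simp add: q_def)
  next
    case False
    define \<rho> where "\<rho> = norm x"
    have \<rho>: "\<rho> > 0" using False by (simp add: \<rho>_def)
    define w where "w = (G x)\<^sup>2 / \<rho>\<^sup>2"
    define \<kappa> where "\<kappa> = G x * (P 1 x * x $ 2 - P 2 x * x $ 1) / \<rho>\<^sup>2"
    have qx: "q x = u x * w + v x * \<kappa>" by (simp add: q_def w_def \<kappa>_def \<rho>_def add_divide_distrib)
    have G: "m * \<rho> \<le> G x" "G x \<le> A * \<rho>" "0 \<le> G x" using G_lower[of x] G_upper[of x] G_nonneg[of x] by (auto simp: \<rho>_def)
    have w: "m\<^sup>2 \<le> w" "w \<le> A\<^sup>2"
    proof -
      have "(m * \<rho>)\<^sup>2 \<le> (G x)\<^sup>2" using G m \<rho> by (intro power_mono) auto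
      then show "m\<^sup>2 \<le> w" using \<rho> by (simp add: w_def le_divide_eq power_mult_distrib)
      have "(G x)\<^sup>2 \<le> (A * \<rho>)\<^sup>2" using G by (intro power_mono) auto
      then show "w \<le> A\<^sup>2" using \<rho> by (simp add: w_def divide_le_eq power_mult_distrib)
    qed
    have \<kappa>: "\<bar>\<kappa>\<bar> \<le> 2 * A\<^sup>2"
    proof -
      have "\<bar>P 1 x * x $ 2\<bar> \<le> A * \<rho>" "\<bar>P 2 x * x $ 1\<bar> \<le> A * \<rho>"
        unfolding abs_mult \<rho>_def using P_bound A_nonneg by (auto intro!: mult_mono component_le_norm_cart)
      then have "\<bar>P 1 x * x $ 2 - P 2 x * x $ 1\<bar> \<le> 2 * (A * \<rho>)" by linarith
      then have "\<bar>G x * (P 1 x * x $ 2 - P 2 x * x $ 1)\<bar> \<le> (A * \<rho>) * (2 * (A * \<rho>))"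
        unfolding abs_mult using G A_nonneg \<rho> by (intro mult_mono) auto
      then show ?thesis using \<rho> by (simp add: \<kappa>_def abs_divide divide_le_eq power2_eq_square mult_ac)
    qed
    have "(h x)\<^sup>2 * m\<^sup>2 \<le> (h x)\<^sup>2 * w" using w by (intro mult_left_mono) auto
    moreover have "(g x)\<^sup>2 * w \<le> (g x)\<^sup>2 * A\<^sup>2" using w by (intro mult_left_mono) auto
    moreover have "0 \<le> (g 0)\<^sup>2 * w" using w(1) by (simp add: w_def)
    moreover have "- ((m\<^sup>2 / 2) * (h x)\<^sup>2 + (8 * A ^ 4 / m\<^sup>2) * (g x)\<^sup>2) \<le> v x * \<kappa>"
    proof -
      have "\<bar>v x * \<kappa>\<bar> \<le> (2 * (\<bar>h x\<bar> * \<bar>g x\<bar>)) * (2 * A\<^sup>2)"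
        unfolding abs_mult v_def using \<kappa> by (intro mult_mono) (auto simp: abs_mult)
      also have "\<dots> \<le> (m\<^sup>2 / 2) * (h x)\<^sup>2 + (8 * A ^ 4 / m\<^sup>2) * (g x)\<^sup>2"
      proof -
        \<comment> \<open>Young's inequality, balanced so that the \<open>h^2\<close> part costs
          exactly half of the coercive term.\<close>
        define s t where "s = m * \<bar>h x\<bar>" and "t = 4 * A\<^sup>2 * \<bar>g x\<bar> / m"
        have "0 \<le> (s - t)\<^sup>2" by simp
        then have "2 * (s * t) \<le> s\<^sup>2 + t\<^sup>2" by (simp add: power2_diff)
        moreover have "s * t = 4 * A\<^sup>2 * (\<bar>h x\<bar> * \<bar>g x\<bar>)" using m by (simp add: s_def t_def)
        moreover have "s\<^sup>2 = m\<^sup>2 * (h x)\<^sup>2" "t\<^sup>2 = 16 * A ^ 4 * (g x)\<^sup>2 / m\<^sup>2"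
          by (simp_all add: s_def t_def power_mult_distrib power_divide)
        ultimately show ?thesis by (simp add: mult_ac)
      qed
      finally show ?thesis by linarith
    qed
    ultimately show ?thesis unfolding qx u_def K_def by (simp add: algebra_simps power2_eq_square)
  qed
  have ch: "h \<in> borel_measurable borel" "g \<in> borel_measurable borel"
    using C1_continuous[OF h(1)] C1_continuous[OF g] by (auto intro: borel_measurable_continuous_onI)
  have Wl: "W \<in> lmeasurable" by (rule lmeasurable_open[OF bounded_W open_W])
  have i2: "integrable (lebesgue_on W) (\<lambda>x. (h x)\<^sup>2)" "integrable (lebesgue_on W) (\<lambda>x. (g x)\<^sup>2)"
    using continuous_sq_int[OF C1_continuous[OF h(1)] bounded_W Wl] continuous_sq_int[OF C1_continuous[OF g] bounded_W Wl]
    by (auto simp: sq_int_def)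
  have qm: "q \<in> borel_measurable borel" unfolding q_def by measurable
  have qi: "integrable (lebesgue_on W) q" "integral\<^sup>L (lebesgue_on W) q = 0"
    using q0 lebesgue_on_integral_lborel[OF qm W_borel] by auto
  have "(\<integral>x. (m\<^sup>2 / 2) * (h x)\<^sup>2 - K * (g x)\<^sup>2 \<partial>lebesgue_on W) \<le> integral\<^sup>L (lebesgue_on W) q"
    using low i2 qi by (intro integral_mono) auto
  then have "(m\<^sup>2 / 2) * (\<integral>x. (h x)\<^sup>2 \<partial>lebesgue_on W) \<le> K * (\<integral>x. (g x)\<^sup>2 \<partial>lebesgue_on W)" using i2 qi by simp
  then show ?thesis using m by (simp add: CHP_def K_def[symmetric] field_simps)
qed

end

lemma interior_Inter_finite: "finite F \<Longrightarrow> interior (\<Inter>F) = \<Inter>(interior ` F)" by (induction F rule: finite_induct) auto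

text \<open>A polytope is a finite intersection of half-planes. Dividing each inequality by its
  slack at \<open>x0\<close>, which is positive inside, and translating normalises the right-hand
  side to one.\<close>

lemma convex_polygon_polyg:
  assumes "convex_polygon \<Omega>" "x0 \<in> \<Omega>"
  shows "\<exists>n a R. polyg n a R \<and> (\<forall>y. x0 + y \<in> \<Omega> \<longleftrightarrow> (\<forall>k<n. a k \<bullet> y < 1))"
proof -
  obtain Q where Q: "finite Q" "\<Omega> = interior (convex hull Q)" using assms(1) by (auto simp: convex_polygon_def)
  have bQ: "bounded (convex hull Q)" using Q(1) by (intro bounded_convex_hull finite_imp_bounded)
  then have bdd: "bounded \<Omega>" unfolding Q(2) by (rule bounded_subset) (rule interior_subset)
  have "polyhedron (convex hull Q)" using Q(1) polytope_imp_polyhedron polytope_def by blast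
  then have "\<exists>F. finite F \<and> convex hull Q = \<Inter>F \<and> (\<forall>h\<in>F. \<exists>a b. a \<noteq> 0 \<and> h = {x. a \<bullet> x \<le> b})"
    by (simp only: polyhedron_def)
  then obtain F where F: "finite F" "convex hull Q = \<Inter>F" "\<forall>H\<in>F. \<exists>a b. a \<noteq> 0 \<and> H = {x. a \<bullet> x \<le> b}" by (elim exE conjE)
  have "\<forall>H\<in>F. \<exists>p. fst p \<noteq> 0 \<and> H = {x. fst p \<bullet> x \<le> snd p}" using F(3) by simp
  from bchoice[OF this] obtain p where p: "\<forall>H\<in>F. fst (p H) \<noteq> 0 \<and> H = {x. fst (p H) \<bullet> x \<le> snd (p H)}" by (elim exE)
  define \<alpha> \<beta> where "\<alpha> H = fst (p H)" and "\<beta> H = snd (p H)" for H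
  have ab: "\<alpha> H \<noteq> 0" "H = {x. \<alpha> H \<bullet> x \<le> \<beta> H}" if "H \<in> F" for H using p that by (auto simp: \<alpha>_def \<beta>_def)
  have O: "\<Omega> = (\<Inter>H\<in>F. {x. \<alpha> H \<bullet> x < \<beta> H})"
  proof -
    have "interior H = {x. \<alpha> H \<bullet> x < \<beta> H}" if "H \<in> F" for H
      by (subst ab(2)[OF that]) (rule interior_halfspace_le[OF ab(1)[OF that]])
    then show ?thesis using Q(2) F(2) interior_Inter_finite[OF F(1)] by auto
  qed
  define \<gamma> where "\<gamma> H = (1 / (\<beta> H - \<alpha> H \<bullet> x0)) *\<^sub>R \<alpha> H" for H
  \<comment> \<open>Passing to the set of normalised vectors identifies half-planes that coincide,
    so the enumeration below can be injective.\<close>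
  define S where "S = \<gamma> ` F"
  have pos: "\<beta> H - \<alpha> H \<bullet> x0 > 0" if "H \<in> F" for H using assms(2) O that by auto
  have mem: "x0 + y \<in> \<Omega> \<longleftrightarrow> (\<forall>s\<in>S. s \<bullet> y < 1)" for y
  proof -
    have "\<alpha> H \<bullet> (x0 + y) < \<beta> H \<longleftrightarrow> \<gamma> H \<bullet> y < 1" if "H \<in> F" for H
      using pos[OF that] by (simp add: \<gamma>_def inner_add_right divide_less_eq) linarith
    then show ?thesis by (auto simp: O S_def)
  qed
  have finS: "finite S" using F(1) by (simp add: S_def)
  obtain f where f: "bij_betw f {0..<card S} S" using ex_bij_betw_nat_finite[OF finS] by blast
  have f': "f ` {..<card S} = S" "inj_on f {..<card S}" using f by (auto simp: bij_betw_def lessThan_atLeast0)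
  have mem': "x0 + y \<in> \<Omega> \<longleftrightarrow> (\<forall>k<card S. f k \<bullet> y < 1)" for y
  proof -
    have "(\<forall>s\<in>f ` {..<card S}. s \<bullet> y < 1) \<longleftrightarrow> (\<forall>k<card S. f k \<bullet> y < 1)" by auto
    then show ?thesis using mem[of y] by (simp only: f'(1))
  qed
  obtain R0 where R0: "\<And>x. x \<in> \<Omega> \<Longrightarrow> norm x \<le> R0" using bdd by (auto simp: bounded_iff)
  have "S \<noteq> {}"
  proof
    assume "S = {}"
    then have "\<Omega> = UNIV" by (auto simp: O S_def)
    then show False using bdd not_bounded_UNIV by simp
  qed
  moreover have "norm y < R0 + norm x0 + 1" if "\<forall>k<card S. f k \<bullet> y < 1" for y
  proof -
    have "norm (x0 + y) \<le> R0" using that mem' R0 by blast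
    moreover have "norm y \<le> norm (x0 + y) + norm x0" using norm_triangle_ineq4[of "x0 + y" x0] by simp
    ultimately show ?thesis by simp
  qed
  ultimately have "polyg (card S) f (R0 + norm x0 + 1)" using f'(2) finS by unfold_locales (auto simp: card_gt_0_iff)
  then show ?thesis using mem' by blast
qed

lemma C1_translate: "C1 f \<Longrightarrow> C1 (\<lambda>y. f (x0 + y))" and pd_translate: "C1 f \<Longrightarrow> pd i (\<lambda>y. f (x0 + y)) y = pd i f (x0 + y)"
proof -
  assume f: "C1 f"
  have d: "((\<lambda>y. f (x0 + y)) has_derivative (\<lambda>h. \<Sum>i\<in>UNIV. h $ i * pd i f (x0 + y))) (at y)" for y
    by (rule has_derivative_compose[where g=f and f="\<lambda>y. x0 + y", OF _ C1_has_derivative[OF f]])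
      (auto intro!: derivative_eq_intros)
  have c: "continuous_on UNIV (\<lambda>y. pd i f (x0 + y))" for i
    by (intro continuous_on_compose2[OF C1_continuous_pd[OF f, of UNIV]] continuous_intros) auto
  show "C1 (\<lambda>y. f (x0 + y))" "pd i (\<lambda>y. f (x0 + y)) y = pd i f (x0 + y)" using C1I[OF d c] by auto
qed

text \<open>Horgan and Payne's inequality for conjugate harmonic functions. With \<open>F = h + i g\<close>,
  \<open>h x0 = 0\<close>, the form \<open>F\<^sup>2 dz / z\<close> is closed, and integrating it over the level lines of the
  Minkowski gauge compares \<open>h\<^sup>2\<close> with \<open>g\<^sup>2\<close>; the value of \<open>F\<^sup>2\<close> at the centre is negative
  and can be dropped.\<close>

theorem Horgan_Payne:
  assumes "convex_polygon \<Omega>" "x0 \<in> \<Omega>"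
  shows "\<exists>C\<ge>0. \<forall>h g. C1 h \<and> C1 g \<and> (\<forall>x\<in>\<Omega>. pd 1 h x = pd 2 g x \<and> pd 2 h x = - pd 1 g x) \<longrightarrow>
    n2 (lebesgue_on \<Omega>) (\<lambda>x. h x - h x0) \<le> C * n2 (lebesgue_on \<Omega>) g"
proof -
  obtain n a R where p: "polyg n a R" and mem: "\<And>y. x0 + y \<in> \<Omega> \<longleftrightarrow> (\<forall>k<n. a k \<bullet> y < 1)"
    using convex_polygon_polyg[OF assms] by blast
  interpret polyg n a R by (rule p)
  have W: "W = {y. x0 + y \<in> \<Omega>}" using mem by (auto simp: W_def)
  have op: "open \<Omega>" using assms(1) by (auto simp: convex_polygon_def)
  have "n2 (lebesgue_on \<Omega>) (\<lambda>x. h x - h x0) \<le> sqrt CHP * n2 (lebesgue_on \<Omega>) g"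
    if "C1 h" "C1 g" "\<forall>x\<in>\<Omega>. pd 1 h x = pd 2 g x \<and> pd 2 h x = - pd 1 g x" for h g
  proof -
    define h' where "h' y = h (x0 + y) - h x0" for y
    define g' where "g' y = g (x0 + y)" for y
    have h': "C1 h'" "h' 0 = 0" unfolding h'_def by (auto intro!: C1_diff C1_translate C1_const that)
    have g': "C1 g'" unfolding g'_def by (intro C1_translate that)
    have ph: "pd i h' y = pd i h (x0 + y)" for i y
      unfolding h'_def pd_diff[OF C1_translate[OF that(1)] C1_const] pd_const by (simp add: pd_translate that)
    have pg: "pd i g' y = pd i g (x0 + y)" for i y unfolding g'_def by (simp add: pd_translate that)
    have "(\<integral>x. (h' x)\<^sup>2 \<partial>lebesgue_on W) \<le> CHP * (\<integral>x. (g' x)\<^sup>2 \<partial>lebesgue_on W)"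
    proof (rule Horgan_Payne_0[OF h' g'])
      fix y i assume "y \<in> W"
      then have "x0 + y \<in> \<Omega>" by (simp add: W)
      then show "pd i h' y = sg i * pd (oth i) g' y"
        using that(3) two_cases[of i] by (auto simp: ph pg sg_def oth_def)
    qed
    moreover have "(\<integral>x. (h x - h x0)\<^sup>2 \<partial>lebesgue_on \<Omega>) = (\<integral>x. (h' x)\<^sup>2 \<partial>lebesgue_on W)"
      unfolding W h'_def by (rule lebesgue_on_translate)
        (use op C1_continuous[OF that(1)] in \<open>auto intro!: borel_measurable_continuous_onI continuous_intros\<close>)
    moreover have "(\<integral>x. (g x)\<^sup>2 \<partial>lebesgue_on \<Omega>) = (\<integral>x. (g' x)\<^sup>2 \<partial>lebesgue_on W)"
      unfolding W g'_def by (rule lebesgue_on_translate)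
        (use op C1_continuous[OF that(2)] in \<open>auto intro!: borel_measurable_continuous_onI continuous_intros\<close>)
    ultimately have "(\<integral>x. (h x - h x0)\<^sup>2 \<partial>lebesgue_on \<Omega>) \<le> CHP * (\<integral>x. (g x)\<^sup>2 \<partial>lebesgue_on \<Omega>)" by simp
    then show ?thesis unfolding n2_def real_sqrt_mult[symmetric] by (rule real_sqrt_le_mono)
  qed
  then show ?thesis by (intro exI[of _ "sqrt CHP"]) (auto simp: CHP_nonneg)
qed

section \<open>The inf-sup condition\<close>

text \<open>Riesz--Fischer: a Cauchy sequence in the mean has an almost everywhere convergent
  subsequence, and Fatou's lemma along it bounds the distance to the limit.\<close>

lemma L2_complete:
  assumes fin: "finite_measure M" and F: "\<And>n. sq_int M (F n)"
    and Cauchy: "\<And>e. e > 0 \<Longrightarrow> \<exists>N. \<forall>m\<ge>N. \<forall>n\<ge>N. n2 M (\<lambda>x. F m x - F n x) < e"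
  shows "\<exists>f. sq_int M f \<and> (\<lambda>n. n2 M (\<lambda>x. F n x - f x)) \<longlonglongrightarrow> 0"
proof -
  have [measurable]: "F n \<in> borel_measurable M" for n using F by (rule sq_int_measurable)
  interpret finite_measure M by (rule fin)
  have one: "sq_int M (\<lambda>x. 1)" by (simp add: sq_int_def)
  have L1: "(\<integral>x. norm (F m x - F n x) \<partial>M) \<le> n2 M (\<lambda>x. F m x - F n x) * n2 M (\<lambda>x. 1)" for m n
  proof -
    have "sq_int M (\<lambda>x. \<bar>F m x - F n x\<bar>)" using sq_int_diff[OF F F, of m n] by (simp add: sq_int_def)
    from n2_CS[OF this one] show ?thesis by (simp add: n2_def)
  qed
  obtain k where k: "strict_mono k" "AE x in M. Cauchy (\<lambda>j. F (k j) x)"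
  proof (rule cauchy_L1_AE_cauchy_subseq[of M F])
    show "integrable M (F n)" for n by (rule sq_int_imp_integrable[OF fin F])
    fix e :: real assume "e > 0"
    define c where "c = n2 M (\<lambda>x. 1) + 1"
    have c: "c > 0" by (simp add: c_def add_nonneg_pos)
    obtain N where N: "\<And>m n. m \<ge> N \<Longrightarrow> n \<ge> N \<Longrightarrow> n2 M (\<lambda>x. F m x - F n x) < e / c"
      using Cauchy[of "e / c"] \<open>e > 0\<close> c by auto
    have "(\<integral>x. norm (F m x - F n x) \<partial>M) < e" if "m \<ge> N" "n \<ge> N" for m n
    proof -
      have "(\<integral>x. norm (F m x - F n x) \<partial>M) \<le> n2 M (\<lambda>x. F m x - F n x) * c"
        by (rule order_trans[OF L1 mult_left_mono]) (auto simp: c_def)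
      also have "\<dots> < e / c * c" using N[OF that] c by (intro mult_strict_right_mono)
      finally show ?thesis using c by simp
    qed
    then show "\<exists>N. \<forall>i\<ge>N. \<forall>j\<ge>N. (\<integral>x. norm (F i x - F j x) \<partial>M) < e" by blast
  qed
  have conv: "AE x in M. convergent (\<lambda>j. F (k j) x)" using k(2) by eventually_elim (rule Cauchy_convergent)
  define f where "f x = lim (\<lambda>j. F (k j) x)" for x
  have [measurable]: "f \<in> borel_measurable M" unfolding f_def by measurable
  have lim: "AE x in M. (\<lambda>j. F (k j) x) \<longlonglongrightarrow> f x" using conv by eventually_elim (simp add: f_def convergent_LIMSEQ_iff)
  have bound: "sq_int M (\<lambda>x. F n x - f x) \<and> n2 M (\<lambda>x. F n x - f x) \<le> e"
    if e: "e > 0" and N: "\<And>m. m \<ge> N \<Longrightarrow> n2 M (\<lambda>x. F n x - F m x) < e" for e n N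
  proof -
    have "(\<integral>\<^sup>+x. ennreal ((F n x - f x)\<^sup>2) \<partial>M) = (\<integral>\<^sup>+x. liminf (\<lambda>j. ennreal ((F n x - F (k j) x)\<^sup>2)) \<partial>M)"
    proof (rule nn_integral_cong_AE)
      show "AE x in M. ennreal ((F n x - f x)\<^sup>2) = liminf (\<lambda>j. ennreal ((F n x - F (k j) x)\<^sup>2))" using lim
      proof eventually_elim
        case (elim x)
        have "(\<lambda>j. ennreal ((F n x - F (k j) x)\<^sup>2)) \<longlonglongrightarrow> ennreal ((F n x - f x)\<^sup>2)"
          by (intro tendsto_ennrealI tendsto_intros elim)
        then show ?case by (rule lim_imp_Liminf[symmetric, rotated]) simp
      qed
    qed
    also have "\<dots> \<le> liminf (\<lambda>j. \<integral>\<^sup>+x. ennreal ((F n x - F (k j) x)\<^sup>2) \<partial>M)" by (rule nn_integral_liminf) measurable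
    also have "\<dots> \<le> liminf (\<lambda>j. ennreal (e\<^sup>2))"
    proof (rule Liminf_mono)
      show "\<forall>\<^sub>F j in sequentially. (\<integral>\<^sup>+x. ennreal ((F n x - F (k j) x)\<^sup>2) \<partial>M) \<le> ennreal (e\<^sup>2)"
        using eventually_ge_at_top[of N]
      proof eventually_elim
        case (elim j)
        have "n2 M (\<lambda>x. F n x - F (k j) x) < e" using N elim seq_suble[OF k(1), of j] by simp
        then have "(n2 M (\<lambda>x. F n x - F (k j) x))\<^sup>2 \<le> e\<^sup>2" by (intro power_mono) auto
        moreover have "integrable M (\<lambda>x. (F n x - F (k j) x)\<^sup>2)"
          using sq_int_diff[OF F F, of n "k j"] by (simp add: sq_int_def)
        ultimately show ?case by (simp add: nn_integral_eq_integral n2_sq ennreal_leI)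
      qed
    qed
    also have "\<dots> = ennreal (e\<^sup>2)" by (simp add: Liminf_const)
    finally have le: "(\<integral>\<^sup>+x. ennreal ((F n x - f x)\<^sup>2) \<partial>M) \<le> ennreal (e\<^sup>2)" .
    then have i: "integrable M (\<lambda>x. (F n x - f x)\<^sup>2)" by (intro integrableI_bounded) (auto intro: order_le_less_trans)
    then have "(n2 M (\<lambda>x. F n x - f x))\<^sup>2 \<le> e\<^sup>2" using le by (simp add: nn_integral_eq_integral n2_sq)
    then have "n2 M (\<lambda>x. F n x - f x) \<le> e" by (rule power2_le_imp_le) (use e in simp)
    then show ?thesis using i by (simp add: sq_int_def)
  qed
  obtain N0 where "\<And>m. m \<ge> N0 \<Longrightarrow> n2 M (\<lambda>x. F N0 x - F m x) < 1" using Cauchy[of 1] by auto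
  then have "sq_int M (\<lambda>x. F N0 x - f x)" using bound[of 1 N0 N0] by simp
  from sq_int_diff[OF F[of N0] this] have sqf: "sq_int M f" by simp
  have "(\<lambda>n. n2 M (\<lambda>x. F n x - f x)) \<longlonglongrightarrow> 0"
  proof (rule LIMSEQ_I)
    fix e :: real assume "e > 0"
    then obtain N where "\<And>m n. m \<ge> N \<Longrightarrow> n \<ge> N \<Longrightarrow> n2 M (\<lambda>x. F m x - F n x) < e / 2" using Cauchy[of "e / 2"] by auto
    then have "n2 M (\<lambda>x. F n x - f x) \<le> e / 2" if "n \<ge> N" for n using bound[of "e / 2" N n] that \<open>e > 0\<close> by simp
    then show "\<exists>no. \<forall>n\<ge>no. norm (n2 M (\<lambda>x. F n x - f x) - 0) < e" using \<open>e > 0\<close> by (intro exI[of _ N]) force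
  qed
  then show ?thesis using sqf by blast
qed

lemma second_difference:
  assumes f: "C1 f" "C1 (pd i f)" and s: "s > 0"
  shows "\<exists>a b. 0 < a \<and> a < s \<and> 0 < b \<and> b < s \<and>
    f (x + s *\<^sub>R axis i 1 + s *\<^sub>R axis j 1) - f (x + s *\<^sub>R axis i 1) - f (x + s *\<^sub>R axis j 1) + f x
      = s * (s * pd j (pd i f) (x + a *\<^sub>R axis i 1 + b *\<^sub>R axis j 1))"
proof -
  have ax: "(\<Sum>k\<in>UNIV. (axis i 1 :: pt) $ k * pd k g y) = pd i g y" for i g y by (simp add: sum_oth[of _ i] axis_def)
  define g where "g t = f ((x + s *\<^sub>R axis j 1) + t *\<^sub>R axis i 1) - f (x + t *\<^sub>R axis i 1)" for t
  have dg: "(g has_real_derivative pd i f ((x + s *\<^sub>R axis j 1) + t *\<^sub>R axis i 1) - pd i f (x + t *\<^sub>R axis i 1)) (at t)" for t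
    unfolding g_def
    using DERIV_diff[OF has_real_derivative_line[OF C1_diff'[OF f(1)], of "x + s *\<^sub>R axis j 1" "axis i 1" t]
        has_real_derivative_line[OF C1_diff'[OF f(1)], of x "axis i 1" t]] by (simp only: ax)
  have "\<exists>t>0. t < s \<and> g s - g 0 = (s - 0) * (pd i f ((x + s *\<^sub>R axis j 1) + t *\<^sub>R axis i 1) - pd i f (x + t *\<^sub>R axis i 1))"
    by (rule MVT2) (use s dg in auto)
  then obtain t where t: "0 < t" "t < s"
    "g s - g 0 = s * (pd i f ((x + s *\<^sub>R axis j 1) + t *\<^sub>R axis i 1) - pd i f (x + t *\<^sub>R axis i 1))" by auto
  define h where "h r = pd i f ((x + t *\<^sub>R axis i 1) + r *\<^sub>R axis j 1)" for r
  have dh: "(h has_real_derivative pd j (pd i f) ((x + t *\<^sub>R axis i 1) + r *\<^sub>R axis j 1)) (at r)" for r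
    unfolding h_def using has_real_derivative_line[OF C1_diff'[OF f(2)], of "x + t *\<^sub>R axis i 1" "axis j 1" r]
    by (simp only: ax)
  have "\<exists>r>0. r < s \<and> h s - h 0 = (s - 0) * pd j (pd i f) ((x + t *\<^sub>R axis i 1) + r *\<^sub>R axis j 1)"
    by (rule MVT2) (use s dh in auto)
  then obtain r where r: "0 < r" "r < s" "h s - h 0 = s * pd j (pd i f) ((x + t *\<^sub>R axis i 1) + r *\<^sub>R axis j 1)" by auto
  have "h s - h 0 = pd i f ((x + s *\<^sub>R axis j 1) + t *\<^sub>R axis i 1) - pd i f (x + t *\<^sub>R axis i 1)"
    by (simp add: h_def algebra_simps)
  then have "g s - g 0 = s * (s * pd j (pd i f) (x + t *\<^sub>R axis i 1 + r *\<^sub>R axis j 1))" using t(3) r(3) by simp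
  then show ?thesis using t r by (intro exI[of _ t] exI[of _ r]) (simp add: g_def algebra_simps)
qed

text \<open>Schwarz's theorem: both mixed derivatives are limits of the same symmetric second
  difference, in which the two directions enter alike.\<close>

lemma pd_commute:
  assumes f: "smooth_fun f"
  shows "pd i (pd j f) x = pd j (pd i f) x"
proof -
  have C: "C1 f" "C1 (pd i f)" "C1 (pd j f)" "C1 (pd i (pd j f))" "C1 (pd j (pd i f))"
    by (intro smooth_fun_C1 smooth_fun_pd f)+
  define s where "s n = 1 / real (Suc n)" for n
  have s: "s n > 0" for n by (simp add: s_def)
  have s0: "s \<longlonglongrightarrow> 0" unfolding s_def by (rule LIMSEQ_Suc) (rule lim_1_over_n)
  have lim: "\<exists>D. (\<lambda>n. D n) \<longlonglongrightarrow> pd j (pd i f) x \<and> (\<forall>n. f (x + s n *\<^sub>R axis i 1 + s n *\<^sub>R axis j 1) - f (x + s n *\<^sub>R axis i 1) - f (x + s n *\<^sub>R axis j 1) + f x = s n * (s n * D n))"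
    if C: "C1 f" "C1 (pd i f)" "C1 (pd j (pd i f))" for i j
  proof -
    have "\<forall>n. \<exists>a b. 0 < a \<and> a < s n \<and> 0 < b \<and> b < s n \<and>
      f (x + s n *\<^sub>R axis i 1 + s n *\<^sub>R axis j 1) - f (x + s n *\<^sub>R axis i 1) - f (x + s n *\<^sub>R axis j 1) + f x
        = s n * (s n * pd j (pd i f) (x + a *\<^sub>R axis i 1 + b *\<^sub>R axis j 1))"
      using second_difference[OF C(1,2) s] by blast
    then obtain a b where ab: "\<And>n. 0 < a n \<and> a n < s n \<and> 0 < b n \<and> b n < s n \<and>
      f (x + s n *\<^sub>R axis i 1 + s n *\<^sub>R axis j 1) - f (x + s n *\<^sub>R axis i 1) - f (x + s n *\<^sub>R axis j 1) + f x
        = s n * (s n * pd j (pd i f) (x + a n *\<^sub>R axis i 1 + b n *\<^sub>R axis j 1))" by metis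
    have a0: "a \<longlonglongrightarrow> 0" by (rule real_tendsto_sandwich[OF _ _ tendsto_const s0]) (use ab in \<open>auto intro!: always_eventually less_imp_le\<close>)
    have b0: "b \<longlonglongrightarrow> 0" by (rule real_tendsto_sandwich[OF _ _ tendsto_const s0]) (use ab in \<open>auto intro!: always_eventually less_imp_le\<close>)
    have "(\<lambda>n. x + a n *\<^sub>R axis i 1 + b n *\<^sub>R axis j 1) \<longlonglongrightarrow> x + 0 *\<^sub>R axis i 1 + 0 *\<^sub>R axis j 1"
      by (intro tendsto_intros a0 b0)
    then have "(\<lambda>n. x + a n *\<^sub>R axis i 1 + b n *\<^sub>R axis j 1) \<longlonglongrightarrow> x" by simp
    moreover have "isCont (pd j (pd i f)) x"
      using C1_continuous[OF C(3), of UNIV] by (simp add: continuous_on_eq_continuous_at)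
    ultimately have "(\<lambda>n. pd j (pd i f) (x + a n *\<^sub>R axis i 1 + b n *\<^sub>R axis j 1)) \<longlonglongrightarrow> pd j (pd i f) x"
      by (rule isCont_tendsto_compose[rotated])
    then show ?thesis using ab by blast
  qed
  obtain D where D: "(\<lambda>n. D n) \<longlonglongrightarrow> pd j (pd i f) x"
    "\<And>n. f (x + s n *\<^sub>R axis i 1 + s n *\<^sub>R axis j 1) - f (x + s n *\<^sub>R axis i 1) - f (x + s n *\<^sub>R axis j 1) + f x = s n * (s n * D n)"
    using lim[of i j] C by blast
  obtain D' where D': "(\<lambda>n. D' n) \<longlonglongrightarrow> pd i (pd j f) x"
    "\<And>n. f (x + s n *\<^sub>R axis j 1 + s n *\<^sub>R axis i 1) - f (x + s n *\<^sub>R axis j 1) - f (x + s n *\<^sub>R axis i 1) + f x = s n * (s n * D' n)"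
    using lim[of j i] C by blast
  have "D n = D' n" for n
  proof -
    have "s n * (s n * D n) = s n * (s n * D' n)"
      unfolding D(2)[symmetric] D'(2)[symmetric] by (simp add: algebra_simps)
    then show ?thesis using s[of n] by simp
  qed
  then have "D = D'" by auto
  then show ?thesis using D(1) D'(1) LIMSEQ_unique by blast
qed

section \<open>Gradient, divergence and curl of test fields\<close>

context conv_dom
begin

lemma integral_M_lborel:
  fixes f :: "pt \<Rightarrow> real"
  assumes "f \<in> borel_measurable borel" "\<And>x. x \<notin> \<Omega> \<Longrightarrow> f x = 0"
  shows "integral\<^sup>L M f = integral\<^sup>L lborel f"
proof -
  have "integral\<^sup>L M f = integral\<^sup>L lborel (\<lambda>x. indicator \<Omega> x * f x)"
    by (rule lebesgue_on_integral_lborel) (use assms open_dom in auto)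
  also have "(\<lambda>x. indicator \<Omega> x * f x) = f" using assms(2) by (auto simp: indicator_def fun_eq_iff)
  finally show ?thesis .
qed

lemma test_sq: "test_fun \<Omega> \<phi> \<Longrightarrow> sq_int M \<phi>" and test_sq_pd: "test_fun \<Omega> \<phi> \<Longrightarrow> sq_int M (pd i \<phi>)"
  by (auto intro: sq_int_C1 test_fun_C1 test_fun_pd)

lemma test_C1_parts:
  assumes "test_fun \<Omega> \<phi>" "C1 g"
  shows "(\<integral>x. g x * pd i \<phi> x \<partial>M) = - (\<integral>x. pd i g x * \<phi> x \<partial>M)"
proof -
  note \<phi> = test_fun_C1[OF assms(1)]
  have C: "C1 (\<lambda>x. g x * \<phi> x)" by (rule C1_mult[OF assms(2) \<phi>])
  have "bounded {x. g x * \<phi> x \<noteq> 0}" by (rule bounded_subset[OF test_fun_bounded_support[OF assms(1)]]) auto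
  from integral_pd_compact_support(1)[OF C this, of i]
  have "(\<integral>x. pd i g x * \<phi> x + g x * pd i \<phi> x \<partial>lborel) = 0" by (simp add: pd_mult[OF assms(2) \<phi>])
  moreover have "integral\<^sup>L M (\<lambda>x. pd i g x * \<phi> x + g x * pd i \<phi> x) = (\<integral>x. pd i g x * \<phi> x + g x * pd i \<phi> x \<partial>lborel)"
  proof (rule integral_M_lborel)
    show "(\<lambda>x. pd i g x * \<phi> x + g x * pd i \<phi> x) \<in> borel_measurable borel"
      by (intro borel_measurable_continuous_onI continuous_intros C1_continuous C1_continuous_pd assms(2) \<phi>)
    show "pd i g x * \<phi> x + g x * pd i \<phi> x = 0" if "x \<notin> \<Omega>" for x
      using test_fun_zero[OF assms(1) that] test_fun_zero[OF test_fun_pd[OF assms(1)] that] by simp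
  qed
  moreover have "integral\<^sup>L M (\<lambda>x. pd i g x * \<phi> x + g x * pd i \<phi> x)
      = (\<integral>x. pd i g x * \<phi> x \<partial>M) + (\<integral>x. g x * pd i \<phi> x \<partial>M)"
    by (intro Bochner_Integration.integral_add sq_int_integrable_mult sq_int_C1 sq_int_C1_pd assms(2) \<phi>)
  ultimately show ?thesis by simp
qed

lemma test_wderiv: "test_fun \<Omega> \<phi> \<Longrightarrow> is_wderiv \<Omega> i \<phi> (pd i \<phi>)"
  unfolding is_wderiv_def using test_C1_parts test_fun_C1 by blast

lemma test_pd_mean: "test_fun \<Omega> \<phi> \<Longrightarrow> (\<integral>x. pd i \<phi> x \<partial>M) = 0"
  using test_C1_parts[of \<phi> "\<lambda>x. 1" i] by (simp add: C1_const pd_const)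

text \<open>One integration by parts on each side leaves the two mixed second derivatives of
  \<open>b\<close>, which agree.\<close>

lemma test_cross:
  assumes a: "test_fun \<Omega> a" and b: "test_fun \<Omega> b"
  shows "(\<integral>x. pd i a x * pd j b x \<partial>M) = (\<integral>x. pd j a x * pd i b x \<partial>M)"
proof -
  have "pd i (pd j b) = pd j (pd i b)" using b pd_commute by (auto simp: test_fun_def)
  moreover have "(\<integral>x. pd i a x * pd j b x \<partial>M) = - (\<integral>x. a x * pd i (pd j b) x \<partial>M)"
    using test_C1_parts[OF a test_fun_C1[OF test_fun_pd[OF b]], of j i] by (simp add: mult.commute)
  moreover have "(\<integral>x. pd j a x * pd i b x \<partial>M) = - (\<integral>x. a x * pd j (pd i b) x \<partial>M)"
    using test_C1_parts[OF a test_fun_C1[OF test_fun_pd[OF b]], of i j] by (simp add: mult.commute)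
  ultimately show ?thesis by simp
qed

abbreviation vtest :: "(2 \<Rightarrow> pt \<Rightarrow> real) \<Rightarrow> bool" where
  "vtest v \<equiv> \<forall>j. test_fun \<Omega> (v j)"

definition gr :: "(2 \<Rightarrow> pt \<Rightarrow> real) \<Rightarrow> 2 \<times> 2 \<Rightarrow> pt \<Rightarrow> real" where
  "gr v p = pd (fst p) (v (snd p))"

definition dv :: "(2 \<Rightarrow> pt \<Rightarrow> real) \<Rightarrow> pt \<Rightarrow> real" where
  "dv v x = (\<Sum>i\<in>UNIV. pd i (v i) x)"

definition cl :: "(2 \<Rightarrow> pt \<Rightarrow> real) \<Rightarrow> pt \<Rightarrow> real" where
  "cl v x = pd 1 (v 2) x - pd 2 (v 1) x"

abbreviation gip where "gip F G \<equiv> ip (UNIV :: (2 \<times> 2) set) (\<lambda>_. M) F G"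
abbreviation gnm where "gnm F \<equiv> nm (UNIV :: (2 \<times> 2) set) (\<lambda>_. M) F"

lemma gr_sqs: "vtest v \<Longrightarrow> sqs UNIV (\<lambda>_. M) (gr v)" by (auto simp: sqs_def gr_def intro: test_sq_pd)

lemma dv_sq: "vtest v \<Longrightarrow> sq_int M (dv v)" unfolding dv_def by (intro sq_int_sum test_sq_pd) auto

lemma cl_sq: "vtest v \<Longrightarrow> sq_int M (cl v)" unfolding cl_def by (intro sq_int_diff test_sq_pd) auto

text \<open>Written out, the products of divergences and of curls contain mixed terms with opposite
  signs; \<open>test_cross\<close> makes them cancel, which uses that the fields vanish near the
  boundary.\<close>

lemma gip_gr:
  assumes "vtest v" "vtest w"
  shows "gip (gr v) (gr w) = (\<integral>x. dv v x * dv w x \<partial>M) + (\<integral>x. cl v x * cl w x \<partial>M)"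
proof -
  have i: "integrable M (\<lambda>x. pd i (v j) x * pd k (w l) x)" for i j k l
    by (intro sq_int_integrable_mult test_sq_pd) (use assms in auto)
  have U: "(UNIV :: (2 \<times> 2) set) = {(1,1), (1,2), (2,1), (2,2)}" by (auto simp: UNIV_2 simp flip: UNIV_Times_UNIV)
  have "(\<integral>x. dv v x * dv w x \<partial>M)
      = (\<integral>x. pd 1 (v 1) x * pd 1 (w 1) x + pd 1 (v 1) x * pd 2 (w 2) x + (pd 2 (v 2) x * pd 1 (w 1) x + pd 2 (v 2) x * pd 2 (w 2) x) \<partial>M)"
    by (intro Bochner_Integration.integral_cong) (auto simp: dv_def sum_2 algebra_simps)
  also have "\<dots> = (\<integral>x. pd 1 (v 1) x * pd 1 (w 1) x \<partial>M) + (\<integral>x. pd 1 (v 1) x * pd 2 (w 2) x \<partial>M)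
      + ((\<integral>x. pd 2 (v 2) x * pd 1 (w 1) x \<partial>M) + (\<integral>x. pd 2 (v 2) x * pd 2 (w 2) x \<partial>M))" using i by simp
  finally have D: "(\<integral>x. dv v x * dv w x \<partial>M) = \<dots>" .
  have "(\<integral>x. cl v x * cl w x \<partial>M)
      = (\<integral>x. pd 1 (v 2) x * pd 1 (w 2) x - pd 1 (v 2) x * pd 2 (w 1) x - (pd 2 (v 1) x * pd 1 (w 2) x - pd 2 (v 1) x * pd 2 (w 1) x) \<partial>M)"
    by (intro Bochner_Integration.integral_cong) (auto simp: cl_def algebra_simps)
  also have "\<dots> = (\<integral>x. pd 1 (v 2) x * pd 1 (w 2) x \<partial>M) - (\<integral>x. pd 1 (v 2) x * pd 2 (w 1) x \<partial>M)
      - ((\<integral>x. pd 2 (v 1) x * pd 1 (w 2) x \<partial>M) - (\<integral>x. pd 2 (v 1) x * pd 2 (w 1) x \<partial>M))" using i by simp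
  finally have C: "(\<integral>x. cl v x * cl w x \<partial>M) = \<dots>" .
  have x: "(\<integral>x. pd 1 (v 1) x * pd 2 (w 2) x \<partial>M) = (\<integral>x. pd 2 (v 1) x * pd 1 (w 2) x \<partial>M)"
    "(\<integral>x. pd 2 (v 2) x * pd 1 (w 1) x \<partial>M) = (\<integral>x. pd 1 (v 2) x * pd 2 (w 1) x \<partial>M)"
    using assms by (intro test_cross; simp)+
  show ?thesis unfolding D C x by (simp add: ip_def U gr_def)
qed

lemma vtest_lin: "vtest v \<Longrightarrow> vtest w \<Longrightarrow> vtest (\<lambda>j x. a * v j x + b * w j x)" by (auto intro: test_fun_lin)

lemma pd_lin: "test_fun \<Omega> \<phi> \<Longrightarrow> test_fun \<Omega> \<psi> \<Longrightarrow> pd i (\<lambda>x. a * \<phi> x + b * \<psi> x) x = a * pd i \<phi> x + b * pd i \<psi> x"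
  using test_fun_C1 by (simp add: pd_add C1_cmult pd_cmult)

lemma gr_lin: "vtest v \<Longrightarrow> vtest w \<Longrightarrow> gr (\<lambda>j x. a * v j x + b * w j x) = (\<lambda>p x. a * gr v p x + b * gr w p x)"
  and dv_lin: "vtest v \<Longrightarrow> vtest w \<Longrightarrow> dv (\<lambda>j x. a * v j x + b * w j x) = (\<lambda>x. a * dv v x + b * dv w x)"
  and cl_lin: "vtest v \<Longrightarrow> vtest w \<Longrightarrow> cl (\<lambda>j x. a * v j x + b * w j x) = (\<lambda>x. a * cl v x + b * cl w x)"
  by (auto simp: gr_def dv_def cl_def pd_lin sum_2 algebra_simps fun_eq_iff)

end

locale conv_poly = conv_dom +
  assumes poly: "convex_polygon \<Omega>"
begin

lemma x0_dom: "x0 \<in> \<Omega>" using ball_dom r_pos by auto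

text \<open>Tested with the mollification kernels, the weak Cauchy--Riemann equations become
  pointwise ones for the mollified functions, to which the Horgan--Payne inequality applies with
  \<open>- c\<close> as conjugate of \<open>g\<close>. The limit removes the mollification.\<close>

lemma conj_harmonic_bound:
  "\<exists>C\<ge>0. \<forall>g c. sq_int M g \<and> sq_int M c \<and> integral\<^sup>L M g = 0
     \<and> (\<forall>\<phi>. test_fun \<Omega> \<phi> \<longrightarrow> (\<integral>x. g x * pd 1 \<phi> x \<partial>M) = - (\<integral>x. c x * pd 2 \<phi> x \<partial>M)
          \<and> (\<integral>x. g x * pd 2 \<phi> x \<partial>M) = (\<integral>x. c x * pd 1 \<phi> x \<partial>M)) \<longrightarrow> n2 M g \<le> C * n2 M c"
proof -
  obtain C where C: "C \<ge> 0" "\<And>h g. C1 h \<Longrightarrow> C1 g \<Longrightarrow> (\<And>x. x \<in> \<Omega> \<Longrightarrow> pd 1 h x = pd 2 g x \<and> pd 2 h x = - pd 1 g x)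
      \<Longrightarrow> n2 M (\<lambda>x. h x - h x0) \<le> C * n2 M g" using Horgan_Payne[OF poly x0_dom] by blast
  have "n2 M g \<le> C * n2 M c"
    if g: "sq_int M g" and c: "sq_int M c" and mean: "integral\<^sup>L M g = 0"
      and cr: "\<And>\<phi>. test_fun \<Omega> \<phi> \<Longrightarrow> (\<integral>x. g x * pd 1 \<phi> x \<partial>M) = - (\<integral>x. c x * pd 2 \<phi> x \<partial>M)"
      "\<And>\<phi>. test_fun \<Omega> \<phi> \<Longrightarrow> (\<integral>x. g x * pd 2 \<phi> x \<partial>M) = (\<integral>x. c x * pd 1 \<phi> x \<partial>M)" for g c
  proof -
    interpret finite_measure M by (rule fin_M)
    have gi: "integrable M g" and ci: "integrable M c" using g c sq_int_integrable by auto
    have const: "sq_int M (\<lambda>x. \<kappa>)" for \<kappa> :: real by (rule sq_int_cont) (rule continuous_on_const)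
    have le: "n2 M g \<le> n2 M (\<lambda>x. moll (dn n) g x - g x) + C * n2 M (moll (dn n) c)" for n
    proof -
      let ?T = "moll (dn n)"
      note sT = moll_L2(1)[OF g dn(1,2), of n]
      have HP: "n2 M (\<lambda>x. ?T g x - ?T g x0) \<le> C * n2 M (\<lambda>x. - 1 * ?T c x)"
      proof (rule C(2))
        show "C1 (?T g)" by (rule moll_deriv(1)[OF gi dn(1,3)])
        show "C1 (\<lambda>x. - 1 * ?T c x)" by (intro C1_cmult moll_deriv(1)[OF ci dn(1,3)])
        fix x assume x: "x \<in> \<Omega>"
        have t: "test_fun \<Omega> (kern (dn n * r) (ctr (dn n) x))" by (rule kern_test[OF x dn(1,3)])
        show "pd 1 (?T g) x = pd 2 (\<lambda>x. - 1 * ?T c x) x \<and> pd 2 (?T g) x = - pd 1 (\<lambda>x. - 1 * ?T c x) x"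
          unfolding pd_cmult[OF moll_deriv(1)[OF ci dn(1,3)]] moll_deriv(2)[OF gi dn(1,3)] moll_deriv(2)[OF ci dn(1,3)]
            cr(1)[OF t] cr(2)[OF t] by simp
      qed
      define \<kappa> where "\<kappa> = ?T g x0"
      \<comment> \<open>A function of mean zero is at least as close to zero as to any other
        constant, so the unknown central value \<open>\<kappa>\<close> is harmless.\<close>
      have "(n2 M g)\<^sup>2 \<le> (n2 M (\<lambda>x. g x - \<kappa>))\<^sup>2"
      proof -
        have "(n2 M (\<lambda>x. g x - \<kappa>))\<^sup>2 = (\<integral>x. (g x)\<^sup>2 + \<kappa>\<^sup>2 - 2 * \<kappa> * g x \<partial>M)"
          unfolding n2_sq by (intro Bochner_Integration.integral_cong) (auto simp: power2_diff)
        also have "\<dots> = (\<integral>x. (g x)\<^sup>2 \<partial>M) + (\<integral>x. \<kappa>\<^sup>2 \<partial>M) - 2 * \<kappa> * integral\<^sup>L M g" using g gi by (simp add: sq_int_def)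
        finally show ?thesis using mean by (simp add: n2_sq)
      qed
      then have "n2 M g \<le> n2 M (\<lambda>x. g x - \<kappa>)" by (rule power2_le_imp_le) simp
      also have "\<dots> \<le> n2 M (\<lambda>x. g x - ?T g x) + n2 M (\<lambda>x. ?T g x - \<kappa>)" by (rule n2_triangle3[OF g sT const])
      also have "n2 M (\<lambda>x. g x - ?T g x) = n2 M (\<lambda>x. ?T g x - g x)" by (rule n2_minus_commute)
      also have "n2 M (\<lambda>x. ?T g x - \<kappa>) \<le> C * n2 M (?T c)" using HP unfolding n2_cmult \<kappa>_def by simp
      finally show ?thesis by simp
    qed
    have "(\<lambda>n. n2 M (\<lambda>x. moll (dn n) g x - g x) + C * n2 M (moll (dn n) c)) \<longlonglongrightarrow> 0 + C * n2 M c"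
      by (intro tendsto_intros moll_tendsto g n2_tendsto[OF _ c moll_tendsto[OF c]] moll_L2(1)[OF c dn(1,2)])
    from LIMSEQ_le_const[OF this] le show ?thesis by auto
  qed
  then show ?thesis using C(1) by (intro exI[of _ C]) blast
qed

text \<open>The velocity field minimising \<open>|v|\<^sub>1\<^sup>2 / 2 - (p, div v)\<close> has
  \<open>p - div v\<close> and \<open>curl v\<close> as conjugate harmonic functions, because
  \<open>|v|\<^sub>1\<^sup>2 = |div v|\<^sup>2 + |curl v|\<^sup>2\<close>; hence \<open>p\<close> is controlled by \<open>|v|\<^sub>1\<close>.\<close>

theorem inf_sup:
  "\<exists>K\<ge>0. \<forall>p S. sq_int M p \<and> integral\<^sup>L M p = 0 \<and> S \<ge> 0
     \<and> (\<forall>v. vtest v \<longrightarrow> \<bar>\<integral>x. p x * dv v x \<partial>M\<bar> \<le> S * gnm (gr v)) \<longrightarrow> n2 M p \<le> K * S"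
proof -
  obtain C where C: "C \<ge> 0" "\<And>g c. sq_int M g \<Longrightarrow> sq_int M c \<Longrightarrow> integral\<^sup>L M g = 0
     \<Longrightarrow> (\<And>\<phi>. test_fun \<Omega> \<phi> \<Longrightarrow> (\<integral>x. g x * pd 1 \<phi> x \<partial>M) = - (\<integral>x. c x * pd 2 \<phi> x \<partial>M)
          \<and> (\<integral>x. g x * pd 2 \<phi> x \<partial>M) = (\<integral>x. c x * pd 1 \<phi> x \<partial>M)) \<Longrightarrow> n2 M g \<le> C * n2 M c"
    using conj_harmonic_bound by blast
  have "n2 M p \<le> (2 * C + 2) * S"
    if p: "sq_int M p" and mean: "integral\<^sup>L M p = 0" and S: "S \<ge> 0"
      and bd: "\<And>v. vtest v \<Longrightarrow> \<bar>\<integral>x. p x * dv v x \<partial>M\<bar> \<le> S * gnm (gr v)" for p S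
  proof -
    interpret finite_measure M by (rule fin_M)
    \<comment> \<open>Twice the functional to be minimised; the hypothesis on \<open>p\<close>
      bounds it below by \<open>- S^2\<close>.\<close>
    define J where "J v = (gnm (gr v))\<^sup>2 - 2 * (\<integral>x. p x * dv v x \<partial>M)" for v
    have Jlow: "- S\<^sup>2 \<le> J v" if "vtest v" for v
    proof -
      have "0 \<le> (gnm (gr v) - S)\<^sup>2" by simp
      moreover have "(\<integral>x. p x * dv v x \<partial>M) \<le> S * gnm (gr v)" using bd[OF that] by (simp add: abs_le_iff)
      ultimately show ?thesis by (simp add: J_def power2_diff algebra_simps)
    qed
    define V where "V = {v. vtest v}"
    have V0: "(\<lambda>j x. 0) \<in> V" by (simp add: V_def test_fun_0)
    define I where "I = (INF v\<in>V. J v)"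
    have bb: "bdd_below (J ` V)" using Jlow by (intro bdd_belowI[of _ "- S\<^sup>2"]) (auto simp: V_def)
    have Ile: "I \<le> J v" if "vtest v" for v unfolding I_def by (rule cINF_lower[OF bb]) (use that in \<open>simp add: V_def\<close>)
    define e where "e n = 1 / real (Suc n)" for n
    have e: "e n > 0" for n by (simp add: e_def)
    have e0: "e \<longlonglongrightarrow> 0" unfolding e_def by (rule LIMSEQ_Suc) (rule lim_1_over_n)
    have "\<forall>n. \<exists>v. vtest v \<and> J v < I + e n"
    proof
      fix n
      have "Inf (J ` V) < I + e n" using e[of n] by (simp add: I_def)
      then obtain y where "y \<in> J ` V" "y < I + e n" using V0 by (metis cInf_lessD empty_iff image_is_empty)
      then show "\<exists>v. vtest v \<and> J v < I + e n" by (auto simp: V_def)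
    qed
    then obtain v where v: "\<And>n. vtest (v n)" "\<And>n. J (v n) < I + e n" by metis
    have comb: "J (\<lambda>j x. a * w j x + b * z j x) = a\<^sup>2 * (gnm (gr w))\<^sup>2 + 2 * a * b * gip (gr w) (gr z) + b\<^sup>2 * (gnm (gr z))\<^sup>2
        - 2 * (a * (\<integral>x. p x * dv w x \<partial>M) + b * (\<integral>x. p x * dv z x \<partial>M))" if w: "vtest w" and z: "vtest z" for a b w z
    proof -
      note s = gr_sqs[OF w] gr_sqs[OF z]
      have "gip (\<lambda>p x. a * gr w p x + b * gr z p x) (\<lambda>p x. a * gr w p x + b * gr z p x)
          = a\<^sup>2 * gip (gr w) (gr w) + 2 * a * b * gip (gr w) (gr z) + b\<^sup>2 * gip (gr z) (gr z)"
        using ip_add_self[OF sqs_cmult[OF s(1), of a] s(2), of b]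
        by (simp only: ip_cmult_left ip_cmult_right) (simp add: power2_eq_square mult_ac)
      moreover have "(\<integral>x. p x * (a * dv w x + b * dv z x) \<partial>M) = a * (\<integral>x. p x * dv w x \<partial>M) + b * (\<integral>x. p x * dv z x \<partial>M)"
      proof -
        have "(\<integral>x. p x * (a * dv w x + b * dv z x) \<partial>M) = (\<integral>x. a * (p x * dv w x) + b * (p x * dv z x) \<partial>M)"
          by (simp add: algebra_simps)
        then show ?thesis using sq_int_integrable_mult[OF p dv_sq[OF w]] sq_int_integrable_mult[OF p dv_sq[OF z]] by simp
      qed
      ultimately show ?thesis unfolding J_def gr_lin[OF w z] dv_lin[OF w z] nm_sq by simp
    qed
    define D where "D n = dv (v n)" for n
    define R where "R n = cl (v n)" for n
    have Dsq: "sq_int M (D n)" and Rsq: "sq_int M (R n)" for n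
      unfolding D_def R_def by (rule dv_sq[OF v(1)], rule cl_sq[OF v(1)])
    \<comment> \<open>The parallelogram identity at the midpoint of two members of the minimising
      sequence. It makes divergences and curls Cauchy sequences; the argument continues with these
      two limits and does not construct a limit velocity.\<close>
    have split: "(n2 M (\<lambda>x. D n x - D k x))\<^sup>2 + (n2 M (\<lambda>x. R n x - R k x))\<^sup>2 \<le> 2 * (e n + e k)" for n k
    proof -
      let ?w = "\<lambda>j x. 1 * v n j x + (- 1) * v k j x"
      let ?m = "\<lambda>j x. (1/2) * v n j x + (1/2) * v k j x"
      have w: "vtest ?w" and m: "vtest ?m" by (rule vtest_lin[OF v(1) v(1)])+
      have dc: "dv ?w = (\<lambda>x. D n x - D k x)" "cl ?w = (\<lambda>x. R n x - R k x)"
        unfolding dv_lin[OF v(1) v(1)] cl_lin[OF v(1) v(1)] D_def R_def by auto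
      have "gip (gr ?w) (gr ?w) = (n2 M (\<lambda>x. D n x - D k x))\<^sup>2 + (n2 M (\<lambda>x. R n x - R k x))\<^sup>2"
        unfolding gip_gr[OF w w] n2_sq dc by (simp add: power2_eq_square)
      moreover have "gip (gr ?w) (gr ?w) = (gnm (gr (v n)))\<^sup>2 - 2 * gip (gr (v n)) (gr (v k)) + (gnm (gr (v k)))\<^sup>2"
        using ip_add_self[OF gr_sqs[OF v(1)[of n]] gr_sqs[OF v(1)[of k]], of "-1"]
        unfolding gr_lin[OF v(1) v(1)] nm_sq by simp
      moreover have "I \<le> J ?m" by (rule Ile[OF m])
      moreover have "4 * J ?m = (gnm (gr (v n)))\<^sup>2 + 2 * gip (gr (v n)) (gr (v k)) + (gnm (gr (v k)))\<^sup>2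
          - 4 * ((\<integral>x. p x * dv (v n) x \<partial>M) + (\<integral>x. p x * dv (v k) x \<partial>M))"
        unfolding comb[OF v(1) v(1)] by (simp add: power2_eq_square)
      ultimately show ?thesis using v(2)[of n] v(2)[of k] J_def[of "v n"] J_def[of "v k"] by (simp only: distrib_left)
    qed
    have cauchy: "\<exists>N. \<forall>m\<ge>N. \<forall>n\<ge>N. n2 M (\<lambda>x. F m x - F n x) < \<epsilon>"
      if "\<epsilon> > 0" "\<And>m n. (n2 M (\<lambda>x. F m x - F n x))\<^sup>2 \<le> 2 * (e m + e n)" for \<epsilon> and F :: "nat \<Rightarrow> pt \<Rightarrow> real"
    proof -
      have "\<forall>\<^sub>F n in sequentially. e n < \<epsilon>\<^sup>2 / 4" using \<open>\<epsilon> > 0\<close> by (intro order_tendstoD(2)[OF e0]) simp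
      then obtain N where N: "\<And>n. n \<ge> N \<Longrightarrow> e n < \<epsilon>\<^sup>2 / 4" by (auto simp: eventually_sequentially)
      have "n2 M (\<lambda>x. F m x - F n x) < \<epsilon>" if "m \<ge> N" "n \<ge> N" for m n
      proof (rule power2_less_imp_less)
        show "(n2 M (\<lambda>x. F m x - F n x))\<^sup>2 < \<epsilon>\<^sup>2"
        proof -
          have "2 * (e m + e n) < \<epsilon>\<^sup>2" using add_strict_mono[OF N[OF that(1)] N[OF that(2)]] \<open>\<epsilon> > 0\<close>
            by (simp add: field_simps)
          with \<open>\<And>m n. (n2 M (\<lambda>x. F m x - F n x))\<^sup>2 \<le> 2 * (e m + e n)\<close> show ?thesis by (rule order_le_less_trans)
        qed
      qed (use \<open>\<epsilon> > 0\<close> in simp)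
      then show ?thesis by blast
    qed
    have spD: "(n2 M (\<lambda>x. D m x - D n x))\<^sup>2 \<le> 2 * (e m + e n)" and spR: "(n2 M (\<lambda>x. R m x - R n x))\<^sup>2 \<le> 2 * (e m + e n)" for m n
      using split[of m n] zero_le_power2[of "n2 M (\<lambda>x. D m x - D n x)"] zero_le_power2[of "n2 M (\<lambda>x. R m x - R n x)"] by linarith+
    obtain d where d: "sq_int M d" "(\<lambda>n. n2 M (\<lambda>x. D n x - d x)) \<longlonglongrightarrow> 0"
      using L2_complete[OF fin_M Dsq cauchy[OF _ spD]] by blast
    obtain c where c: "sq_int M c" "(\<lambda>n. n2 M (\<lambda>x. R n x - c x)) \<longlonglongrightarrow> 0"
      using L2_complete[OF fin_M Rsq cauchy[OF _ spR]] by blast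
    \<comment> \<open>Perturbing \<open>v n\<close> by a multiple of \<open>w\<close> gives a
      quadratic that is nonnegative up to the gap \<open>e n\<close>; its discriminant bounds the
      defect of the Euler--Lagrange equation by \<open>sqrt (e n)\<close> times the norm of
      \<open>gr w\<close>.\<close>
    have euler: "(\<integral>x. d x * dv w x \<partial>M) + (\<integral>x. c x * cl w x \<partial>M) = (\<integral>x. p x * dv w x \<partial>M)" if w: "vtest w" for w
    proof -
      define b where "b n = gip (gr (v n)) (gr w) - (\<integral>x. p x * dv w x \<partial>M)" for n
      have "(b n)\<^sup>2 \<le> e n * (gnm (gr w))\<^sup>2" for n
      proof (rule quadratic_nonneg_discr)
        fix t
        have "I \<le> J (\<lambda>j x. 1 * v n j x + t * w j x)" by (rule Ile[OF vtest_lin[OF v(1) w]])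
        then have "I \<le> J (v n) + 2 * t * b n + t\<^sup>2 * (gnm (gr w))\<^sup>2"
          unfolding comb[OF v(1) w] J_def b_def by (simp add: algebra_simps)
        then show "0 \<le> e n + 2 * t * b n + t\<^sup>2 * (gnm (gr w))\<^sup>2" using v(2)[of n] by linarith
      qed simp
      then have "(\<lambda>n. (b n)\<^sup>2) \<longlonglongrightarrow> 0"
        by (intro real_tendsto_sandwich[OF _ _ tendsto_const tendsto_mult_left_zero[OF e0]])
          (auto intro!: always_eventually)
      then have "(\<lambda>n. sqrt ((b n)\<^sup>2)) \<longlonglongrightarrow> sqrt 0" by (rule tendsto_real_sqrt)
      then have "b \<longlonglongrightarrow> 0" using tendsto_rabs_zero_cancel[of b] by simp
      moreover have "b \<longlonglongrightarrow> (\<integral>x. d x * dv w x \<partial>M) + (\<integral>x. c x * cl w x \<partial>M) - (\<integral>x. p x * dv w x \<partial>M)"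
        unfolding b_def gip_gr[OF v(1) w] D_def[symmetric] R_def[symmetric]
        by (intro tendsto_intros integral_n2_tendsto[OF Dsq d(1) dv_sq[OF w] d(2)] integral_n2_tendsto[OF Rsq c(1) cl_sq[OF w] c(2)])
      ultimately show ?thesis using LIMSEQ_unique by fastforce
    qed
    define g where "g x = p x - d x" for x
    have g: "sq_int M g" unfolding g_def by (rule sq_int_diff[OF p d(1)])
    have one: "sq_int M (\<lambda>x. 1)" by (rule sq_int_cont) (rule continuous_on_const)
    have "(\<integral>x. D n x * 1 \<partial>M) = 0" for n
    proof -
      have "integrable M (pd i (v n i))" for i using sq_int_integrable[OF test_sq_pd] v(1) by blast
      then show ?thesis using test_pd_mean v(1) by (simp add: D_def dv_def sum_2)
    qed
    then have d0: "integral\<^sup>L M d = 0" using integral_n2_tendsto[OF Dsq d(1) one d(2)] by (simp add: LIMSEQ_const_iff)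
    have gmean: "integral\<^sup>L M g = 0" unfolding g_def using sq_int_integrable p d(1) mean d0 by simp
    have gle: "n2 M g \<le> C * n2 M c"
    proof (rule C(2)[OF g c(1) gmean])
      fix \<phi> assume \<phi>: "test_fun \<Omega> \<phi>"
      \<comment> \<open>Fields with a single nonzero component turn the Euler--Lagrange equation
        into the weak Cauchy--Riemann equations for \<open>p - d\<close> and
        \<open>c\<close>.\<close>
      have fld: "vtest (\<lambda>j. if j = k then \<phi> else (\<lambda>x. 0))" for k using \<phi> test_fun_0 by auto
      have gd: "(\<integral>x. g x * q x \<partial>M) = (\<integral>x. p x * q x \<partial>M) - (\<integral>x. d x * q x \<partial>M)" if "sq_int M q" for q
        unfolding g_def using sq_int_integrable_mult[OF p that] sq_int_integrable_mult[OF d(1) that]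
        by (simp add: left_diff_distrib)
      have E1: "dv (\<lambda>j. if j = 1 then \<phi> else (\<lambda>x. 0)) = pd 1 \<phi>" "cl (\<lambda>j. if j = 1 then \<phi> else (\<lambda>x. 0)) = (\<lambda>x. - pd 2 \<phi> x)"
        "dv (\<lambda>j. if j = 2 then \<phi> else (\<lambda>x. 0)) = pd 2 \<phi>" "cl (\<lambda>j. if j = 2 then \<phi> else (\<lambda>x. 0)) = pd 1 \<phi>"
        by (auto simp: dv_def cl_def sum_2 pd_const)
      show "(\<integral>x. g x * pd 1 \<phi> x \<partial>M) = - (\<integral>x. c x * pd 2 \<phi> x \<partial>M)
          \<and> (\<integral>x. g x * pd 2 \<phi> x \<partial>M) = (\<integral>x. c x * pd 1 \<phi> x \<partial>M)"
        using euler[OF fld[of 1]] euler[OF fld[of 2]] gd[OF test_sq_pd[OF \<phi>, of 1]] gd[OF test_sq_pd[OF \<phi>, of 2]]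
        unfolding E1 by simp
    qed
    have small: "n2 M (D n) \<le> 2 * S + sqrt (e n) \<and> n2 M (R n) \<le> 2 * S + sqrt (e n)" for n
    proof -
      define E where "E = gnm (gr (v n))"
      have E0: "E \<ge> 0" by (simp add: E_def)
      \<comment> \<open>The zero field shows \<open>I \<le> 0\<close>, hence
        \<open>E^2 - 2 S E < e n\<close>. Solving this quadratic inequality bounds \<open>E\<close>
        by \<open>2 S\<close> up to a vanishing term.\<close>
      have "J (\<lambda>j x. 0 * v n j x + 0 * v n j x) = 0" unfolding comb[OF v(1) v(1)] by simp
      then have "I \<le> 0" using Ile[OF vtest_lin[OF v(1)[of n] v(1)[of n], of 0 0]] by simp
      then have q: "E\<^sup>2 - 2 * (S * E) < e n" using v(2)[of n] bd[OF v(1)[of n]] by (simp add: J_def E_def abs_le_iff)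
      have E: "E \<le> 2 * S + sqrt (e n)"
      proof (rule ccontr)
        assume "\<not> ?thesis"
        then have "sqrt (e n) * sqrt (e n) \<le> E * (E - 2 * S)" using S e[of n] E0 by (intro mult_mono) auto
        then show False using q e[of n] by (simp add: power2_eq_square algebra_simps)
      qed
      have E2: "E\<^sup>2 = (n2 M (D n))\<^sup>2 + (n2 M (R n))\<^sup>2"
        unfolding E_def nm_sq gip_gr[OF v(1) v(1)] n2_sq D_def R_def by (simp add: power2_eq_square)
      have "n2 M (D n) \<le> E" "n2 M (R n) \<le> E"
        using power2_le_imp_le[OF _ E0, of "n2 M (D n)"] power2_le_imp_le[OF _ E0, of "n2 M (R n)"]
          zero_le_power2[of "n2 M (D n)"] zero_le_power2[of "n2 M (R n)"] E2 by linarith+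
      then show ?thesis using E by simp
    qed
    have lim: "(\<lambda>n. 2 * S + sqrt (e n)) \<longlonglongrightarrow> 2 * S + sqrt 0" by (intro tendsto_intros e0)
    have "n2 M d \<le> 2 * S + sqrt 0" by (rule LIMSEQ_le[OF n2_tendsto[OF Dsq d] lim]) (use small in auto)
    moreover have "n2 M c \<le> 2 * S + sqrt 0" by (rule LIMSEQ_le[OF n2_tendsto[OF Rsq c] lim]) (use small in auto)
    moreover have "n2 M p \<le> n2 M g + n2 M d" using n2_triangle[OF g d(1)] by (simp add: g_def)
    ultimately have "n2 M p \<le> C * (2 * S) + 2 * S" using gle C(1) mult_left_mono[of "n2 M c" "2 * S" C] by simp
    then show ?thesis by (simp add: algebra_simps)
  qed
  then show ?thesis using C(1) by (intro exI[of _ "2 * C + 2"]) auto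
qed

end

section \<open>Triangles\<close>

definition cr :: "pt \<Rightarrow> pt \<Rightarrow> real" where "cr u v = u $ 1 * v $ 2 - u $ 2 * v $ 1"

text \<open>Clockwise rotation by a right angle: it takes an edge vector of a counterclockwise
  triangle to the outward normal scaled by the edge length.\<close>

definition rot :: "pt \<Rightarrow> pt" where "rot u = vector [u $ 2, - u $ 1]"

lemma rot_nth [simp]: "rot u $ 1 = u $ 2" "rot u $ 2 = - u $ 1" by (simp_all add: rot_def)

lemma pt_eq_iff: "(x::pt) = y \<longleftrightarrow> x $ 1 = y $ 1 \<and> x $ 2 = y $ 2" by (simp add: vec_eq_iff forall_2)

lemma rot_inner: "rot u \<bullet> v = - cr u v" by (simp add: inner_pt cr_def)

lemma norm_rot [simp]: "norm (rot u) = norm u" by (simp add: norm_eq_sqrt_inner inner_pt)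

lemma cr_self [simp]: "cr u u = 0" by (simp add: cr_def)

lemma cr_scale [simp]: "cr (s *\<^sub>R u) v = s * cr u v" "cr u (s *\<^sub>R v) = s * cr u v" "cr 0 v = 0" "cr u 0 = 0"
  by (simp_all add: cr_def algebra_simps)

lemma cr_swap: "cr u v = - cr v u" by (simp add: cr_def)

lemma cr_cyc: "cr (c - b) (a - b) = cr (b - a) (c - a)" for a b c :: pt by (simp add: cr_def algebra_simps)

lemma cr_basis:
  assumes "cr u v \<noteq> 0" "w \<bullet> u = 0" "w \<bullet> v = 0" shows "w = 0"
proof -
  have "w $ 1 * cr u v = (w \<bullet> u) * v $ 2 - (w \<bullet> v) * u $ 2" "w $ 2 * cr u v = (w \<bullet> v) * u $ 1 - (w \<bullet> u) * v $ 1"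
    by (simp_all add: inner_pt cr_def algebra_simps)
  then show ?thesis using assms by (simp add: pt_eq_iff)
qed

lemma cr_collinear: "cr (b - a) (c - a) = 0 \<Longrightarrow> collinear {a, b, c}"
proof (cases "b = a")
  case False
  assume z: "cr (b - a) (c - a) = 0"
  define p q where "p = b - a" and "q = c - a"
  have pq: "p $ 1 * q $ 2 = p $ 2 * q $ 1" "p $ 1 \<noteq> 0 \<or> p $ 2 \<noteq> 0"
    using z False by (auto simp: cr_def p_def q_def pt_eq_iff)
  then have "q = (q $ 1 / p $ 1) *\<^sub>R p \<or> q = (q $ 2 / p $ 2) *\<^sub>R p"
    by (cases "p $ 1 = 0") (auto simp: pt_eq_iff field_simps)
  then obtain u where "c - a = u *\<^sub>R (b - a)" unfolding p_def q_def by blast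
  then have "c = u *\<^sub>R b + (1 - u) *\<^sub>R a" by (simp add: algebra_simps)
  then have "collinear {b, c, a}" by (auto simp: collinear_3_expand)
  then show ?thesis by (simp add: insert_commute)
qed (simp add: collinear_2)

lemma collinear_cr: "collinear {a, b, c} \<Longrightarrow> cr (b - a) (c - a) = 0"
proof -
  assume "collinear {a, b, c}"
  then consider "a = c" | u where "b = u *\<^sub>R a + (1 - u) *\<^sub>R c" by (auto simp: collinear_3_expand)
  then show ?thesis
  proof cases
    case (2 u)
    then have "b - a = (1 - u) *\<^sub>R (c - a)" by (simp add: algebra_simps)
    then show ?thesis by simp
  qed simp
qed

text \<open>Every triangle is treated with its vertices in counterclockwise order.\<close>

definition ccw :: "pt set \<Rightarrow> pt \<Rightarrow> pt \<Rightarrow> pt \<Rightarrow> bool" where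
  "ccw K a b c \<longleftrightarrow> K = convex hull {a, b, c} \<and> cr (b - a) (c - a) > 0"

lemma is_triangle_ccw: "is_triangle K \<Longrightarrow> \<exists>a b c. ccw K a b c"
proof -
  assume "is_triangle K"
  then obtain a b c where abc: "\<not> collinear {a, b, c}" "K = convex hull {a, b, c}" by (auto simp: is_triangle_def)
  then have "cr (b - a) (c - a) \<noteq> 0" using cr_collinear by blast
  then consider "cr (b - a) (c - a) > 0" | "cr (c - a) (b - a) > 0" using cr_swap[of "b - a" "c - a"] by linarith
  then show ?thesis
  proof cases
    case 1 then show ?thesis using abc by (auto simp: ccw_def)
  next
    case 2
    then have "ccw K a c b" using abc by (simp add: ccw_def insert_commute)
    then show ?thesis by blast
  qed
qed

lemma ccw_cyc: "ccw K a b c \<Longrightarrow> ccw K b c a" by (simp add: ccw_def cr_cyc insert_commute)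

lemma ccw_distinct: "ccw K a b c \<Longrightarrow> a \<noteq> b \<and> b \<noteq> c \<and> a \<noteq> c" by (auto simp: ccw_def)

lemma ccw_verts:
  assumes "ccw K a b c" shows "tri_verts K = {a, b, c}"
proof -
  have "\<not> collinear {a, b, c}" using assms collinear_cr unfolding ccw_def by force
  then have "\<not> affine_dependent {a, b, c}" using affine_dependent_imp_collinear_3 by blast
  then have "x extreme_point_of (convex hull {a, b, c}) \<longleftrightarrow> x \<in> {a, b, c}" for x
    by (rule extreme_point_of_convex_hull_affine_independent)
  then show ?thesis using assms by (auto simp: tri_verts_def ccw_def)
qed

lemma ccw_edges:
  assumes "ccw K a b c"
  shows "tri_edges K = {closed_segment a b, closed_segment b c, closed_segment c a}"
  unfolding tri_edges_def ccw_verts[OF assms] using ccw_distinct[OF assms] by (auto simp: closed_segment_commute)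

lemma ccw_edges_distinct:
  assumes "ccw K a b c"
  shows "closed_segment a b \<noteq> closed_segment b c" "closed_segment b c \<noteq> closed_segment c a" "closed_segment a b \<noteq> closed_segment c a"
  using ccw_distinct[OF assms] by (auto simp: closed_segment_eq doubleton_eq_iff)

lemma ccw_edge_cases:
  assumes "ccw K a b c" "e \<in> tri_edges K"
  obtains p q r where "ccw K p q r" "e = closed_segment p q"
  using assms(2) ccw_edges[OF assms(1)] ccw_cyc[OF assms(1)] ccw_cyc[OF ccw_cyc[OF assms(1)]] assms(1) by auto

text \<open>For integrands that are not integrable both sides are zero by convention, so every
  \<open>g\<close> is covered. The reflection makes edge integrals independent of the orientation
  that \<open>edge_int\<close> happens to choose.\<close>

lemma integral_reflect_01: "integral {0..1} (\<lambda>t. g (1 - t)) = integral {0..1} (g :: real \<Rightarrow> real)"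
proof -
  have *: "(f has_integral I) {0..1} \<Longrightarrow> ((\<lambda>t. f (1 - t)) has_integral I) {0..1}" for f :: "real \<Rightarrow> real" and I
    using has_integral_affinity'[of f I 0 1 "-1" 1] has_integral_affinity[of f I 0 1 "-1" 1] by (simp add: image_affinity_atLeastAtMost)
  show ?thesis
  proof (cases "g integrable_on {0..1}")
    case True
    then have "(g has_integral integral {0..1} g) {0..1}" by (rule integrable_integral)
    then show ?thesis using * by (intro integral_unique) blast
  next
    case False
    have "\<not> (\<lambda>t. g (1 - t)) integrable_on {0..1}"
    proof
      assume "(\<lambda>t. g (1 - t)) integrable_on {0..1}"
      then obtain I where "((\<lambda>t. g (1 - t)) has_integral I) {0..1}" by (auto simp: integrable_on_def)
      from *[OF this] have "g integrable_on {0..1}" by (auto simp: integrable_on_def)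
      then show False using False by simp
    qed
    then show ?thesis using False by (simp add: not_integrable_integral)
  qed
qed

section \<open>Edge integrals and normals\<close>

definition sg01 :: "pt \<Rightarrow> pt \<Rightarrow> real \<Rightarrow> pt" where "sg01 p q t = (1 - t) *\<^sub>R p + t *\<^sub>R q"

lemma sg01_in: "0 \<le> t \<Longrightarrow> t \<le> 1 \<Longrightarrow> sg01 p q t \<in> closed_segment p q" by (auto simp: sg01_def closed_segment_def)

lemma sg01_cont [continuous_intros]: "continuous_on S (sg01 p q)" unfolding sg01_def by (intro continuous_intros)

lemma edge_int_segment:
  assumes "p \<noteq> q"
  shows "edge_int (closed_segment p q) g = dist p q * integral {0..1} (\<lambda>t. g (sg01 p q t))"
proof -
  define ab where "ab = (SOME (a, b). a \<noteq> b \<and> closed_segment p q = closed_segment a b)"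
  have "case ab of (a, b) \<Rightarrow> a \<noteq> b \<and> closed_segment p q = closed_segment a b"
    unfolding ab_def by (rule someI[where x="(p, q)"]) (use assms in auto)
  then have "{fst ab, snd ab} = {p, q}" by (auto simp: closed_segment_eq case_prod_unfold)
  then consider "fst ab = p" "snd ab = q" | "fst ab = q" "snd ab = p" by (auto simp: doubleton_eq_iff)
  then show ?thesis
  proof cases
    case 1 then show ?thesis unfolding edge_int_def Let_def ab_def[symmetric] by (simp add: sg01_def)
  next
    case 2
    have "integral {0..1} (\<lambda>t. g (sg01 p q (1 - t))) = integral {0..1} (\<lambda>t. g (sg01 p q t))"
      by (rule integral_reflect_01[of "\<lambda>t. g (sg01 p q t)"])
    moreover have "sg01 p q (1 - t) = sg01 q p t" for t by (simp add: sg01_def add.commute)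
    ultimately show ?thesis using 2 unfolding edge_int_def Let_def ab_def[symmetric]
      by (simp add: sg01_def[symmetric] dist_commute)
  qed
qed

lemma ccw_halfplane:
  assumes "ccw K p q r" "x \<in> K" shows "cr (q - p) (x - p) \<ge> 0"
proof -
  have "K \<subseteq> {x. cr (q - p) (x - p) \<ge> 0}"
  proof -
    have "{x. cr (q - p) (x - p) \<ge> 0} = {x. rot (q - p) \<bullet> x \<le> rot (q - p) \<bullet> p}"
      by (auto simp: inner_pt cr_def algebra_simps)
    then have "convex {x. cr (q - p) (x - p) \<ge> 0}" by (simp add: convex_halfspace_le)
    moreover have "{p, q, r} \<subseteq> {x. cr (q - p) (x - p) \<ge> 0}" using assms(1) by (simp add: ccw_def)
    ultimately have "convex hull {p, q, r} \<subseteq> {x. cr (q - p) (x - p) \<ge> 0}" by (rule hull_minimal[rotated])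
    then show ?thesis using assms(1) by (simp add: ccw_def)
  qed
  then show ?thesis using assms(2) by auto
qed

lemma segment_minus: "x \<in> closed_segment p q \<Longrightarrow> \<exists>t. x - p = t *\<^sub>R (q - p)"
proof -
  assume "x \<in> closed_segment p q"
  then obtain u where "x = (1 - u) *\<^sub>R p + u *\<^sub>R q" by (auto simp: closed_segment_def)
  then have "x - p = u *\<^sub>R (q - p)" by (simp add: algebra_simps)
  then show ?thesis by blast
qed

text \<open>Orthogonality to the edge leaves a multiple of \<open>rot (q - p)\<close>, the norm
  fixes its size and the third vertex its sign, so the choice in \<open>outer_normal\<close> has
  exactly one candidate.\<close>

lemma outer_normal_eq:
  assumes "ccw K p q r"
  shows "outer_normal K (closed_segment p q) = (1 / norm (q - p)) *\<^sub>R rot (q - p)"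
proof -
  define l where "l = norm (q - p)"
  have l: "l > 0" using ccw_distinct[OF assms] by (auto simp: l_def)
  let ?e = "closed_segment p q"
  let ?P = "\<lambda>n. norm n = 1 \<and> (\<forall>x\<in>?e. \<forall>y\<in>?e. n \<bullet> (x - y) = 0) \<and> (\<forall>x\<in>K. \<forall>y\<in>?e. n \<bullet> (x - y) \<le> 0)"
  let ?n = "(1 / l) *\<^sub>R rot (q - p)"
  have orth: "rot (q - p) \<bullet> (y - p) = 0" if "y \<in> ?e" for y using segment_minus[OF that] by (auto simp: rot_inner)
  have diff: "n \<bullet> (x - y) = n \<bullet> (x - p) - n \<bullet> (y - p)" for n x y :: pt by (simp add: inner_diff_right)
  have Pn: "?P ?n"
  proof (intro conjI ballI)
    show "norm ?n = 1" using l by (simp add: l_def[symmetric])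
    show "?n \<bullet> (x - y) = 0" if "x \<in> ?e" "y \<in> ?e" for x y using orth that by (simp add: diff[of _ x y])
    show "?n \<bullet> (x - y) \<le> 0" if "x \<in> K" "y \<in> ?e" for x y
    proof -
      have "rot (q - p) \<bullet> (x - p) \<le> 0" using ccw_halfplane[OF assms that(1)] by (simp add: rot_inner)
      then show ?thesis using orth[OF that(2)] l by (simp add: diff[of _ x y] divide_le_eq mult_nonneg_nonpos)
    qed
  qed
  have uniq: "n = ?n" if n: "?P n" for n
  proof -
    have rK: "r \<in> K" using assms by (auto simp: ccw_def intro: hull_inc)
    have 1: "n \<bullet> (q - p) = 0" using n by blast
    have 2: "n \<bullet> (r - p) \<le> 0" using n rK by blast
    define \<mu> where "\<mu> = (n \<bullet> rot (q - p)) / l\<^sup>2"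
    have ll: "rot (q - p) \<bullet> rot (q - p) = l\<^sup>2" by (simp add: power2_norm_eq_inner[symmetric] l_def)
    have "n - \<mu> *\<^sub>R rot (q - p) = 0"
    proof (rule cr_basis[of "q - p" "rot (q - p)"])
      have "cr (q - p) (rot (q - p)) = - (l\<^sup>2)"
        by (simp add: cr_def l_def power2_norm_eq_inner inner_pt algebra_simps)
      then show "cr (q - p) (rot (q - p)) \<noteq> 0" using l by simp
      show "(n - \<mu> *\<^sub>R rot (q - p)) \<bullet> (q - p) = 0" using 1 by (simp add: inner_diff_left rot_inner)
      show "(n - \<mu> *\<^sub>R rot (q - p)) \<bullet> rot (q - p) = 0" using l by (simp add: inner_diff_left ll \<mu>_def)
    qed
    then have nm: "n = \<mu> *\<^sub>R rot (q - p)" by simp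
    then have "\<bar>\<mu>\<bar> * l = 1" using n by (simp add: l_def)
    moreover have "\<mu> \<ge> 0"
    proof (rule ccontr)
      assume "\<not> \<mu> \<ge> 0"
      then have "\<mu> * cr (q - p) (r - p) < 0" using assms by (simp add: ccw_def mult_neg_pos)
      then show False using 2 by (simp add: nm rot_inner)
    qed
    ultimately have "\<mu> = 1 / l" using l by (simp add: field_simps)
    then show ?thesis using nm by simp
  qed
  have "(SOME n. ?P n) = ?n" by (rule some_equality) (use Pn uniq in blast)+
  then show ?thesis by (simp add: outer_normal_def l_def)
qed

text \<open>The edge is run through in unit time, without the edge length. The length is carried by
  \<open>rot (q - p)\<close> instead, so fluxes are free of normalising factors.\<close>

definition eI :: "pt \<Rightarrow> pt \<Rightarrow> (pt \<Rightarrow> real) \<Rightarrow> real" where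
  "eI p q g = integral {0..1} (\<lambda>t. g (sg01 p q t))"

lemma eI_commute: "eI p q g = eI q p g"
proof -
  have "sg01 p q (1 - t) = sg01 q p t" for t by (simp add: sg01_def add.commute)
  then show ?thesis unfolding eI_def using integral_reflect_01[of "\<lambda>t. g (sg01 p q t)"] by simp
qed

lemma edge_int_normal:
  assumes "ccw K p q r"
  shows "edge_int (closed_segment p q) (\<lambda>x. F x \<bullet> outer_normal K (closed_segment p q)) = eI p q (\<lambda>x. F x \<bullet> rot (q - p))"
proof -
  have l: "dist p q > 0" "norm (q - p) = dist p q" using ccw_distinct[OF assms] by (simp_all add: dist_norm norm_minus_commute)
  have "edge_int (closed_segment p q) (\<lambda>x. F x \<bullet> outer_normal K (closed_segment p q))
     = dist p q * integral {0..1} (\<lambda>t. (1 / dist p q) * (F (sg01 p q t) \<bullet> rot (q - p)))"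
    using ccw_distinct[OF assms] by (simp add: edge_int_segment outer_normal_eq[OF assms] l)
  also have "\<dots> = dist p q * ((1 / dist p q) * integral {0..1} (\<lambda>t. F (sg01 p q t) \<bullet> rot (q - p)))"
    by (simp only: integral_mult_right)
  finally show ?thesis using l by (simp add: eI_def)
qed

lemma boundary_sum:
  assumes "ccw K a b c"
  shows "(\<Sum>e\<in>tri_edges K. edge_int e (\<lambda>x. F e x \<bullet> outer_normal K e))
    = eI a b (\<lambda>x. F (closed_segment a b) x \<bullet> rot (b - a)) + eI b c (\<lambda>x. F (closed_segment b c) x \<bullet> rot (c - b))
      + eI c a (\<lambda>x. F (closed_segment c a) x \<bullet> rot (a - c))"
proof -
  note c2 = ccw_cyc[OF assms] and c3 = ccw_cyc[OF ccw_cyc[OF assms]]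
  show ?thesis unfolding ccw_edges[OF assms] using ccw_edges_distinct[OF assms]
    by (simp add: edge_int_normal[OF assms, of "F (closed_segment a b)"] edge_int_normal[OF c2, of "F (closed_segment b c)"]
        edge_int_normal[OF c3, of "F (closed_segment c a)"])
qed

section \<open>The divergence theorem on a triangle\<close>

lemma cont_borel: "continuous_on UNIV f \<Longrightarrow> f \<in> borel_measurable borel" for f :: "pt \<Rightarrow> real"
  by (rule borel_measurable_continuous_onI)

lemma compact_lmeasurable: "compact S \<Longrightarrow> S \<in> lmeasurable" for S :: "pt set" by (rule lmeasurable_compact)

lemma cont_sq_compact: "continuous_on UNIV f \<Longrightarrow> compact S \<Longrightarrow> sq_int (lebesgue_on S) f" for f :: "pt \<Rightarrow> real"
  by (intro continuous_sq_int compact_imp_bounded compact_lmeasurable)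

lemma cont_integrable_compact: "continuous_on UNIV f \<Longrightarrow> compact S \<Longrightarrow> integrable (lebesgue_on S) f" for f :: "pt \<Rightarrow> real"
  by (rule sq_int_imp_integrable[OF finite_measure_lebesgue_on[OF compact_lmeasurable] cont_sq_compact])

lemma cont_abs_integrable:
  fixes f :: "pt \<Rightarrow> 'b::euclidean_space"
  assumes "continuous_on UNIV f" "compact S"
  shows "f absolutely_integrable_on S"
proof -
  have i: "integrable lborel (\<lambda>x. indicator S x *\<^sub>R f x)"
    by (rule borel_integrable_compact[OF assms(2)]) (use assms(1) continuous_on_subset in blast)
  then have "(\<lambda>x. indicator S x *\<^sub>R f x) \<in> borel_measurable lborel" by (rule borel_measurable_integrable)
  then show ?thesis using i by (simp add: set_integrable_def integrable_completion)
qed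

lemma kint_HK:
  assumes "continuous_on UNIV f" "compact S"
  shows "kint S f = integral S f"
  unfolding kint_def by (rule lebesgue_integral_eq_integral[OF cont_integrable_compact[OF assms]])
    (use compact_lmeasurable[OF assms(2)] in blast)

lemma kint_lborel:
  assumes "continuous_on UNIV f" "compact S"
  shows "kint S f = (\<integral>x. indicator S x * f x \<partial>lborel)"
  unfolding kint_def by (rule lebesgue_on_integral_lborel(1)[OF cont_borel[OF assms(1)]])
    (use assms(2) in \<open>simp add: compact_imp_closed\<close>)

definition S0 :: "pt set" where "S0 = {z. 0 \<le> z $ 1 \<and> 0 \<le> z $ 2 \<and> z $ 1 + z $ 2 \<le> 1}"

lemma compact_S0: "compact S0"
proof -
  have "closed S0" unfolding S0_def by (intro closed_Collect_conj closed_Collect_le continuous_intros)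
  moreover have "bounded S0"
  proof -
    have "norm z \<le> 2" if "z \<in> S0" for z using norm_le_l1_cart[of z] that by (auto simp: S0_def sum_2)
    then show ?thesis by (auto simp: bounded_iff)
  qed
  ultimately show ?thesis by (simp add: compact_eq_bounded_closed)
qed

lemma S0_mk: "mk i t c \<in> S0 \<longleftrightarrow> 0 \<le> t \<and> 0 \<le> c \<and> t + c \<le> 1"
  using two_cases[of i] mk_nth[of i t c] by (auto simp: S0_def oth_def)

text \<open>Slicing in direction \<open>i\<close> leaves, at each height \<open>s\<close>, the
  difference between the values on the hypotenuse and on a leg.\<close>

lemma simplex_divergence:
  assumes "C1 f"
  shows "kint S0 (pd i f) = integral {0..1} (\<lambda>s. f (mk i (1 - s) s) - f (mk i 0 s))"
proof -
  let ?g = "\<lambda>x. indicator S0 x * pd i f x"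
  have S0m: "S0 \<in> sets borel" using compact_S0 by (simp add: compact_imp_closed)
  have gi: "integrable lborel ?g" using cont_integrable_compact[OF C1_continuous_pd[OF assms] compact_S0]
      lebesgue_on_integral_lborel(2)[OF cont_borel[OF C1_continuous_pd[OF assms]] S0m] by blast
  let ?h = "\<lambda>s. f (mk i (1 - s) s) - f (mk i 0 s)"
  have inner: "(\<integral>t. ?g (mk i t c) \<partial>lborel) = indicator {0..1} c * ?h c" if ic: "integrable lborel (\<lambda>t. ?g (mk i t c))" for c
  proof (cases "c \<in> {0..1}")
    case False
    then have "(\<lambda>t. ?g (mk i t c)) = (\<lambda>t. 0)" by (auto simp: S0_mk indicator_def fun_eq_iff)
    then show ?thesis using False by (simp only:) simp
  next
    case True
    have "(\<integral>t. ?g (mk i t c) \<partial>lborel) = f (mk i (1 - c) c) - f (mk i 0 c)"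
    proof (rule FTC_lborel[where S="{}" and f="\<lambda>t. f (mk i t c)" and f'="\<lambda>t. pd i f (mk i t c)" and a=0 and b="1 - c"])
      show "continuous_on {0..1 - c} (\<lambda>t. f (mk i t c))"
        by (intro continuous_on_compose2[OF C1_continuous[OF assms, of UNIV]] continuous_intros) auto
      show "((\<lambda>t. f (mk i t c)) has_real_derivative pd i f (mk i t c)) (at t)" for t
        by (rule has_real_derivative_mk[OF C1_diff'[OF assms]])
    qed (use True ic in \<open>auto simp: S0_mk\<close>)
    then show ?thesis using True by simp
  qed
  have hc: "continuous_on {0..1} ?h"
    by (intro continuous_intros continuous_on_compose2[OF C1_continuous[OF assms, of UNIV]]) auto
  have "kint S0 (pd i f) = integral\<^sup>L lborel ?g" by (rule kint_lborel[OF C1_continuous_pd[OF assms] compact_S0])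
  also have "\<dots> = (\<integral>c. (\<integral>t. ?g (mk i t c) \<partial>lborel) \<partial>lborel)" by (rule slice_integral[OF gi])
  also have "\<dots> = (\<integral>c. indicator {0..1} c * ?h c \<partial>lborel)"
  proof (rule integral_cong_AE)
    show "AE c in lborel. (\<integral>t. ?g (mk i t c) \<partial>lborel) = indicator {0..1} c * ?h c"
      using slice_AE_integrable[OF gi, of i] by eventually_elim (rule inner)
    have [measurable]: "?h \<in> borel_measurable borel"
      by (intro borel_measurable_continuous_onI continuous_intros continuous_on_compose2[OF C1_continuous[OF assms, of UNIV]]) auto
    show "(\<lambda>c. indicator {0..1} c * ?h c) \<in> borel_measurable lborel" by measurable
    have "(\<lambda>(t, c). mk i t c) \<in> borel_measurable (lborel \<Otimes>\<^sub>M lborel)" by (rule measurable_mk)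
    then have [measurable]: "(\<lambda>p. ?g (mk i (snd p) (fst p))) \<in> borel_measurable (lborel \<Otimes>\<^sub>M lborel)"
    proof -
      have [measurable]: "?g \<in> borel_measurable borel" using gi by auto
      have "(\<lambda>p. mk i (snd p) (fst p)) \<in> borel_measurable (lborel \<Otimes>\<^sub>M lborel)" unfolding mk_def by measurable
      then show ?thesis by measurable
    qed
    show "(\<lambda>c. \<integral>t. ?g (mk i t c) \<partial>lborel) \<in> borel_measurable lborel"
      by (rule lborel.borel_measurable_lebesgue_integral) (simp add: case_prod_unfold)
  qed
  also have "\<dots> = integral {0..1} ?h"
  proof -
    have "set_integrable lborel {0..1} ?h" unfolding set_integrable_def
      using borel_integrable_compact[OF compact_Icc hc] by simp
    from set_borel_integral_eq_integral(2)[OF this] show ?thesis by (simp add: set_lebesgue_integral_def)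
  qed
  finally show ?thesis .
qed

lemma eI_int:
  fixes f :: "pt \<Rightarrow> real"
  assumes "continuous_on (closed_segment p q) f"
  shows "(\<lambda>t. f (sg01 p q t)) integrable_on {0..1}"
proof -
  have "continuous_on {0..1} (\<lambda>t. f (sg01 p q t))"
    by (rule continuous_on_compose2[OF assms sg01_cont]) (auto intro: sg01_in)
  then show ?thesis by (rule integrable_continuous_real)
qed

locale tri =
  fixes K :: "pt set" and a b c :: pt
  assumes ccw: "ccw K a b c"
begin

definition D :: real where "D = cr (b - a) (c - a)"

lemma D: "D > 0" using ccw by (simp add: ccw_def D_def)

lemma K: "K = convex hull {a, b, c}" using ccw by (simp add: ccw_def)

lemma compact_K: "compact K" unfolding K by (intro compact_convex_hull finite_imp_compact) simp
lemma convex_K: "convex K" unfolding K by simp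

definition L :: "pt \<Rightarrow> pt" where "L z = z $ 1 *\<^sub>R (b - a) + z $ 2 *\<^sub>R (c - a)"

lemma linear_L: "linear L" unfolding L_def by (intro linearI) (simp_all add: algebra_simps)

lemma cont_L: "continuous_on S (\<lambda>z. a + L z)" unfolding L_def by (intro continuous_intros)

lemma det_L: "det (matrix L) = D" by (simp add: det_2 matrix_def L_def D_def cr_def axis_def)

lemma K_L: "{y. a + y \<in> K} = L ` S0"
proof -
  have "a + y \<in> K \<longleftrightarrow> (\<exists>u v. 0 \<le> u \<and> 0 \<le> v \<and> u + v \<le> 1 \<and> y = u *\<^sub>R (b - a) + v *\<^sub>R (c - a))" for y
    unfolding K convex_hull_3_alt by (auto simp: algebra_simps)
  moreover have "y \<in> L ` S0 \<longleftrightarrow> (\<exists>u v. 0 \<le> u \<and> 0 \<le> v \<and> u + v \<le> 1 \<and> y = u *\<^sub>R (b - a) + v *\<^sub>R (c - a))" for y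
  proof
    assume "y \<in> L ` S0"
    then show "\<exists>u v. 0 \<le> u \<and> 0 \<le> v \<and> u + v \<le> 1 \<and> y = u *\<^sub>R (b - a) + v *\<^sub>R (c - a)" unfolding L_def S0_def by blast
  next
    assume "\<exists>u v. 0 \<le> u \<and> 0 \<le> v \<and> u + v \<le> 1 \<and> y = u *\<^sub>R (b - a) + v *\<^sub>R (c - a)"
    then obtain u v where uv: "0 \<le> u" "0 \<le> v" "u + v \<le> 1" "y = u *\<^sub>R (b - a) + v *\<^sub>R (c - a)" by blast
    then have "y = L (mk 1 u v)" "mk 1 u v \<in> S0" using mk_nth[of 1 u v] by (simp_all add: L_def S0_mk oth_def)
    then show "y \<in> L ` S0" by blast
  qed
  ultimately show ?thesis unfolding set_eq_iff mem_Collect_eq by blast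
qed

lemma kint_L:
  assumes f: "continuous_on UNIV f"
  shows "kint K f = D * kint S0 (\<lambda>z. f (a + L z))"
proof -
  \<comment> \<open>The change of variables rule is applied to a vector valued function, so the
    scalar \<open>f\<close> travels as its only component.\<close>
  define F :: "pt \<Rightarrow> real^1" where "F y = f (a + y) *\<^sub>R axis 1 1" for y
  have fa: "continuous_on UNIV (\<lambda>y. f (a + y))" by (intro continuous_on_compose2[OF f] continuous_intros) auto
  have fL: "continuous_on UNIV (\<lambda>z. f (a + L z))" by (intro continuous_on_compose2[OF f] cont_L) auto
  have Fc: "continuous_on UNIV F" unfolding F_def by (intro continuous_intros fa)
  have FLc: "continuous_on UNIV (\<lambda>z. D *\<^sub>R F (L z))" unfolding F_def by (intro continuous_intros fL)
  have LS: "compact (L ` S0)" by (intro compact_continuous_image compact_S0) (unfold L_def, intro continuous_intros)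
  have "F absolutely_integrable_on (L ` S0)" by (rule cont_abs_integrable[OF Fc LS])
  then have I: "integral S0 (\<lambda>z. D *\<^sub>R F (L z)) = integral (L ` S0) F"
    using has_absolute_integral_change_of_variables_linear[OF linear_L, where f=F and S=S0 and b="integral (L ` S0) F"] D
    by (simp add: det_L)
  have Fi: "F integrable_on (L ` S0)" "(\<lambda>z. D *\<^sub>R F (L z)) integrable_on S0"
    using cont_abs_integrable[OF Fc LS] cont_abs_integrable[OF FLc compact_S0] by (auto dest: set_lebesgue_integral_eq_integral(1))
  have "kint K f = kint (L ` S0) (\<lambda>y. f (a + y))" unfolding kint_def K_L[symmetric]
    by (rule lebesgue_on_translate[OF cont_borel[OF f]]) (use compact_K in \<open>simp add: compact_imp_closed\<close>)
  also have "\<dots> = integral (L ` S0) (\<lambda>y. f (a + y))" by (rule kint_HK[OF fa LS])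
  also have "\<dots> = integral (L ` S0) F $ 1"
    using integral_component_eq_cart[OF Fi(1), of 1] by (simp add: F_def axis_def)
  also have "\<dots> = integral S0 (\<lambda>z. D * f (a + L z))"
    unfolding I[symmetric] using integral_component_eq_cart[OF Fi(2), of 1] by (simp add: F_def axis_def)
  also have "\<dots> = D * integral S0 (\<lambda>z. f (a + L z))" by (rule integral_mult_right)
  also have "integral S0 (\<lambda>z. f (a + L z)) = kint S0 (\<lambda>z. f (a + L z))" by (rule kint_HK[OF fL compact_S0, symmetric])
  finally show ?thesis .
qed

definition ed :: "2 \<Rightarrow> pt" where "ed i = (if i = 1 then b - a else c - a)"

lemma L_comp:
  assumes "C1 f"
  shows "C1 (\<lambda>z. f (a + L z))" "pd i (\<lambda>z. f (a + L z)) = (\<lambda>z. \<Sum>j\<in>UNIV. ed i $ j * pd j f (a + L z))"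
proof -
  have dL: "((\<lambda>z. a + L z) has_derivative L) (at z)" for z
    using linear_L by (auto intro!: derivative_eq_intros linear_imp_has_derivative)
  have d: "((\<lambda>z. f (a + L z)) has_derivative (\<lambda>h. \<Sum>i\<in>UNIV. h $ i * (\<Sum>j\<in>UNIV. ed i $ j * pd j f (a + L z)))) (at z)" for z
  proof -
    have "((\<lambda>z. f (a + L z)) has_derivative (\<lambda>h. \<Sum>j\<in>UNIV. L h $ j * pd j f (a + L z))) (at z)"
      by (rule has_derivative_compose[where g=f and f="\<lambda>z. a + L z", OF dL C1_has_derivative[OF assms]])
    moreover have "(\<lambda>h. \<Sum>j\<in>UNIV. L h $ j * pd j f (a + L z)) = (\<lambda>h. \<Sum>i\<in>UNIV. h $ i * (\<Sum>j\<in>UNIV. ed i $ j * pd j f (a + L z)))"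
      by (auto simp: L_def ed_def sum_2 algebra_simps)
    ultimately show ?thesis by simp
  qed
  have c: "continuous_on UNIV (\<lambda>z. \<Sum>j\<in>UNIV. ed i $ j * pd j f (a + L z))" for i
    by (intro continuous_intros continuous_on_compose2[OF C1_continuous_pd[OF assms, of UNIV]] cont_L) auto
  show "C1 (\<lambda>z. f (a + L z))" "pd i (\<lambda>z. f (a + L z)) = (\<lambda>z. \<Sum>j\<in>UNIV. ed i $ j * pd j f (a + L z))"
    using C1I[OF d c] by auto
qed

lemma directional:
  assumes "C1 f"
  shows "kint K (\<lambda>x. \<Sum>j\<in>UNIV. (b - a) $ j * pd j f x) = D * (eI b c f - eI a c f)"
    "kint K (\<lambda>x. \<Sum>j\<in>UNIV. (c - a) $ j * pd j f x) = D * (eI c b f - eI a b f)"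
proof -
  have cf: "continuous_on UNIV (\<lambda>x. \<Sum>j\<in>UNIV. w $ j * pd j f x)" for w :: pt
    by (intro continuous_intros C1_continuous_pd[OF assms])
  have mkn: "mk 1 t s $ 1 = t" "mk 1 t s $ 2 = s" "mk 2 t s $ 2 = t" "mk 2 t s $ 1 = s" for t s
    using mk_nth[of 1 t s] mk_nth[of 2 t s] by (simp_all add: oth_def)
  have p1: "a + L (mk 1 (1 - s) s) = sg01 b c s" "a + L (mk 1 0 s) = sg01 a c s"
    "a + L (mk 2 (1 - s) s) = sg01 c b s" "a + L (mk 2 0 s) = sg01 a b s" for s
    by (simp_all add: L_def mkn sg01_def algebra_simps)
  note fi = eI_int[OF C1_continuous[OF assms]]
  show "kint K (\<lambda>x. \<Sum>j\<in>UNIV. (b - a) $ j * pd j f x) = D * (eI b c f - eI a c f)"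
    unfolding kint_L[OF cf] using simplex_divergence[OF L_comp(1)[OF assms], of 1] fi
    by (simp add: L_comp(2)[OF assms] ed_def p1 eI_def integral_diff)
  show "kint K (\<lambda>x. \<Sum>j\<in>UNIV. (c - a) $ j * pd j f x) = D * (eI c b f - eI a b f)"
    unfolding kint_L[OF cf] using simplex_divergence[OF L_comp(1)[OF assms], of 2] fi
    by (simp add: L_comp(2)[OF assms] ed_def p1 eI_def integral_diff)
qed

text \<open>The reference simplex yields the derivatives along the two edge vectors at
  \<open>a\<close>. These vectors are independent, so the two scalar identities determine the vector
  identity.\<close>

lemma Gauss:
  assumes "C1 f"
  shows "kint K (pd i f) = eI a b f * rot (b - a) $ i + eI b c f * rot (c - b) $ i + eI c a f * rot (a - c) $ i"
proof -
  define V where "V = (\<chi> j. kint K (pd j f))"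
  define B where "B = eI a b f *\<^sub>R rot (b - a) + eI b c f *\<^sub>R rot (c - b) + eI c a f *\<^sub>R rot (a - c)"
  have Vin: "V \<bullet> w = kint K (\<lambda>x. \<Sum>j\<in>UNIV. w $ j * pd j f x)" for w
    using cont_integrable_compact[OF C1_continuous_pd[OF assms] compact_K]
    by (simp add: V_def inner_pt kint_def sum_2 algebra_simps)
  have "V - B = 0"
  proof (rule cr_basis)
    show "cr (b - a) (c - a) \<noteq> 0" using D by (simp add: D_def)
    have 1: "cr (c - b) (b - a) = - D" "cr (a - c) (b - a) = D" "cr (b - a) (c - a) = D" "cr (c - b) (c - a) = - D" "cr (a - c) (c - a) = 0"
      by (simp_all add: D_def cr_def algebra_simps)
    show "(V - B) \<bullet> (b - a) = 0" unfolding inner_diff_left Vin directional[OF assms] B_def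
      by (simp add: inner_add_left rot_inner 1 eI_commute[of a c] right_diff_distrib)
    show "(V - B) \<bullet> (c - a) = 0" unfolding inner_diff_left Vin directional[OF assms] B_def
      by (simp add: inner_add_left rot_inner 1 eI_commute[of c b] right_diff_distrib)
  qed
  then have "V $ i = B $ i" by simp
  then show ?thesis by (simp add: V_def B_def)
qed

end

section \<open>The Poincare inequality on a convex body\<close>

text \<open>The increment is the integral of a directional derivative along the segment;
  Cauchy--Schwarz is used once in time and once in the plane. The extended real form prepares the
  exchange of integrals.\<close>

lemma difference_square_bound:
  assumes g: "C1 g" and d: "norm (x - y) \<le> d"
  shows "ennreal ((g x - g y)\<^sup>2) \<le> ennreal (d\<^sup>2) * (\<integral>\<^sup>+t. indicator {0..1} t * ennreal (\<Sum>i\<in>UNIV. (pd i g ((1 - t) *\<^sub>R y + t *\<^sub>R x))\<^sup>2) \<partial>lborel)"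
proof -
  let ?M = "lebesgue_on {0..1::real}"
  let ?p = "\<lambda>t. y + t *\<^sub>R (x - y)"
  define Df where "Df t = (\<Sum>i\<in>UNIV. (x - y) $ i * pd i g (?p t))" for t
  define q where "q t = (\<Sum>i\<in>UNIV. (pd i g (?p t))\<^sup>2)" for t
  have pc: "continuous_on S (\<lambda>t. pd i g (?p t))" for S i
    by (intro continuous_on_compose2[OF C1_continuous_pd[OF g, of UNIV]] continuous_intros) auto
  have Dc: "continuous_on S Df" and qc: "continuous_on S q" for S
    unfolding Df_def q_def by (intro continuous_intros pc)+
  have fin: "finite_measure ?M" by (rule finite_measure_lebesgue_on) simp
  interpret finite_measure ?M by (rule fin)
  have csq: "sq_int ?M h" and cint: "integrable ?M h" and cm: "h \<in> borel_measurable ?M"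
    if "continuous_on UNIV h" for h :: "real \<Rightarrow> real"
  proof -
    have "h \<in> borel_measurable lebesgue"
      using borel_measurable_continuous_onI[OF that] by (simp add: measurable_completion)
    then show m: "h \<in> borel_measurable ?M" by (rule measurable_restrict_space1)
    have "compact (h ` {0..1})" by (intro compact_continuous_image continuous_on_subset[OF that]) auto
    then obtain B where "\<forall>z\<in>h ` {0..1}. norm z \<le> B" using compact_imp_bounded bounded_iff by metis
    then show "sq_int ?M h" by (intro sq_int_bounded[OF fin m, of B]) (auto simp: space_restrict_space)
    then show "integrable ?M h" by (rule sq_int_imp_integrable[OF fin])
  qed
  have "(Df has_integral (g (?p 1) - g (?p 0))) {0..1}"
  proof (rule fundamental_theorem_of_calculus)
    fix t :: real
    have "((\<lambda>t. g (?p t)) has_real_derivative Df t) (at t)"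
      unfolding Df_def by (rule has_real_derivative_line[OF C1_diff'[OF g]])
    then show "((\<lambda>t. g (?p t)) has_vector_derivative Df t) (at t within {0..1})"
      by (simp only: has_field_derivative_at_within flip: has_real_derivative_iff_has_vector_derivative)
  qed simp
  then have "g x - g y = integral {0..1} Df" by (simp add: integral_unique)
  also have "\<dots> = integral\<^sup>L ?M Df" by (rule lebesgue_integral_eq_integral[symmetric, OF cint[OF Dc]]) simp
  also have "\<dots> = (\<integral>t. Df t * 1 \<partial>?M)" by simp
  finally have "\<bar>g x - g y\<bar> \<le> n2 ?M Df * n2 ?M (\<lambda>t. 1)"
    using n2_CS[OF csq[OF Dc] csq[OF continuous_on_const, of 1]] by simp
  also have "n2 ?M (\<lambda>t. 1) = 1" by (simp add: n2_def space_restrict_space measure_restrict_space)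
  finally have "\<bar>g x - g y\<bar>\<^sup>2 \<le> (n2 ?M Df)\<^sup>2" by (intro power_mono) auto
  then have "(g x - g y)\<^sup>2 \<le> (\<integral>t. (Df t)\<^sup>2 \<partial>?M)" by (simp add: n2_sq)
  also have "\<dots> \<le> (\<integral>t. d\<^sup>2 * q t \<partial>?M)"
  proof (rule integral_mono)
    show "integrable ?M (\<lambda>t. (Df t)\<^sup>2)" using csq[OF Dc] by (simp add: sq_int_def)
    show "integrable ?M (\<lambda>t. d\<^sup>2 * q t)" using cint[OF qc] by simp
    fix t
    have "(Df t)\<^sup>2 \<le> (norm (x - y))\<^sup>2 * q t" unfolding Df_def q_def norm_eq_sqrt_inner inner_vec_def
      using Cauchy_Schwarz_ineq_sum[of "\<lambda>i. (x - y) $ i" "\<lambda>i. pd i g (?p t)" UNIV]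
      by (simp add: power2_eq_square sum_nonneg)
    also have "\<dots> \<le> d\<^sup>2 * q t" using d by (intro mult_right_mono power_mono) (auto simp: q_def sum_nonneg)
    finally show "(Df t)\<^sup>2 \<le> d\<^sup>2 * q t" .
  qed
  finally have "ennreal ((g x - g y)\<^sup>2) \<le> ennreal (d\<^sup>2 * integral\<^sup>L ?M q)" by (simp add: ennreal_leI)
  also have "\<dots> = ennreal (d\<^sup>2) * (\<integral>\<^sup>+t. ennreal (q t) \<partial>?M)"
    using cint[OF qc] by (subst nn_integral_eq_integral) (auto simp: q_def sum_nonneg ennreal_mult' intro!: AE_I2)
  also have "(\<integral>\<^sup>+t. ennreal (q t) \<partial>?M) = (\<integral>\<^sup>+t. ennreal (q t) * indicator {0..1} t \<partial>lebesgue)"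
    by (simp add: nn_integral_restrict_space)
  also have "\<dots> = (\<integral>\<^sup>+t. indicator {0..1} t * ennreal (q t) \<partial>lborel)"
    by (simp add: nn_integral_completion mult.commute)
  finally show ?thesis by (simp add: q_def algebra_simps)
qed

text \<open>In the double integral of \<open>(g x - g y)\<^sup>2\<close> along
  segments, the end point with the larger weight is used as the variable of substitution.\<close>

lemma Poincare_convex:
  assumes g: "C1 g" and K: "compact K" "convex K" "measure lebesgue K > 0"
    and d: "\<And>x y. x \<in> K \<Longrightarrow> y \<in> K \<Longrightarrow> norm (x - y) \<le> d"
  shows "kint K (\<lambda>x. (g x - kint K g / measure lebesgue K)\<^sup>2) \<le> 2 * d\<^sup>2 * kint K (\<lambda>x. \<Sum>i\<in>UNIV. (pd i g x)\<^sup>2)"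
proof -
  define M where "M = lebesgue_on K"
  define \<mu> where "\<mu> = measure lebesgue K"
  define q where "q x = (\<Sum>i\<in>UNIV. (pd i g x)\<^sup>2)" for x
  have qc: "continuous_on UNIV q" unfolding q_def by (intro continuous_intros C1_continuous_pd[OF g])
  have q0: "q x \<ge> 0" for x by (simp add: q_def sum_nonneg)
  have Kb [measurable]: "K \<in> sets borel" using K(1) by (simp add: compact_imp_closed)
  have [measurable]: "q \<in> borel_measurable borel" "g \<in> borel_measurable borel"
    using cont_borel[OF qc] cont_borel[OF C1_continuous[OF g]] by auto
  have fin: "finite_measure M" unfolding M_def by (rule finite_measure_lebesgue_on[OF compact_lmeasurable[OF K(1)]])
  interpret finite_measure M by (rule fin)
  have spM: "space M = K" by (simp add: M_def space_restrict_space)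
  have \<mu>: "measure M (space M) = \<mu>" unfolding spM unfolding M_def \<mu>_def
    using compact_lmeasurable[OF K(1)] by (simp add: measure_restrict_space fmeasurableD)
  have ci: "integrable M h" if "continuous_on UNIV h" for h :: "pt \<Rightarrow> real"
    unfolding M_def by (rule cont_integrable_compact[OF that K(1)])
  have nnM: "(\<integral>\<^sup>+x. h x \<partial>M) = (\<integral>\<^sup>+x. indicator K x * h x \<partial>lborel)" for h :: "pt \<Rightarrow> ennreal"
    unfolding M_def using Kb by (simp add: nn_integral_restrict_space nn_integral_completion mult.commute)
  define Q where "Q = (\<integral>\<^sup>+x. indicator K x * ennreal (q x) \<partial>lborel)"
  have Qk: "Q = ennreal (integral\<^sup>L M q)"
    unfolding Q_def nnM[symmetric] by (rule nn_integral_eq_integral[OF ci[OF qc]]) (use q0 in auto)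
  have vol: "(\<integral>\<^sup>+x. indicator K x \<partial>lborel) = ennreal \<mu>"
  proof -
    have "(\<integral>\<^sup>+x. indicator K x \<partial>lborel) = (\<integral>\<^sup>+x. indicator K x * ennreal 1 \<partial>lborel)" by simp
    also have "\<dots> = (\<integral>\<^sup>+x. ennreal 1 \<partial>M)" by (rule nnM[symmetric])
    also have "\<dots> = ennreal (\<integral>x. 1 \<partial>M)" by (rule nn_integral_eq_integral) auto
    finally show ?thesis by (simp add: \<mu>)
  qed
  define \<Phi> where "\<Phi> t x y = indicator K x * (indicator K y * ennreal (q ((1 - t) *\<^sub>R y + t *\<^sub>R x)))" for t x y
  have [measurable]: "(\<lambda>(t, x, y). \<Phi> t x y) \<in> borel_measurable (borel \<Otimes>\<^sub>M borel \<Otimes>\<^sub>M borel)"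
    unfolding \<Phi>_def by measurable
  \<comment> \<open>For \<open>s \<ge> 1/2\<close> the substitution moves \<open>x\<close> towards
    \<open>y\<close> inside the convex set, with Jacobian \<open>s^2 \<ge> 1/4\<close>; this is the
    factor \<open>4\<close>.\<close>
  have sub: "(\<integral>\<^sup>+x. indicator K x * ennreal (q ((1 - s) *\<^sub>R y + s *\<^sub>R x)) \<partial>lborel) \<le> 4 * Q"
    if s: "1/2 \<le> s" "s \<le> 1" and y: "y \<in> K" for s y
  proof -
    let ?z = "\<lambda>x. (1 - s) *\<^sub>R y + s *\<^sub>R x"
    have "(\<integral>\<^sup>+x. indicator K x * ennreal (q (?z x)) \<partial>lborel) \<le> (\<integral>\<^sup>+x. indicator K (?z x) * ennreal (q (?z x)) \<partial>lborel)"
    proof (rule nn_integral_mono)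
      fix x show "indicator K x * ennreal (q (?z x)) \<le> indicator K (?z x) * ennreal (q (?z x))"
        using convexD[OF K(2) y, of x "1 - s" s] s by (cases "x \<in> K") auto
    qed
    moreover have "Q = ennreal (s\<^sup>2) * (\<integral>\<^sup>+x. indicator K (?z x) * ennreal (q (?z x)) \<partial>lborel)"
      unfolding Q_def by (rule nn_integral_pt_affine) (use s in auto)
    moreover have "X \<le> 4 * (ennreal (s\<^sup>2) * X)" for X
    proof -
      have "1 \<le> 4 * s\<^sup>2" using power_mono[OF s(1), of 2] by (simp add: power2_eq_square)
      then have "ennreal 1 * X \<le> ennreal (4 * s\<^sup>2) * X" by (intro mult_right_mono ennreal_leI) auto
      then show ?thesis by (simp add: ennreal_mult' mult.assoc)
    qed
    ultimately show ?thesis by (simp only:) (rule order_trans)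
  qed
  have inner: "(\<integral>\<^sup>+x. (\<integral>\<^sup>+y. \<Phi> t x y \<partial>lborel) \<partial>lborel) \<le> ennreal \<mu> * (4 * Q)" if t: "t \<in> {0..1}" for t
  proof -
    have c: "(\<integral>\<^sup>+x. indicator K x * (4 * Q) \<partial>lborel) = ennreal \<mu> * (4 * Q)" by (simp add: nn_integral_multc vol)
    show ?thesis
    proof (cases "t \<le> 1/2")
      case True
      have "(\<integral>\<^sup>+y. \<Phi> t x y \<partial>lborel) \<le> indicator K x * (4 * Q)" for x
        using sub[of "1 - t" x] True t by (cases "x \<in> K") (auto simp: \<Phi>_def add.commute)
      then show ?thesis unfolding c[symmetric] by (intro nn_integral_mono)
    next
      case False
      have "(\<integral>\<^sup>+x. \<Phi> t x y \<partial>lborel) \<le> indicator K y * (4 * Q)" for y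
        using sub[of t y] False t by (cases "y \<in> K") (auto simp: \<Phi>_def)
      then have "(\<integral>\<^sup>+y. (\<integral>\<^sup>+x. \<Phi> t x y \<partial>lborel) \<partial>lborel) \<le> ennreal \<mu> * (4 * Q)"
        unfolding c[symmetric] by (intro nn_integral_mono)
      moreover have "(\<integral>\<^sup>+x. (\<integral>\<^sup>+y. \<Phi> t x y \<partial>lborel) \<partial>lborel) = (\<integral>\<^sup>+y. (\<integral>\<^sup>+x. \<Phi> t x y \<partial>lborel) \<partial>lborel)"
        unfolding \<Phi>_def by (rule lborel_pair.Fubini') measurable
      ultimately show ?thesis by simp
    qed
  qed
  define X where "X = (\<integral>\<^sup>+x. indicator K x * (\<integral>\<^sup>+y. indicator K y * ennreal ((g x - g y)\<^sup>2) \<partial>lborel) \<partial>lborel)"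
  have "X \<le> (\<integral>\<^sup>+x. (\<integral>\<^sup>+y. (\<integral>\<^sup>+t. ennreal (d\<^sup>2) * (indicator {0..1} t * \<Phi> t x y) \<partial>lborel) \<partial>lborel) \<partial>lborel)"
    unfolding X_def
  proof (rule nn_integral_mono)
    fix x
    have "indicator K x * (\<integral>\<^sup>+y. indicator K y * ennreal ((g x - g y)\<^sup>2) \<partial>lborel)
        = (\<integral>\<^sup>+y. indicator K x * (indicator K y * ennreal ((g x - g y)\<^sup>2)) \<partial>lborel)"
      by (rule nn_integral_cmult[symmetric]) auto
    also have "\<dots> \<le> (\<integral>\<^sup>+y. (\<integral>\<^sup>+t. ennreal (d\<^sup>2) * (indicator {0..1} t * \<Phi> t x y) \<partial>lborel) \<partial>lborel)"
    proof (rule nn_integral_mono)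
      fix y
      show "indicator K x * (indicator K y * ennreal ((g x - g y)\<^sup>2)) \<le> (\<integral>\<^sup>+t. ennreal (d\<^sup>2) * (indicator {0..1} t * \<Phi> t x y) \<partial>lborel)"
      proof (cases "x \<in> K \<and> y \<in> K")
        case True
        then show ?thesis using difference_square_bound[OF g d[of x y]]
          unfolding \<Phi>_def by (simp add: q_def[symmetric] nn_integral_cmult)
      qed auto
    qed
    finally show "indicator K x * (\<integral>\<^sup>+y. indicator K y * ennreal ((g x - g y)\<^sup>2) \<partial>lborel) \<le> \<dots>" .
  qed
  also have "\<dots> = (\<integral>\<^sup>+x. (\<integral>\<^sup>+t. (\<integral>\<^sup>+y. ennreal (d\<^sup>2) * (indicator {0..1} t * \<Phi> t x y) \<partial>lborel) \<partial>lborel) \<partial>lborel)"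
    unfolding \<Phi>_def by (intro nn_integral_cong lborel_pair.Fubini') measurable
  also have "\<dots> = (\<integral>\<^sup>+t. (\<integral>\<^sup>+x. (\<integral>\<^sup>+y. ennreal (d\<^sup>2) * (indicator {0..1} t * \<Phi> t x y) \<partial>lborel) \<partial>lborel) \<partial>lborel)"
    unfolding \<Phi>_def by (rule lborel_pair.Fubini') measurable
  also have "\<dots> \<le> (\<integral>\<^sup>+t. indicator {0..1::real} t * (ennreal (d\<^sup>2) * (ennreal \<mu> * (4 * Q))) \<partial>lborel)"
  proof (rule nn_integral_mono)
    fix t :: real
    have "(\<integral>\<^sup>+x. (\<integral>\<^sup>+y. ennreal (d\<^sup>2) * (indicator {0..1} t * \<Phi> t x y) \<partial>lborel) \<partial>lborel)
       = ennreal (d\<^sup>2) * (indicator {0..1} t * (\<integral>\<^sup>+x. (\<integral>\<^sup>+y. \<Phi> t x y \<partial>lborel) \<partial>lborel))"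
      unfolding \<Phi>_def by (simp add: nn_integral_cmult)
    also have "\<dots> \<le> ennreal (d\<^sup>2) * (indicator {0..1} t * (ennreal \<mu> * (4 * Q)))"
      using inner[of t] by (cases "t \<in> {0..1}") (auto simp: mult_left_mono)
    finally show "(\<integral>\<^sup>+x. (\<integral>\<^sup>+y. ennreal (d\<^sup>2) * (indicator {0..1} t * \<Phi> t x y) \<partial>lborel) \<partial>lborel)
       \<le> indicator {0..1} t * (ennreal (d\<^sup>2) * (ennreal \<mu> * (4 * Q)))" by (simp add: mult.left_commute)
  qed
  also have "\<dots> = ennreal (d\<^sup>2) * (ennreal \<mu> * (4 * Q))" by (simp add: nn_integral_multc)
  also have "\<dots> = ennreal (d\<^sup>2 * (\<mu> * (4 * integral\<^sup>L M q)))"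
  proof -
    have "(4::ennreal) = ennreal 4" by simp
    then show ?thesis unfolding Qk using K(3) q0 by (simp only: \<mu>_def) (simp add: ennreal_mult' integral_nonneg_AE)
  qed
  finally have XQ: "X \<le> ennreal (d\<^sup>2 * (\<mu> * (4 * integral\<^sup>L M q)))" .
  define G where "G = integral\<^sup>L M g"
  define G2 where "G2 = (\<integral>x. (g x)\<^sup>2 \<partial>M)"
  have gi: "integrable M g" "integrable M (\<lambda>x. (g x)\<^sup>2)" by (intro ci continuous_intros C1_continuous[OF g])+
  have "X = (\<integral>\<^sup>+x. (\<integral>\<^sup>+y. ennreal ((g x - g y)\<^sup>2) \<partial>M) \<partial>M)" by (simp add: X_def nnM)
  also have "\<dots> = (\<integral>\<^sup>+x. ennreal (\<mu> * (g x)\<^sup>2 - 2 * g x * G + G2) \<partial>M)"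
  proof (rule nn_integral_cong)
    fix x
    have "(\<integral>\<^sup>+y. ennreal ((g x - g y)\<^sup>2) \<partial>M) = ennreal (\<integral>y. (g x - g y)\<^sup>2 \<partial>M)"
      by (rule nn_integral_eq_integral) (auto intro!: ci continuous_intros C1_continuous[OF g])
    also have "(\<integral>y. (g x - g y)\<^sup>2 \<partial>M) = (\<integral>y. (g x)\<^sup>2 - 2 * g x * g y + (g y)\<^sup>2 \<partial>M)"
      by (simp add: power2_diff algebra_simps)
    also have "\<dots> = \<mu> * (g x)\<^sup>2 - 2 * g x * G + G2" using gi by (simp add: \<mu> G_def G2_def)
    finally show "(\<integral>\<^sup>+y. ennreal ((g x - g y)\<^sup>2) \<partial>M) = ennreal (\<mu> * (g x)\<^sup>2 - 2 * g x * G + G2)" .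
  qed
  also have "\<dots> = ennreal (\<integral>x. \<mu> * (g x)\<^sup>2 - 2 * g x * G + G2 \<partial>M)"
  proof (rule nn_integral_eq_integral)
    show "integrable M (\<lambda>x. \<mu> * (g x)\<^sup>2 - 2 * g x * G + G2)" using gi by auto
    have "0 \<le> \<mu> * (g x)\<^sup>2 - 2 * g x * G + G2" for x
    proof -
      have "\<mu> * (g x)\<^sup>2 - 2 * g x * G + G2 = (\<integral>y. (g x)\<^sup>2 - 2 * g x * g y + (g y)\<^sup>2 \<partial>M)"
        using gi by (simp add: \<mu> G_def G2_def)
      also have "\<dots> = (\<integral>y. (g x - g y)\<^sup>2 \<partial>M)" by (simp add: power2_diff algebra_simps)
      finally show ?thesis by simp
    qed
    then show "AE x in M. 0 \<le> \<mu> * (g x)\<^sup>2 - 2 * g x * G + G2" by simp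
  qed
  \<comment> \<open>The double integral of \<open>(g x - g y)^2\<close> is \<open>2 * \<mu>\<close>
    times the squared deviation from the mean.\<close>
  also have "(\<integral>x. \<mu> * (g x)\<^sup>2 - 2 * g x * G + G2 \<partial>M) = 2 * (\<mu> * G2 - G\<^sup>2)"
    using gi by (simp add: \<mu> G_def[symmetric] G2_def[symmetric]) (simp add: power2_eq_square algebra_simps)
  finally have "2 * (\<mu> * G2 - G\<^sup>2) \<le> d\<^sup>2 * (\<mu> * (4 * integral\<^sup>L M q))"
    using XQ K(3) q0 by (simp add: ennreal_le_iff \<mu>_def integral_nonneg_AE)
  moreover have "kint K (\<lambda>x. (g x - kint K g / measure lebesgue K)\<^sup>2) = (\<mu> * G2 - G\<^sup>2) / \<mu>"
  proof -
    have "kint K (\<lambda>x. (g x - kint K g / measure lebesgue K)\<^sup>2) = (\<integral>x. (g x)\<^sup>2 - 2 * (G / \<mu>) * g x + (G / \<mu>)\<^sup>2 \<partial>M)"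
      unfolding kint_def M_def[symmetric] G_def[symmetric] \<mu>_def[symmetric] by (simp add: power2_diff algebra_simps)
    also have "\<dots> = G2 - 2 * (G / \<mu>) * G + \<mu> * (G / \<mu>)\<^sup>2" using gi by (simp add: \<mu> G_def[symmetric] G2_def[symmetric])
    also have "\<dots> = (\<mu> * G2 - G\<^sup>2) / \<mu>" using K(3) by (simp add: \<mu>_def field_simps power2_eq_square)
    finally show ?thesis .
  qed
  moreover have "kint K (\<lambda>x. \<Sum>i\<in>UNIV. (pd i g x)\<^sup>2) = integral\<^sup>L M q" by (simp add: kint_def M_def q_def[abs_def])
  ultimately show ?thesis using K(3) by (simp add: \<mu>_def[symmetric] divide_le_eq algebra_simps)
qed

section \<open>Weak gradient and weak divergence\<close>

text \<open>Definiteness makes the map from \<open>x\<close> to the coefficients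
  \<open>B x b\<close> injective, and in finite dimension an injective linear map is
  surjective.\<close>

lemma finite_dim_riesz:
  fixes B :: "'a::euclidean_space \<Rightarrow> 'a \<Rightarrow> real"
  assumes l1: "\<And>y. linear (\<lambda>x. B x y)" and l2: "\<And>x. linear (B x)"
    and pos: "\<And>x. B x x = 0 \<Longrightarrow> x = 0" and l: "linear l"
  shows "\<exists>x. \<forall>y. B x y = l y"
proof -
  define T where "T x = (\<Sum>b\<in>Basis. B x b *\<^sub>R b)" for x
  have T: "linear T" unfolding T_def
    by (intro linear_compose_sum ballI linearI) (simp_all add: linear_add[OF l1] linear_scale[OF l1] scaleR_left_distrib)
  have Tb: "T x \<bullet> b = B x b" if "b \<in> Basis" for x b
    using that by (simp add: T_def inner_sum_left inner_Basis if_distrib sum.delta' cong: if_cong)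
  have ext: "g y = (\<Sum>b\<in>Basis. (y \<bullet> b) * g b)" if "linear g" for g :: "'a \<Rightarrow> real" and y
  proof -
    have "g y = g (\<Sum>b\<in>Basis. (y \<bullet> b) *\<^sub>R b)" by (simp add: euclidean_representation)
    also have "\<dots> = (\<Sum>b\<in>Basis. (y \<bullet> b) * g b)" by (simp add: linear_sum[OF that] linear_scale[OF that])
    finally show ?thesis .
  qed
  have "inj T" unfolding linear_injective_0[OF T]
  proof (intro allI impI)
    fix x assume "T x = 0"
    then have "B x b = 0" if "b \<in> Basis" for b using Tb[OF that, of x] by simp
    then have "B x x = 0" using ext[OF l2[of x], of x] by simp
    then show "x = 0" by (rule pos)
  qed
  then have "surj T" using linear_injective_imp_surjective[OF T] by blast
  then obtain x where x: "T x = (\<Sum>b\<in>Basis. l b *\<^sub>R b)" by (metis surjD)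
  have "B x b = l b" if "b \<in> Basis" for b
    using Tb[OF that, of x] that by (simp add: x inner_sum_left inner_Basis if_distrib sum.delta' cong: if_cong)
  then have "B x y = l y" for y using ext[OF l2[of x], of y] ext[OF l, of y] by simp
  then show ?thesis by blast
qed

text \<open>Affine fields are parametrised by the Euclidean space of their coefficients, on which
  \<open>finite_dim_riesz\<close> can act.\<close>

definition af :: "pt \<times> (real^2^2) \<Rightarrow> pt \<Rightarrow> pt" where "af p x = fst p + snd p *v x"

lemma af_nth: "af p x $ i = fst p $ i + (snd p $ i $ 1 * x $ 1 + snd p $ i $ 2 * x $ 2)"
  by (simp add: af_def matrix_vector_mult_def sum_2)

lemma af_add: "af (p + p') x = af p x + af p' x" and af_scale: "af (s *\<^sub>R p) x = s *\<^sub>R af p x"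
  by (simp_all add: pt_eq_iff af_nth algebra_simps)

lemma af_nth_C1: "C1 (\<lambda>x. af p x $ i)" unfolding af_nth by (intro C1_add C1_const C1_cmult C1_nth)

lemma pd_af_nth: "pd j (\<lambda>x. af p x $ i) = (\<lambda>x. snd p $ i $ j)"
proof -
  have "pd j (\<lambda>x. af p x $ i) = (\<lambda>x. snd p $ i $ 1 * (if j = 1 then 1 else 0) + snd p $ i $ 2 * (if j = 2 then 1 else 0))"
    unfolding af_nth by (subst pd_add[OF C1_const C1_add[OF C1_cmult[OF C1_nth] C1_cmult[OF C1_nth]]],
        subst pd_add[OF C1_cmult[OF C1_nth] C1_cmult[OF C1_nth]])
      (simp add: pd_const pd_cmult[OF C1_nth] pd_nth)
  also have "\<dots> = (\<lambda>x. snd p $ i $ j)" using two_cases[of j] by auto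
  finally show ?thesis .
qed

lemma af_cont [continuous_intros]: "continuous_on S f \<Longrightarrow> continuous_on S (\<lambda>x. af p (f x))"
proof -
  assume f: "continuous_on S f"
  have "continuous_on UNIV ((*v) (snd p))" by (rule linear_continuous_on) (rule matrix_vector_mul_bounded_linear)
  then have "continuous_on S (\<lambda>x. snd p *v f x)" by (rule continuous_on_compose2[OF _ f]) auto
  then show ?thesis unfolding af_def by (intro continuous_intros)
qed

lemma eI_cong: "(\<And>x. x \<in> closed_segment p q \<Longrightarrow> f x = g x) \<Longrightarrow> eI p q f = eI p q g"
  unfolding eI_def by (rule integral_cong) (auto intro: sg01_in)

lemma eI_add:
  assumes "continuous_on (closed_segment p q) f" "continuous_on (closed_segment p q) g"
  shows "eI p q (\<lambda>x. f x + g x) = eI p q f + eI p q g" "eI p q (\<lambda>x. f x - g x) = eI p q f - eI p q g"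
  unfolding eI_def using eI_int assms by (auto intro: integral_add integral_diff)

lemma eI_cmult: "eI p q (\<lambda>x. c * f x) = c * eI p q f" unfolding eI_def by simp

lemma eI_cmult2: "eI p q (\<lambda>x. f x * c) = eI p q f * c" unfolding eI_def by simp

lemma eI_const: "eI p q (\<lambda>x. c) = c" unfolding eI_def by simp

context tri
begin

lemma kint_add: "continuous_on UNIV f \<Longrightarrow> continuous_on UNIV g \<Longrightarrow> kint K (\<lambda>x. f x + g x) = kint K f + kint K g"
  and kint_diff: "continuous_on UNIV f \<Longrightarrow> continuous_on UNIV g \<Longrightarrow> kint K (\<lambda>x. f x - g x) = kint K f - kint K g"
  unfolding kint_def using cont_integrable_compact[OF _ compact_K] by auto

lemma kint_cmult: "kint K (\<lambda>x. s * f x) = s * kint K f" by (simp add: kint_def)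

lemma K_sets: "K \<in> sets lebesgue" using compact_lmeasurable[OF compact_K] by (rule fmeasurableD)

lemma kint_const: "kint K (\<lambda>x. s) = s * measure lebesgue K"
  using K_sets by (simp add: kint_def space_restrict_space measure_restrict_space)

lemma area: "measure lebesgue K = D / 2"
proof -
  have "((\<lambda>s. (1 - s) - 0) has_integral (1 - 1\<^sup>2 / 2) - (0 - 0\<^sup>2 / 2)) {0..1::real}"
    by (rule fundamental_theorem_of_calculus)
      (auto intro!: derivative_eq_intros simp flip: has_real_derivative_iff_has_vector_derivative)
  then have "kint S0 (pd 1 (\<lambda>z. z $ 1)) = 1 / 2"
    unfolding simplex_divergence[OF C1_nth] by (simp add: integral_unique)
  then have "kint S0 (\<lambda>z. 1) = 1 / 2" by (simp add: pd_nth)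
  then show ?thesis using kint_L[of "\<lambda>x. 1"] kint_const[of 1] by simp
qed

lemma interior_nonempty: "interior K \<noteq> {}"
proof -
  have "\<not> negligible K" using area D negligible_imp_measure0[of K] by auto
  then show ?thesis using negligible_convex_interior[OF convex_K] by simp
qed

lemma kint_sq_zero:
  assumes f: "continuous_on UNIV f" and z: "kint K (\<lambda>x. f x * f x) = 0" and x: "x \<in> interior K"
  shows "f x = 0"
proof -
  have i: "integrable (lebesgue_on K) (\<lambda>x. f x * f x)"
    by (intro cont_integrable_compact compact_K continuous_intros f)
  have "AE x in lebesgue_on K. f x * f x = 0" using z integral_nonneg_eq_0_iff_AE[OF i] by (simp add: kint_def)
  then have "AE x in lebesgue. x \<in> K \<longrightarrow> f x = 0" using K_sets by (simp add: AE_restrict_space_iff)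
  then have "AE x \<in> interior K in lebesgue. x \<in> {x. f x = 0}" by eventually_elim (use interior_subset in auto)
  moreover have "closed {x. f x = 0}" by (intro closed_Collect_eq f continuous_on_const)
  ultimately have "x \<in> {x. f x = 0}"
    by (intro mem_closed_if_AE_lebesgue_open[of "interior K" "{x. f x = 0}" x]) (use x in auto)
  then show ?thesis by simp
qed

lemma affine_zero:
  assumes "\<And>x. x \<in> interior K \<Longrightarrow> \<alpha> + (p * x $ 1 + q * x $ 2) = (0::real)"
  shows "\<alpha> = 0" "p = 0" "q = 0"
proof -
  obtain x e where x: "e > 0" "ball x e \<subseteq> interior K"
    using interior_nonempty open_contains_ball[of "interior K"] open_interior by fastforce
  have m: "x \<in> interior K" "x + (e/2) *\<^sub>R axis 1 1 \<in> interior K" "x + (e/2) *\<^sub>R axis 2 1 \<in> interior K"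
    using x by (auto simp: dist_norm intro!: subsetD[OF x(2)])
  have "p * (e / 2) = (\<alpha> + (p * (x + (e/2) *\<^sub>R axis 1 1) $ 1 + q * (x + (e/2) *\<^sub>R axis 1 1) $ 2)) - (\<alpha> + (p * x $ 1 + q * x $ 2))"
    "q * (e / 2) = (\<alpha> + (p * (x + (e/2) *\<^sub>R axis 2 1) $ 1 + q * (x + (e/2) *\<^sub>R axis 2 1) $ 2)) - (\<alpha> + (p * x $ 1 + q * x $ 2))"
    by (simp_all add: axis_def algebra_simps)
  then have "p * (e / 2) = 0" "q * (e / 2) = 0" unfolding assms[OF m(1)] assms[OF m(2)] assms[OF m(3)] by simp_all
  then show "p = 0" "q = 0" using x(1) by auto
  then show "\<alpha> = 0" using assms[OF m(1)] by simp
qed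

text \<open>Continuity on each edge makes edge integrals additive; discrete traces and restrictions
  of smooth functions both have it.\<close>

definition cb :: "(pt set \<Rightarrow> pt \<Rightarrow> 'a::topological_space) \<Rightarrow> bool" where
  "cb vb \<longleftrightarrow> (\<forall>e\<in>tri_edges K. continuous_on e (vb e))"

definition bdy :: "(pt set \<Rightarrow> pt \<Rightarrow> pt) \<Rightarrow> real" where
  "bdy F = (\<Sum>e\<in>tri_edges K. edge_int e (\<lambda>x. F e x \<bullet> outer_normal K e))"

lemma bdy_eI: "bdy F = eI a b (\<lambda>x. F (closed_segment a b) x \<bullet> rot (b - a))
    + eI b c (\<lambda>x. F (closed_segment b c) x \<bullet> rot (c - b)) + eI c a (\<lambda>x. F (closed_segment c a) x \<bullet> rot (a - c))"
  unfolding bdy_def by (rule boundary_sum[OF ccw])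

lemma edges: "tri_edges K = {closed_segment a b, closed_segment b c, closed_segment c a}" by (rule ccw_edges[OF ccw])

lemma bdy_add: "cb F \<Longrightarrow> cb G \<Longrightarrow> bdy (\<lambda>e x. F e x + G e x) = bdy F + bdy G"
  unfolding bdy_eI cb_def edges by (simp add: inner_add_left eI_add continuous_on_inner continuous_on_const)

lemma bdy_diff: "cb F \<Longrightarrow> cb G \<Longrightarrow> bdy (\<lambda>e x. F e x - G e x) = bdy F - bdy G"
  unfolding bdy_eI cb_def edges by (simp add: inner_diff_left eI_add continuous_on_inner continuous_on_const)

lemma bdy_scale: "bdy (\<lambda>e x. s *\<^sub>R F e x) = s * bdy F" unfolding bdy_eI by (simp add: eI_cmult distrib_left)

lemma bdy_scale2: "bdy (\<lambda>e x. w e x *\<^sub>R s *\<^sub>R F e x) = s * bdy (\<lambda>e x. w e x *\<^sub>R F e x)"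
  using bdy_scale[of s "\<lambda>e x. w e x *\<^sub>R F e x"] by (simp add: mult.commute)

lemma bdy_cong: "(\<And>e x. e \<in> tri_edges K \<Longrightarrow> x \<in> e \<Longrightarrow> F e x = G e x) \<Longrightarrow> bdy F = bdy G"
  unfolding bdy_eI edges by (intro arg_cong2[where f="(+)"] eI_cong) auto

lemma Gauss_bdy:
  assumes "\<And>i. C1 (\<lambda>x. F x $ i)"
  shows "kint K (\<lambda>x. \<Sum>i\<in>UNIV. pd i (\<lambda>x. F x $ i) x) = bdy (\<lambda>e. F)"
proof -
  have c: "continuous_on S (\<lambda>x. F x $ i * w)" for S i w by (intro continuous_intros C1_continuous[OF assms])
  have e: "eI p q (\<lambda>x. F x \<bullet> w) = eI p q (\<lambda>x. F x $ 1) * w $ 1 + eI p q (\<lambda>x. F x $ 2) * w $ 2" for p q w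
    unfolding inner_pt by (simp only: eI_add(1)[OF c c] eI_cmult2)
  have "kint K (\<lambda>x. \<Sum>i\<in>UNIV. pd i (\<lambda>x. F x $ i) x) = (\<Sum>i\<in>UNIV. kint K (pd i (\<lambda>x. F x $ i)))"
    by (simp add: sum_2 kint_add C1_continuous_pd[OF assms])
  also have "\<dots> = bdy (\<lambda>e. F)" unfolding bdy_eI sum_2 Gauss[OF assms] e by simp
  finally show ?thesis .
qed

lemma cb_af: "cb vb \<Longrightarrow> cb (\<lambda>e x. vb e x *\<^sub>R af p x)" unfolding cb_def by (auto intro!: continuous_intros)

lemma af_inner_cont: "continuous_on S (\<lambda>x. af p x \<bullet> af p' x)" by (intro continuous_intros)

lemma is_wgrad_iff: "is_wgrad K v0 vb G \<longleftrightarrow> (\<exists>p. G = af p) \<and> (\<forall>p. kint K (\<lambda>x. G x \<bullet> af p x)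
    = - kint K (\<lambda>x. v0 * (\<Sum>i\<in>UNIV. snd p $ i $ i)) + bdy (\<lambda>e x. vb e x *\<^sub>R af p x))"
  unfolding is_wgrad_def bdy_def af_def[abs_def] by (simp add: fun_eq_iff)

text \<open>The \<open>L^2\<close> product is definite on affine fields, since a field that vanishes
  on the interior of \<open>K\<close> has zero coefficients. This gives the \<open>THE\<close> in
  \<open>wgrad\<close> its meaning.\<close>

lemma is_wgrad_ex1:
  assumes vb: "cb vb"
  shows "\<exists>!G. is_wgrad K v0 vb G"
proof -
  let ?B = "\<lambda>p p'. kint K (\<lambda>x. af p x \<bullet> af p' x)"
  let ?l = "\<lambda>p. - kint K (\<lambda>x. v0 * (\<Sum>i\<in>UNIV. snd p $ i $ i)) + bdy (\<lambda>e x. vb e x *\<^sub>R af p x)"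
  have l1: "linear (\<lambda>p. ?B p p')" for p'
    by (intro linearI) (simp_all add: af_add af_scale inner_add_left kint_add af_inner_cont kint_cmult)
  have l2: "linear (?B p)" for p
    by (intro linearI) (simp_all add: af_add af_scale inner_add_right kint_add af_inner_cont kint_cmult)
  have l: "linear ?l" by (intro linearI)
      (simp_all add: kint_const af_add af_scale scaleR_add_right bdy_add cb_af vb sum_2 algebra_simps bdy_scale2 del: scaleR_scaleR)
  have pos: "p = 0" if z: "?B p p = 0" for p
  proof -
    have c: "continuous_on UNIV (\<lambda>x. norm (af p x))" by (intro continuous_intros)
    have "af p x = 0" if "x \<in> interior K" for x
      using kint_sq_zero[OF c _ that] z by (simp add: power2_norm_eq_inner flip: power2_eq_square)
    then have "fst p $ i + (snd p $ i $ 1 * x $ 1 + snd p $ i $ 2 * x $ 2) = 0" if "x \<in> interior K" for x i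
      using that by (simp add: af_nth[symmetric])
    from affine_zero[OF this] have "fst p $ i = 0 \<and> snd p $ i $ 1 = 0 \<and> snd p $ i $ 2 = 0" for i by blast
    then show "p = 0" by (simp add: prod_eq_iff vec_eq_iff forall_2)
  qed
  obtain p where p: "\<And>p'. ?B p p' = ?l p'" using finite_dim_riesz[OF l1 l2 pos l] by blast
  show ?thesis
  proof (rule ex1I[of _ "af p"])
    show "is_wgrad K v0 vb (af p)" unfolding is_wgrad_iff using p by blast
    fix G assume "is_wgrad K v0 vb G"
    then obtain p' where p': "G = af p'" "\<And>r. ?B p' r = ?l r" unfolding is_wgrad_iff by blast
    have "?B (p' - p) (p' - p) = ?B p' (p' - p) - ?B p (p' - p)" by (rule linear_diff[OF l1])
    then have "p' - p = 0" using p p'(2) by (intro pos) simp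
    then show "G = af p" using p'(1) by simp
  qed
qed

lemma wgrad_spec: "cb vb \<Longrightarrow> is_wgrad K v0 vb (wgrad K v0 vb)" unfolding wgrad_def by (rule theI'[OF is_wgrad_ex1])

lemma wgrad_unique: "cb vb \<Longrightarrow> is_wgrad K v0 vb G \<Longrightarrow> wgrad K v0 vb = G" using is_wgrad_ex1 wgrad_spec by blast

lemma wgrad_af: "cb vb \<Longrightarrow> \<exists>p. wgrad K v0 vb = af p" using wgrad_spec is_wgrad_iff by blast

lemma wgrad_eq: "cb vb \<Longrightarrow> kint K (\<lambda>x. wgrad K v0 vb x \<bullet> af p x)
    = - v0 * (\<Sum>i\<in>UNIV. snd p $ i $ i) * measure lebesgue K + bdy (\<lambda>e x. vb e x *\<^sub>R af p x)"
proof -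
  assume "cb vb"
  then have "\<forall>p. kint K (\<lambda>x. wgrad K v0 vb x \<bullet> af p x)
    = - kint K (\<lambda>x. v0 * (\<Sum>i\<in>UNIV. snd p $ i $ i)) + bdy (\<lambda>e x. vb e x *\<^sub>R af p x)"
    using wgrad_spec[of vb v0] unfolding is_wgrad_iff by blast
  then show ?thesis unfolding kint_const by (simp only: mult_minus_left)
qed

lemma wgrad_cont: "cb vb \<Longrightarrow> continuous_on S (wgrad K v0 vb)"
  using wgrad_af[of vb v0] by (auto intro!: continuous_intros)

lemma wgrad_diff:
  assumes "cb vb" "cb wb"
  shows "wgrad K (v0 - w0) (\<lambda>e x. vb e x - wb e x) = (\<lambda>x. wgrad K v0 vb x - wgrad K w0 wb x)"
proof (rule wgrad_unique)
  show "cb (\<lambda>e x. vb e x - wb e x)" using assms unfolding cb_def by (auto intro!: continuous_intros)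
  obtain p q where p: "wgrad K v0 vb = af p" and q: "wgrad K w0 wb = af q" using wgrad_af assms by metis
  have d: "(\<lambda>x. af p x - af q x) = af (p - q)" by (rule ext) (simp add: pt_eq_iff af_nth algebra_simps)
  show "is_wgrad K (v0 - w0) (\<lambda>e x. vb e x - wb e x) (\<lambda>x. wgrad K v0 vb x - wgrad K w0 wb x)" unfolding is_wgrad_iff
  proof (intro conjI allI)
    show "\<exists>p. (\<lambda>x. wgrad K v0 vb x - wgrad K w0 wb x) = af p" unfolding p q d by blast
    fix r
    have "kint K (\<lambda>x. (wgrad K v0 vb x - wgrad K w0 wb x) \<bullet> af r x)
        = kint K (\<lambda>x. wgrad K v0 vb x \<bullet> af r x) - kint K (\<lambda>x. wgrad K w0 wb x \<bullet> af r x)"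
      unfolding p q inner_diff_left by (rule kint_diff[OF af_inner_cont af_inner_cont])
    then show "kint K (\<lambda>x. (wgrad K v0 vb x - wgrad K w0 wb x) \<bullet> af r x)
        = - kint K (\<lambda>x. (v0 - w0) * (\<Sum>i\<in>UNIV. snd r $ i $ i)) + bdy (\<lambda>e x. (vb e x - wb e x) *\<^sub>R af r x)"
      by (simp add: wgrad_eq assms kint_const scaleR_diff_left bdy_diff cb_af algebra_simps)
  qed
qed

section \<open>The weak divergence\<close>

definition as :: "real \<times> pt \<Rightarrow> pt \<Rightarrow> real" where "as p x = fst p + snd p \<bullet> x"

lemma as_cont [continuous_intros]: "continuous_on S f \<Longrightarrow> continuous_on S (\<lambda>x. as p (f x))"
  unfolding as_def by (intro continuous_intros)

lemma is_wdiv_iff: "is_wdiv K v0 vb d \<longleftrightarrow> (\<exists>p. d = as p) \<and> (\<forall>p. kint K (\<lambda>x. d x * as p x)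
    = - kint K (\<lambda>x. v0 \<bullet> snd p) + bdy (\<lambda>e x. as p x *\<^sub>R vb e x))"
  unfolding is_wdiv_def bdy_def as_def[abs_def] by (simp add: fun_eq_iff mult.commute)

lemma is_wdiv_ex1:
  assumes vb: "cb vb"
  shows "\<exists>!d. is_wdiv K v0 vb d"
proof -
  let ?B = "\<lambda>p p'. kint K (\<lambda>x. as p x * as p' x)"
  let ?l = "\<lambda>p. - kint K (\<lambda>x. v0 \<bullet> snd p) + bdy (\<lambda>e x. as p x *\<^sub>R vb e x)"
  have as_add: "as (p + p') x = as p x + as p' x" and as_scale: "as (s *\<^sub>R p) x = s * as p x" for p p' x s
    by (simp_all add: as_def inner_add_left algebra_simps)
  have cc: "continuous_on UNIV (\<lambda>x. as p x * as p' x)" for p p' by (intro continuous_intros)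
  have cv: "cb (\<lambda>e x. as p x *\<^sub>R vb e x)" for p using vb unfolding cb_def by (auto intro!: continuous_intros)
  have l1: "linear (\<lambda>p. ?B p p')" for p'
    by (intro linearI) (simp_all add: as_add as_scale distrib_right kint_add cc kint_cmult mult.assoc)
  have l2: "linear (?B p)" for p
    by (intro linearI) (simp_all add: as_add as_scale distrib_left kint_add cc kint_cmult mult.left_commute)
  have l: "linear ?l" by (intro linearI)
      (simp_all add: kint_const as_add as_scale scaleR_add_left bdy_add cv inner_add_right algebra_simps bdy_scale flip: scaleR_scaleR)
  have pos: "p = 0" if z: "?B p p = 0" for p
  proof -
    have c: "continuous_on UNIV (as p)" using as_cont[OF continuous_on_id] by simp
    have "fst p + (snd p $ 1 * x $ 1 + snd p $ 2 * x $ 2) = 0" if "x \<in> interior K" for x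
      using kint_sq_zero[OF c z that] by (simp add: as_def inner_pt)
    from affine_zero[OF this] have "fst p = 0 \<and> snd p $ 1 = 0 \<and> snd p $ 2 = 0" by blast
    then show "p = 0" by (simp add: prod_eq_iff vec_eq_iff forall_2)
  qed
  obtain p where p: "\<And>p'. ?B p p' = ?l p'" using finite_dim_riesz[OF l1 l2 pos l] by blast
  show ?thesis
  proof (rule ex1I[of _ "as p"])
    show "is_wdiv K v0 vb (as p)" unfolding is_wdiv_iff using p by blast
    fix d assume "is_wdiv K v0 vb d"
    then obtain p' where p': "d = as p'" "\<And>r. ?B p' r = ?l r" unfolding is_wdiv_iff by blast
    have "?B (p' - p) (p' - p) = ?B p' (p' - p) - ?B p (p' - p)" by (rule linear_diff[OF l1])
    then have "p' - p = 0" using p p'(2) by (intro pos) simp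
    then show "d = as p" using p'(1) by simp
  qed
qed

lemma kint_wdiv:
  assumes "cb vb" shows "kint K (\<lambda>x. wdiv K v0 vb x) = bdy vb"
proof -
  have "is_wdiv K v0 vb (wdiv K v0 vb)" unfolding wdiv_def by (rule theI'[OF is_wdiv_ex1[OF assms]])
  then have "kint K (\<lambda>x. wdiv K v0 vb x * as (1, 0) x) = - kint K (\<lambda>x. v0 \<bullet> snd (1::real, 0)) + bdy (\<lambda>e x. as (1, 0) x *\<^sub>R vb e x)"
    unfolding is_wdiv_iff by blast
  then show ?thesis by (simp add: as_def kint_const)
qed

text \<open>Tested with constants, both the weak divergence and the trace of the weak gradient
  return the boundary flux. Agreement of cell integrals is enough because discrete pressures are
  piecewise constant.\<close>

lemma kint_wdiv_trace:
  assumes "cb vb"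
  shows "kint K (\<lambda>x. wdiv K v0 vb x) = kint K (\<lambda>x. \<Sum>i\<in>UNIV. wgradv K v0 vb x $ i $ i)"
proof -
  have c: "cb (\<lambda>e x. vb e x $ i)" for i using assms unfolding cb_def by (auto intro!: continuous_intros)
  have "kint K (\<lambda>x. wgradv K v0 vb x $ i $ i) = bdy (\<lambda>e x. vb e x $ i *\<^sub>R axis i 1)" for i
    using wgrad_eq[OF c, of "v0 $ i" i "(axis i 1, 0)"] by (simp add: wgradv_def af_def inner_axis)
  moreover have "continuous_on UNIV (\<lambda>x. wgradv K v0 vb x $ i $ i)" for i
    using wgrad_cont[OF c] by (auto simp: wgradv_def intro!: continuous_intros)
  moreover have "bdy (\<lambda>e x. vb e x $ 1 *\<^sub>R axis 1 1) + bdy (\<lambda>e x. vb e x $ 2 *\<^sub>R axis 2 1) = bdy vb"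
  proof -
    have "cb (\<lambda>e x. vb e x $ i *\<^sub>R axis i 1 :: pt)" for i
      using c[of i] unfolding cb_def by (intro ballI continuous_on_scaleR continuous_on_const) (rule bspec)
    then have "bdy (\<lambda>e x. vb e x $ 1 *\<^sub>R axis 1 1) + bdy (\<lambda>e x. vb e x $ 2 *\<^sub>R axis 2 1)
        = bdy (\<lambda>e x. vb e x $ 1 *\<^sub>R axis 1 1 + vb e x $ 2 *\<^sub>R axis 2 1)" by (simp add: bdy_add)
    also have "\<dots> = bdy vb" by (rule bdy_cong) (simp add: pt_eq_iff axis_def)
    finally show ?thesis .
  qed
  ultimately show ?thesis by (simp add: kint_wdiv[OF assms] sum_2 kint_add)
qed

end

section \<open>Consistency on one triangle\<close>

definition grad :: "(pt \<Rightarrow> real) \<Rightarrow> pt \<Rightarrow> pt" where "grad g x = (\<chi> i. pd i g x)"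

lemma grad_nth [simp]: "grad g x $ i = pd i g x" by (simp add: grad_def)

lemma grad_cont: "C1 g \<Longrightarrow> continuous_on S (grad g)"
  unfolding grad_def by (intro continuous_on_vec_lambda C1_continuous_pd)

lemma norm_grad_sq: "(norm (grad g x))\<^sup>2 = (\<Sum>i\<in>UNIV. (pd i g x)\<^sup>2)"
  unfolding power2_norm_eq_inner inner_pt by (simp add: sum_2 power2_eq_square)

lemma grad_mult_div:
  assumes "C1 g" "\<And>i. C1 (\<lambda>x. q x $ i)"
  shows "(\<Sum>i\<in>UNIV. pd i (\<lambda>x. (g x *\<^sub>R q x) $ i) x) = grad g x \<bullet> q x + g x * (\<Sum>i\<in>UNIV. pd i (\<lambda>x. q x $ i) x)"
  by (simp add: pd_mult[OF assms] sum_2 inner_pt algebra_simps)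

definition affine_on :: "pt set \<Rightarrow> (pt \<Rightarrow> real) \<Rightarrow> bool" where
  "affine_on e f \<longleftrightarrow> (\<exists>\<alpha> \<beta>. \<forall>x\<in>e. f x = \<alpha> + \<beta> \<bullet> x)"

lemma affine_on_cont: "affine_on e f \<Longrightarrow> continuous_on e f"
proof -
  assume "affine_on e f"
  then obtain \<alpha> \<beta> where *: "\<And>x. x \<in> e \<Longrightarrow> f x = \<alpha> + \<beta> \<bullet> x" by (auto simp: affine_on_def)
  have "continuous_on e (\<lambda>x. \<alpha> + \<beta> \<bullet> x)" by (intro continuous_intros)
  then show ?thesis using * by (simp cong: continuous_on_cong)
qed

lemma integral_quad: "integral {0..1} (\<lambda>t::real. \<alpha> + \<beta> * t + \<gamma> * t\<^sup>2) = \<alpha> + \<beta> / 2 + \<gamma> / 3"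
proof -
  have "((\<lambda>t::real. \<alpha> + \<beta> * t + \<gamma> * t\<^sup>2) has_integral (\<alpha> * 1 + \<beta> / 2 * 1\<^sup>2 + \<gamma> / 3 * 1 ^ 3) - (\<alpha> * 0 + \<beta> / 2 * 0\<^sup>2 + \<gamma> / 3 * 0 ^ 3)) {0..1}"
    by (rule fundamental_theorem_of_calculus)
      (auto intro!: derivative_eq_intros simp flip: has_real_derivative_iff_has_vector_derivative)
  then show ?thesis by (simp add: integral_unique)
qed

lemma affine_sg01: "\<alpha> + \<beta> \<bullet> sg01 p q t = (1 - t) * (\<alpha> + \<beta> \<bullet> p) + t * (\<alpha> + \<beta> \<bullet> q)"
  by (simp add: sg01_def inner_add_right algebra_simps)

context tri
begin

abbreviation "MK \<equiv> lebesgue_on K"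

lemma fin_MK: "finite_measure MK" by (rule finite_measure_lebesgue_on[OF compact_lmeasurable[OF compact_K]])

lemma csq: "continuous_on UNIV f \<Longrightarrow> sq_int MK f" by (rule cont_sq_compact[OF _ compact_K])

lemma n2_bound:
  assumes "continuous_on UNIV f" "\<And>x. x \<in> K \<Longrightarrow> \<bar>f x\<bar> \<le> B" "0 \<le> B"
  shows "n2 MK f \<le> B * sqrt (D / 2)"
proof -
  interpret finite_measure MK by (rule fin_MK)
  have "(\<integral>x. (f x)\<^sup>2 \<partial>MK) \<le> (\<integral>x. B\<^sup>2 \<partial>MK)"
  proof (rule integral_mono)
    show "integrable MK (\<lambda>x. (f x)\<^sup>2)" using csq[OF assms(1)] by (simp add: sq_int_def)
    fix x assume "x \<in> space MK"
    then have "\<bar>f x\<bar> \<le> \<bar>B\<bar>" using assms(2)[of x] assms(3) by simp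
    then show "(f x)\<^sup>2 \<le> B\<^sup>2" by (simp add: abs_le_square_iff)
  qed simp
  also have "\<dots> = B\<^sup>2 * (D / 2)" using kint_const[of "B\<^sup>2"] by (simp add: kint_def area)
  finally have "n2 MK f \<le> sqrt (B\<^sup>2 * (D / 2))" by (simp add: n2_def)
  then show ?thesis using assms(3) by (simp only: real_sqrt_mult real_sqrt_abs abs_of_nonneg)
qed

abbreviation vn :: "(pt \<Rightarrow> pt) \<Rightarrow> real" where "vn F \<equiv> n2 MK (\<lambda>x. norm (F x))"

lemma kint_inner_CS:
  fixes F H :: "pt \<Rightarrow> pt"
  assumes "continuous_on UNIV F" "continuous_on UNIV H"
  shows "\<bar>kint K (\<lambda>x. F x \<bullet> H x)\<bar> \<le> vn F * vn H"
proof -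
  have c: "continuous_on UNIV (\<lambda>x. F x \<bullet> H x)" "continuous_on UNIV (\<lambda>x. norm (F x))" "continuous_on UNIV (\<lambda>x. norm (H x))"
    by (intro continuous_intros assms)+
  have "\<bar>kint K (\<lambda>x. F x \<bullet> H x)\<bar> \<le> (\<integral>x. \<bar>F x \<bullet> H x\<bar> \<partial>MK)" unfolding kint_def by (rule integral_abs_bound)
  also have "\<dots> \<le> (\<integral>x. norm (F x) * norm (H x) \<partial>MK)"
    by (rule integral_mono) (auto intro!: cont_integrable_compact continuous_intros assms compact_K Cauchy_Schwarz_ineq2)
  also have "\<dots> \<le> vn F * vn H" using n2_CS[OF csq[OF c(2)] csq[OF c(3)]] by simp
  finally show ?thesis .
qed

text \<open>\<open>la\<close> and \<open>lb\<close> are the barycentric coordinates belonging to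
  \<open>a\<close> and \<open>b\<close>; each vanishes on the opposite edge.\<close>

definition la :: "pt \<Rightarrow> real" where "la x = cr (c - b) (x - b) / D"
definition lb :: "pt \<Rightarrow> real" where "lb x = cr (a - c) (x - c) / D"

lemma la_lb_K: assumes "x \<in> K" shows "0 \<le> la x" "0 \<le> lb x" "la x + lb x \<le> 1"
proof -
  show "0 \<le> la x" "0 \<le> lb x"
    using ccw_halfplane[OF ccw_cyc[OF ccw] assms] ccw_halfplane[OF ccw_cyc[OF ccw_cyc[OF ccw]] assms] D
    by (simp_all add: la_def lb_def)
  have "cr (c - b) (x - b) + cr (a - c) (x - c) = D - cr (b - a) (x - a)" by (simp add: D_def cr_def algebra_simps)
  then have "la x + lb x = (D - cr (b - a) (x - a)) / D" by (simp add: la_def lb_def add_divide_distrib[symmetric])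
  then show "la x + lb x \<le> 1" using ccw_halfplane[OF ccw assms] D by (simp add: divide_le_eq)
qed

text \<open>The Brezzi--Douglas--Marini field whose normal component is affine on the edge \<open>a b\<close>, with
  end values \<open>wa\<close>, \<open>wb\<close>, and vanishes on the two other edges.\<close>

lemma lifting:
  fixes wa wb h :: real
  assumes h: "\<And>x y. x \<in> K \<Longrightarrow> y \<in> K \<Longrightarrow> norm (x - y) \<le> h"
  shows "\<exists>p. (\<forall>x\<in>K. norm (af p x) \<le> (\<bar>wa\<bar> + \<bar>wb\<bar>) * h / D)
    \<and> (\<Sum>i\<in>UNIV. snd p $ i $ i) = (wa + wb) / D
    \<and> (\<forall>F. bdy (\<lambda>e x. F e x *\<^sub>R af p x) = eI a b (\<lambda>x. F (closed_segment a b) x * (wa * la x + wb * lb x)))"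
proof -
  \<comment> \<open>Writes \<open>cr u (x - z)\<close> as a constant plus a linear functional of
    \<open>x\<close>, in order to read off the coefficients of the lifting.\<close>
  define lfun where "lfun u z = (- cr u z, (\<chi> j. if j = 1 then - u $ 2 else u $ 1) :: pt)" for u z :: pt
  have lf: "cr u (x - z) = fst (lfun u z) + snd (lfun u z) \<bullet> x" for u x z
    by (simp add: lfun_def cr_def inner_pt algebra_simps)
  define \<alpha>1 \<beta>1 \<alpha>2 \<beta>2 where "\<alpha>1 = fst (lfun (c - b) b)" and "\<beta>1 = snd (lfun (c - b) b)"
    and "\<alpha>2 = fst (lfun (a - c) c)" and "\<beta>2 = snd (lfun (a - c) c)"
  define k1 k2 where "k1 = wa / D\<^sup>2" and "k2 = wb / D\<^sup>2"
  \<comment> \<open>The part with \<open>la\<close> points along the edge \<open>c a\<close>, so it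
    has no normal component there, and \<open>la\<close> vanishes on \<open>b c\<close>; the other
    part is the mirror image. Only the edge \<open>a b\<close> retains a normal component.\<close>
  define p where "p = ((k1 * \<alpha>1) *\<^sub>R (a - c) + (k2 * \<alpha>2) *\<^sub>R (b - c),
     (\<chi> i j. k1 * (a - c) $ i * \<beta>1 $ j + k2 * (b - c) $ i * \<beta>2 $ j) :: real^2^2)"
  have q: "af p x = (wa * la x / D) *\<^sub>R (a - c) + (wb * lb x / D) *\<^sub>R (b - c)" for x
  proof -
    have "la x = (\<alpha>1 + \<beta>1 \<bullet> x) / D" "lb x = (\<alpha>2 + \<beta>2 \<bullet> x) / D"
      by (simp_all add: la_def lb_def lf \<alpha>1_def \<alpha>2_def \<beta>1_def \<beta>2_def)
    then have "wa * la x / D = k1 * (\<alpha>1 + \<beta>1 \<bullet> x)" "wb * lb x / D = k2 * (\<alpha>2 + \<beta>2 \<bullet> x)"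
      by (simp_all add: k1_def k2_def power2_eq_square)
    then show ?thesis unfolding pt_eq_iff af_nth p_def by (simp add: inner_pt algebra_simps)
  qed
  have in_K: "a \<in> K" "b \<in> K" "c \<in> K" unfolding K by (auto intro: hull_inc)
  show ?thesis
  proof (intro exI[of _ p] conjI ballI allI)
    fix x assume x: "x \<in> K"
    note l = la_lb_K[OF x]
    have "norm (af p x) \<le> norm ((wa * la x / D) *\<^sub>R (a - c)) + norm ((wb * lb x / D) *\<^sub>R (b - c))"
      unfolding q by (rule norm_triangle_ineq)
    also have "\<dots> = (\<bar>wa\<bar> / D) * (la x * norm (a - c)) + (\<bar>wb\<bar> / D) * (lb x * norm (b - c))"
      using l D by (simp add: abs_mult)
    also have "\<dots> \<le> (\<bar>wa\<bar> / D) * (1 * h) + (\<bar>wb\<bar> / D) * (1 * h)"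
      using l D h[OF in_K(1,3)] h[OF in_K(2,3)] by (intro add_mono mult_left_mono mult_mono) auto
    finally show "norm (af p x) \<le> (\<bar>wa\<bar> + \<bar>wb\<bar>) * h / D" by (simp add: add_divide_distrib distrib_right)
  next
    have 1: "(a - c) \<bullet> \<beta>1 = D" "(b - c) \<bullet> \<beta>2 = D"
      by (simp_all add: \<beta>1_def \<beta>2_def lfun_def inner_pt D_def cr_def algebra_simps)
    have "(\<Sum>i\<in>UNIV. snd p $ i $ i) = k1 * ((a - c) \<bullet> \<beta>1) + k2 * ((b - c) \<bullet> \<beta>2)"
      by (simp add: p_def sum_2 inner_pt algebra_simps)
    then show "(\<Sum>i\<in>UNIV. snd p $ i $ i) = (wa + wb) / D"
      using D unfolding 1 by (simp add: k1_def k2_def power2_eq_square add_divide_distrib)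
  next
    fix F :: "pt set \<Rightarrow> pt \<Rightarrow> real"
    have ab: "af p x \<bullet> rot (b - a) = wa * la x + wb * lb x" for x
    proof -
      have "(a - c) \<bullet> rot (b - a) = D" "(b - c) \<bullet> rot (b - a) = D"
        by (simp_all add: inner_pt D_def cr_def algebra_simps)
      then show ?thesis using D by (simp add: q inner_add_left)
    qed
    have bc: "af p x \<bullet> rot (c - b) = 0" if x: "x \<in> closed_segment b c" for x
    proof -
      obtain t where "x - b = t *\<^sub>R (c - b)" using segment_minus[OF x] by blast
      then have "la x = 0" by (simp add: la_def)
      moreover have "(b - c) \<bullet> rot (c - b) = 0" by (simp add: inner_pt algebra_simps)
      ultimately show ?thesis by (simp add: q)
    qed
    have ca: "af p x \<bullet> rot (a - c) = 0" if x: "x \<in> closed_segment c a" for x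
    proof -
      obtain t where "x - c = t *\<^sub>R (a - c)" using segment_minus[OF x] by blast
      then have "lb x = 0" by (simp add: lb_def)
      moreover have "(a - c) \<bullet> rot (a - c) = 0" by (simp add: inner_pt algebra_simps)
      ultimately show ?thesis by (simp add: q)
    qed
    have "eI b c (\<lambda>x. F (closed_segment b c) x * (af p x \<bullet> rot (c - b))) = eI b c (\<lambda>x. 0)"
      by (rule eI_cong) (simp add: bc)
    moreover have "eI c a (\<lambda>x. F (closed_segment c a) x * (af p x \<bullet> rot (a - c))) = eI c a (\<lambda>x. 0)"
      by (rule eI_cong) (simp add: ca)
    ultimately show "bdy (\<lambda>e x. F e x *\<^sub>R af p x) = eI a b (\<lambda>x. F (closed_segment a b) x * (wa * la x + wb * lb x))"
      unfolding bdy_eI by (simp add: ab eI_const)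
  qed
qed

text \<open>The lifting \<open>p\<close> of the edge function \<open>w\<close> is used twice:
  testing \<open>I1\<close> with it bounds the size of \<open>w\<close> by the norm of
  \<open>G\<close>, and the divergence theorem for \<open>g\<close> times \<open>p\<close> turns the
  edge pairing into cell integrals.\<close>

lemma edge_estimate:
  assumes h: "\<And>x y. x \<in> K \<Longrightarrow> y \<in> K \<Longrightarrow> norm (x - y) \<le> h"
    and G: "continuous_on UNIV G"
    and w: "affine_on (closed_segment a b) (w (closed_segment a b))"
    and I1: "\<And>p. kint K (\<lambda>x. G x \<bullet> af p x) = bdy (\<lambda>e x. w e x *\<^sub>R af p x)"
    and g: "C1 g" and Pg: "n2 MK g \<le> 2 * h * vn (grad g)"
  shows "\<bar>eI a b (\<lambda>x. w (closed_segment a b) x * g x)\<bar>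
    \<le> 24 * (h\<^sup>2 / D) * vn G * vn (grad g)"
proof -
  let ?e = "closed_segment a b"
  define N where "N = vn G"
  define E where "E = vn (grad g)"
  define s where "s = sqrt (D / 2)"
  have s: "s > 0" "s * s = D / 2" using D by (simp_all add: s_def)
  have NE: "N \<ge> 0" "E \<ge> 0" by (simp_all add: N_def E_def)
  have h0: "h \<ge> 0" using h[of a a] by (simp add: K hull_inc)
  obtain \<alpha> \<beta> where \<alpha>\<beta>: "\<And>x. x \<in> ?e \<Longrightarrow> w ?e x = \<alpha> + \<beta> \<bullet> x" using w by (auto simp: affine_on_def)
  define wa wb where "wa = \<alpha> + \<beta> \<bullet> a" and "wb = \<alpha> + \<beta> \<bullet> b"
  obtain p where p: "\<forall>x\<in>K. norm (af p x) \<le> (\<bar>wa\<bar> + \<bar>wb\<bar>) * h / D"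
    "(\<Sum>i\<in>UNIV. snd p $ i $ i) = (wa + wb) / D"
    "\<forall>F. bdy (\<lambda>e x. F e x *\<^sub>R af p x) = eI a b (\<lambda>x. F ?e x * (wa * la x + wb * lb x))"
    using lifting[of h wa wb] h by blast
  have ws: "w ?e (sg01 a b t) = (1 - t) * wa + t * wb" if "t \<in> {0..1}" for t
    using \<alpha>\<beta>[OF sg01_in[of t a b]] that affine_sg01[of \<alpha> \<beta> a b t] by (simp add: wa_def wb_def)
  have ls: "wa * la (sg01 a b t) + wb * lb (sg01 a b t) = (1 - t) * wa + t * wb" for t
  proof -
    have "cr (c - b) (sg01 a b t - b) = (1 - t) * D" "cr (a - c) (sg01 a b t - c) = t * D"
      by (simp_all add: sg01_def D_def cr_def algebra_simps)
    then show ?thesis using D by (simp add: la_def lb_def)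
  qed
  have lw: "eI a b (\<lambda>x. f x * (wa * la x + wb * lb x)) = eI a b (\<lambda>x. w ?e x * f x)" for f
    unfolding eI_def by (rule integral_cong) (simp add: ws ls)
  \<comment> \<open>The mean of \<open>w^2\<close> over the edge is at least \<open>m^2 / 4\<close>,
    while the lifting has size proportional to \<open>m\<close>. The resulting inequality between
    \<open>m^2\<close> and a multiple of \<open>m\<close> can be divided by
    \<open>m\<close>.\<close>
  define m where "m = max \<bar>wa\<bar> \<bar>wb\<bar>"
  have m0: "m \<ge> 0" by (simp add: m_def)
  define B where "B = 2 * m * h / D"
  have B0: "B \<ge> 0" using m0 h0 D by (simp add: B_def)
  have pB: "norm (af p x) \<le> B" if "x \<in> K" for x
  proof -
    have "(\<bar>wa\<bar> + \<bar>wb\<bar>) * h / D \<le> 2 * m * h / D"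
      using h0 D by (intro divide_right_mono mult_right_mono) (auto simp: m_def)
    then show ?thesis using bspec[OF p(1) that] by (simp add: B_def)
  qed
  have afc: "continuous_on UNIV (af p)" using af_cont[OF continuous_on_id] by simp
  have nq: "vn (af p) \<le> B * s" unfolding s_def by (rule n2_bound) (use pB B0 afc in \<open>auto intro!: continuous_intros\<close>)
  have "m\<^sup>2 / 4 \<le> (wa\<^sup>2 + wa * wb + wb\<^sup>2) / 3"
  proof -
    have "0 \<le> (wa + 2 * wb)\<^sup>2" "0 \<le> (2 * wa + wb)\<^sup>2" by simp_all
    then have "3 * wa\<^sup>2 \<le> 4 * (wa\<^sup>2 + wa * wb + wb\<^sup>2)" "3 * wb\<^sup>2 \<le> 4 * (wa\<^sup>2 + wa * wb + wb\<^sup>2)"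
      by (simp_all add: power2_eq_square algebra_simps)
    moreover have "m\<^sup>2 = wa\<^sup>2 \<or> m\<^sup>2 = wb\<^sup>2" by (auto simp: m_def max_def)
    ultimately show ?thesis by auto
  qed
  also have "\<dots> = eI a b (\<lambda>x. w ?e x * w ?e x)"
  proof -
    have "eI a b (\<lambda>x. w ?e x * w ?e x) = integral {0..1} (\<lambda>t. wa\<^sup>2 + (2 * wa * (wb - wa)) * t + (wb - wa)\<^sup>2 * t\<^sup>2)"
      unfolding eI_def by (rule integral_cong) (simp add: ws power2_eq_square algebra_simps)
    moreover have "wa\<^sup>2 + 2 * wa * (wb - wa) / 2 + (wb - wa)\<^sup>2 / 3 = (wa\<^sup>2 + wa * wb + wb\<^sup>2) / 3"
      by (simp add: power2_eq_square field_simps)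
    ultimately show ?thesis unfolding integral_quad by simp
  qed
  also have "\<dots> = kint K (\<lambda>x. G x \<bullet> af p x)" unfolding I1 spec[OF p(3)] lw by simp
  also have "\<dots> \<le> N * (B * s)" using kint_inner_CS[OF G afc] mult_left_mono[OF nq NE(1)] by (simp add: N_def)
  finally have mm: "m * m \<le> m * (8 * N * h * s / D)" by (simp add: B_def power2_eq_square field_simps)
  define X where "X = 8 * N * h * s / D"
  have "X \<ge> 0" using NE h0 s D by (simp add: X_def)
  moreover have "m * m \<le> m * X" using mm by (simp add: X_def)
  ultimately have mb: "m \<le> 8 * N * h * s / D"
    unfolding X_def[symmetric] using m0 by (cases "m = 0") (auto simp: mult_le_cancel_left)
  have gc: "continuous_on UNIV g" "continuous_on UNIV (grad g)" using C1_continuous[OF g] grad_cont[OF g] .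
  define \<tau> where "\<tau> = (wa + wb) / D"
  have "eI a b (\<lambda>x. w ?e x * g x) = bdy (\<lambda>e x. g x *\<^sub>R af p x)" unfolding spec[OF p(3), of "\<lambda>e. g"] lw ..
  also have "\<dots> = kint K (\<lambda>x. \<Sum>i\<in>UNIV. pd i (\<lambda>x. (g x *\<^sub>R af p x) $ i) x)"
    by (rule Gauss_bdy[symmetric]) (simp add: C1_mult[OF g af_nth_C1])
  also have "\<dots> = kint K (\<lambda>x. grad g x \<bullet> af p x + \<tau> * g x)"
    unfolding grad_mult_div[OF g af_nth_C1] pd_af_nth p(2) \<tau>_def by (simp add: mult.commute)
  also have "\<dots> = kint K (\<lambda>x. grad g x \<bullet> af p x) + \<tau> * kint K g"
    by (subst kint_add) (auto intro!: continuous_intros gc simp: kint_cmult)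
  finally have eq: "eI a b (\<lambda>x. w ?e x * g x) = kint K (\<lambda>x. grad g x \<bullet> af p x) + \<tau> * kint K g" .
  have 1: "\<bar>kint K (\<lambda>x. grad g x \<bullet> af p x)\<bar> \<le> E * (B * s)"
    using kint_inner_CS[OF gc(2) afc] mult_left_mono[OF nq NE(2)] by (simp add: E_def)
  have 2: "\<bar>\<tau> * kint K g\<bar> \<le> (2 * m / D) * ((2 * h * E) * s)"
  proof -
    have "\<bar>wa + wb\<bar> \<le> 2 * m" by (auto simp: m_def)
    then have "\<bar>\<tau>\<bar> \<le> 2 * m / D" using D by (simp add: \<tau>_def divide_right_mono)
    moreover have "\<bar>kint K g\<bar> \<le> n2 MK g * n2 MK (\<lambda>x. 1)"
      using n2_CS[OF csq[OF gc(1)] csq[OF continuous_on_const, of 1]] by (simp add: kint_def)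
    moreover have "n2 MK g * n2 MK (\<lambda>x. 1) \<le> (2 * h * E) * s"
      using n2_bound[of "\<lambda>x. 1" 1] Pg h0 NE by (intro mult_mono) (auto simp: s_def E_def)
    ultimately show ?thesis unfolding abs_mult by (intro mult_mono) (use m0 D in auto)
  qed
  have "\<bar>eI a b (\<lambda>x. w ?e x * g x)\<bar> \<le> E * (B * s) + (2 * m / D) * ((2 * h * E) * s)"
    using 1 2 unfolding eq by linarith
  also have "\<dots> = m * (6 * h * E * s / D)" using D by (simp add: B_def field_simps)
  also have "\<dots> \<le> (8 * N * h * s / D) * (6 * h * E * s / D)" using mb h0 NE s D by (intro mult_right_mono) auto
  also have "\<dots> = 48 * N * h\<^sup>2 * E * (s * s) / D\<^sup>2" by (simp add: power2_eq_square)
  also have "\<dots> = 24 * (h\<^sup>2 / D) * N * E" unfolding s(2) using D by (simp add: power2_eq_square)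
  finally show ?thesis by (simp add: N_def E_def)
qed

lemma Poincare_K:
  assumes g: "C1 g" and h: "\<And>x y. x \<in> K \<Longrightarrow> y \<in> K \<Longrightarrow> norm (x - y) \<le> h"
  shows "n2 MK (\<lambda>x. g x - kint K g / measure lebesgue K) \<le> 2 * h * vn (grad g)"
proof -
  have h0: "h \<ge> 0" using h[of a a] by (simp add: K hull_inc)
  have "(n2 MK (\<lambda>x. g x - kint K g / measure lebesgue K))\<^sup>2 \<le> 2 * h\<^sup>2 * (vn (grad g))\<^sup>2"
  proof -
    have "measure lebesgue K > 0" using area D by simp
    from Poincare_convex[OF g compact_K convex_K this h] show ?thesis by (simp add: n2_sq norm_grad_sq kint_def)
  qed
  also have "\<dots> \<le> 4 * h\<^sup>2 * (vn (grad g))\<^sup>2" by (intro mult_right_mono) auto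
  also have "\<dots> = (2 * h * vn (grad g))\<^sup>2" by (simp add: power_mult_distrib)
  finally show ?thesis by (rule power2_le_imp_le) (use h0 in simp)
qed

lemma edge_estimate_ccw:
  assumes pqr: "ccw K p q r"
    and h: "\<And>x y. x \<in> K \<Longrightarrow> y \<in> K \<Longrightarrow> norm (x - y) \<le> h"
    and G: "continuous_on UNIV G"
    and w: "\<And>e. e \<in> tri_edges K \<Longrightarrow> affine_on e (w e)"
    and I1: "\<And>p. kint K (\<lambda>x. G x \<bullet> af p x) = bdy (\<lambda>e x. w e x *\<^sub>R af p x)"
    and g: "C1 g" and Pg: "n2 MK g \<le> 2 * h * vn (grad g)"
  shows "\<bar>eI p q (\<lambda>x. w (closed_segment p q) x * g x)\<bar>
    \<le> 24 * (h\<^sup>2 / D) * vn G * vn (grad g)"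
proof -
  interpret e: tri K p q r by unfold_locales (rule pqr)
  have "e.D = D" using area e.area by simp
  moreover have "affine_on (closed_segment p q) (w (closed_segment p q))" using w e.edges by simp
  ultimately show ?thesis using e.edge_estimate[OF h G _ I1 g Pg] by simp
qed

lemma cb_affine: "(\<And>e. e \<in> tri_edges K \<Longrightarrow> affine_on e (vb e)) \<Longrightarrow> cb vb"
  unfolding cb_def by (blast intro: affine_on_cont)

text \<open>Subtracting the cell value leaves \<open>w = vb - v0\<close>, which alone determines the
  weak gradient through \<open>I1\<close>; subtracting the mean of \<open>s\<close> makes the
  Poincare inequality available. In the constant, \<open>72\<close> is three edges times the
  \<open>24\<close> of \<open>edge_estimate\<close>, and \<open>2\<close> comes from the cell
  integral.\<close>

lemma local_consistency:
  assumes h: "\<And>x y. x \<in> K \<Longrightarrow> y \<in> K \<Longrightarrow> norm (x - y) \<le> h" and \<kappa>: "h\<^sup>2 \<le> \<kappa> * D" "\<kappa> \<ge> 0"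
    and vb: "\<And>e. e \<in> tri_edges K \<Longrightarrow> affine_on e (vb e)"
    and s: "\<And>i. C1 (\<lambda>x. s x $ i)"
  shows "\<bar>bdy (\<lambda>e x. vb e x *\<^sub>R s x) - v0 * kint K (\<lambda>x. \<Sum>i\<in>UNIV. pd i (\<lambda>x. s x $ i) x) - kint K (\<lambda>x. wgrad K v0 vb x \<bullet> s x)\<bar>
    \<le> (72 * \<kappa> + 2) * h * vn (wgrad K v0 vb)
       * (\<Sum>i\<in>UNIV. vn (grad (\<lambda>x. s x $ i)))"
proof -
  let ?G = "wgrad K v0 vb"
  have cvb: "cb vb" by (rule cb_affine[OF vb])
  have Gc: "continuous_on UNIV ?G" by (rule wgrad_cont[OF cvb])
  define N where "N = vn ?G"
  define E where "E i = vn (grad (\<lambda>x. s x $ i))" for i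
  have N0: "N \<ge> 0" and E0: "E i \<ge> 0" for i by (simp_all add: N_def E_def)
  have h0: "h \<ge> 0" using h[of a a] by (simp add: K hull_inc)
  define w where "w e x = vb e x - v0" for e x
  have wa: "affine_on e (w e)" if e: "e \<in> tri_edges K" for e
  proof -
    obtain \<alpha> \<beta> where "\<forall>x\<in>e. vb e x = \<alpha> + \<beta> \<bullet> x" using vb[OF e] by (auto simp: affine_on_def)
    then have "\<forall>x\<in>e. w e x = (\<alpha> - v0) + \<beta> \<bullet> x" by (simp add: w_def)
    then show ?thesis unfolding affine_on_def by blast
  qed
  have wc: "cb w" by (rule cb_affine[OF wa])
  have scc: "continuous_on S s" for S
  proof -
    have "s = (\<lambda>x. \<chi> i. s x $ i)" by (simp add: vec_eq_iff)
    then show ?thesis using continuous_on_vec_lambda[of S "\<lambda>i x. s x $ i"] C1_continuous[OF s] by auto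
  qed
  have cbs: "cb (\<lambda>e x. f e x *\<^sub>R t x)" if "cb f" "\<And>S. continuous_on S t" for f and t :: "pt \<Rightarrow> pt"
    using that unfolding cb_def by (auto intro!: continuous_intros)
  have bconst: "bdy (\<lambda>e x. v0 *\<^sub>R t x) = v0 * kint K (\<lambda>x. \<Sum>i\<in>UNIV. pd i (\<lambda>x. t x $ i) x)" if "\<And>i. C1 (\<lambda>x. t x $ i)" for t
    by (simp add: bdy_scale Gauss_bdy[OF that])
  have cbc: "cb (\<lambda>e x. v0)" unfolding cb_def by (auto intro: continuous_intros)
  have wsplit: "bdy (\<lambda>e x. w e x *\<^sub>R t x) = bdy (\<lambda>e x. vb e x *\<^sub>R t x) - v0 * kint K (\<lambda>x. \<Sum>i\<in>UNIV. pd i (\<lambda>x. t x $ i) x)"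
    if "\<And>i. C1 (\<lambda>x. t x $ i)" "\<And>S. continuous_on S t" for t
    unfolding w_def scaleR_diff_left bconst[OF that(1), symmetric]
    by (rule bdy_diff) (use cbs[OF cvb that(2)] cbs[OF cbc that(2)] in auto)
  have I1: "kint K (\<lambda>x. ?G x \<bullet> af p x) = bdy (\<lambda>e x. w e x *\<^sub>R af p x)" for p
  proof -
    have "continuous_on S (af p)" for S using af_cont[OF continuous_on_id] by simp
    from wsplit[OF af_nth_C1 this] show ?thesis unfolding pd_af_nth kint_const wgrad_eq[OF cvb] by simp
  qed
  define \<mu> where "\<mu> i = kint K (\<lambda>x. s x $ i) / measure lebesgue K" for i
  define g where "g i x = s x $ i - \<mu> i" for i x
  have g: "C1 (g i)" for i unfolding g_def by (intro C1_diff s C1_const)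
  have gg: "grad (g i) x = grad (\<lambda>x. s x $ i) x" for i x
    unfolding g_def grad_def by (simp add: pd_diff[OF s C1_const] pd_const)
  have Pg: "n2 MK (g i) \<le> 2 * h * vn (grad (g i))" for i
    unfolding gg unfolding g_def \<mu>_def by (rule Poincare_K[OF s h])
  define Bd where "Bd i = 24 * (h\<^sup>2 / D) * N * E i" for i
  have kb: "Bd i \<le> 24 * \<kappa> * N * E i" for i
    unfolding Bd_def using \<kappa> D N0 E0 by (intro mult_right_mono mult_left_mono) (auto simp: divide_le_eq)
  define sb :: pt where "sb = (\<chi> i. \<mu> i)"
  have sbp: "af (sb, 0) x = sb" for x by (simp add: af_def)
  have cg: "continuous_on S (\<lambda>x. s x - sb)" for S by (intro continuous_intros scc)
  have sg: "(s x - sb) $ i = g i x" for x i by (simp add: sb_def g_def)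
  \<comment> \<open>Constant fields are admissible in \<open>I1\<close>, so replacing
    \<open>s\<close> by \<open>s - sb\<close> changes both terms by the same amount.\<close>
  have main: "bdy (\<lambda>e x. w e x *\<^sub>R s x) - kint K (\<lambda>x. ?G x \<bullet> s x)
      = bdy (\<lambda>e x. w e x *\<^sub>R (s x - sb)) - kint K (\<lambda>x. ?G x \<bullet> (s x - sb))"
  proof -
    have "bdy (\<lambda>e x. w e x *\<^sub>R (s x - sb)) = bdy (\<lambda>e x. w e x *\<^sub>R s x) - bdy (\<lambda>e x. w e x *\<^sub>R sb)"
      unfolding scaleR_diff_right by (rule bdy_diff) (use cbs[OF wc scc] cbs[OF wc continuous_on_const] in auto)
    moreover have "kint K (\<lambda>x. ?G x \<bullet> (s x - sb)) = kint K (\<lambda>x. ?G x \<bullet> s x) - kint K (\<lambda>x. ?G x \<bullet> sb)"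
      unfolding inner_diff_right by (rule kint_diff) (intro continuous_intros Gc scc)+
    moreover have "kint K (\<lambda>x. ?G x \<bullet> sb) = bdy (\<lambda>e x. w e x *\<^sub>R sb)" using I1[of "(sb, 0)"] by (simp add: sbp)
    ultimately show ?thesis by simp
  qed
  have e1: "\<bar>eI p q (\<lambda>x. (w (closed_segment p q) x *\<^sub>R (s x - sb)) \<bullet> rot (q - p))\<bar> \<le> h * (24 * \<kappa> * N * (E 1 + E 2))"
    if pqr: "ccw K p q r" for p q r
  proof -
    have pq: "p \<in> K" "q \<in> K" "closed_segment p q \<in> tri_edges K"
      using pqr ccw_edges[OF pqr] by (auto simp: ccw_def hull_inc)
    have ee: "\<bar>eI p q (\<lambda>x. w (closed_segment p q) x * g i x)\<bar> \<le> Bd i" for i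
      using edge_estimate_ccw[OF pqr h Gc wa I1 g Pg, of i] unfolding Bd_def N_def E_def gg .
    let ?w = "w (closed_segment p q)"
    have cw: "continuous_on (closed_segment p q) (\<lambda>x. ?w x * g i x * z)" for i z
      using wc pq(3) unfolding cb_def by (intro continuous_intros C1_continuous[OF g]) auto
    have "eI p q (\<lambda>x. (?w x *\<^sub>R (s x - sb)) \<bullet> rot (q - p)) = eI p q (\<lambda>x. ?w x * g 1 x * rot (q - p) $ 1 + ?w x * g 2 x * rot (q - p) $ 2)"
      unfolding inner_pt vector_scaleR_component sg by (simp del: rot_nth)
    also have "\<dots> = eI p q (\<lambda>x. ?w x * g 1 x) * rot (q - p) $ 1 + eI p q (\<lambda>x. ?w x * g 2 x) * rot (q - p) $ 2"
      unfolding eI_add(1)[OF cw cw] eI_cmult2 ..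
    also have "\<bar>\<dots>\<bar> \<le> Bd 1 * h + Bd 2 * h"
    proof -
      have n: "\<bar>rot (q - p) $ i\<bar> \<le> h" for i using component_le_norm_cart[of "rot (q - p)" i] h[OF pq(2,1)] by simp
      have "\<bar>eI p q (\<lambda>x. ?w x * g i x) * rot (q - p) $ i\<bar> \<le> Bd i * h" for i
        unfolding abs_mult using ee[of i] n[of i] by (intro mult_mono) auto
      from this[of 1] this[of 2] show ?thesis by linarith
    qed
    also have "\<dots> \<le> 24 * \<kappa> * N * E 1 * h + 24 * \<kappa> * N * E 2 * h"
      using kb[of 1] kb[of 2] h0 by (intro add_mono mult_right_mono) auto
    finally show ?thesis by (simp add: algebra_simps)
  qed
  have b1: "\<bar>bdy (\<lambda>e x. w e x *\<^sub>R (s x - sb))\<bar> \<le> 3 * (h * (24 * \<kappa> * N * (E 1 + E 2)))"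
    unfolding bdy_eI using e1[OF ccw] e1[OF ccw_cyc[OF ccw]] e1[OF ccw_cyc[OF ccw_cyc[OF ccw]]] by simp
  have b2: "\<bar>kint K (\<lambda>x. ?G x \<bullet> (s x - sb))\<bar> \<le> N * (2 * h * (E 1 + E 2))"
  proof -
    have "\<bar>kint K (\<lambda>x. ?G x \<bullet> (s x - sb))\<bar> \<le> N * n2 MK (\<lambda>x. norm (s x - sb))"
      unfolding N_def by (rule kint_inner_CS[OF Gc cg])
    also have "n2 MK (\<lambda>x. norm (s x - sb)) \<le> n2 MK (\<lambda>x. \<bar>g 1 x\<bar> + \<bar>g 2 x\<bar>)"
    proof -
      have "(\<integral>x. (norm (s x - sb))\<^sup>2 \<partial>MK) \<le> (\<integral>x. (\<bar>g 1 x\<bar> + \<bar>g 2 x\<bar>)\<^sup>2 \<partial>MK)"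
      proof (rule integral_mono)
        fix x
        have "norm (s x - sb) \<le> \<bar>g 1 x\<bar> + \<bar>g 2 x\<bar>" using norm_le_l1_cart[of "s x - sb"] unfolding sum_2 sg .
        then show "(norm (s x - sb))\<^sup>2 \<le> (\<bar>g 1 x\<bar> + \<bar>g 2 x\<bar>)\<^sup>2" by (intro power_mono) auto
      qed (auto intro!: cont_integrable_compact compact_K continuous_intros cg C1_continuous[OF g])
      then show ?thesis by (simp add: n2_def)
    qed
    also have "n2 MK (\<lambda>x. \<bar>g 1 x\<bar> + \<bar>g 2 x\<bar>) \<le> n2 MK (\<lambda>x. \<bar>g 1 x\<bar>) + n2 MK (\<lambda>x. \<bar>g 2 x\<bar>)"
      by (intro n2_triangle csq continuous_intros C1_continuous[OF g])
    also have "\<dots> = n2 MK (g 1) + n2 MK (g 2)" by (simp add: n2_def)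
    also have "\<dots> \<le> 2 * h * (E 1 + E 2)" using Pg[of 1] Pg[of 2] unfolding gg by (simp add: E_def algebra_simps)
    finally show ?thesis using N0 by (simp add: mult_left_mono)
  qed
  have "\<bar>bdy (\<lambda>e x. w e x *\<^sub>R s x) - kint K (\<lambda>x. ?G x \<bullet> s x)\<bar> \<le> 3 * (h * (24 * \<kappa> * N * (E 1 + E 2))) + N * (2 * h * (E 1 + E 2))"
    unfolding main using b1 b2 by linarith
  also have "\<dots> = (72 * \<kappa> + 2) * h * N * (\<Sum>i\<in>UNIV. E i)" by (simp add: sum_2 algebra_simps)
  finally show ?thesis unfolding wsplit[OF s scc] by (simp add: N_def E_def)
qed

end

section \<open>Interpolation and cancellation across edges\<close>

definition ends :: "pt set \<Rightarrow> pt \<times> pt" where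
  "ends e = (SOME (a, b). a \<noteq> b \<and> e = closed_segment a b)"

definition ecoord :: "pt \<Rightarrow> pt \<Rightarrow> pt \<Rightarrow> real" where
  "ecoord p q x = ((x - p) \<bullet> (q - p)) / ((q - p) \<bullet> (q - p))"

text \<open>The coefficients \<open>4\<close>, \<open>- 6\<close> and \<open>12\<close> are the
  entries of the inverse Gram matrix of \<open>1\<close> and \<open>t\<close> on the unit
  interval.\<close>

definition qb2 :: "(pt \<Rightarrow> real) \<Rightarrow> pt \<Rightarrow> pt \<Rightarrow> pt \<Rightarrow> real" where
  "qb2 \<phi> p q x = (4 * eI p q \<phi> - 6 * eI p q (\<lambda>x. \<phi> x * ecoord p q x))
     + (12 * eI p q (\<lambda>x. \<phi> x * ecoord p q x) - 6 * eI p q \<phi>) * ecoord p q x"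

text \<open>The \<open>L\<^sup>2\<close> projection onto affine functions on an edge, written out by its first two moments.\<close>

definition qb :: "(pt \<Rightarrow> real) \<Rightarrow> pt set \<Rightarrow> pt \<Rightarrow> real" where
  "qb \<phi> e = qb2 \<phi> (fst (ends e)) (snd (ends e))"

lemma ends_segment:
  assumes "p \<noteq> q"
  shows "(fst (ends (closed_segment p q)) = p \<and> snd (ends (closed_segment p q)) = q)
    \<or> (fst (ends (closed_segment p q)) = q \<and> snd (ends (closed_segment p q)) = p)"
proof -
  define ab where "ab = ends (closed_segment p q)"
  have "case ab of (a, b) \<Rightarrow> a \<noteq> b \<and> closed_segment p q = closed_segment a b"
    unfolding ab_def ends_def by (rule someI[where x="(p, q)"]) (use assms in auto)
  then have "{fst ab, snd ab} = {p, q}" by (auto simp: closed_segment_eq case_prod_unfold)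
  then show ?thesis unfolding ab_def[symmetric] by (auto simp: doubleton_eq_iff)
qed

lemma ecoord_affine: "ecoord p q x = - (p \<bullet> (q - p)) / ((q - p) \<bullet> (q - p)) + ((1 / ((q - p) \<bullet> (q - p))) *\<^sub>R (q - p)) \<bullet> x"
  by (simp add: ecoord_def inner_diff_left diff_divide_distrib inner_commute[of x])

lemma ecoord_cont: "continuous_on S (ecoord p q)" unfolding ecoord_affine[abs_def] by (intro continuous_intros)

lemma qb2_affine: "\<exists>\<alpha> \<beta>. \<forall>x. qb2 \<phi> p q x = \<alpha> + \<beta> \<bullet> x"
proof -
  define A B where "A = 4 * eI p q \<phi> - 6 * eI p q (\<lambda>x. \<phi> x * ecoord p q x)"
    and "B = 12 * eI p q (\<lambda>x. \<phi> x * ecoord p q x) - 6 * eI p q \<phi>"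
  obtain a b where ab: "\<And>x. ecoord p q x = a + b \<bullet> x" using ecoord_affine by metis
  have "qb2 \<phi> p q x = (A + B * a) + (B *\<^sub>R b) \<bullet> x" for x
    unfolding qb2_def A_def[symmetric] B_def[symmetric] unfolding ab by (simp add: algebra_simps)
  then show ?thesis by blast
qed

lemma qb_affine: "\<exists>\<alpha> \<beta>. \<forall>x. qb \<phi> e x = \<alpha> + \<beta> \<bullet> x" unfolding qb_def by (rule qb2_affine)

lemma qb_affine_on: "affine_on e (qb \<phi> e')" using qb_affine[of \<phi> e'] unfolding affine_on_def by blast

lemma qb2_moments:
  assumes "p \<noteq> q" "continuous_on UNIV \<phi>"
  shows "eI p q (\<lambda>x. qb2 \<phi> p q x * (c + d \<bullet> x)) = eI p q (\<lambda>x. \<phi> x * (c + d \<bullet> x))"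
proof -
  have ec: "ecoord p q (sg01 p q t) = t" for t
  proof -
    have "sg01 p q t - p = t *\<^sub>R (q - p)" by (simp add: sg01_def algebra_simps)
    then show ?thesis using assms(1) by (simp add: ecoord_def)
  qed
  define l0 l1 where "l0 = c + d \<bullet> p" and "l1 = d \<bullet> (q - p)"
  have l: "c + d \<bullet> sg01 p q t = l0 + t * l1" for t
    unfolding affine_sg01 l0_def l1_def by (simp add: inner_diff_right algebra_simps)
  define m0 m1 where "m0 = eI p q \<phi>" and "m1 = eI p q (\<lambda>x. \<phi> x * ecoord p q x)"
  define A B where "A = 4 * m0 - 6 * m1" and "B = 12 * m1 - 6 * m0"
  have "eI p q (\<lambda>x. qb2 \<phi> p q x * (c + d \<bullet> x)) = integral {0..1} (\<lambda>t. A * l0 + (A * l1 + B * l0) * t + (B * l1) * t\<^sup>2)"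
    unfolding eI_def qb2_def l ec m0_def[symmetric, unfolded eI_def] m1_def[symmetric, unfolded eI_def ec]
    by (simp add: A_def B_def m0_def m1_def eI_def ec algebra_simps power2_eq_square)
  also have "\<dots> = l0 * m0 + l1 * m1" unfolding integral_quad A_def B_def by (simp add: field_simps)
  also have "\<dots> = eI p q (\<lambda>x. l0 * \<phi> x + l1 * (\<phi> x * ecoord p q x))"
    by (subst eI_add(1)) (auto simp: eI_cmult m0_def m1_def
        intro!: continuous_intros continuous_on_subset[OF assms(2)] ecoord_cont)
  also have "\<dots> = eI p q (\<lambda>x. \<phi> x * (c + d \<bullet> x))"
    unfolding eI_def by (rule integral_cong) (simp add: l ec algebra_simps)
  finally show ?thesis .
qed

text \<open>\<open>ends\<close> may return either orientation of the edge; the moment identity is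
  symmetric in the end points and covers both.\<close>

lemma qb_moments:
  assumes "p \<noteq> q" "continuous_on UNIV \<phi>"
  shows "eI p q (\<lambda>x. qb \<phi> (closed_segment p q) x * (c + d \<bullet> x)) = eI p q (\<lambda>x. \<phi> x * (c + d \<bullet> x))"
  using ends_segment[OF assms(1)] qb2_moments[OF assms, of c d] qb2_moments[OF _ assms(2), of q p c d] assms(1)
  unfolding qb_def by (auto simp: eI_commute[of p q])

lemma qb_zero:
  assumes "p \<noteq> q" "\<And>x. x \<in> closed_segment p q \<Longrightarrow> \<phi> x = 0"
  shows "qb \<phi> (closed_segment p q) x = 0"
proof -
  have "eI p q f = eI p q (\<lambda>x. 0)" if "\<And>x. x \<in> closed_segment p q \<Longrightarrow> f x = 0" for f
    by (rule eI_cong) (use that in auto)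
  then have z: "eI p q f = 0" "eI q p f = 0" if "\<And>x. x \<in> closed_segment p q \<Longrightarrow> f x = 0" for f
    using that by (auto simp: eI_const eI_commute[of q p])
  have "eI p q (\<lambda>x. \<phi> x * g x) = 0" "eI q p (\<lambda>x. \<phi> x * g x) = 0" "eI p q \<phi> = 0" "eI q p \<phi> = 0" for g
    by (intro z; simp add: assms(2))+
  then show ?thesis using ends_segment[OF assms(1)] unfolding qb_def qb2_def by auto
qed

context tri
begin

lemma cb_qb: "cb (qb \<phi>)" by (rule cb_affine[OF qb_affine_on])

lemma bdy_qb:
  assumes "continuous_on UNIV \<phi>"
  shows "bdy (\<lambda>e x. qb \<phi> e x *\<^sub>R af p x) = bdy (\<lambda>e x. \<phi> x *\<^sub>R af p x)"
proof -
  have "\<exists>c d. \<forall>x. af p x \<bullet> \<nu> = c + d \<bullet> x" for \<nu>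
  proof -
    have "af p x \<bullet> \<nu> = fst p \<bullet> \<nu> + (\<chi> j. snd p $ 1 $ j * \<nu> $ 1 + snd p $ 2 $ j * \<nu> $ 2) \<bullet> x" for x
      by (simp add: inner_pt af_nth algebra_simps)
    then show ?thesis by blast
  qed
  then have "eI p' q' (\<lambda>x. qb \<phi> (closed_segment p' q') x * (af p x \<bullet> \<nu>)) = eI p' q' (\<lambda>x. \<phi> x * (af p x \<bullet> \<nu>))"
    if "p' \<noteq> q'" for p' q' \<nu>
  proof -
    obtain u v where "\<forall>x. af p x \<bullet> \<nu> = u + v \<bullet> x" using \<open>\<And>\<nu>. \<exists>u v. \<forall>x. af p x \<bullet> \<nu> = u + v \<bullet> x\<close> by blast
    then show ?thesis using qb_moments[OF that assms, of u v] by simp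
  qed
  moreover have "a \<noteq> b" "b \<noteq> c" "c \<noteq> a" using ccw_distinct[OF ccw] by auto
  ultimately show ?thesis unfolding bdy_eI by simp
qed

text \<open>An affine field has an affine normal component on each edge and a constant divergence,
  so the weak gradient sees only the edge moments and the cell mean of \<open>\<phi>\<close>. The
  interpolant preserves these, and the divergence theorem does the rest.\<close>

lemma Qh_grad:
  assumes \<phi>: "C1 \<phi>"
  shows "kint K (\<lambda>x. wgrad K (kint K \<phi> / measure lebesgue K) (qb \<phi>) x \<bullet> af p x) = kint K (\<lambda>x. grad \<phi> x \<bullet> af p x)"
proof -
  have m: "measure lebesgue K \<noteq> 0" using area D by simp
  have "bdy (\<lambda>e x. \<phi> x *\<^sub>R af p x) = kint K (\<lambda>x. \<Sum>i\<in>UNIV. pd i (\<lambda>x. (\<phi> x *\<^sub>R af p x) $ i) x)"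
    by (rule Gauss_bdy[symmetric]) (simp add: C1_mult[OF \<phi> af_nth_C1])
  also have "\<dots> = kint K (\<lambda>x. grad \<phi> x \<bullet> af p x + (\<Sum>i\<in>UNIV. snd p $ i $ i) * \<phi> x)"
    unfolding grad_mult_div[OF \<phi> af_nth_C1] pd_af_nth by (simp add: mult.commute)
  also have "\<dots> = kint K (\<lambda>x. grad \<phi> x \<bullet> af p x) + (\<Sum>i\<in>UNIV. snd p $ i $ i) * kint K \<phi>"
    by (subst kint_add) (auto intro!: continuous_intros grad_cont[OF \<phi>] C1_continuous[OF \<phi>] simp: kint_cmult)
  finally show ?thesis unfolding wgrad_eq[OF cb_qb] bdy_qb[OF C1_continuous[OF \<phi>]] using m by simp
qed

end

section \<open>Adjacent triangles of a conforming mesh\<close>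

lemma ccw_mem:
  assumes "ccw K p q r"
  shows "x \<in> K \<longleftrightarrow> cr (q - p) (x - p) \<ge> 0 \<and> cr (r - q) (x - q) \<ge> 0 \<and> cr (p - r) (x - r) \<ge> 0"
proof
  assume "x \<in> K"
  then show "cr (q - p) (x - p) \<ge> 0 \<and> cr (r - q) (x - q) \<ge> 0 \<and> cr (p - r) (x - r) \<ge> 0"
    using ccw_halfplane assms ccw_cyc by blast
next
  assume x: "cr (q - p) (x - p) \<ge> 0 \<and> cr (r - q) (x - q) \<ge> 0 \<and> cr (p - r) (x - r) \<ge> 0"
  define D where "D = cr (q - p) (r - p)"
  have D: "D > 0" using assms by (simp add: D_def ccw_def)
  define u v w where "u = cr (r - q) (x - q) / D" and "v = cr (p - r) (x - r) / D" and "w = cr (q - p) (x - p) / D"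
  have "cr (r - q) (x - q) + cr (p - r) (x - r) + cr (q - p) (x - p) = D" by (simp add: D_def cr_def algebra_simps)
  then have "u + v + w = 1" using D by (simp add: u_def v_def w_def add_divide_distrib[symmetric])
  moreover have "u \<ge> 0" "v \<ge> 0" "w \<ge> 0" using x D by (auto simp: u_def v_def w_def)
  moreover have "x = u *\<^sub>R p + v *\<^sub>R q + w *\<^sub>R r"
  proof -
    have "D *\<^sub>R x = cr (r - q) (x - q) *\<^sub>R p + cr (p - r) (x - r) *\<^sub>R q + cr (q - p) (x - p) *\<^sub>R r"
      unfolding pt_eq_iff by (simp add: D_def cr_def algebra_simps)
    then have "(1 / D) *\<^sub>R (D *\<^sub>R x) = (1 / D) *\<^sub>R (cr (r - q) (x - q) *\<^sub>R p + cr (p - r) (x - r) *\<^sub>R q + cr (q - p) (x - p) *\<^sub>R r)"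
      by (simp only:)
    then show ?thesis using D by (simp add: u_def v_def w_def scaleR_add_right)
  qed
  ultimately show "x \<in> K" using assms unfolding ccw_def convex_hull_3 by blast
qed

lemma segment_cr: "x \<in> closed_segment a b \<Longrightarrow> y \<in> closed_segment a b \<Longrightarrow> z \<in> closed_segment a b \<Longrightarrow> cr (y - x) (z - x) = 0"
proof -
  assume "x \<in> closed_segment a b" "y \<in> closed_segment a b" "z \<in> closed_segment a b"
  then obtain s t r where "x - a = s *\<^sub>R (b - a)" "y - a = t *\<^sub>R (b - a)" "z - a = r *\<^sub>R (b - a)"
    using segment_minus by metis
  moreover have "y - x = (y - a) - (x - a)" "z - x = (z - a) - (x - a)" by simp_all
  ultimately have "y - x = (t - s) *\<^sub>R (b - a)" "z - x = (r - s) *\<^sub>R (b - a)" by (simp_all only: scaleR_diff_left)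
  moreover have "cr (b - a) (b - a) = 0" by (simp add: cr_def)
  ultimately show ?thesis by (simp only: cr_scale mult_zero_right)
qed

lemma cr_cont [continuous_intros]: "continuous_on S f \<Longrightarrow> continuous_on S g \<Longrightarrow> continuous_on S (\<lambda>x. cr (f x) (g x))"
  unfolding cr_def by (intro continuous_intros)

lemma ccw_sg01:
  assumes "ccw K p q r"
  shows "cr (q - p) (sg01 p q t - p) = 0" "cr (r - q) (sg01 p q t - q) = (1 - t) * cr (q - p) (r - p)"
    "cr (p - r) (sg01 p q t - r) = t * cr (q - p) (r - p)" by (simp_all add: sg01_def cr_def algebra_simps)

text \<open>At a relative interior point of the edge the other two half-plane conditions hold
  strictly, hence also nearby; only the condition of the edge itself remains.\<close>

lemma half_disk:
  assumes "ccw K p q r" "0 < t" "t < 1"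
  shows "\<exists>\<rho>>0. \<forall>y\<in>ball (sg01 p q t) \<rho>. cr (q - p) (y - p) \<ge> 0 \<longrightarrow> y \<in> K"
proof -
  let ?U = "{y. cr (r - q) (y - q) > 0} \<inter> {y. cr (p - r) (y - r) > 0}"
  have "open ?U" by (intro open_Int open_Collect_less continuous_intros)
  moreover have "sg01 p q t \<in> ?U" using ccw_sg01[OF assms(1), of t] assms by (simp add: ccw_def)
  ultimately obtain \<rho> where "\<rho> > 0" "ball (sg01 p q t) \<rho> \<subseteq> ?U" using open_contains_ball by meson
  then show ?thesis using ccw_mem[OF assms(1)] by (intro exI[of _ \<rho>]) auto
qed

lemma cr_rot: "cr u (rot u) = - (norm u)\<^sup>2" unfolding power2_norm_eq_inner inner_pt by (simp add: cr_def)

lemma cr_diff_right: "cr u (v - w) = cr u v - cr u w" and cr_add_right: "cr u (v + w) = cr u v + cr u w"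
  by (simp_all add: cr_def algebra_simps)

text \<open>Just inside the common edge there is a point of both triangles that is off the line of
  the edge. Their intersection is then neither empty nor a vertex nor an edge, and conformity forces
  equality.\<close>

lemma same_side_eq:
  assumes T: "conf_triangulation \<Omega> T" "K \<in> T" "K' \<in> T" and K: "ccw K p q r" and K': "ccw K' p q r'"
  shows "K = K'"
proof (rule ccontr)
  assume "K \<noteq> K'"
  then consider "K \<inter> K' = {}" | v where "K \<inter> K' = {v}" | e where "e \<in> tri_edges K" "K \<inter> K' = e"
    using T unfolding conf_triangulation_def by metis
  moreover have pq: "p \<in> K \<inter> K'" "q \<in> K \<inter> K'" using K K' by (auto simp: ccw_def hull_inc)
  moreover have "p \<noteq> q" using ccw_distinct[OF K] by simp
  ultimately obtain e where e: "e \<in> tri_edges K" "K \<inter> K' = e" by (metis empty_iff singletonD)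
  let ?x = "sg01 p q (1/2)" and ?u = "q - p"
  obtain \<rho> where \<rho>: "\<rho> > 0" "\<forall>y\<in>ball ?x \<rho>. cr ?u (y - p) \<ge> 0 \<longrightarrow> y \<in> K" using half_disk[OF K, of "1/2"] by auto
  obtain \<rho>' where \<rho>': "\<rho>' > 0" "\<forall>y\<in>ball ?x \<rho>'. cr ?u (y - p) \<ge> 0 \<longrightarrow> y \<in> K'" using half_disk[OF K', of "1/2"] by auto
  define s where "s = min \<rho> \<rho>' / (2 * norm ?u)"
  have u: "norm ?u > 0" using \<open>p \<noteq> q\<close> by simp
  have s: "s > 0" using \<rho> \<rho>' u by (simp add: s_def)
  define z where "z = ?x - s *\<^sub>R rot ?u"
  have "z - p = (?x - p) - s *\<^sub>R rot ?u" by (simp add: z_def)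
  then have crz: "cr ?u (z - p) = s * (norm ?u)\<^sup>2"
    by (simp only: cr_diff_right[of _ "?x - p"] ccw_sg01(1)[OF K] cr_scale cr_rot)
  have dz: "dist ?x z = min \<rho> \<rho>' / 2" using s u by (simp add: z_def dist_norm) (simp add: s_def)
  have "dist ?x z < \<rho>" "dist ?x z < \<rho>'" unfolding dz using \<rho>(1) \<rho>'(1) by auto
  then have "z \<in> K \<inter> K'" using \<rho>(2) \<rho>'(2) crz s u by auto
  moreover obtain a b where "e = closed_segment a b" using e(1) by (auto simp: tri_edges_def)
  ultimately have "cr ?u (z - p) = 0" using segment_cr[of p a b q z] pq e(2) by auto
  then show False using crz s u by simp
qed

lemma tri_edge_ccw:
  assumes "is_triangle K" "closed_segment p q \<in> tri_edges K" "p \<noteq> q"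
  shows "(\<exists>r. ccw K p q r) \<or> (\<exists>r. ccw K q p r)"
proof -
  obtain a b c where "ccw K a b c" using is_triangle_ccw[OF assms(1)] by blast
  then obtain p' q' r' where "ccw K p' q' r'" "closed_segment p q = closed_segment p' q'"
    using ccw_edge_cases[OF _ assms(2)] by metis
  then show ?thesis by (auto simp: closed_segment_eq doubleton_eq_iff)
qed

lemma ccw_compact: "ccw K a b c \<Longrightarrow> compact K" by (simp add: ccw_def finite_imp_compact_convex_hull)

text \<open>Points approaching the edge from outside \<open>K\<close> are covered by the other
  triangles, whose finite union is closed, so the limit point lies in one of them. It is not a
  vertex and on no other edge of \<open>K\<close>; conformity then makes the edge common, and
  \<open>same_side_eq\<close> excludes the same side.\<close>

lemma opposite_triangle:
  assumes T: "conf_triangulation \<Omega> T" and op: "open \<Omega>" and K: "K \<in> T" "ccw K p q r"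
    and nf: "\<not> closed_segment p q \<subseteq> frontier \<Omega>"
  shows "\<exists>K' r'. K' \<in> T \<and> ccw K' q p r'"
proof -
  let ?u = "q - p"
  have u: "norm ?u > 0" using ccw_distinct[OF K(2)] by auto
  have fin: "finite T" and cov: "\<Union>T = closure \<Omega>" and tr: "\<And>K. K \<in> T \<Longrightarrow> is_triangle K"
    using T by (auto simp: conf_triangulation_def)
  have pqK: "closed_segment p q \<subseteq> K"
    using K(2) by (auto simp: ccw_def segment_convex_hull intro!: hull_mono subsetD[OF hull_mono])
  obtain x where x: "x \<in> closed_segment p q" "x \<notin> frontier \<Omega>" using nf by auto
  have "x \<in> closure \<Omega>" using x(1) pqK K(1) cov by auto
  then have "x \<in> \<Omega>" using x(2) op by (simp add: frontier_def interior_open)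
  then obtain \<rho>0 where \<rho>0: "\<rho>0 > 0" "ball x \<rho>0 \<subseteq> \<Omega>" using op open_contains_ball by meson
  obtain t0 where t0: "0 \<le> t0" "t0 \<le> 1" "x = sg01 p q t0" using x(1) by (auto simp: closed_segment_def sg01_def)
  \<comment> \<open>The given point of the edge inside the domain may be an end point; a small shift
    towards the farther end reaches a relative interior point that is still in the domain.\<close>
  obtain t where t: "0 < t" "t < 1" "sg01 p q t \<in> \<Omega>"
  proof -
    define d where "d = min (1/4) (\<rho>0 / (2 * norm ?u))"
    have d: "d > 0" "d \<le> 1/4" "d * norm ?u < \<rho>0"
    proof -
      show "d > 0" "d \<le> 1/4" using \<rho>0 u by (auto simp: d_def)
      have "d * norm ?u \<le> \<rho>0 / (2 * norm ?u) * norm ?u" using u by (intro mult_right_mono) (auto simp: d_def)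
      also have "\<dots> < \<rho>0" using \<rho>0 u by simp
      finally show "d * norm ?u < \<rho>0" .
    qed
    define t where "t = (if t0 \<le> 1/2 then t0 + d else t0 - d)"
    have "x - sg01 p q t = (t0 - t) *\<^sub>R ?u" by (simp add: t0(3) sg01_def algebra_simps)
    then have "dist x (sg01 p q t) = \<bar>t0 - t\<bar> * norm ?u" by (simp add: dist_norm)
    also have "\<bar>t0 - t\<bar> = d" using d by (auto simp: t_def)
    finally have "sg01 p q t \<in> \<Omega>" using \<rho>0(2) d(3) by auto
    moreover have "0 < t" "t < 1" using t0 d by (auto simp: t_def)
    ultimately show ?thesis using that by blast
  qed
  let ?x = "sg01 p q t"
  obtain \<rho> where \<rho>: "\<rho> > 0" "ball ?x \<rho> \<subseteq> \<Omega>" using op t(3) open_contains_ball by meson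
  \<comment> \<open>\<open>rot\<close> points out of \<open>K\<close>, so these points stay in the
    domain but outside \<open>K\<close> while tending to the edge.\<close>
  define y where "y n = ?x + (\<rho> / (2 * norm ?u) * (1 / real (Suc n))) *\<^sub>R rot ?u" for n
  define U where "U = \<Union>(T - {K})"
  have clU: "closed U" unfolding U_def
  proof (intro closed_Union ballI)
    fix L assume "L \<in> T - {K}"
    then obtain a b c where "ccw L a b c" using tr is_triangle_ccw by blast
    then show "closed L" using ccw_compact compact_imp_closed by blast
  qed (use fin in simp)
  have yU: "y n \<in> U" for n
  proof -
    define s where "s = \<rho> / (2 * norm ?u) * (1 / real (Suc n))"
    have s: "s > 0" using \<rho> u by (simp add: s_def)
    have "dist ?x (y n) = s * norm ?u" using s unfolding y_def s_def[symmetric] by (simp add: dist_norm)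
    also have "\<dots> = \<rho> / 2 * (1 / real (Suc n))" using u by (simp add: s_def)
    also have "\<dots> \<le> \<rho> / 2 * 1" using \<rho> by (intro mult_left_mono) auto
    also have "\<dots> < \<rho>" using \<rho> by simp
    finally have "y n \<in> \<Omega>" using \<rho>(2) by auto
    then have "y n \<in> \<Union>T" using cov closure_subset by auto
    moreover have "y n \<notin> K"
    proof -
      have "y n - p = (?x - p) + s *\<^sub>R rot ?u" by (simp add: y_def s_def)
      then have "cr ?u (y n - p) = - s * (norm ?u)\<^sup>2"
        by (simp only: cr_add_right[of _ "?x - p"] ccw_sg01(1)[OF K(2)] cr_scale cr_rot)
      then have "cr ?u (y n - p) < 0" using s u by simp
      then show ?thesis using ccw_mem[OF K(2)] by auto
    qed
    ultimately show ?thesis by (auto simp: U_def)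
  qed
  have "y \<longlonglongrightarrow> ?x + (\<rho> / (2 * norm ?u) * 0) *\<^sub>R rot ?u"
    unfolding y_def by (intro tendsto_intros LIMSEQ_Suc[OF lim_1_over_n])
  then have "y \<longlonglongrightarrow> ?x" by simp
  then have "?x \<in> U" using clU yU by (meson closed_sequentially)
  then obtain K' where K': "K' \<in> T" "K' \<noteq> K" "?x \<in> K'" by (auto simp: U_def)
  have xK: "?x \<in> K" using pqK sg01_in[of t p q] t by auto
  have D: "cr (q - p) (r - p) > 0" using K(2) by (simp add: ccw_def)
  note cs = ccw_sg01[OF K(2), of t]
  have nv: "?x \<notin> tri_verts K"
  proof
    assume "?x \<in> tri_verts K"
    then consider "?x = p" | "?x = q" | "?x = r" using ccw_verts[OF K(2)] by auto
    then show False
    proof cases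
      case 1 then show ?thesis using cs(3) D t by (simp add: cr_swap[of "p - r"])
    next
      case 2 then show ?thesis using cs(2) D t by simp
    next
      case 3 then show ?thesis using cs(1) D by simp
    qed
  qed
  consider "K \<inter> K' = {}" | v where "v \<in> tri_verts K" "K \<inter> K' = {v}"
    | e where "e \<in> tri_edges K" "e \<in> tri_edges K'" "K \<inter> K' = e"
    using T K(1) K'(1,2) unfolding conf_triangulation_def by metis
  then obtain e where e: "e \<in> tri_edges K" "e \<in> tri_edges K'" "K \<inter> K' = e"
  proof cases
    case 1 then show ?thesis using xK K'(3) by auto
  next
    case 2
    have "?x \<in> K \<inter> K'" using xK K'(3) by blast
    then show ?thesis using 2 nv by simp
  next
    case 3 then show ?thesis using that by blast
  qed
  have xe: "?x \<in> e" using e(3) xK K'(3) by auto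
  have "e = closed_segment p q"
  proof -
    have "?x \<notin> closed_segment q r"
    proof
      assume "?x \<in> closed_segment q r"
      then obtain z where "?x - q = z *\<^sub>R (r - q)" using segment_minus by blast
      then show False using cs(2) D t by simp
    qed
    moreover have "?x \<notin> closed_segment r p"
    proof
      assume "?x \<in> closed_segment r p"
      then obtain z where "?x - r = z *\<^sub>R (p - r)" using segment_minus by blast
      then show False using cs(3) D t by simp
    qed
    ultimately show ?thesis using e(1) xe ccw_edges[OF K(2)] by auto
  qed
  then have "(\<exists>r. ccw K' p q r) \<or> (\<exists>r. ccw K' q p r)"
    using e(2) tri_edge_ccw[OF tr[OF K'(1)]] ccw_distinct[OF K(2)] by auto
  moreover have "\<not> ccw K' p q r'" for r' using same_side_eq[OF T K(1) K'(1) K(2)] K'(2) by blast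
  ultimately show ?thesis using K'(1) by blast
qed

lemma edge_int_cong:
  assumes "p \<noteq> q" "\<And>x. x \<in> closed_segment p q \<Longrightarrow> f x = g x"
  shows "edge_int (closed_segment p q) f = edge_int (closed_segment p q) g"
proof -
  have "eI p q f = eI p q g" by (rule eI_cong[OF assms(2)])
  then show ?thesis by (simp add: edge_int_segment[OF assms(1)] eI_def)
qed

text \<open>Across an interior edge the two outer normals cancel, and on a boundary edge the
  trace vanishes.\<close>

lemma mesh_boundary_cancel:
  assumes T: "conf_triangulation \<Omega> T" and op: "open \<Omega>"
    and vb: "\<And>e x. e \<in> mesh_edges T \<Longrightarrow> e \<subseteq> frontier \<Omega> \<Longrightarrow> x \<in> e \<Longrightarrow> F e x = 0"
  shows "(\<Sum>K\<in>T. \<Sum>e\<in>tri_edges K. edge_int e (\<lambda>x. F e x \<bullet> outer_normal K e)) = 0"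
proof -
  have fin: "finite T" and tr: "\<And>K. K \<in> T \<Longrightarrow> is_triangle K" using T by (auto simp: conf_triangulation_def)
  have finE: "finite (tri_edges K)" if KT: "K \<in> T" for K
  proof -
    obtain a b c where "ccw K a b c" using is_triangle_ccw[OF tr[OF KT]] by blast
    then show ?thesis using ccw_edges by auto
  qed
  let ?t = "\<lambda>K e. edge_int e (\<lambda>x. F e x \<bullet> outer_normal K e)"
  have "(\<Sum>K\<in>T. \<Sum>e\<in>tri_edges K. ?t K e) = (\<Sum>K\<in>T. \<Sum>e\<in>{e\<in>mesh_edges T. e \<in> tri_edges K}. ?t K e)"
    by (intro sum.cong) (auto simp: mesh_edges_def)
  also have "\<dots> = (\<Sum>e\<in>mesh_edges T. \<Sum>K\<in>{K\<in>T. e \<in> tri_edges K}. ?t K e)"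
    by (rule sum.swap_restrict) (use fin finE in \<open>auto simp: mesh_edges_def\<close>)
  also have "\<dots> = (\<Sum>e\<in>mesh_edges T. 0)"
  proof (rule sum.cong[OF refl])
    fix e assume e: "e \<in> mesh_edges T"
    then obtain K where K: "K \<in> T" "e \<in> tri_edges K" by (auto simp: mesh_edges_def)
    obtain a b c where "ccw K a b c" using is_triangle_ccw[OF tr[OF K(1)]] by blast
    then obtain p q r where pqr: "ccw K p q r" "e = closed_segment p q" using ccw_edge_cases[OF _ K(2)] by metis
    have pq: "p \<noteq> q" using ccw_distinct[OF pqr(1)] by simp
    show "(\<Sum>K\<in>{K\<in>T. e \<in> tri_edges K}. ?t K e) = 0"
    proof (cases "e \<subseteq> frontier \<Omega>")
      case True
      have "?t K e = 0" for K
      proof -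
        have "?t K e = edge_int e (\<lambda>x. 0)"
          unfolding pqr(2) by (rule edge_int_cong[OF pq]) (use vb[OF e True] pqr(2) in auto)
        then show ?thesis unfolding pqr(2) by (simp add: edge_int_segment[OF pq])
      qed
      then show ?thesis by simp
    next
      case False
      then obtain K' r' where K': "K' \<in> T" "ccw K' q p r'"
        using opposite_triangle[OF T op K(1) pqr(1)] pqr(2) by blast
      have "K \<noteq> K'"
      proof
        assume "K = K'"
        then have "r' \<in> K" using K'(2) by (auto simp: ccw_def hull_inc)
        then have "cr (q - p) (r' - p) \<ge> 0" using ccw_halfplane[OF pqr(1)] by blast
        moreover have "cr (p - q) (r' - q) > 0" using K'(2) by (simp add: ccw_def)
        moreover have "cr (p - q) (r' - q) = - cr (q - p) (r' - p)" by (simp add: cr_def algebra_simps)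
        ultimately show False by simp
      qed
      have set: "{K\<in>T. e \<in> tri_edges K} = {K, K'}"
      proof -
        have "K'' = K \<or> K'' = K'" if "K'' \<in> T" "e \<in> tri_edges K''" for K''
          using tri_edge_ccw[OF tr[OF that(1)], of p q] that pqr pq same_side_eq[OF T that(1) K(1) _ pqr(1)]
            same_side_eq[OF T that(1) K'(1) _ K'(2)] by blast
        moreover have "e \<in> tri_edges K'" using ccw_edges[OF K'(2)] pqr(2) by (simp add: closed_segment_commute)
        ultimately show ?thesis using K K'(1) by blast
      qed
      have n: "outer_normal K' e = - outer_normal K e"
      proof -
        have "outer_normal K' (closed_segment q p) = (1 / norm (p - q)) *\<^sub>R rot (p - q)" by (rule outer_normal_eq[OF K'(2)])
        moreover have "rot (p - q) = - rot (q - p)" by (simp add: pt_eq_iff)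
        ultimately show ?thesis unfolding pqr(2) outer_normal_eq[OF pqr(1)]
          by (simp add: closed_segment_commute norm_minus_commute)
      qed
      have "?t K' e = - ?t K e" unfolding n unfolding pqr(2) by (simp add: edge_int_segment[OF pq])
      then show ?thesis unfolding set using \<open>K \<noteq> K'\<close> by simp
    qed
  qed
  finally show ?thesis by simp
qed

section \<open>Functions on a mesh\<close>

text \<open>Closed triangles may leave the open domain, but only by a null set; measurability passes
  to them across it.\<close>

lemma measurable_lebesgue_on_negligible:
  fixes f :: "pt \<Rightarrow> real"
  assumes f: "f \<in> borel_measurable (lebesgue_on A)" and A: "A \<in> sets lebesgue" "B \<in> sets lebesgue"
    and n: "negligible (B - A)"
  shows "f \<in> borel_measurable (lebesgue_on B)"
proof -
  have "(\<lambda>x. if x \<in> A then f x else 0) \<in> borel_measurable lebesgue" using f borel_measurable_if[OF A(1)] by blast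
  then have "(\<lambda>x. if x \<in> A then f x else 0) \<in> borel_measurable (lebesgue_on B)" by (rule measurable_restrict_space1)
  then have m: "(\<lambda>x. if x \<in> B then if x \<in> A then f x else 0 else 0) \<in> borel_measurable lebesgue"
    using borel_measurable_if[OF A(2), of "\<lambda>x. if x \<in> A then f x else 0"] by blast
  have "B - A \<in> null_sets lebesgue" using n by (simp add: negligible_iff_null_sets)
  then have "AE x in lebesgue. x \<notin> B - A" by (rule AE_not_in)
  then have "AE x in lebesgue. (if x \<in> B then if x \<in> A then f x else 0 else 0) = (if x \<in> B then f x else 0)"
    by eventually_elim auto
  from borel_measurable_AE[OF m this] show ?thesis using borel_measurable_if[OF A(2)] by blast
qed

lemma integrable_lebesgue_on_iff: "S \<in> sets lebesgue \<Longrightarrow> integrable (lebesgue_on S) f \<longleftrightarrow> f absolutely_integrable_on S"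
  for f :: "pt \<Rightarrow> real" by (simp add: set_integrable_def integrable_restrict_space)

lemma kint_set_integral: "S \<in> sets lebesgue \<Longrightarrow> integral\<^sup>L (lebesgue_on S) f = (LINT x:S|lebesgue. f x)"
  for f :: "pt \<Rightarrow> real" by (simp add: set_lebesgue_integral_def integral_restrict_space)

lemma negligible_segment: "negligible (closed_segment p (q::pt))"
proof -
  have "interior (closed_segment p q) = {}" by (simp add: interior_closed_segment_ge2)
  then show ?thesis by (simp add: negligible_convex_interior)
qed

text \<open>A disc of radius \<open>r\<close> has area at least \<open>r^2\<close>. Shape regularity
  is thereby converted into a bound of the squared diameter by the area.\<close>

lemma inradius_bound:
  assumes "K \<in> lmeasurable"
  shows "0 \<le> inradius K" "(inradius K)\<^sup>2 \<le> measure lebesgue K"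
proof -
  have b: "r \<le> sqrt (measure lebesgue K)" if "ball x r \<subseteq> K" for x r
  proof (cases "r \<ge> 0")
    case True
    have "r\<^sup>2 \<le> pi * r\<^sup>2" using pi_ge_two mult_right_mono[of 1 pi "r\<^sup>2"] by simp
    also have "\<dots> = measure lebesgue (ball x r)" using content_ball[OF True, of x] by (simp add: unit_ball_vol_2)
    also have "\<dots> \<le> measure lebesgue K" using that assms by (intro measure_mono_fmeasurable) auto
    finally show ?thesis by (rule real_le_rsqrt)
  next
    case False
    moreover have "0 \<le> sqrt (measure lebesgue K)" by simp
    ultimately show ?thesis by linarith
  qed
  let ?S = "{r. \<exists>x. ball x r \<subseteq> K}"
  have bd: "bdd_above ?S" using b by (intro bdd_aboveI[of _ "sqrt (measure lebesgue K)"]) auto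
  have "0 \<in> ?S" by simp
  then show 0: "0 \<le> inradius K" unfolding inradius_def by (rule cSup_upper[OF _ bd])
  have "inradius K \<le> sqrt (measure lebesgue K)" unfolding inradius_def
  proof (rule cSup_least)
    show "?S \<noteq> {}" using \<open>0 \<in> ?S\<close> by blast
  qed (use b in auto)
  then have "(inradius K)\<^sup>2 \<le> (sqrt (measure lebesgue K))\<^sup>2" using 0 by (rule power_mono)
  then show "(inradius K)\<^sup>2 \<le> measure lebesgue K" by simp
qed

text \<open>\<open>2 * measure lebesgue K\<close> is the determinant \<open>D\<close> of a triangle,
  so \<open>shape\<close> is the bound \<open>h^2 \<le> \<kappa> * D\<close> that
  \<open>local_consistency\<close> asks for, with the diameter of the cell as
  \<open>h\<close>.\<close>

locale mesh = conv_dom +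
  fixes T :: "pt set set" and \<kappa> :: real
  assumes conf: "conf_triangulation \<Omega> T" and \<kappa>: "0 \<le> \<kappa>"
    and shape: "\<And>K. K \<in> T \<Longrightarrow> (diameter K)\<^sup>2 \<le> \<kappa> * (2 * measure lebesgue K)"
begin

abbreviation "h \<equiv> meshsize T"

lemma finT: "finite T" and T_ne: "T \<noteq> {}" and cover: "\<Union>T = closure \<Omega>"
  using conf by (auto simp: conf_triangulation_def)

lemma mesh_tri: assumes "K \<in> T" obtains a b c where "tri K a b c"
proof -
  have "is_triangle K" using conf assms by (auto simp: conf_triangulation_def)
  then show ?thesis using is_triangle_ccw that by (auto simp: tri_def)
qed

lemma mesh_compact: "K \<in> T \<Longrightarrow> compact K" by (rule mesh_tri) (auto intro: tri.compact_K)

lemma mesh_lm: "K \<in> T \<Longrightarrow> K \<in> lmeasurable" and mesh_sets: "K \<in> T \<Longrightarrow> K \<in> sets lebesgue"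
  using compact_lmeasurable[OF mesh_compact] fmeasurableD by auto

lemma mesh_area: "K \<in> T \<Longrightarrow> measure lebesgue K > 0" by (rule mesh_tri) (auto simp: tri.area tri.D)

lemma mesh_fin: "K \<in> T \<Longrightarrow> finite_measure (lebesgue_on K)" by (rule finite_measure_lebesgue_on[OF mesh_lm])

lemma mesh_overlap:
  assumes "K \<in> T" "K' \<in> T" "K \<noteq> K'" shows "negligible (K \<inter> K')"
proof -
  consider "K \<inter> K' = {}" | v where "K \<inter> K' = {v}" | e where "e \<in> tri_edges K" "K \<inter> K' = e"
    using conf assms unfolding conf_triangulation_def by metis
  then show ?thesis by cases (auto simp: tri_edges_def negligible_segment)
qed

lemma frontier_null: "negligible (closure \<Omega> - \<Omega>)"
  using negligible_convex_frontier[OF convex_dom] open_dom by (simp add: frontier_def interior_open)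

lemma mesh_null: "K \<in> T \<Longrightarrow> negligible (K - \<Omega>)" by (rule negligible_subset[OF frontier_null]) (use cover in auto)

lemma mesh_meas: "f \<in> borel_measurable M \<Longrightarrow> K \<in> T \<Longrightarrow> f \<in> borel_measurable (lebesgue_on K)" for f :: "pt \<Rightarrow> real"
  by (rule measurable_lebesgue_on_negligible[OF _ dom_sets mesh_sets mesh_null])

lemma integrable_closure:
  fixes f :: "pt \<Rightarrow> real"
  assumes "integrable M f" shows "f absolutely_integrable_on closure \<Omega>"
proof (rule absolutely_integrable_spike_set)
  show "f absolutely_integrable_on \<Omega>" using assms integrable_lebesgue_on_iff[OF dom_sets] by blast
  show "negligible {x \<in> \<Omega> - closure \<Omega>. f x \<noteq> 0}" using closure_subset by (auto intro: empty_imp_negligible)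
  show "negligible {x \<in> closure \<Omega> - \<Omega>. f x \<noteq> 0}" by (rule negligible_subset[OF frontier_null]) auto
qed

lemma mesh_integrable:
  fixes f :: "pt \<Rightarrow> real"
  assumes "integrable M f" "K \<in> T" shows "integrable (lebesgue_on K) f"
proof -
  have "f absolutely_integrable_on K"
    by (rule set_integrable_subset[OF integrable_closure[OF assms(1)] mesh_sets[OF assms(2)]]) (use cover assms(2) in auto)
  then show ?thesis using integrable_lebesgue_on_iff[OF mesh_sets[OF assms(2)]] by blast
qed

text \<open>The cells overlap in null sets, and their union exceeds the open domain only by its
  frontier, which is null by convexity.\<close>

lemma mesh_sum:
  fixes f :: "pt \<Rightarrow> real"
  assumes f: "integrable M f" shows "(\<Sum>K\<in>T. kint K f) = integral\<^sup>L M f"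
proof -
  have ai: "f absolutely_integrable_on \<Omega>" using f integrable_lebesgue_on_iff[OF dom_sets] by blast
  have "(\<Sum>K\<in>T. kint K f) = (\<Sum>K\<in>T. LINT x:K|lebesgue. f x)"
    by (rule sum.cong) (auto simp: kint_def kint_set_integral mesh_sets)
  also have "\<dots> = (LINT x:(\<Union>K\<in>T. K)|lebesgue. f x)"
  proof (rule set_integral_finite_UN_AE[symmetric])
    fix K K' assume K: "K \<in> T" "K' \<in> T"
    show "AE x in lebesgue. x \<in> K \<and> x \<in> K' \<longrightarrow> K = K'"
    proof (cases "K = K'")
      case False
      then have "K \<inter> K' \<in> null_sets lebesgue" using mesh_overlap[OF K] by (simp add: negligible_iff_null_sets)
      from AE_not_in[OF this] show ?thesis by eventually_elim auto
    qed simp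
  qed (use finT mesh_sets mesh_integrable[OF f] integrable_lebesgue_on_iff[OF mesh_sets] in auto)
  also have "(\<Union>K\<in>T. K) = closure \<Omega>" using cover by simp
  also have "(LINT x:closure \<Omega>|lebesgue. f x) = (LINT x:\<Omega>|lebesgue. f x)"
  proof (rule set_integral_cong_set)
    show "set_borel_measurable lebesgue \<Omega> f" "set_borel_measurable lebesgue (closure \<Omega>) f"
      using ai integrable_closure[OF f] unfolding set_borel_measurable_def set_integrable_def by auto
    have "closure \<Omega> - \<Omega> \<in> null_sets lebesgue" using frontier_null by (simp add: negligible_iff_null_sets)
    from AE_not_in[OF this] show "AE x in lebesgue. (x \<in> \<Omega>) = (x \<in> closure \<Omega>)"
      by eventually_elim (use closure_subset in auto)
  qed
  finally show ?thesis by (simp add: kint_set_integral)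
qed

lemma mesh_sq: "sq_int M f \<Longrightarrow> K \<in> T \<Longrightarrow> sq_int (lebesgue_on K) f"
proof -
  assume f: "sq_int M f" and K: "K \<in> T"
  have "f \<in> borel_measurable (lebesgue_on K)" by (rule mesh_meas[OF sq_int_measurable[OF f] K])
  moreover have "integrable (lebesgue_on K) (\<lambda>x. (f x)\<^sup>2)"
    by (rule mesh_integrable[OF _ K]) (use f in \<open>simp only: sq_int_def\<close>)
  ultimately show ?thesis unfolding sq_int_def by (rule conjI)
qed

lemma mesh_AE:
  assumes "AE x in M. P x" "K \<in> T" shows "AE x in lebesgue_on K. P x"
proof -
  have "AE x in lebesgue. x \<in> \<Omega> \<longrightarrow> P x" using assms(1) by (simp add: AE_restrict_space_iff dom_sets)
  moreover have "closure \<Omega> - \<Omega> \<in> null_sets lebesgue" using frontier_null by (simp add: negligible_iff_null_sets)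
  then have "AE x in lebesgue. x \<notin> closure \<Omega> - \<Omega>" by (rule AE_not_in)
  ultimately have "AE x in lebesgue. x \<in> K \<longrightarrow> P x" by eventually_elim (use cover assms(2) in auto)
  then show ?thesis using mesh_sets[OF assms(2)] by (simp add: AE_restrict_space_iff)
qed

abbreviation nK :: "pt set \<Rightarrow> (pt \<Rightarrow> real) \<Rightarrow> real" where "nK K \<equiv> n2 (lebesgue_on K)"

lemma mesh_n2: "sq_int M f \<Longrightarrow> L2_set (\<lambda>K. nK K f) T = n2 M f"
  unfolding L2_set_def n2_sq using mesh_sum[of "\<lambda>x. (f x)\<^sup>2"] by (simp add: sq_int_def n2_def kint_def)

lemma mesh_n2_le: "sq_int M f \<Longrightarrow> K \<in> T \<Longrightarrow> nK K f \<le> n2 M f"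
  using member_le_L2_set[OF finT, of K "\<lambda>K. nK K f"] mesh_n2 by simp

lemma diam_le: "K \<in> T \<Longrightarrow> diameter K \<le> h" unfolding meshsize_def using finT by simp

lemma norm_le_diam: "K \<in> T \<Longrightarrow> x \<in> K \<Longrightarrow> y \<in> K \<Longrightarrow> norm (x - y) \<le> diameter K"
  using diameter_bounded_bound[OF compact_imp_bounded[OF mesh_compact]] by (simp add: dist_norm)

lemma h_nonneg: "0 \<le> h"
proof -
  obtain K where K: "K \<in> T" using T_ne by blast
  have "0 \<le> diameter K" using diameter_ge_0[OF compact_imp_bounded[OF mesh_compact[OF K]]] .
  then show ?thesis using diam_le[OF K] by simp
qed

lemma mesh_cont_sq: "K \<in> T \<Longrightarrow> continuous_on UNIV f \<Longrightarrow> sq_int (lebesgue_on K) f" for f :: "pt \<Rightarrow> real"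
  by (rule cont_sq_compact[OF _ mesh_compact])

abbreviation BM :: "pt set \<times> 'j \<Rightarrow> pt measure" where "BM q \<equiv> lebesgue_on (fst q)"

lemma bip: "ip (T \<times> (UNIV :: 'j::finite set)) BM F G = (\<Sum>K\<in>T. \<Sum>j\<in>UNIV. kint K (\<lambda>x. F (K, j) x * G (K, j) x))"
  unfolding ip_def kint_def sum.cartesian_product by (rule sum.cong) auto

lemma mesh_CS:
  assumes "sq_int M f" "\<And>K. K \<in> T \<Longrightarrow> 0 \<le> N K"
  shows "(\<Sum>K\<in>T. N K * nK K f) \<le> L2_set N T * n2 M f"
proof -
  have "(\<Sum>K\<in>T. N K * nK K f) = (\<Sum>K\<in>T. \<bar>N K\<bar> * \<bar>nK K f\<bar>)" using assms(2) by (intro sum.cong) auto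
  also have "\<dots> \<le> L2_set N T * L2_set (\<lambda>K. nK K f) T" by (rule L2_set_mult_ineq)
  finally show ?thesis by (simp only: mesh_n2[OF assms(1)])
qed

section \<open>Consistency on the whole mesh\<close>

definition Sh :: "(pt set \<Rightarrow> pt \<Rightarrow> real) \<Rightarrow> bool" where
  "Sh vb \<longleftrightarrow> (\<forall>e\<in>mesh_edges T. affine_on e (vb e) \<and> (e \<subseteq> frontier \<Omega> \<longrightarrow> (\<forall>x\<in>e. vb e x = 0)))"

definition wg :: "(pt set \<Rightarrow> real) \<Rightarrow> (pt set \<Rightarrow> pt \<Rightarrow> real) \<Rightarrow> pt set \<times> 2 \<Rightarrow> pt \<Rightarrow> real" where
  "wg v0 vb = (\<lambda>(K, j) x. wgrad K (v0 K) vb x $ j)"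

lemma Sh_affine: "Sh vb \<Longrightarrow> K \<in> T \<Longrightarrow> e \<in> tri_edges K \<Longrightarrow> affine_on e (vb e)" by (auto simp: Sh_def mesh_edges_def)

lemma wg_cont: assumes "Sh vb" "K \<in> T" shows "continuous_on S (wgrad K v vb)"
proof -
  obtain a b c where "tri K a b c" using assms(2) by (rule mesh_tri)
  then interpret t: tri K a b c .
  show ?thesis by (rule t.wgrad_cont[OF t.cb_affine[OF Sh_affine[OF assms]]])
qed

lemma wg_cont_nth: "Sh vb \<Longrightarrow> K \<in> T \<Longrightarrow> continuous_on S (\<lambda>x. wgrad K v vb x $ j)" by (intro continuous_intros wg_cont)

lemma wg_nm:
  assumes "Sh vb"
  shows "nm (T \<times> UNIV) BM (wg v0 vb) = L2_set (\<lambda>K. nK K (\<lambda>x. norm (wgrad K (v0 K) vb x))) T"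
proof -
  have "(\<Sum>j\<in>UNIV. kint K (\<lambda>x. wg v0 vb (K, j) x * wg v0 vb (K, j) x)) = (nK K (\<lambda>x. norm (wgrad K (v0 K) vb x)))\<^sup>2"
    if K: "K \<in> T" for K
  proof -
    have "(norm (wgrad K (v0 K) vb x))\<^sup>2 = (\<Sum>j\<in>UNIV. wg v0 vb (K, j) x * wg v0 vb (K, j) x)" for x
      unfolding power2_norm_eq_inner inner_vec_def wg_def by simp
    moreover have "integrable (lebesgue_on K) (\<lambda>x. wg v0 vb (K, j) x * wg v0 vb (K, j) x)" for j
      unfolding wg_def by (auto intro!: cont_integrable_compact mesh_compact K continuous_intros wg_cont assms)
    ultimately show ?thesis unfolding n2_sq kint_def by simp
  qed
  then show ?thesis unfolding nm_def bip L2_set_def by simp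
qed

lemma grad_n2: "C1 g \<Longrightarrow> K \<in> T \<Longrightarrow> nK K (\<lambda>x. norm (grad g x)) \<le> (\<Sum>j\<in>UNIV. nK K (pd j g))"
proof -
  assume g: "C1 g" and K: "K \<in> T"
  have "(nK K (\<lambda>x. norm (grad g x)))\<^sup>2 = (\<Sum>j\<in>UNIV. (nK K (pd j g))\<^sup>2)" unfolding n2_sq norm_grad_sq
    by (rule Bochner_Integration.integral_sum)
      (intro cont_integrable_compact continuous_intros C1_continuous_pd[OF g] mesh_compact[OF K])
  then have "nK K (\<lambda>x. norm (grad g x)) = L2_set (\<lambda>j. nK K (pd j g)) UNIV"
    unfolding L2_set_def by (metis n2_nonneg real_sqrt_unique)
  also have "\<dots> \<le> (\<Sum>j\<in>UNIV. nK K (pd j g))" by (rule L2_set_le_sum) simp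
  finally show ?thesis .
qed

text \<open>The local estimates are added up: the edge integrals cancel over the mesh, and
  Cauchy--Schwarz over the cells joins the local norms.\<close>

lemma consistency_C1:
  assumes vb: "Sh vb" and s: "\<And>j. C1 (s j)"
  shows "\<bar>(\<Sum>K\<in>T. v0 K * (\<Sum>j\<in>UNIV. kint K (pd j (s j)))) + ip (T \<times> UNIV) BM (wg v0 vb) (\<lambda>(K, j). s j)\<bar>
    \<le> (72 * \<kappa> + 2) * h * nm (T \<times> UNIV) BM (wg v0 vb) * (\<Sum>j\<in>UNIV. \<Sum>k\<in>UNIV. n2 M (pd k (s j)))"
proof -
  define S where "S x = (\<chi> j. s j x)" for x
  have Sj: "(\<lambda>x. S x $ j) = s j" for j by (simp add: S_def)
  define b where "b K = (\<Sum>e\<in>tri_edges K. edge_int e (\<lambda>x. (vb e x *\<^sub>R S x) \<bullet> outer_normal K e))" for K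
  define N where "N K = nK K (\<lambda>x. norm (wgrad K (v0 K) vb x))" for K
  define L where "L K = v0 K * (\<Sum>j\<in>UNIV. kint K (pd j (s j))) + (\<Sum>j\<in>UNIV. kint K (\<lambda>x. wg v0 vb (K, j) x * s j x))" for K
  have b0: "(\<Sum>K\<in>T. b K) = 0" unfolding b_def
    by (rule mesh_boundary_cancel[OF conf open_dom]) (use vb in \<open>auto simp: Sh_def\<close>)
  have loc: "\<bar>b K - L K\<bar> \<le> (72 * \<kappa> + 2) * h * (\<Sum>j\<in>UNIV. \<Sum>k\<in>UNIV. N K * nK K (pd k (s j)))"
    if K: "K \<in> T" for K
  proof -
    obtain a1 a2 a3 where "tri K a1 a2 a3" using K by (rule mesh_tri)
    then interpret t: tri K a1 a2 a3 .
    have "(diameter K)\<^sup>2 \<le> \<kappa> * t.D" using shape[OF K] by (simp add: t.area)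
    note lc = t.local_consistency[where s=S, unfolded Sj, OF norm_le_diam[OF K] this \<kappa> Sh_affine[OF vb K] s, of "v0 K"]
    have 1: "kint K (\<lambda>x. \<Sum>j\<in>UNIV. pd j (s j) x) = (\<Sum>j\<in>UNIV. kint K (pd j (s j)))"
      unfolding kint_def by (rule Bochner_Integration.integral_sum)
        (intro cont_integrable_compact C1_continuous_pd s mesh_compact[OF K])
    have 2: "kint K (\<lambda>x. wgrad K (v0 K) vb x \<bullet> S x) = (\<Sum>j\<in>UNIV. kint K (\<lambda>x. wg v0 vb (K, j) x * s j x))"
      unfolding inner_vec_def inner_real_def wg_def prod.case unfolding kint_def S_def vec_lambda_beta
      by (rule Bochner_Integration.integral_sum)
        (intro cont_integrable_compact continuous_intros wg_cont_nth vb K C1_continuous s mesh_compact[OF K])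
    have "\<bar>b K - L K\<bar> \<le> (72 * \<kappa> + 2) * diameter K * N K * (\<Sum>j\<in>UNIV. nK K (\<lambda>x. norm (grad (s j) x)))"
      using lc unfolding 1 2 t.bdy_def b_def[symmetric] N_def[symmetric] L_def by (simp add: algebra_simps)
    also have "\<dots> \<le> (72 * \<kappa> + 2) * h * N K * (\<Sum>j\<in>UNIV. \<Sum>k\<in>UNIV. nK K (pd k (s j)))"
      using \<kappa> diam_le[OF K] h_nonneg diameter_ge_0[OF compact_imp_bounded[OF mesh_compact[OF K]]]
      by (intro mult_mono mult_nonneg_nonneg sum_mono grad_n2 s K sum_nonneg) (auto simp: N_def)
    finally show ?thesis by (simp add: sum_distrib_left mult.assoc)
  qed
  have "(\<Sum>K\<in>T. v0 K * (\<Sum>j\<in>UNIV. kint K (pd j (s j)))) + ip (T \<times> UNIV) BM (wg v0 vb) (\<lambda>(K, j). s j) = (\<Sum>K\<in>T. L K)"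
    unfolding bip L_def by (simp add: sum.distrib)
  also have "\<bar>\<dots>\<bar> = \<bar>\<Sum>K\<in>T. b K - L K\<bar>" using b0 by (simp add: sum_subtractf)
  also have "\<dots> \<le> (\<Sum>K\<in>T. (72 * \<kappa> + 2) * h * (\<Sum>j\<in>UNIV. \<Sum>k\<in>UNIV. N K * nK K (pd k (s j))))"
    using loc by (intro order_trans[OF sum_abs] sum_mono)
  also have "\<dots> = (72 * \<kappa> + 2) * h * (\<Sum>j\<in>UNIV. \<Sum>k\<in>UNIV. \<Sum>K\<in>T. N K * nK K (pd k (s j)))"
    by (simp add: sum_2 sum.distrib distrib_left sum_distrib_left)
  also have "\<dots> \<le> (72 * \<kappa> + 2) * h * (\<Sum>j\<in>UNIV. \<Sum>k\<in>UNIV. L2_set N T * n2 M (pd k (s j)))"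
    using \<kappa> h_nonneg by (intro mult_left_mono sum_mono mesh_CS sq_int_C1_pd s) (auto simp: N_def)
  also have "\<dots> = (72 * \<kappa> + 2) * h * nm (T \<times> UNIV) BM (wg v0 vb) * (\<Sum>j\<in>UNIV. \<Sum>k\<in>UNIV. n2 M (pd k (s j)))"
    unfolding wg_nm[OF vb] N_def[symmetric] by (simp add: sum_distrib_left mult.assoc)
  finally show ?thesis .
qed

lemma mesh_n2_tendsto:
  assumes "\<And>n. sq_int M (f n)" "sq_int M g" "(\<lambda>n. n2 M (\<lambda>x. f n x - g x)) \<longlonglongrightarrow> 0" "K \<in> T" "sq_int (lebesgue_on K) k"
  shows "(\<lambda>n. kint K (\<lambda>x. k x * f n x)) \<longlonglongrightarrow> kint K (\<lambda>x. k x * g x)"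
proof -
  have "(\<lambda>n. nK K (\<lambda>x. f n x - g x)) \<longlonglongrightarrow> 0"
    by (rule Lim_null_comparison[OF _ assms(3)]) (simp add: mesh_n2_le[OF sq_int_diff[OF assms(1,2)] assms(4)])
  from integral_n2_tendsto[OF mesh_sq[OF assms(1,4)] mesh_sq[OF assms(2,4)] assms(5) this]
  show ?thesis by (simp add: kint_def mult.commute)
qed

lemma moll_limits:
  assumes "sq_int M g" "\<And>k. sq_int M (g' k)" "\<And>k. is_wderiv \<Omega> k g (g' k)"
  shows "C1 (moll (dn n) g)" "(\<lambda>n. n2 M (\<lambda>x. moll (dn n) g x - g x)) \<longlonglongrightarrow> 0"
    "(\<lambda>n. n2 M (\<lambda>x. pd k (moll (dn n) g) x - g' k x)) \<longlonglongrightarrow> 0"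
    "(\<lambda>n. n2 M (pd k (moll (dn n) g))) \<longlonglongrightarrow> n2 M (g' k)"
proof -
  show c: "C1 (moll (dn n) g)" for n by (rule moll_deriv(1)[OF sq_int_integrable[OF assms(1)] dn(1,3)])
  show "(\<lambda>n. n2 M (\<lambda>x. moll (dn n) g x - g x)) \<longlonglongrightarrow> 0" by (rule moll_tendsto[OF assms(1)])
  show p: "(\<lambda>n. n2 M (\<lambda>x. pd k (moll (dn n) g) x - g' k x)) \<longlonglongrightarrow> 0" by (rule moll_pd_tendsto[OF assms])
  show "(\<lambda>n. n2 M (pd k (moll (dn n) g))) \<longlonglongrightarrow> n2 M (g' k)" by (rule n2_tendsto[OF sq_int_C1_pd[OF c] assms(2) p])
qed

text \<open>The fields in question need not vanish on the boundary, so their approximations must be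
  smooth up to it and converge with first derivatives on the whole domain; \<open>moll\<close>
  provides this.\<close>

lemma consistency:
  assumes vb: "Sh vb" and s: "\<And>j. sq_int M (s j)" "\<And>j k. sq_int M (g j k)" "\<And>j k. is_wderiv \<Omega> k (s j) (g j k)"
  shows "\<bar>(\<Sum>K\<in>T. v0 K * (\<Sum>j\<in>UNIV. kint K (g j j))) + ip (T \<times> UNIV) BM (wg v0 vb) (\<lambda>(K, j). s j)\<bar>
    \<le> (72 * \<kappa> + 2) * h * nm (T \<times> UNIV) BM (wg v0 vb) * (\<Sum>j\<in>UNIV. \<Sum>k\<in>UNIV. n2 M (g j k))"
proof (rule LIMSEQ_le)
  let ?s = "\<lambda>n j. moll (dn n) (s j)"
  note ml = moll_limits[OF s]
  show "\<exists>N. \<forall>n\<ge>N. \<bar>(\<Sum>K\<in>T. v0 K * (\<Sum>j\<in>UNIV. kint K (pd j (?s n j)))) + ip (T \<times> UNIV) BM (wg v0 vb) (\<lambda>(K, j). ?s n j)\<bar>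
    \<le> (72 * \<kappa> + 2) * h * nm (T \<times> UNIV) BM (wg v0 vb) * (\<Sum>j\<in>UNIV. \<Sum>k\<in>UNIV. n2 M (pd k (?s n j)))"
    by (intro exI[of _ 0] allI impI consistency_C1[OF vb ml(1)])
  have one: "sq_int (lebesgue_on K) (\<lambda>x. 1)" if "K \<in> T" for K
    by (rule mesh_cont_sq[OF that]) (rule continuous_on_const)
  have "(\<lambda>n. kint K (pd j (?s n j))) \<longlonglongrightarrow> kint K (g j j)" if "K \<in> T" for K j
    using mesh_n2_tendsto[OF sq_int_C1_pd[OF ml(1)] s(2) ml(3) that one[OF that], of j j] by simp
  moreover have "(\<lambda>n. kint K (\<lambda>x. wg v0 vb (K, j) x * ?s n j x)) \<longlonglongrightarrow> kint K (\<lambda>x. wg v0 vb (K, j) x * s j x)" if "K \<in> T" for K j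
    by (rule mesh_n2_tendsto[OF sq_int_C1[OF ml(1)] s(1) ml(2) that])
      (use that in \<open>auto simp: wg_def intro!: mesh_cont_sq wg_cont_nth vb\<close>)
  ultimately show "(\<lambda>n. \<bar>(\<Sum>K\<in>T. v0 K * (\<Sum>j\<in>UNIV. kint K (pd j (?s n j)))) + ip (T \<times> UNIV) BM (wg v0 vb) (\<lambda>(K, j). ?s n j)\<bar>)
    \<longlonglongrightarrow> \<bar>(\<Sum>K\<in>T. v0 K * (\<Sum>j\<in>UNIV. kint K (g j j))) + ip (T \<times> UNIV) BM (wg v0 vb) (\<lambda>(K, j). s j)\<bar>"
    unfolding bip prod.case by (intro tendsto_rabs tendsto_add tendsto_sum tendsto_mult tendsto_const)
  show "(\<lambda>n. (72 * \<kappa> + 2) * h * nm (T \<times> UNIV) BM (wg v0 vb) * (\<Sum>j\<in>UNIV. \<Sum>k\<in>UNIV. n2 M (pd k (?s n j))))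
    \<longlonglongrightarrow> (72 * \<kappa> + 2) * h * nm (T \<times> UNIV) BM (wg v0 vb) * (\<Sum>j\<in>UNIV. \<Sum>k\<in>UNIV. n2 M (g j k))"
    by (intro tendsto_mult tendsto_const tendsto_sum ml(4))
qed

section \<open>Cell averages\<close>

definition mean :: "(pt \<Rightarrow> real) \<Rightarrow> pt set \<Rightarrow> real" where "mean g K = kint K g / measure lebesgue K"

lemma kint_const_mesh: "K \<in> T \<Longrightarrow> kint K (\<lambda>x. w) = w * measure lebesgue K"
  by (rule mesh_tri) (auto simp: tri.kint_const)

lemma mean_const_orth:
  assumes g: "sq_int M g" and K: "K \<in> T"
  shows "kint K (\<lambda>x. (g x - mean g K) * w) = 0"
proof -
  have i: "integrable (lebesgue_on K) g" by (rule mesh_integrable[OF sq_int_integrable[OF g] K])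
  interpret finite_measure "lebesgue_on K" by (rule mesh_fin[OF K])
  have "kint K (\<lambda>x. (g x - mean g K) * w) = (kint K g - kint K (\<lambda>x. mean g K)) * w" using i by (simp add: kint_def)
  also have "\<dots> = 0" unfolding kint_const_mesh[OF K] using mesh_area[OF K] by (simp add: mean_def)
  finally show ?thesis .
qed

lemma const_sq: "K \<in> T \<Longrightarrow> sq_int (lebesgue_on K) (\<lambda>x. w)" by (rule mesh_cont_sq) (auto intro: continuous_on_const)

lemma mean_minimal:
  assumes g: "sq_int M g" and K: "K \<in> T"
  shows "nK K (\<lambda>x. g x - mean g K) \<le> nK K (\<lambda>x. g x - w)"
proof -
  let ?m = "mean g K" and ?MK = "lebesgue_on K"
  note gK = mesh_sq[OF g K]
  have s: "sq_int ?MK (\<lambda>x. g x - ?m)" by (intro sq_int_diff gK const_sq K)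
  interpret finite_measure ?MK by (rule mesh_fin[OF K])
  have i: "integrable ?MK (\<lambda>x. g x - ?m)" by (rule sq_int_imp_integrable[OF mesh_fin[OF K] s])
  have e: "(g x - w)\<^sup>2 = (g x - ?m)\<^sup>2 + (g x - ?m) * (2 * (?m - w)) + (?m - w)\<^sup>2" for x
    by (simp add: power2_eq_square algebra_simps)
  have "(\<integral>x. (g x - w)\<^sup>2 \<partial>?MK) = (\<integral>x. (g x - ?m)\<^sup>2 \<partial>?MK) + (\<integral>x. (g x - ?m) * (2 * (?m - w)) \<partial>?MK) + (\<integral>x. (?m - w)\<^sup>2 \<partial>?MK)"
    unfolding e using s i by (simp add: sq_int_def)
  also have "(\<integral>x. (g x - ?m) * (2 * (?m - w)) \<partial>?MK) = 0" using mean_const_orth[OF g K, of "2 * (?m - w)"] by (simp only: kint_def)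
  finally have "(\<integral>x. (g x - ?m)\<^sup>2 \<partial>?MK) \<le> (\<integral>x. (g x - w)\<^sup>2 \<partial>?MK)" by simp
  then show ?thesis by (simp add: n2_def)
qed

text \<open>The cell mean of \<open>g\<close> is the best constant, so it may be replaced by the
  mean of a smooth approximation, for which the inequality on a triangle is known. The error of
  approximation disappears in the limit.\<close>

lemma Poincare_mesh:
  assumes g: "sq_int M g" "\<And>k. sq_int M (g' k)" "\<And>k. is_wderiv \<Omega> k g (g' k)"
  shows "L2_set (\<lambda>K. nK K (\<lambda>x. g x - mean g K)) T \<le> 2 * h * (\<Sum>k\<in>UNIV. n2 M (g' k))"
proof (rule LIMSEQ_le)
  let ?g = "\<lambda>n. moll (dn n) g"
  note ml = moll_limits[OF g]
  show "(\<lambda>n. L2_set (\<lambda>K. nK K (\<lambda>x. g x - mean g K)) T) \<longlonglongrightarrow> L2_set (\<lambda>K. nK K (\<lambda>x. g x - mean g K)) T"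
    by (rule tendsto_const)
  have "(\<lambda>n. n2 M (\<lambda>x. ?g n x - g x) + 2 * h * (\<Sum>k\<in>UNIV. n2 M (pd k (?g n)))) \<longlonglongrightarrow> 0 + 2 * h * (\<Sum>k\<in>UNIV. n2 M (g' k))"
    by (intro tendsto_add tendsto_mult tendsto_const tendsto_sum ml)
  then show "(\<lambda>n. n2 M (\<lambda>x. ?g n x - g x) + 2 * h * (\<Sum>k\<in>UNIV. n2 M (pd k (?g n)))) \<longlonglongrightarrow> 2 * h * (\<Sum>k\<in>UNIV. n2 M (g' k))" by simp
  show "\<exists>N. \<forall>n\<ge>N. L2_set (\<lambda>K. nK K (\<lambda>x. g x - mean g K)) T
      \<le> n2 M (\<lambda>x. ?g n x - g x) + 2 * h * (\<Sum>k\<in>UNIV. n2 M (pd k (?g n)))"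
  proof (intro exI allI impI)
    fix n
    have c: "C1 (?g n)" by (rule ml(1))
    have loc: "nK K (\<lambda>x. g x - mean g K)
        \<le> nK K (\<lambda>x. ?g n x - g x) + 2 * h * (\<Sum>k\<in>UNIV. nK K (pd k (?g n)))" if K: "K \<in> T" for K
    proof -
      obtain a1 a2 a3 where "tri K a1 a2 a3" using K by (rule mesh_tri)
      then interpret t: tri K a1 a2 a3 .
      have "nK K (\<lambda>x. g x - mean g K) \<le> nK K (\<lambda>x. g x - mean (?g n) K)" by (rule mean_minimal[OF g(1) K])
      also have "\<dots> \<le> nK K (\<lambda>x. g x - ?g n x) + nK K (\<lambda>x. ?g n x - mean (?g n) K)"
        by (rule n2_triangle3[OF mesh_sq[OF g(1) K] mesh_sq[OF sq_int_C1[OF c] K] const_sq[OF K]])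
      also have "nK K (\<lambda>x. ?g n x - mean (?g n) K) \<le> 2 * diameter K * nK K (\<lambda>x. norm (grad (?g n) x))"
        unfolding mean_def by (rule t.Poincare_K[OF c norm_le_diam[OF K]])
      also have "\<dots> \<le> 2 * h * (\<Sum>k\<in>UNIV. nK K (pd k (?g n)))"
        using diam_le[OF K] h_nonneg diameter_ge_0[OF compact_imp_bounded[OF mesh_compact[OF K]]]
        by (intro mult_mono grad_n2 c K) auto
      finally show ?thesis by (simp add: n2_minus_commute[of _ g])
    qed
    have "L2_set (\<lambda>K. nK K (\<lambda>x. g x - mean g K)) T
        \<le> L2_set (\<lambda>K. nK K (\<lambda>x. ?g n x - g x) + 2 * h * (\<Sum>k\<in>UNIV. nK K (pd k (?g n)))) T"
      by (rule L2_set_mono) (auto intro: loc)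
    also have "\<dots> \<le> L2_set (\<lambda>K. nK K (\<lambda>x. ?g n x - g x)) T + L2_set (\<lambda>K. 2 * h * (\<Sum>k\<in>UNIV. nK K (pd k (?g n)))) T"
      by (rule L2_set_triangle_ineq)
    also have "L2_set (\<lambda>K. 2 * h * (\<Sum>k\<in>UNIV. nK K (pd k (?g n)))) T = 2 * h * L2_set (\<lambda>K. \<Sum>k\<in>UNIV. nK K (pd k (?g n))) T"
      using h_nonneg by (intro L2_set_right_distrib[symmetric]) auto
    also have "L2_set (\<lambda>K. \<Sum>k\<in>UNIV. nK K (pd k (?g n))) T \<le> (\<Sum>k\<in>UNIV. n2 M (pd k (?g n)))"
      unfolding sum_2 by (rule order_trans[OF L2_set_triangle_ineq]) (simp add: mesh_n2 sq_int_C1_pd c)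
    finally show "L2_set (\<lambda>K. nK K (\<lambda>x. g x - mean g K)) T
        \<le> n2 M (\<lambda>x. ?g n x - g x) + 2 * h * (\<Sum>k\<in>UNIV. n2 M (pd k (?g n)))"
      using h_nonneg by (simp add: mesh_n2 sq_int_diff sq_int_C1 c g(1) mult_left_mono)
  qed
qed

end

section \<open>Energy argument\<close>

lemma n2_cong_AE:
  assumes "AE x in M. f x = g x" "f \<in> borel_measurable M" "g \<in> borel_measurable M"
  shows "n2 M f = n2 M g"
proof -
  have "(\<integral>x. (f x)\<^sup>2 \<partial>M) = (\<integral>x. (g x)\<^sup>2 \<partial>M)" by (rule integral_cong_AE) (use assms in auto)
  then show ?thesis by (simp add: n2_def)
qed

lemma sum22: "(\<Sum>p\<in>(UNIV :: (2 \<times> 2) set). f p) = (\<Sum>i\<in>UNIV. \<Sum>j\<in>UNIV. f (j, i))"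
proof -
  have "(\<Sum>p\<in>(UNIV :: (2 \<times> 2) set). f p) = (\<Sum>j\<in>UNIV. \<Sum>i\<in>UNIV. f (j, i))"
    unfolding UNIV_Times_UNIV[symmetric] sum.cartesian_product by (rule sum.cong) auto
  then show ?thesis by (simp add: sum.swap[of "\<lambda>i j. f (j, i)"])
qed

lemma ip_cong: "(\<And>q x. q \<in> I \<Longrightarrow> F q x = F' q x) \<Longrightarrow> (\<And>q x. q \<in> I \<Longrightarrow> G q x = G' q x) \<Longrightarrow> ip I M F G = ip I M F' G'"
  unfolding ip_def by (rule sum.cong) auto

lemma nm_cong: "(\<And>q x. q \<in> I \<Longrightarrow> F q x = F' q x) \<Longrightarrow> nm I M F = nm I M F'"
  unfolding nm_def by (simp add: ip_cong[of I F F' F F'])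

context mesh
begin

text \<open>The index pair is direction of differentiation, then component: transposed against rows
  and columns of \<open>wgradv\<close>, in order to match \<open>gr\<close>.\<close>

definition gm :: "(pt set \<Rightarrow> real^2) \<Rightarrow> (pt set \<Rightarrow> pt \<Rightarrow> real^2) \<Rightarrow> pt set \<times> (2 \<times> 2) \<Rightarrow> pt \<Rightarrow> real" where
  "gm v0 vb = (\<lambda>(K, p) x. wgradv K (v0 K) vb x $ snd p $ fst p)"

definition Vh :: "(pt set \<Rightarrow> pt \<Rightarrow> real^2) \<Rightarrow> bool" where
  "Vh vb \<longleftrightarrow> (\<forall>i. Sh (\<lambda>e y. vb e y $ i))"

abbreviation bnm where "bnm F \<equiv> nm (T \<times> (UNIV :: (2 \<times> 2) set)) BM F"
abbreviation bip' where "bip' F G \<equiv> ip (T \<times> (UNIV :: (2 \<times> 2) set)) BM F G"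
abbreviation bsq where "bsq F \<equiv> sqs (T \<times> (UNIV :: (2 \<times> 2) set)) BM F"

definition bf :: "(2 \<times> 2 \<Rightarrow> pt \<Rightarrow> real) \<Rightarrow> pt set \<times> (2 \<times> 2) \<Rightarrow> pt \<Rightarrow> real" where
  "bf F = (\<lambda>(K, p). F p)"

text \<open>On discrete fields this is the pairing of \<open>\<rho>\<close> with the weak
  divergence, by \<open>kint_wdiv_gm\<close>.\<close>

definition bt :: "(pt set \<Rightarrow> real) \<Rightarrow> (pt set \<times> (2 \<times> 2) \<Rightarrow> pt \<Rightarrow> real) \<Rightarrow> real" where
  "bt \<rho> F = (\<Sum>K\<in>T. \<rho> K * (\<Sum>i\<in>UNIV. kint K (F (K, (i, i)))))"

lemma in_Vh_iff: "in_Vh \<Omega> T v0 vb \<longleftrightarrow> Vh vb"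
proof -
  have "(\<exists>c (A::real^2^2). \<forall>x\<in>e. vb e x = c + A *v x) \<longleftrightarrow> (\<forall>i. affine_on e (\<lambda>y. vb e y $ i))" for e
  proof
    assume "\<exists>c (A::real^2^2). \<forall>x\<in>e. vb e x = c + A *v x"
    then obtain c and A :: "real^2^2" where "\<And>x. x \<in> e \<Longrightarrow> vb e x = c + A *v x" by blast
    then have "vb e x $ i = c $ i + A $ i \<bullet> x" if "x \<in> e" for x i
      using that by (simp add: matrix_vector_mul_component)
    then show "\<forall>i. affine_on e (\<lambda>y. vb e y $ i)" unfolding affine_on_def by blast
  next
    assume "\<forall>i. affine_on e (\<lambda>y. vb e y $ i)"
    then obtain \<alpha> \<beta> where "\<And>i x. x \<in> e \<Longrightarrow> vb e x $ i = \<alpha> i + \<beta> i \<bullet> x" unfolding affine_on_def by metis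
    then have "\<forall>x\<in>e. vb e x = (\<chi> i. \<alpha> i) + (\<chi> i. \<beta> i) *v x" by (simp add: vec_eq_iff matrix_vector_mul_component)
    then show "\<exists>c (A::real^2^2). \<forall>x\<in>e. vb e x = c + A *v x" by blast
  qed
  then show ?thesis unfolding in_Vh_def Vh_def Sh_def by (auto simp: vec_eq_iff)
qed

lemma gm_wg: "gm v0 vb (K, (j, i)) = wg (\<lambda>K. v0 K $ i) (\<lambda>e y. vb e y $ i) (K, j)"
  by (simp add: gm_def wg_def wgradv_def)

lemma gm_cont: "Vh vb \<Longrightarrow> K \<in> T \<Longrightarrow> continuous_on S (gm v0 vb (K, p))"
  by (cases p) (auto simp: gm_wg wg_def Vh_def intro!: wg_cont_nth)

lemma gm_sqs: "Vh vb \<Longrightarrow> bsq (gm v0 vb)" unfolding sqs_def by (auto intro!: mesh_cont_sq gm_cont)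

lemma Sh_diff: "Sh vb \<Longrightarrow> Sh wb \<Longrightarrow> Sh (\<lambda>e x. vb e x - wb e x)"
proof -
  assume "Sh vb" "Sh wb"
  moreover have "affine_on e (\<lambda>x. f x - g x)" if f: "affine_on e f" and g: "affine_on e g" for e f g
  proof -
    obtain \<alpha> \<beta> where "\<And>x. x \<in> e \<Longrightarrow> f x = \<alpha> + \<beta> \<bullet> x" using f by (auto simp: affine_on_def)
    moreover obtain \<alpha>' \<beta>' where "\<And>x. x \<in> e \<Longrightarrow> g x = \<alpha>' + \<beta>' \<bullet> x" using g by (auto simp: affine_on_def)
    ultimately have "\<forall>x\<in>e. f x - g x = (\<alpha> - \<alpha>') + (\<beta> - \<beta>') \<bullet> x" by (simp add: inner_diff_left)
    then show ?thesis unfolding affine_on_def by blast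
  qed
  ultimately show ?thesis unfolding Sh_def by simp
qed

lemma Vh_diff: "Vh vb \<Longrightarrow> Vh wb \<Longrightarrow> Vh (\<lambda>e x. vb e x - wb e x)" unfolding Vh_def by (simp add: Sh_diff)

lemma gm_diff:
  assumes "Vh vb" "Vh wb" "K \<in> T"
  shows "gm (\<lambda>K. v0 K - w0 K) (\<lambda>e x. vb e x - wb e x) (K, p) x = gm v0 vb (K, p) x - gm w0 wb (K, p) x"
proof -
  obtain a b c where "tri K a b c" using assms(3) by (rule mesh_tri)
  then interpret t: tri K a b c .
  have "t.cb (\<lambda>e y. vb e y $ snd p)" "t.cb (\<lambda>e y. wb e y $ snd p)"
  proof -
    have sh: "Sh (\<lambda>e y. vb e y $ snd p)" "Sh (\<lambda>e y. wb e y $ snd p)" using assms(1,2) by (auto simp: Vh_def)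
    show "t.cb (\<lambda>e y. vb e y $ snd p)" "t.cb (\<lambda>e y. wb e y $ snd p)"
      by (rule t.cb_affine, rule Sh_affine[OF sh(1) assms(3)], assumption)
        (rule t.cb_affine, rule Sh_affine[OF sh(2) assms(3)], assumption)
  qed
  from t.wgrad_diff[OF this, of "v0 K $ snd p" "w0 K $ snd p"] show ?thesis by (simp add: gm_def wgradv_def)
qed

lemma bf_sqs: "(\<And>p. sq_int M (F p)) \<Longrightarrow> bsq (bf F)" unfolding sqs_def bf_def by (auto intro: mesh_sq)

lemma bf_ip: "(\<And>p. sq_int M (F p)) \<Longrightarrow> (\<And>p. sq_int M (G p)) \<Longrightarrow> bip' (bf F) (bf G) = gip F G"
proof -
  assume "\<And>p. sq_int M (F p)" "\<And>p. sq_int M (G p)"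
  then have "(\<Sum>K\<in>T. kint K (\<lambda>x. F p x * G p x)) = (\<integral>x. F p x * G p x \<partial>M)" for p
    by (intro mesh_sum sq_int_integrable_mult)
  then show ?thesis unfolding bip bf_def prod.case by (subst sum.swap) (simp add: ip_def)
qed

lemma bf_nm: "(\<And>p. sq_int M (F p)) \<Longrightarrow> bnm (bf F) = gnm F" unfolding nm_def by (simp add: bf_ip)

lemma gnm_le_sum: "(\<And>p. sq_int M (F p)) \<Longrightarrow> gnm F \<le> (\<Sum>p\<in>UNIV. n2 M (F p))"
proof -
  have "gnm F = L2_set (\<lambda>p. n2 M (F p)) UNIV" unfolding nm_def ip_def L2_set_def n2_sq by (simp add: power2_eq_square)
  also have "\<dots> \<le> (\<Sum>p\<in>UNIV. n2 M (F p))" by (rule L2_set_le_sum) simp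
  finally show ?thesis .
qed

lemma bnm_L2: "bnm F = L2_set (\<lambda>p. L2_set (\<lambda>K. nK K (F (K, p))) T) UNIV"
proof -
  have "bnm F = sqrt (\<Sum>p\<in>UNIV. \<Sum>K\<in>T. (nK K (F (K, p)))\<^sup>2)"
    unfolding nm_def bip n2_sq kint_def by (subst sum.swap) (simp add: power2_eq_square)
  then show ?thesis by (simp add: L2_set_def sum_nonneg)
qed

lemma bnm_le_sum: "bnm F \<le> (\<Sum>p\<in>UNIV. L2_set (\<lambda>K. nK K (F (K, p))) T)" unfolding bnm_L2 by (rule L2_set_le_sum) simp

lemma L2_le_bnm: "L2_set (\<lambda>K. nK K (F (K, p))) T \<le> bnm F" unfolding bnm_L2 by (rule member_le_L2_set) auto

lemma wg_le_gm: "nm (T \<times> UNIV) BM (wg (\<lambda>K. v0 K $ i) (\<lambda>e y. vb e y $ i)) \<le> bnm (gm v0 vb)"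
proof -
  let ?w = "\<lambda>i. wg (\<lambda>K. v0 K $ i) (\<lambda>e y. vb e y $ i)"
  have "bip' (gm v0 vb) (gm v0 vb) = (\<Sum>i\<in>UNIV. ip (T \<times> UNIV) BM (?w i) (?w i))"
    unfolding bip sum22 gm_wg by (rule sum.swap)
  moreover have "ip (T \<times> UNIV) BM (?w i) (?w i) \<le> (\<Sum>i\<in>UNIV. ip (T \<times> UNIV) BM (?w i) (?w i))"
    by (rule member_le_sum) (auto intro: ip_nonneg)
  ultimately show ?thesis unfolding nm_def by simp
qed

section \<open>The interpolant and its projection property\<close>

definition q0 :: "(2 \<Rightarrow> pt \<Rightarrow> real) \<Rightarrow> pt set \<Rightarrow> real^2" where "q0 \<phi> K = (\<chi> i. mean (\<phi> i) K)"
definition qv :: "(2 \<Rightarrow> pt \<Rightarrow> real) \<Rightarrow> pt set \<Rightarrow> pt \<Rightarrow> real^2" where "qv \<phi> e x = (\<chi> i. qb (\<phi> i) e x)"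

abbreviation gq where "gq \<phi> \<equiv> gm (q0 \<phi>) (qv \<phi>)"

lemma qv_Vh:
  assumes "vtest \<phi>" shows "Vh (qv \<phi>)"
proof -
  have "qb (\<phi> i) e x = 0" if e: "e \<in> mesh_edges T" "e \<subseteq> frontier \<Omega>" for i e x
  proof -
    obtain p q where pq: "p \<noteq> q" "e = closed_segment p q" using e(1) by (auto simp: mesh_edges_def tri_edges_def)
    have "\<phi> i y = 0" if "y \<in> closed_segment p q" for y
    proof -
      have "y \<notin> \<Omega>" using that e(2) pq(2) open_dom by (auto simp: frontier_def interior_open)
      then show ?thesis using test_fun_zero assms by blast
    qed
    then show ?thesis unfolding pq(2) by (rule qb_zero[OF pq(1)])
  qed
  then show ?thesis unfolding Vh_def Sh_def qv_def by (simp add: qb_affine_on)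
qed

lemma gr_sq: "vtest \<phi> \<Longrightarrow> sq_int M (gr \<phi> p)" unfolding gr_def by (rule test_sq_pd) blast

text \<open>Fields whose rows are affine on each cell. Discrete weak gradients and cellwise
  constants are of this kind, and against them \<open>gq\<close> behaves as a projection.\<close>

definition aff :: "(pt set \<times> (2 \<times> 2) \<Rightarrow> pt \<Rightarrow> real) \<Rightarrow> bool" where
  "aff A \<longleftrightarrow> (\<exists>P. \<forall>K\<in>T. \<forall>j i x. A (K, (j, i)) x = af (P K i) x $ j)"

lemma gm_aff: assumes "Vh vb" shows "aff (gm v0 vb)"
proof -
  have "\<exists>p. wgrad K (v0 K $ i) (\<lambda>e y. vb e y $ i) = af p" if K: "K \<in> T" for K i
  proof -
    obtain a b c where "tri K a b c" using K by (rule mesh_tri)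
    then interpret t: tri K a b c .
    show ?thesis by (rule t.wgrad_af[OF t.cb_affine]) (use assms K Sh_affine in \<open>auto simp: Vh_def\<close>)
  qed
  then obtain P where "\<And>K i. K \<in> T \<Longrightarrow> wgrad K (v0 K $ i) (\<lambda>e y. vb e y $ i) = af (P K i)" by metis
  then show ?thesis unfolding aff_def gm_wg wg_def by (intro exI[of _ P]) simp
qed

lemma const_aff: "aff (\<lambda>q x. w q)"
  unfolding aff_def by (intro exI[of _ "\<lambda>K i. (\<chi> j. w (K, (j, i)), 0)"]) (simp add: af_nth)

lemma gq_ip:
  assumes \<phi>: "vtest \<phi>" and A: "aff A"
  shows "bip' (gq \<phi>) A = bip' (bf (gr \<phi>)) A"
proof -
  obtain P where P: "\<And>K j i x. K \<in> T \<Longrightarrow> A (K, (j, i)) x = af (P K i) x $ j" using A unfolding aff_def by blast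
  have C: "C1 (\<phi> i)" for i using \<phi> test_fun_C1 by blast
  have "(\<Sum>j\<in>UNIV. kint K (\<lambda>x. gq \<phi> (K, (j, i)) x * A (K, (j, i)) x)) = (\<Sum>j\<in>UNIV. kint K (\<lambda>x. pd j (\<phi> i) x * A (K, (j, i)) x))"
    if K: "K \<in> T" for K i
  proof -
    obtain a b c where "tri K a b c" using K by (rule mesh_tri)
    then interpret t: tri K a b c .
    have 1: "kint K (\<lambda>x. wgrad K (mean (\<phi> i) K) (qb (\<phi> i)) x \<bullet> af (P K i) x) = kint K (\<lambda>x. grad (\<phi> i) x \<bullet> af (P K i) x)"
      unfolding mean_def by (rule t.Qh_grad[OF C])
    have ac: "continuous_on UNIV (\<lambda>x. A (K, (j, i)) x)" for j unfolding P[OF K] by (intro continuous_intros)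
    have gc: "continuous_on UNIV (gq \<phi> (K, (j, i)))" for j by (rule gm_cont[OF qv_Vh[OF \<phi>] K])
    have "(\<Sum>j\<in>UNIV. kint K (\<lambda>x. gq \<phi> (K, (j, i)) x * A (K, (j, i)) x)) = kint K (\<lambda>x. \<Sum>j\<in>UNIV. gq \<phi> (K, (j, i)) x * A (K, (j, i)) x)"
      unfolding kint_def by (rule Bochner_Integration.integral_sum[symmetric])
        (intro cont_integrable_compact continuous_on_mult gc ac mesh_compact K)
    also have "\<dots> = kint K (\<lambda>x. wgrad K (mean (\<phi> i) K) (qb (\<phi> i)) x \<bullet> af (P K i) x)"
      by (simp add: gm_def wgradv_def q0_def qv_def P[OF K] inner_vec_def)
    also have "\<dots> = kint K (\<lambda>x. \<Sum>j\<in>UNIV. pd j (\<phi> i) x * A (K, (j, i)) x)"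
      unfolding 1 by (simp add: inner_vec_def P[OF K])
    also have "\<dots> = (\<Sum>j\<in>UNIV. kint K (\<lambda>x. pd j (\<phi> i) x * A (K, (j, i)) x))"
      unfolding kint_def by (rule Bochner_Integration.integral_sum)
        (intro cont_integrable_compact continuous_on_mult C1_continuous_pd C ac mesh_compact K)
    finally show ?thesis .
  qed
  then show ?thesis unfolding bip sum22 bf_def gr_def by simp
qed

text \<open>Half of the Fortin property: testing the projection with constants preserves the cell
  integral of each diagonal entry. The other half is \<open>nm_gq\<close>.\<close>

lemma bt_gq:
  assumes \<phi>: "vtest \<phi>"
  shows "bt \<rho> (gq \<phi>) = (\<Sum>K\<in>T. \<rho> K * kint K (dv \<phi>))"
proof -
  have C: "C1 (\<phi> i)" for i using \<phi> test_fun_C1 by blast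
  have "kint K (gq \<phi> (K, (i, i))) = kint K (pd i (\<phi> i))" if K: "K \<in> T" for K i
  proof -
    obtain a b c where "tri K a b c" using K by (rule mesh_tri)
    then interpret t: tri K a b c .
    have "kint K (\<lambda>x. wgrad K (mean (\<phi> i) K) (qb (\<phi> i)) x \<bullet> af (axis i 1, 0) x) = kint K (\<lambda>x. grad (\<phi> i) x \<bullet> af (axis i 1, 0) x)"
      unfolding mean_def by (rule t.Qh_grad[OF C])
    then show ?thesis by (simp add: af_def inner_axis gm_def wgradv_def q0_def qv_def)
  qed
  moreover have "kint K (dv \<phi>) = (\<Sum>i\<in>UNIV. kint K (pd i (\<phi> i)))" if K: "K \<in> T" for K
    unfolding kint_def dv_def by (rule Bochner_Integration.integral_sum)
      (intro cont_integrable_compact C1_continuous_pd C mesh_compact K)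
  ultimately show ?thesis by (simp add: bt_def)
qed

lemma nm_gq: assumes \<phi>: "vtest \<phi>" shows "bnm (gq \<phi>) \<le> gnm (gr \<phi>)"
proof -
  note s = gm_sqs[OF qv_Vh[OF \<phi>], of "q0 \<phi>"] 
  have b: "bsq (bf (gr \<phi>))" by (rule bf_sqs[OF gr_sq[OF \<phi>]])
  have "(bnm (gq \<phi>))\<^sup>2 = bip' (bf (gr \<phi>)) (gq \<phi>)" unfolding nm_sq by (rule gq_ip[OF \<phi> gm_aff[OF qv_Vh[OF \<phi>]]])
  also have "\<dots> \<le> bnm (bf (gr \<phi>)) * bnm (gq \<phi>)" using ip_CS[OF b s] by simp
  finally have "bnm (gq \<phi>) * bnm (gq \<phi>) \<le> gnm (gr \<phi>) * bnm (gq \<phi>)" unfolding bf_nm[OF gr_sq[OF \<phi>]] power2_eq_square .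
  then show ?thesis by (cases "bnm (gq \<phi>) = 0") (auto simp: mult_le_cancel_right less_le)
qed

text \<open>\<open>gq \<phi>\<close> is the \<open>L\<^sup>2\<close> projection of the gradient.\<close>

lemma gq_best:
  assumes \<phi>: "vtest \<phi>"
  shows "bnm (\<lambda>q x. gq \<phi> q x - bf (gr \<phi>) q x) \<le> bnm (\<lambda>q x. bf (gr \<phi>) q x - w q)"
proof -
  let ?G = "gq \<phi>" and ?b = "bf (gr \<phi>)" and ?C = "\<lambda>q x. w q"
  note s = gm_sqs[OF qv_Vh[OF \<phi>], of "q0 \<phi>"] 
  have b: "bsq (bf (gr \<phi>))" by (rule bf_sqs[OF gr_sq[OF \<phi>]])
  have c: "bsq ?C" by (auto simp: sqs_def intro!: const_sq)
  note d = sqs_diff[OF s b] and e = sqs_diff[OF b c]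
  have o: "bip' (\<lambda>q x. ?G q x - ?b q x) A = 0" if "aff A" "bsq A" for A
    using gq_ip[OF \<phi> that(1)] by (simp add: ip_diff_left[OF s b that(2)])
  have "(bnm (\<lambda>q x. ?G q x - ?b q x))\<^sup>2 = bip' (\<lambda>q x. ?G q x - ?b q x) ?G - bip' (\<lambda>q x. ?G q x - ?b q x) ?b"
    unfolding nm_sq by (rule ip_diff_right[OF s b d])
  also have "\<dots> = bip' (\<lambda>q x. ?G q x - ?b q x) ?C - bip' (\<lambda>q x. ?G q x - ?b q x) ?b"
    using o[OF gm_aff[OF qv_Vh[OF \<phi>]] s] o[OF const_aff c] by simp
  also have "\<dots> = - bip' (\<lambda>q x. ?G q x - ?b q x) (\<lambda>q x. ?b q x - ?C q x)" using ip_diff_right[OF b c d] by simp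
  also have "\<dots> \<le> bnm (\<lambda>q x. ?G q x - ?b q x) * bnm (\<lambda>q x. ?b q x - ?C q x)" using ip_CS[OF d e] by linarith
  finally have "bnm (\<lambda>q x. ?G q x - ?b q x) * bnm (\<lambda>q x. ?G q x - ?b q x) \<le> bnm (\<lambda>q x. ?b q x - ?C q x) * bnm (\<lambda>q x. ?G q x - ?b q x)"
    by (simp add: power2_eq_square mult.commute)
  then show ?thesis by (cases "bnm (\<lambda>q x. ?G q x - ?b q x) = 0") (auto simp: mult_le_cancel_right less_le)
qed

text \<open>Testing with the discrete solution minus the projected test function gives the weak
  gradient \<open>D + R\<close>, where \<open>D\<close> is the error and \<open>R\<close> the
  projection error. Best approximation by cell means bounds \<open>R\<close> by
  \<open>2 * \<delta> n + E\<close>, and since the discrete solution is orthogonal to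
  \<open>\<rho>\<close>, the pressure contributes only \<open>t n\<close>.\<close>

lemma energy:
  assumes uh: "Vh uhb" and U: "\<And>p. sq_int M (U p)" and E: "0 \<le> E"
    and res: "\<And>v0 vb. Vh vb \<Longrightarrow>
      \<bar>bip' (\<lambda>q x. gm uh0 uhb q x - bf U q x) (gm v0 vb) - bt \<rho> (gm v0 vb)\<bar> \<le> E * bnm (gm v0 vb)"
    and divuh: "bt \<rho> (gm uh0 uhb) = 0" and divU: "AE x in M. (\<Sum>i\<in>UNIV. U (i, i) x) = 0"
    and \<phi>: "\<And>n. vtest (\<phi> n)" "\<And>p. (\<lambda>n. n2 M (\<lambda>x. gr (\<phi> n) p x - U p x)) \<longlonglongrightarrow> 0"
    and e0: "bnm (\<lambda>q x. bf U q x - mean (U (snd q)) (fst q)) \<le> E"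
  shows "bnm (\<lambda>q x. gm uh0 uhb q x - bf U q x) \<le> 3 * E"
    and "\<And>v. vtest v \<Longrightarrow> \<bar>\<Sum>K\<in>T. \<rho> K * kint K (dv v)\<bar> \<le> 4 * E * gnm (gr v)"
proof -
  let ?D = "\<lambda>q x. gm uh0 uhb q x - bf U q x"
  let ?C = "\<lambda>q x. mean (U (snd q)) (fst q)"
  let ?Q = "\<lambda>n. gq (\<phi> n)"
  define d where "d = bnm ?D"
  have d0: "d \<ge> 0" by (simp add: d_def)
  have sU: "bsq (bf U)" by (rule bf_sqs[OF U])
  note sG = gm_sqs[OF uh, of uh0]
  note sD = sqs_diff[OF sG sU]
  have sg: "bsq (bf (gr (\<phi> n)))" for n by (rule bf_sqs[OF gr_sq[OF \<phi>(1)]])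
  have sQ: "bsq (?Q n)" for n by (rule gm_sqs[OF qv_Vh[OF \<phi>(1)]])
  have sC: "bsq ?C" by (auto simp: sqs_def intro!: const_sq)
  define \<delta> where "\<delta> n = bnm (\<lambda>q x. bf (gr (\<phi> n)) q x - bf U q x)" for n
  define t where "t n = (\<Sum>K\<in>T. \<rho> K * kint K (dv (\<phi> n)))" for n
  have \<delta>: "\<delta> \<longlonglongrightarrow> 0"
  proof (rule tendsto_sandwich[OF _ _ tendsto_const])
    have "\<delta> n = gnm (\<lambda>p x. gr (\<phi> n) p x - U p x)" for n
    proof -
      have "\<delta> n = bnm (bf (\<lambda>p x. gr (\<phi> n) p x - U p x))" unfolding \<delta>_def by (rule nm_cong) (auto simp: bf_def)
      then show ?thesis by (simp only: bf_nm[OF sq_int_diff[OF gr_sq[OF \<phi>(1)] U]])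
    qed
    then show "\<forall>\<^sub>F n in sequentially. \<delta> n \<le> (\<Sum>p\<in>UNIV. n2 M (\<lambda>x. gr (\<phi> n) p x - U p x))"
      using gnm_le_sum[OF sq_int_diff[OF gr_sq[OF \<phi>(1)] U]] by simp
    have "(\<lambda>n. \<Sum>p\<in>UNIV. n2 M (\<lambda>x. gr (\<phi> n) p x - U p x)) \<longlonglongrightarrow> (\<Sum>p\<in>(UNIV :: (2 \<times> 2) set). 0)"
      by (rule tendsto_sum) (rule \<phi>(2))
    then show "(\<lambda>n. \<Sum>p\<in>UNIV. n2 M (\<lambda>x. gr (\<phi> n) p x - U p x)) \<longlonglongrightarrow> 0" by simp
  qed (simp add: \<delta>_def)
  \<comment> \<open>On the fixed mesh \<open>\<rho>\<close> has finitely many fixed values, so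
    convergence of the divergences to the zero trace of \<open>U\<close> suffices, at whatever
    rate.\<close>
  have t: "t \<longlonglongrightarrow> 0"
  proof -
    have "(\<lambda>n. kint K (dv (\<phi> n))) \<longlonglongrightarrow> 0" if K: "K \<in> T" for K
    proof -
      have i: "integrable (lebesgue_on K) (U p)" for p by (rule mesh_integrable[OF sq_int_integrable[OF U] K])
      have "(\<lambda>n. kint K (gr (\<phi> n) (i, i))) \<longlonglongrightarrow> kint K (U (i, i))" for i
        using mesh_n2_tendsto[OF gr_sq[OF \<phi>(1)] U \<phi>(2) K const_sq[OF K, of 1]] by simp
      then have "(\<lambda>n. \<Sum>i\<in>UNIV. kint K (gr (\<phi> n) (i, i))) \<longlonglongrightarrow> (\<Sum>i\<in>UNIV. kint K (U (i, i)))" by (intro tendsto_sum)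
      moreover have "(\<Sum>i\<in>UNIV. kint K (gr (\<phi> n) (i, i))) = kint K (dv (\<phi> n))" for n
      proof -
        have "integrable (lebesgue_on K) (pd i (\<phi> n i))" for i
          using mesh_integrable[OF sq_int_integrable[OF gr_sq[OF \<phi>(1)]] K, of n "(i, i)"] by (simp add: gr_def)
        then show ?thesis unfolding kint_def dv_def gr_def by simp
      qed
      moreover have "(\<Sum>i\<in>UNIV. kint K (U (i, i))) = (\<integral>x. (\<Sum>i\<in>UNIV. U (i, i) x) \<partial>lebesgue_on K)"
        unfolding kint_def using i by simp
      moreover have "(\<integral>x. (\<Sum>i\<in>UNIV. U (i, i) x) \<partial>lebesgue_on K) = 0"
        by (rule integral_eq_zero_AE[OF mesh_AE[OF divU K]])
      ultimately show ?thesis by simp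
    qed
    then have "t \<longlonglongrightarrow> (\<Sum>K\<in>T. \<rho> K * 0)" unfolding t_def by (intro tendsto_sum tendsto_mult tendsto_const)
    then show ?thesis by simp
  qed
  have main: "d\<^sup>2 \<le> E * (d + (2 * \<delta> n + E)) + \<bar>t n\<bar> + d * (2 * \<delta> n + E)" for n
  proof -
    let ?R = "\<lambda>q x. bf U q x - ?Q n q x"
    let ?v0 = "\<lambda>K. uh0 K - q0 (\<phi> n) K" and ?vb = "\<lambda>e x. uhb e x - qv (\<phi> n) e x"
    have sR: "bsq ?R" by (rule sqs_diff[OF sU sQ])
    have vV: "Vh ?vb" by (rule Vh_diff[OF uh qv_Vh[OF \<phi>(1)]])
    have g: "gm ?v0 ?vb q x = gm uh0 uhb q x - ?Q n q x" if "q \<in> T \<times> UNIV" for q x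
      using that gm_diff[OF uh qv_Vh[OF \<phi>(1)]] by (cases q) auto
    have R: "bnm ?R \<le> 2 * \<delta> n + E"
    proof -
      have "bnm ?R \<le> bnm (\<lambda>q x. bf U q x - bf (gr (\<phi> n)) q x) + bnm (\<lambda>q x. bf (gr (\<phi> n)) q x - ?Q n q x)"
        by (rule nm_triangle3[OF sU sg sQ])
      also have "bnm (\<lambda>q x. bf U q x - bf (gr (\<phi> n)) q x) = \<delta> n" unfolding \<delta>_def by (rule nm_minus_commute)
      also have "bnm (\<lambda>q x. bf (gr (\<phi> n)) q x - ?Q n q x) = bnm (\<lambda>q x. ?Q n q x - bf (gr (\<phi> n)) q x)" by (rule nm_minus_commute)
      also have "\<dots> \<le> bnm (\<lambda>q x. bf (gr (\<phi> n)) q x - ?C q x)" by (rule gq_best[OF \<phi>(1)])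
      also have "\<dots> \<le> \<delta> n + bnm (\<lambda>q x. bf U q x - ?C q x)" unfolding \<delta>_def by (rule nm_triangle3[OF sg sU sC])
      finally show ?thesis using e0 by simp
    qed
    have gR: "bip' ?D (gm ?v0 ?vb) = bip' ?D (\<lambda>q x. ?D q x + ?R q x)" by (rule ip_cong) (use g in auto)
    have nR: "bnm (gm ?v0 ?vb) = bnm (\<lambda>q x. ?D q x + ?R q x)" by (rule nm_cong) (use g in auto)
    have "bt \<rho> (gm ?v0 ?vb) = - t n"
    proof -
      have "kint K (gm ?v0 ?vb (K, (i, i))) = kint K (gm uh0 uhb (K, (i, i))) - kint K (?Q n (K, (i, i)))" if K: "K \<in> T" for K i
      proof -
        have "gm ?v0 ?vb (K, (i, i)) = (\<lambda>x. gm uh0 uhb (K, (i, i)) x - ?Q n (K, (i, i)) x)"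
          by (rule ext) (use g K in auto)
        moreover have "integrable (lebesgue_on K) (gm uh0 uhb (K, (i, i)))" "integrable (lebesgue_on K) (?Q n (K, (i, i)))"
          by (intro cont_integrable_compact gm_cont uh qv_Vh \<phi>(1) K mesh_compact)+
        ultimately show ?thesis by (simp add: kint_def)
      qed
      then have "bt \<rho> (gm ?v0 ?vb) = bt \<rho> (gm uh0 uhb) - bt \<rho> (?Q n)"
        unfolding bt_def by (simp add: sum_subtractf right_diff_distrib)
      then show ?thesis using divuh bt_gq[OF \<phi>(1)] by (simp add: t_def)
    qed
    then have "\<bar>bip' ?D (\<lambda>q x. ?D q x + ?R q x) + t n\<bar> \<le> E * bnm (\<lambda>q x. ?D q x + ?R q x)"
      using res[OF vV, of ?v0] unfolding gR nR by simp
    moreover have "bip' ?D (\<lambda>q x. ?D q x + ?R q x) = d\<^sup>2 + bip' ?D ?R"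
      unfolding ip_add_right[OF sD sR sD] d_def nm_sq ..
    moreover have "\<bar>bip' ?D ?R\<bar> \<le> d * (2 * \<delta> n + E)"
      using ip_CS[OF sD sR] mult_left_mono[OF R d0] unfolding d_def by linarith
    moreover have "E * bnm (\<lambda>q x. ?D q x + ?R q x) \<le> E * (d + (2 * \<delta> n + E))"
      using nm_triangle[OF sD sR] R E unfolding d_def by (intro mult_left_mono) auto
    ultimately show ?thesis by linarith
  qed
  have lim: "d\<^sup>2 \<le> E * (d + (2 * 0 + E)) + \<bar>0\<bar> + d * (2 * 0 + E)"
  proof (rule LIMSEQ_le_const)
    show "(\<lambda>n. E * (d + (2 * \<delta> n + E)) + \<bar>t n\<bar> + d * (2 * \<delta> n + E)) \<longlonglongrightarrow> E * (d + (2 * 0 + E)) + \<bar>0\<bar> + d * (2 * 0 + E)"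
      by (intro tendsto_intros \<delta> t)
  qed (use main in blast)
  \<comment> \<open>The limit inequality reads \<open>d^2 \<le> 2 E d + E^2\<close>, that is
    \<open>d \<le> (1 + sqrt 2) E\<close>, rounded up to \<open>3 E\<close>.\<close>
  have d3: "d \<le> 3 * E"
  proof (rule ccontr)
    assume "\<not> d \<le> 3 * E"
    then have "3 * E < d" by simp
    then have "0 < d" "E * E \<le> E * d" using E by (auto intro: mult_left_mono)
    moreover have "3 * E * d < d * d" using \<open>3 * E < d\<close> \<open>0 < d\<close> by simp
    moreover have "d * d \<le> 2 * (E * d) + E * E" using lim by (simp add: power2_eq_square algebra_simps)
    ultimately show False unfolding mult.assoc by linarith
  qed
  then show "bnm ?D \<le> 3 * E" by (simp add: d_def)
  fix v assume v: "vtest v"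
  have "\<bar>\<Sum>K\<in>T. \<rho> K * kint K (dv v)\<bar> = \<bar>bt \<rho> (gq v)\<bar>" by (simp only: bt_gq[OF v])
  also have "\<dots> \<le> \<bar>bip' ?D (gq v)\<bar> + E * bnm (gq v)" using res[OF qv_Vh[OF v], of "q0 v"] by linarith
  also have "\<dots> \<le> d * bnm (gq v) + E * bnm (gq v)"
    using ip_CS[OF sD gm_sqs[OF qv_Vh[OF v], of "q0 v"]] by (simp add: d_def)
  also have "\<dots> \<le> (4 * E) * bnm (gq v)" using d3 mult_right_mono[OF d3, of "bnm (gq v)"] by (simp add: algebra_simps)
  also have "\<dots> \<le> (4 * E) * gnm (gr v)" using nm_gq[OF v] E by (intro mult_left_mono) auto
  finally show "\<bar>\<Sum>K\<in>T. \<rho> K * kint K (dv v)\<bar> \<le> 4 * E * gnm (gr v)" .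
qed

text \<open>Turns cell values into a function on the domain, to which the continuous inf-sup
  condition applies. On common edges several values are added up, but only on a null set.\<close>

definition pw :: "(pt set \<Rightarrow> real) \<Rightarrow> pt \<Rightarrow> real" where
  "pw \<rho> x = (\<Sum>K\<in>T. \<rho> K * indicator K x)"

lemma pw_AE: assumes K: "K \<in> T" shows "AE x in lebesgue_on K. pw \<rho> x = \<rho> K"
proof -
  have "AE x in lebesgue. \<forall>K'\<in>T - {K}. x \<notin> K \<inter> K'"
  proof (rule AE_finite_allI)
    fix K' assume "K' \<in> T - {K}"
    then have "K \<inter> K' \<in> null_sets lebesgue" using mesh_overlap[OF K] by (auto simp: negligible_iff_null_sets[symmetric])
    then show "AE x in lebesgue. x \<notin> K \<inter> K'" by (rule AE_not_in)
  qed (use finT in simp)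
  then have "AE x in lebesgue. x \<in> K \<longrightarrow> pw \<rho> x = \<rho> K"
  proof eventually_elim
    fix x assume x: "\<forall>K'\<in>T - {K}. x \<notin> K \<inter> K'"
    show "x \<in> K \<longrightarrow> pw \<rho> x = \<rho> K"
    proof
      assume xK: "x \<in> K"
      have "pw \<rho> x = \<rho> K * indicator K x + (\<Sum>K'\<in>T - {K}. \<rho> K' * indicator K' x)"
        unfolding pw_def by (rule sum.remove[OF finT K])
      also have "(\<Sum>K'\<in>T - {K}. \<rho> K' * indicator K' x) = (\<Sum>K'\<in>T - {K}. 0)" by (rule sum.cong) (use x xK in auto)
      finally show "pw \<rho> x = \<rho> K" using xK by simp
    qed
  qed
  then show ?thesis using mesh_sets[OF K] by (simp add: AE_restrict_space_iff)
qed

lemma pw_sq: "sq_int M (pw \<rho>)"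
proof (rule sq_int_bounded[OF fin_M])
  have "(\<lambda>x. \<rho> K * indicator K x) \<in> borel_measurable lebesgue" if "K \<in> T" for K
    using mesh_sets[OF that] by (intro borel_measurable_times borel_measurable_indicator) auto
  then have "pw \<rho> \<in> borel_measurable lebesgue" unfolding pw_def by (intro borel_measurable_sum)
  then show "pw \<rho> \<in> borel_measurable M" by (rule measurable_restrict_space1)
  show "\<bar>pw \<rho> x\<bar> \<le> (\<Sum>K\<in>T. \<bar>\<rho> K\<bar>)" for x
    unfolding pw_def by (rule order_trans[OF sum_abs sum_mono]) (auto simp: indicator_def)
qed

lemma pw_integral:
  assumes "sq_int M g" shows "(\<integral>x. pw \<rho> x * g x \<partial>M) = (\<Sum>K\<in>T. \<rho> K * kint K g)"
proof -
  have "(\<integral>x. pw \<rho> x * g x \<partial>M) = (\<Sum>K\<in>T. kint K (\<lambda>x. pw \<rho> x * g x))"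
    by (rule mesh_sum[symmetric, OF sq_int_integrable_mult[OF pw_sq assms]])
  also have "\<dots> = (\<Sum>K\<in>T. \<rho> K * kint K g)"
  proof (rule sum.cong[OF refl])
    fix K assume K: "K \<in> T"
    note m = sq_int_measurable[OF mesh_sq[OF assms K]] sq_int_measurable[OF mesh_sq[OF pw_sq K]]
    have "kint K (\<lambda>x. pw \<rho> x * g x) = kint K (\<lambda>x. \<rho> K * g x)" unfolding kint_def
    proof (rule integral_cong_AE)
      show "AE x in lebesgue_on K. pw \<rho> x * g x = \<rho> K * g x" using pw_AE[OF K, of \<rho>] by eventually_elim simp
    qed (intro borel_measurable_times m borel_measurable_const)+
    then show "kint K (\<lambda>x. pw \<rho> x * g x) = \<rho> K * kint K g" by (simp add: kint_def)
  qed
  finally show ?thesis .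
qed

lemma pw_n2: "L2_set (\<lambda>K. nK K (\<lambda>x. \<rho> K)) T = n2 M (pw \<rho>)"
proof -
  have "nK K (\<lambda>x. \<rho> K) = nK K (pw \<rho>)" if K: "K \<in> T" for K
    by (rule n2_cong_AE[symmetric, OF pw_AE[OF K] sq_int_measurable[OF mesh_sq[OF pw_sq K]]]) simp
  then have "L2_set (\<lambda>K. nK K (\<lambda>x. \<rho> K)) T = L2_set (\<lambda>K. nK K (pw \<rho>)) T" by (rule L2_set_cong[OF refl])
  then show ?thesis by (simp only: mesh_n2[OF pw_sq])
qed

end

section \<open>The error estimate\<close>

context conv_dom
begin

lemma H1_wd: assumes "H1 \<Omega> g" shows "sq_int M (wd \<Omega> k g)" "is_wderiv \<Omega> k g (wd \<Omega> k g)"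
proof -
  have "\<exists>g'. L2 \<Omega> g' \<and> is_wderiv \<Omega> k g g'" using assms by (simp add: H1_def)
  from someI_ex[OF this] have "L2 \<Omega> (wd \<Omega> k g) \<and> is_wderiv \<Omega> k g (wd \<Omega> k g)" unfolding wd_def .
  then show "sq_int M (wd \<Omega> k g)" "is_wderiv \<Omega> k g (wd \<Omega> k g)" by (simp_all add: L2_iff_sq_int)
qed

lemma H1_sq: "H1 \<Omega> g \<Longrightarrow> sq_int M g" by (simp add: H1_def L2_iff_sq_int)

lemma is_wderiv_diff:
  assumes "sq_int M f" "sq_int M g" "sq_int M f'" "sq_int M g'" "is_wderiv \<Omega> k f f'" "is_wderiv \<Omega> k g g'"
  shows "is_wderiv \<Omega> k (\<lambda>x. f x - g x) (\<lambda>x. f' x - g' x)"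
  unfolding is_wderiv_def
proof (intro allI impI)
  fix \<phi> assume \<phi>: "test_fun \<Omega> \<phi>"
  note i = sq_int_integrable_mult[OF _ test_sq_pd[OF \<phi>]] sq_int_integrable_mult[OF _ test_sq[OF \<phi>]]
  have "(\<integral>x. (f x - g x) * pd k \<phi> x \<partial>M) = (\<integral>x. f x * pd k \<phi> x \<partial>M) - (\<integral>x. g x * pd k \<phi> x \<partial>M)"
    unfolding left_diff_distrib by (rule Bochner_Integration.integral_diff[OF i(1)[OF assms(1)] i(1)[OF assms(2)]])
  also have "\<dots> = - (\<integral>x. f' x * \<phi> x \<partial>M) + (\<integral>x. g' x * \<phi> x \<partial>M)" using assms(5,6) \<phi> unfolding is_wderiv_def by simp
  also have "\<dots> = - (\<integral>x. (f' x - g' x) * \<phi> x \<partial>M)" unfolding left_diff_distrib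
    by (subst Bochner_Integration.integral_diff[OF i(2)[OF assms(3)] i(2)[OF assms(4)]]) simp
  finally show "(\<integral>x. (f x - g x) * pd k \<phi> x \<partial>M) = - (\<integral>x. (f' x - g' x) * \<phi> x \<partial>M)" .
qed

lemma n2_le_H1norm: "n2 M (wd \<Omega> k u) \<le> H1norm \<Omega> u"
proof -
  have "(n2 M (wd \<Omega> k u))\<^sup>2 \<le> (\<Sum>i\<in>UNIV. (n2 M (wd \<Omega> i u))\<^sup>2)" by (rule member_le_sum) auto
  also have "\<dots> \<le> (n2 M u)\<^sup>2 + (\<Sum>i\<in>UNIV. (n2 M (wd \<Omega> i u))\<^sup>2)" by simp
  finally show ?thesis unfolding H1norm_def n2_sq[symmetric] by (rule real_le_rsqrt)
qed

lemma n2_le_vH2norm: "n2 M (wd \<Omega> k (wd \<Omega> j (vcomp u i))) \<le> vH2norm \<Omega> u"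
proof -
  have "n2 M (wd \<Omega> k (wd \<Omega> j v)) \<le> H2norm \<Omega> v" for v
  proof -
    have "(n2 M (wd \<Omega> k (wd \<Omega> j v)))\<^sup>2 \<le> (\<Sum>k\<in>UNIV. (n2 M (wd \<Omega> k (wd \<Omega> j v)))\<^sup>2)" by (rule member_le_sum) auto
    also have "\<dots> \<le> (\<Sum>j\<in>UNIV. \<Sum>k\<in>UNIV. (n2 M (wd \<Omega> k (wd \<Omega> j v)))\<^sup>2)"
      by (rule member_le_sum[of j UNIV "\<lambda>j. \<Sum>k\<in>UNIV. (n2 M (wd \<Omega> k (wd \<Omega> j v)))\<^sup>2"]) (auto intro: sum_nonneg)
    also have "\<dots> \<le> (n2 M v)\<^sup>2 + (\<Sum>i\<in>UNIV. (n2 M (wd \<Omega> i v))\<^sup>2) + (\<Sum>j\<in>UNIV. \<Sum>k\<in>UNIV. (n2 M (wd \<Omega> k (wd \<Omega> j v)))\<^sup>2)"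
      by (simp add: sum_nonneg)
    finally show ?thesis unfolding H2norm_def n2_sq[symmetric] by (rule real_le_rsqrt)
  qed
  also have "H2norm \<Omega> (vcomp u i) \<le> vH2norm \<Omega> u"
    unfolding vH2norm_def by (rule real_le_rsqrt, rule member_le_sum) auto
  finally show ?thesis .
qed

text \<open>\<open>wd\<close> is a choice, so the derivative of the difference that occurs in
  \<open>H1norm\<close> has to be identified almost everywhere with the difference of derivatives;
  \<open>wderiv_unique\<close> does this.\<close>

lemma H10_seq:
  assumes "H10 \<Omega> u"
  shows "\<exists>\<phi>. (\<forall>n. test_fun \<Omega> (\<phi> n)) \<and> (\<forall>k. (\<lambda>n. n2 M (\<lambda>x. pd k (\<phi> n) x - wd \<Omega> k u x)) \<longlonglongrightarrow> 0)"
proof -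
  have u: "H1 \<Omega> u" using assms by (simp add: H10_def)
  obtain \<phi> where \<phi>: "\<And>n. test_fun \<Omega> (\<phi> n)" "(\<lambda>n. H1norm \<Omega> (\<lambda>x. \<phi> n x - u x)) \<longlonglongrightarrow> 0"
    using assms unfolding H10_def by blast
  have "n2 M (\<lambda>x. pd k (\<phi> n) x - wd \<Omega> k u x) \<le> H1norm \<Omega> (\<lambda>x. \<phi> n x - u x)" for k n
  proof -
    let ?w = "\<lambda>x. \<phi> n x - u x" and ?g = "\<lambda>k x. pd k (\<phi> n) x - wd \<Omega> k u x"
    have g: "sq_int M (?g k)" "is_wderiv \<Omega> k ?w (?g k)" for k
      by (rule sq_int_diff[OF test_sq_pd[OF \<phi>(1)] H1_wd(1)[OF u]])
        (rule is_wderiv_diff[OF test_sq[OF \<phi>(1)] H1_sq[OF u] test_sq_pd[OF \<phi>(1)] H1_wd(1)[OF u] test_wderiv[OF \<phi>(1)] H1_wd(2)[OF u]])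
    have "sq_int M ?w" by (rule sq_int_diff[OF test_sq[OF \<phi>(1)] H1_sq[OF u]])
    then have w: "H1 \<Omega> ?w" unfolding H1_def L2_iff_sq_int using g by blast
    have "AE x in M. ?g k x = wd \<Omega> k ?w x" by (rule wderiv_unique[OF g(1) H1_wd(1)[OF w] g(2) H1_wd(2)[OF w]])
    then have "n2 M (?g k) = n2 M (wd \<Omega> k ?w)"
      by (rule n2_cong_AE[OF _ sq_int_measurable[OF g(1)] sq_int_measurable[OF H1_wd(1)[OF w]]])
    then show ?thesis using n2_le_H1norm[of k ?w] by simp
  qed
  then have "(\<lambda>n. n2 M (\<lambda>x. pd k (\<phi> n) x - wd \<Omega> k u x)) \<longlonglongrightarrow> 0" for k by (intro Lim_null_comparison[OF _ \<phi>(2)]) simp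
  then show ?thesis using \<phi>(1) by blast
qed

end

context mesh
begin

lemma kint_wdiv_gm:
  assumes vb: "Vh vb" and K: "K \<in> T"
  shows "kint K (\<lambda>x. wdiv K (v0 K) vb x) = (\<Sum>i\<in>UNIV. kint K (gm v0 vb (K, (i, i))))"
proof -
  obtain a b c where "tri K a b c" using K by (rule mesh_tri)
  then interpret t: tri K a b c .
  have "continuous_on e (vb e)" if e: "e \<in> tri_edges K" for e
  proof -
    have "continuous_on e (\<lambda>x. \<chi> i. vb e x $ i)"
    proof (rule continuous_on_vec_lambda)
      fix i
      have "Sh (\<lambda>e y. vb e y $ i)" using vb by (simp add: Vh_def)
      then show "continuous_on e (\<lambda>x. vb e x $ i)" using affine_on_cont Sh_affine[OF _ K e] by blast
    qed
    then show ?thesis by (simp only: vec_nth_inverse)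
  qed
  then have "t.cb vb" by (simp add: t.cb_def)
  then have "kint K (\<lambda>x. wdiv K (v0 K) vb x) = kint K (\<lambda>x. \<Sum>i\<in>UNIV. gm v0 vb (K, (i, i)) x)"
    by (simp add: t.kint_wdiv_trace gm_def)
  also have "\<dots> = (\<Sum>i\<in>UNIV. kint K (gm v0 vb (K, (i, i))))"
    unfolding kint_def by (rule Bochner_Integration.integral_sum)
      (intro cont_integrable_compact gm_cont vb K mesh_compact)
  finally show ?thesis .
qed

lemma Poincare_mesh_H1:
  assumes g: "H1 \<Omega> g" and b: "\<And>k. n2 M (wd \<Omega> k g) \<le> b"
  shows "L2_set (\<lambda>K. nK K (\<lambda>x. g x - mean g K)) T \<le> 4 * h * b"
proof -
  have "L2_set (\<lambda>K. nK K (\<lambda>x. g x - mean g K)) T \<le> 2 * h * (\<Sum>k\<in>UNIV. n2 M (wd \<Omega> k g))"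
    by (rule Poincare_mesh[OF H1_sq[OF g] H1_wd[OF g]])
  also have "\<dots> \<le> 2 * h * (\<Sum>k\<in>(UNIV :: 2 set). b)" using h_nonneg by (intro mult_left_mono sum_mono b) auto
  finally show ?thesis by simp
qed

lemma is_wderiv_0: "is_wderiv \<Omega> k (\<lambda>x. 0) (\<lambda>x. 0)" by (simp add: is_wderiv_def)

text \<open>For each component \<open>i\<close>, \<open>consistency\<close> is applied to row
  \<open>i\<close> of the stress \<open>grad u - p I\<close>. By the Stokes equation its divergence
  is minus component \<open>i\<close> of \<open>f\<close>, which cancels the right-hand side of the
  scheme. Passing from \<open>p\<close> to its cell means then costs \<open>Z\<close>.\<close>

lemma residual:
  assumes f: "\<And>j. L2 \<Omega> (vcomp f j)" and st: "stokes_solution \<Omega> f u p" and uh: "Vh uhb"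
    and scheme: "wg_scheme \<Omega> T f uh0 uhb ph" and vb: "Vh vb"
  defines "U \<equiv> \<lambda>q. wd \<Omega> (fst q) (vcomp u (snd q))"
  shows "\<bar>bip' (\<lambda>q x. gm uh0 uhb q x - bf U q x) (gm v0 vb) - bt (\<lambda>K. ph K - mean p K) (gm v0 vb)\<bar>
    \<le> (8 * (72 * \<kappa> + 2) + 8) * h * (vH2norm \<Omega> u + H1norm \<Omega> p) * bnm (gm v0 vb)"
proof -
  let ?W = "gm v0 vb" and ?G = "gm uh0 uhb"
  let ?z = "\<lambda>i K. kint K (\<lambda>x. ?W (K, (i, i)) x * (p x - mean p K))"
  define c where "c = 72 * \<kappa> + 2"
  define V where "V = vH2norm \<Omega> u"
  define \<theta> where "\<theta> = H1norm \<Omega> p"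
  have H1u: "H1 \<Omega> (vcomp u i)" "H1 \<Omega> (U (j, i))" for i j using st by (auto simp: stokes_solution_def H2_def U_def)
  have H1p: "H1 \<Omega> p" using st by (simp add: stokes_solution_def)
  have eq: "AE x in M. - (\<Sum>j\<in>UNIV. wd \<Omega> j (U (j, i)) x) + wd \<Omega> i p x = f x $ i" for i
    using st by (simp add: stokes_solution_def U_def)
  have Usq: "sq_int M (U q)" for q using H1_sq[OF H1u(2)] by (cases q) auto
  have Vb: "n2 M (wd \<Omega> k (U (j, i))) \<le> V" for i j k unfolding U_def V_def using n2_le_vH2norm by simp
  have \<theta>b: "n2 M (wd \<Omega> k p) \<le> \<theta>" for k unfolding \<theta>_def by (rule n2_le_H1norm)
  have V0: "0 \<le> V" "0 \<le> \<theta>" using Vb[of 1 1 1] \<theta>b[of 1] n2_nonneg order_trans by blast+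
  have c0: "0 \<le> c" using \<kappa> by (simp add: c_def)
  have h0: "0 \<le> h" by (rule h_nonneg)
  note sW = gm_sqs[OF vb, of v0] and sG = gm_sqs[OF uh, of uh0]
  have sU: "bsq (bf U)" by (rule bf_sqs[OF Usq])
  have Wsq: "sq_int (lebesgue_on K) (?W (K, q))" if "K \<in> T" for K q by (intro mesh_cont_sq gm_cont vb that)
  have fsq: "sq_int M (\<lambda>x. f x $ i)" for i using f[of i] by (simp add: L2_iff_sq_int vcomp_def)
  define Rh where "Rh i = (\<Sum>K\<in>T. v0 K $ i * kint K (\<lambda>x. f x $ i))" for i
  have sch: "bip' ?G ?W - bt ph ?W = (\<Sum>i\<in>UNIV. Rh i)"
  proof -
    have "in_Vh \<Omega> T v0 vb" using vb in_Vh_iff by blast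
    then have s: "(\<Sum>K\<in>T. kint K (\<lambda>x. \<Sum>i\<in>UNIV. wgradv K (uh0 K) uhb x $ i \<bullet> wgradv K (v0 K) vb x $ i))
        - (\<Sum>K\<in>T. kint K (\<lambda>x. ph K * wdiv K (v0 K) vb x)) = (\<Sum>K\<in>T. kint K (\<lambda>x. f x \<bullet> v0 K))"
      using scheme unfolding wg_scheme_def by blast
    have 1: "kint K (\<lambda>x. \<Sum>i\<in>UNIV. wgradv K (uh0 K) uhb x $ i \<bullet> wgradv K (v0 K) vb x $ i)
        = (\<Sum>q\<in>UNIV. kint K (\<lambda>x. ?G (K, q) x * ?W (K, q) x))" if K: "K \<in> T" for K
    proof -
      have "(\<Sum>i\<in>UNIV. wgradv K (uh0 K) uhb x $ i \<bullet> wgradv K (v0 K) vb x $ i) = (\<Sum>q\<in>UNIV. ?G (K, q) x * ?W (K, q) x)" for x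
        unfolding sum22 gm_def inner_vec_def by simp
      moreover have "integrable (lebesgue_on K) (\<lambda>x. ?G (K, q) x * ?W (K, q) x)" for q
        by (intro cont_integrable_compact continuous_on_mult gm_cont vb uh K mesh_compact)
      ultimately show ?thesis by (simp add: kint_def)
    qed
    have 2: "kint K (\<lambda>x. ph K * wdiv K (v0 K) vb x) = ph K * (\<Sum>i\<in>UNIV. kint K (?W (K, (i, i))))" if K: "K \<in> T" for K
      using kint_wdiv_gm[OF vb K, of v0] by (simp add: kint_def)
    have 3: "kint K (\<lambda>x. f x \<bullet> v0 K) = (\<Sum>i\<in>UNIV. v0 K $ i * kint K (\<lambda>x. f x $ i))" if K: "K \<in> T" for K
    proof -
      have "integrable (lebesgue_on K) (\<lambda>x. f x $ i)" for i by (rule mesh_integrable[OF sq_int_integrable[OF fsq] K])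
      then show ?thesis by (simp add: kint_def inner_vec_def mult.commute)
    qed
    have "(\<Sum>K\<in>T. kint K (\<lambda>x. f x \<bullet> v0 K)) = (\<Sum>K\<in>T. \<Sum>i\<in>UNIV. v0 K $ i * kint K (\<lambda>x. f x $ i))"
      by (rule sum.cong[OF refl 3])
    also have "\<dots> = (\<Sum>i\<in>UNIV. Rh i)" unfolding Rh_def by (rule sum.swap)
    finally have r3: "(\<Sum>K\<in>T. kint K (\<lambda>x. f x \<bullet> v0 K)) = (\<Sum>i\<in>UNIV. Rh i)" .
    have r1: "(\<Sum>K\<in>T. kint K (\<lambda>x. \<Sum>i\<in>UNIV. wgradv K (uh0 K) uhb x $ i \<bullet> wgradv K (v0 K) vb x $ i)) = bip' ?G ?W"
      unfolding bip by (rule sum.cong[OF refl 1])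
    have r2: "(\<Sum>K\<in>T. kint K (\<lambda>x. ph K * wdiv K (v0 K) vb x)) = bt ph ?W"
      unfolding bt_def by (rule sum.cong[OF refl 2])
    show ?thesis using s unfolding r1 r2 r3 .
  qed
  let ?w = "\<lambda>i. wg (\<lambda>K. v0 K $ i) (\<lambda>e y. vb e y $ i)"
  \<comment> \<open>The entries of \<open>p I\<close> and their derivatives, so that every entry of
    the stress has a designated weak derivative.\<close>
  define P where "P i j = (if i = j then p else (\<lambda>x. 0))" for i j :: 2
  define P' where "P' i j k = (if i = j then wd \<Omega> k p else (\<lambda>x. 0))" for i j k :: 2
  have P: "sq_int M (P i j)" "sq_int M (P' i j k)" "is_wderiv \<Omega> k (P i j) (P' i j k)" "n2 M (P' i j k) \<le> \<theta>" for i j k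
    using H1_sq[OF H1p] H1_wd[OF H1p] is_wderiv_0 \<theta>b V0(2) by (auto simp: P_def P'_def n2_def)
  define s where "s i j x = U (j, i) x - P i j x" for i j x
  let ?s = "\<lambda>i. ip (T \<times> UNIV) BM (?w i) (\<lambda>(K, j). s i j)"
  define g where "g i j k x = wd \<Omega> k (U (j, i)) x - P' i j k x" for i j k x
  have ssq: "sq_int M (s i j)" for i j unfolding s_def by (rule sq_int_diff[OF Usq P(1)])
  have gsq: "sq_int M (g i j k)" for i j k unfolding g_def by (rule sq_int_diff[OF H1_wd(1)[OF H1u(2)] P(2)])
  have gw: "is_wderiv \<Omega> k (s i j) (g i j k)" for i j k
    unfolding s_def g_def by (rule is_wderiv_diff[OF Usq P(1) H1_wd(1)[OF H1u(2)] P(2) H1_wd(2)[OF H1u(2)] P(3)])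
  have gn: "n2 M (g i j k) \<le> V + \<theta>" for i j k
    unfolding g_def using n2_triangle_diff[OF H1_wd(1)[OF H1u(2)] P(2), of k j i i j k] Vb[of k j i] P(4)[of i j k] by linarith
  have cons: "\<bar>?s i - Rh i\<bar> \<le> c * h * bnm ?W * (4 * (V + \<theta>))" for i
  proof -
    have Shi: "Sh (\<lambda>e y. vb e y $ i)" using vb by (simp add: Vh_def)
    have dv: "(\<Sum>j\<in>UNIV. kint K (g i j j)) = - kint K (\<lambda>x. f x $ i)" if K: "K \<in> T" for K
    proof -
      have "(\<Sum>j\<in>UNIV. kint K (g i j j)) = (\<integral>x. (\<Sum>j\<in>UNIV. g i j j x) \<partial>lebesgue_on K)"
        unfolding kint_def by (rule Bochner_Integration.integral_sum[symmetric])
          (rule mesh_integrable[OF sq_int_integrable[OF gsq] K])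
      also have "\<dots> = (\<integral>x. - (f x $ i) \<partial>lebesgue_on K)"
      proof (rule integral_cong_AE)
        have P1: "(\<Sum>j\<in>UNIV. P' i j j x) = wd \<Omega> i p x" for x
        proof -
          have "(\<Sum>j\<in>UNIV. P' i j j x) = (\<Sum>j\<in>UNIV. if i = j then wd \<Omega> j p x else 0)"
            unfolding P'_def by (rule sum.cong) auto
          then show ?thesis by simp
        qed
        show "AE x in lebesgue_on K. (\<Sum>j\<in>UNIV. g i j j x) = - (f x $ i)"
          using mesh_AE[OF eq K, of i] by eventually_elim (simp add: g_def sum_subtractf P1)
        show "(\<lambda>x. \<Sum>j\<in>UNIV. g i j j x) \<in> borel_measurable (lebesgue_on K)"
          by (rule borel_measurable_sum) (rule sq_int_measurable[OF mesh_sq[OF gsq K]])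
        show "(\<lambda>x. - (f x $ i)) \<in> borel_measurable (lebesgue_on K)"
          by (rule borel_measurable_uminus[OF sq_int_measurable[OF mesh_sq[OF fsq K]]])
      qed
      finally show ?thesis by (simp add: kint_def)
    qed
    have "\<bar>?s i - Rh i\<bar>
        = \<bar>(\<Sum>K\<in>T. v0 K $ i * (\<Sum>j\<in>UNIV. kint K (g i j j))) + ?s i\<bar>" by (simp add: dv Rh_def sum_negf)
    also have "\<dots> \<le> c * h * nm (T \<times> UNIV) BM (?w i) * (\<Sum>j\<in>UNIV. \<Sum>k\<in>UNIV. n2 M (g i j k))"
      unfolding c_def by (rule consistency[OF Shi ssq gsq gw])
    also have "\<dots> \<le> c * h * bnm ?W * (4 * (V + \<theta>))"
    proof (intro mult_mono mult_nonneg_nonneg wg_le_gm order_refl c0 h0 nm_nonneg sum_nonneg n2_nonneg)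
      have "(\<Sum>j\<in>UNIV. \<Sum>k\<in>UNIV. n2 M (g i j k)) \<le> (\<Sum>j\<in>(UNIV::2 set). \<Sum>k\<in>(UNIV::2 set). V + \<theta>)" by (intro sum_mono gn)
      then show "(\<Sum>j\<in>UNIV. \<Sum>k\<in>UNIV. n2 M (g i j k)) \<le> 4 * (V + \<theta>)" by simp
    qed
    finally show ?thesis .
  qed
  \<comment> \<open>The weak gradient is affine on a cell, so pairing it with \<open>p\<close> and
    with the cell mean of \<open>p\<close> may differ; the difference is of first order by the
    Poincare inequality.\<close>
  define Z where "Z = (\<Sum>i\<in>UNIV. \<Sum>K\<in>T. ?z i K)"
  have psq: "sq_int M p" by (rule H1_sq[OF H1p])
  have split: "(\<Sum>i\<in>UNIV. ?s i) = bip' ?W (bf U) - (bt (mean p) ?W + Z)"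
  proof -
    have K1: "(\<Sum>j\<in>UNIV. kint K (\<lambda>x. ?w i (K, j) x * s i j x))
        = (\<Sum>j\<in>UNIV. kint K (\<lambda>x. ?W (K, (j, i)) x * U (j, i) x)) - kint K (\<lambda>x. ?W (K, (i, i)) x * p x)" if K: "K \<in> T" for K i
    proof -
      have "kint K (\<lambda>x. ?w i (K, j) x * s i j x) = kint K (\<lambda>x. ?W (K, (j, i)) x * U (j, i) x) - kint K (\<lambda>x. ?W (K, (j, i)) x * P i j x)" for j
        unfolding gm_wg[symmetric] s_def right_diff_distrib kint_def by (rule Bochner_Integration.integral_diff)
          (rule sq_int_integrable_mult[OF Wsq[OF K] mesh_sq[OF Usq K]], rule sq_int_integrable_mult[OF Wsq[OF K] mesh_sq[OF P(1) K]])
      moreover have "(\<Sum>j\<in>UNIV. kint K (\<lambda>x. ?W (K, (j, i)) x * P i j x)) = kint K (\<lambda>x. ?W (K, (i, i)) x * p x)"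
      proof -
        have "(\<Sum>j\<in>UNIV. kint K (\<lambda>x. ?W (K, (j, i)) x * P i j x)) = (\<Sum>j\<in>UNIV. if i = j then kint K (\<lambda>x. ?W (K, (j, i)) x * p x) else 0)"
          by (rule sum.cong) (auto simp: P_def kint_def)
        then show ?thesis by simp
      qed
      ultimately show ?thesis by (simp add: sum_subtractf)
    qed
    have K2: "kint K (\<lambda>x. ?W (K, (i, i)) x * p x) = mean p K * kint K (?W (K, (i, i))) + ?z i K" if K: "K \<in> T" for K i
    proof -
      have "kint K (\<lambda>x. ?W (K, (i, i)) x * p x) = kint K (\<lambda>x. mean p K * ?W (K, (i, i)) x + ?W (K, (i, i)) x * (p x - mean p K))"
        by (simp add: algebra_simps)
      also have "\<dots> = kint K (\<lambda>x. mean p K * ?W (K, (i, i)) x) + ?z i K" unfolding kint_def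
      proof (rule Bochner_Integration.integral_add)
        show "integrable (lebesgue_on K) (\<lambda>x. mean p K * ?W (K, (i, i)) x)"
          by (rule sq_int_imp_integrable[OF mesh_fin[OF K] sq_int_cmult[OF Wsq[OF K]]])
        show "integrable (lebesgue_on K) (\<lambda>x. ?W (K, (i, i)) x * (p x - mean p K))"
          by (rule sq_int_integrable_mult[OF Wsq[OF K] sq_int_diff[OF mesh_sq[OF psq K] const_sq[OF K]]])
      qed
      finally show ?thesis by (simp add: kint_def)
    qed
    have "(\<Sum>i\<in>UNIV. ?s i)
        = (\<Sum>i\<in>UNIV. \<Sum>K\<in>T. \<Sum>j\<in>UNIV. kint K (\<lambda>x. ?W (K, (j, i)) x * U (j, i) x)) - (\<Sum>i\<in>UNIV. \<Sum>K\<in>T. kint K (\<lambda>x. ?W (K, (i, i)) x * p x))"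
      unfolding bip prod.case by (simp add: K1 sum_subtractf)
    also have "(\<Sum>i\<in>UNIV. \<Sum>K\<in>T. \<Sum>j\<in>UNIV. kint K (\<lambda>x. ?W (K, (j, i)) x * U (j, i) x)) = bip' ?W (bf U)"
      unfolding bip sum22 bf_def prod.case by (rule sum.swap)
    also have "(\<Sum>i\<in>UNIV. \<Sum>K\<in>T. kint K (\<lambda>x. ?W (K, (i, i)) x * p x)) = (\<Sum>i\<in>UNIV. \<Sum>K\<in>T. mean p K * kint K (?W (K, (i, i)))) + Z"
      unfolding Z_def by (simp add: K2 sum.distrib)
    also have "(\<Sum>i\<in>UNIV. \<Sum>K\<in>T. mean p K * kint K (?W (K, (i, i)))) = bt (mean p) ?W"
      unfolding bt_def by (subst sum.swap) (simp add: sum_distrib_left)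
    finally show ?thesis .
  qed
  have Zb: "\<bar>Z\<bar> \<le> 8 * h * \<theta> * bnm ?W"
  proof -
    let ?n = "\<lambda>K. nK K (\<lambda>x. p x - mean p K)"
    have Po: "L2_set ?n T \<le> 4 * h * \<theta>" by (rule Poincare_mesh_H1[OF H1p \<theta>b])
    have "\<bar>\<Sum>K\<in>T. ?z i K\<bar> \<le> bnm ?W * (4 * h * \<theta>)" for i
    proof -
      have "\<bar>\<Sum>K\<in>T. ?z i K\<bar> \<le> (\<Sum>K\<in>T. \<bar>nK K (?W (K, (i, i)))\<bar> * \<bar>?n K\<bar>)"
      proof (rule order_trans[OF sum_abs sum_mono])
        fix K assume K: "K \<in> T"
        show "\<bar>?z i K\<bar> \<le> \<bar>nK K (?W (K, (i, i)))\<bar> * \<bar>?n K\<bar>"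
          using n2_CS[OF Wsq[OF K] sq_int_diff[OF mesh_sq[OF psq K] const_sq[OF K]]] by (simp add: kint_def)
      qed
      also have "\<dots> \<le> L2_set (\<lambda>K. nK K (?W (K, (i, i)))) T * L2_set ?n T" by (rule L2_set_mult_ineq)
      also have "\<dots> \<le> bnm ?W * (4 * h * \<theta>)" by (intro mult_mono L2_le_bnm Po) auto
      finally show ?thesis .
    qed
    then have "(\<Sum>i\<in>UNIV. \<bar>\<Sum>K\<in>T. ?z i K\<bar>) \<le> (\<Sum>i\<in>(UNIV :: 2 set). bnm ?W * (4 * h * \<theta>))" by (intro sum_mono)
    then show ?thesis unfolding Z_def by (intro order_trans[OF sum_abs]) (simp add: algebra_simps)
  qed
  have "bt (\<lambda>K. ph K - mean p K) ?W = bt ph ?W - bt (mean p) ?W"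
    unfolding bt_def by (simp add: left_diff_distrib sum_subtractf)
  then have "bip' (\<lambda>q x. ?G q x - bf U q x) ?W - bt (\<lambda>K. ph K - mean p K) ?W
      = - ((\<Sum>i\<in>UNIV. ?s i) - (\<Sum>i\<in>UNIV. Rh i)) - Z"
    using split sch by (simp add: ip_diff_left[OF sG sU sW] ip_sym[of _ _ "bf U"])
  also have "\<dots> = - (\<Sum>i\<in>UNIV. ?s i - Rh i) - Z" by (simp add: sum_subtractf)
  finally have "\<bar>bip' (\<lambda>q x. ?G q x - bf U q x) ?W - bt (\<lambda>K. ph K - mean p K) ?W\<bar>
      \<le> (\<Sum>i\<in>UNIV. \<bar>?s i - Rh i\<bar>) + \<bar>Z\<bar>" using sum_abs[of "\<lambda>i. ?s i - Rh i" UNIV] by linarith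
  \<comment> \<open>Two rows with four derivatives of the stress each give the factor
    \<open>8\<close> of \<open>c\<close>; the other \<open>8\<close> is the pressure term.\<close>
  also have "\<dots> \<le> (\<Sum>i\<in>(UNIV :: 2 set). c * h * bnm ?W * (4 * (V + \<theta>))) + 8 * h * \<theta> * bnm ?W"
    by (intro add_mono sum_mono cons Zb)
  also have "\<dots> \<le> (8 * c + 8) * h * (V + \<theta>) * bnm ?W"
  proof -
    have "0 \<le> 8 * h * V * bnm ?W" using h0 V0 by simp
    then show ?thesis by (simp add: algebra_simps)
  qed
  finally show ?thesis unfolding c_def V_def \<theta>_def .
qed

text \<open>The factor \<open>4 + 4 * B\<close> collects \<open>3 E\<close> for the gradient,
  \<open>E\<close> for replacing the pressure by its cell averages and \<open>4 B E\<close> for the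
  remaining discrete pressure error.\<close>

lemma mesh_error:
  assumes f: "\<And>j. L2 \<Omega> (vcomp f j)" and st: "stokes_solution \<Omega> f u p" and uh: "in_Vh \<Omega> T uh0 uhb"
    and ph: "in_Mh T ph" and scheme: "wg_scheme \<Omega> T f uh0 uhb ph" and B: "0 \<le> B"
    and infsup: "\<And>q S. sq_int M q \<Longrightarrow> integral\<^sup>L M q = 0 \<Longrightarrow> 0 \<le> S
      \<Longrightarrow> (\<And>v. vtest v \<Longrightarrow> \<bar>\<integral>x. q x * dv v x \<partial>M\<bar> \<le> S * gnm (gr v)) \<Longrightarrow> n2 M q \<le> B * S"
  shows "err_grad \<Omega> T u uh0 uhb + err_p T p ph
    \<le> (4 + 4 * B) * (8 * (72 * \<kappa> + 2) + 24) * h * (vH2norm \<Omega> u + H1norm \<Omega> p)"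
proof -
  define U where "U q = wd \<Omega> (fst q) (vcomp u (snd q))" for q
  define V where "V = vH2norm \<Omega> u"
  define \<theta> where "\<theta> = H1norm \<Omega> p"
  \<comment> \<open>One quantity that dominates the residual bound and the Poincare terms
    \<open>16 h V\<close> and \<open>4 h \<theta>\<close> at once.\<close>
  define E where "E = (8 * (72 * \<kappa> + 2) + 24) * h * (V + \<theta>)"
  define \<rho> where "\<rho> K = ph K - mean p K" for K
  have Vh: "Vh uhb" using uh in_Vh_iff by blast
  have H1u: "H1 \<Omega> (U q)" for q using st by (auto simp: stokes_solution_def H2_def U_def)
  have H1p: "H1 \<Omega> p" using st by (simp add: stokes_solution_def)
  have Usq: "sq_int M (U q)" for q by (rule H1_sq[OF H1u])
  have psq: "sq_int M p" by (rule H1_sq[OF H1p])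
  have Vb: "n2 M (wd \<Omega> k (U q)) \<le> V" for k q unfolding U_def V_def by (rule n2_le_vH2norm)
  have \<theta>b: "n2 M (wd \<Omega> k p) \<le> \<theta>" for k unfolding \<theta>_def by (rule n2_le_H1norm)
  have V0: "0 \<le> V" "0 \<le> \<theta>" using Vb \<theta>b n2_nonneg order_trans by blast+
  have h0: "0 \<le> h" by (rule h_nonneg)
  have Eb: "a * h * (V + \<theta>) \<le> E" if "a \<le> 8 * (72 * \<kappa> + 2) + 24" for a
    unfolding E_def using that h0 V0 by (intro mult_right_mono) auto
  have E0: "0 \<le> E" using Eb[of 0] \<kappa> by simp
  have res: "\<bar>bip' (\<lambda>q x. gm uh0 uhb q x - bf U q x) (gm v0 vb) - bt \<rho> (gm v0 vb)\<bar> \<le> E * bnm (gm v0 vb)" if vb: "Vh vb" for v0 vb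
  proof -
    have "\<bar>bip' (\<lambda>q x. gm uh0 uhb q x - bf U q x) (gm v0 vb) - bt \<rho> (gm v0 vb)\<bar>
        \<le> (8 * (72 * \<kappa> + 2) + 8) * h * (V + \<theta>) * bnm (gm v0 vb)"
      unfolding U_def[abs_def] \<rho>_def[abs_def] V_def \<theta>_def by (rule residual[OF f st Vh scheme vb])
    also have "\<dots> \<le> E * bnm (gm v0 vb)" by (intro mult_right_mono Eb nm_nonneg) simp
    finally show ?thesis .
  qed
  \<comment> \<open>Both pressures have mean zero, so \<open>\<rho>\<close> belongs to
    \<open>M_h\<close> and may be used in the second equation of the scheme.\<close>
  have \<rho>0: "(\<Sum>K\<in>T. measure lebesgue K * \<rho> K) = 0"
  proof -
    have "measure lebesgue K * \<rho> K = measure lebesgue K * ph K - kint K p" if "K \<in> T" for K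
      using mesh_area[OF that] by (simp add: \<rho>_def mean_def right_diff_distrib)
    then have "(\<Sum>K\<in>T. measure lebesgue K * \<rho> K) = (\<Sum>K\<in>T. measure lebesgue K * ph K) - (\<Sum>K\<in>T. kint K p)"
      by (simp add: sum_subtractf)
    then show ?thesis using ph st mesh_sum[OF sq_int_integrable[OF psq]] by (simp add: in_Mh_def stokes_solution_def)
  qed
  have divuh: "bt \<rho> (gm uh0 uhb) = 0"
  proof -
    have "(\<Sum>K\<in>T. kint K (\<lambda>x. wdiv K (uh0 K) uhb x * \<rho> K)) = 0"
      using scheme \<rho>0 unfolding wg_scheme_def in_Mh_def by blast
    moreover have "kint K (\<lambda>x. wdiv K (uh0 K) uhb x * \<rho> K) = \<rho> K * (\<Sum>i\<in>UNIV. kint K (gm uh0 uhb (K, (i, i))))" if "K \<in> T" for K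
      unfolding kint_wdiv_gm[OF Vh that, of uh0, symmetric] by (simp add: kint_def)
    ultimately show ?thesis by (simp add: bt_def)
  qed
  have divU: "AE x in M. (\<Sum>i\<in>UNIV. U (i, i) x) = 0" using st by (simp add: stokes_solution_def U_def)
  have "\<exists>\<phi>. \<forall>j. (\<forall>n. test_fun \<Omega> (\<phi> j n)) \<and> (\<forall>k. (\<lambda>n. n2 M (\<lambda>x. pd k (\<phi> j n) x - wd \<Omega> k (vcomp u j) x)) \<longlonglongrightarrow> 0)"
    by (rule choice) (use H10_seq st in \<open>auto simp: stokes_solution_def\<close>)
  then obtain \<phi> where \<phi>: "\<And>j n. test_fun \<Omega> (\<phi> j n)"
    "\<And>j k. (\<lambda>n. n2 M (\<lambda>x. pd k (\<phi> j n) x - wd \<Omega> k (vcomp u j) x)) \<longlonglongrightarrow> 0" by blast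
  have \<phi>1: "\<And>n. vtest (\<lambda>j. \<phi> j n)" using \<phi>(1) by blast
  have \<phi>2: "(\<lambda>n. n2 M (\<lambda>x. gr (\<lambda>j. \<phi> j n) q x - U q x)) \<longlonglongrightarrow> 0" for q unfolding gr_def U_def by (rule \<phi>(2))
  have e0: "bnm (\<lambda>q x. bf U q x - mean (U (snd q)) (fst q)) \<le> E"
  proof -
    have "L2_set (\<lambda>K. nK K (\<lambda>x. U q x - mean (U q) K)) T \<le> 4 * h * V" for q by (rule Poincare_mesh_H1[OF H1u Vb])
    then have "(\<Sum>q\<in>UNIV. L2_set (\<lambda>K. nK K (\<lambda>x. U q x - mean (U q) K)) T) \<le> (\<Sum>q\<in>(UNIV :: (2 \<times> 2) set). 4 * h * V)"
      by (intro sum_mono)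
    also have "\<dots> = 16 * h * V" by (simp add: sum22)
    also have "\<dots> \<le> 16 * h * (V + \<theta>)" using h0 V0 by (intro mult_left_mono) auto
    also have "\<dots> \<le> E" using \<kappa> by (intro Eb) simp
    finally show ?thesis using bnm_le_sum[of "\<lambda>q x. bf U q x - mean (U (snd q)) (fst q)"] by (simp add: bf_def)
  qed
  note en = energy[where U=U and \<phi>="\<lambda>n j. \<phi> j n" and \<rho>=\<rho>, OF Vh Usq E0 res divuh divU \<phi>1 \<phi>2 e0]
  have 1: "err_grad \<Omega> T u uh0 uhb \<le> 3 * E"
  proof -
    have "err_grad \<Omega> T u uh0 uhb = bnm (\<lambda>q x. gm uh0 uhb q x - bf U q x)"
    proof -
      have "kint K (\<lambda>x. \<Sum>i\<in>UNIV. \<Sum>j\<in>UNIV. (wd \<Omega> j (vcomp u i) x - wgradv K (uh0 K) uhb x $ i $ j)\<^sup>2)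
          = (\<Sum>q\<in>UNIV. kint K (\<lambda>x. (gm uh0 uhb (K, q) x - bf U (K, q) x) * (gm uh0 uhb (K, q) x - bf U (K, q) x)))" if K: "K \<in> T" for K
      proof -
        have "sq_int (lebesgue_on K) (\<lambda>x. gm uh0 uhb (K, q) x - bf U (K, q) x)" for q
          by (rule sq_int_diff) (use mesh_cont_sq[OF K gm_cont[OF Vh K]] mesh_sq[OF Usq K] in \<open>auto simp: bf_def\<close>)
        then have i: "integrable (lebesgue_on K) (\<lambda>x. (gm uh0 uhb (K, q) x - bf U (K, q) x) * (gm uh0 uhb (K, q) x - bf U (K, q) x))" for q
          by (intro sq_int_integrable_mult)
        have "(\<Sum>i\<in>UNIV. \<Sum>j\<in>UNIV. (wd \<Omega> j (vcomp u i) x - wgradv K (uh0 K) uhb x $ i $ j)\<^sup>2)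
          = (\<Sum>q\<in>UNIV. (gm uh0 uhb (K, q) x - bf U (K, q) x) * (gm uh0 uhb (K, q) x - bf U (K, q) x))" for x
          unfolding sum22 gm_def bf_def U_def by (intro sum.cong refl) (simp add: power2_eq_square algebra_simps)
        then show ?thesis using i by (simp add: kint_def)
      qed
      then show ?thesis by (simp add: err_grad_def nm_def bip)
    qed
    then show ?thesis using en(1) by simp
  qed
  \<comment> \<open>The bound of \<open>energy\<close> for all test fields is exactly the hypothesis
    of the inf-sup condition for \<open>\<rho>\<close>, read as a function on the domain.\<close>
  have r2: "n2 M (pw \<rho>) \<le> B * (4 * E)"
  proof (rule infsup)
    have "(\<integral>x. pw \<rho> x * 1 \<partial>M) = (\<Sum>K\<in>T. \<rho> K * kint K (\<lambda>x. 1))"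
      by (rule pw_integral) (rule sq_int_cont[OF continuous_on_const])
    also have "\<dots> = 0" using \<rho>0 by (simp add: kint_const_mesh mult.commute)
    finally show "integral\<^sup>L M (pw \<rho>) = 0" by simp
    show "\<bar>\<integral>x. pw \<rho> x * dv v x \<partial>M\<bar> \<le> 4 * E * gnm (gr v)" if v: "vtest v" for v
      unfolding pw_integral[OF dv_sq[OF v]] using en(2) v by blast
  qed (use E0 pw_sq in auto)
  have 2: "err_p T p ph \<le> E + 4 * B * E"
  proof -
    have "err_p T p ph = L2_set (\<lambda>K. nK K (\<lambda>x. p x - ph K)) T" by (simp add: err_p_def L2_set_def n2_sq kint_def)
    also have "\<dots> \<le> L2_set (\<lambda>K. nK K (\<lambda>x. p x - mean p K) + nK K (\<lambda>x. \<rho> K)) T"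
    proof (rule L2_set_mono)
      fix K assume K: "K \<in> T"
      have "nK K (\<lambda>x. p x - ph K) \<le> nK K (\<lambda>x. p x - mean p K) + nK K (\<lambda>x. mean p K - ph K)"
        by (rule n2_triangle3[OF mesh_sq[OF psq K] const_sq[OF K] const_sq[OF K]])
      then show "nK K (\<lambda>x. p x - ph K) \<le> nK K (\<lambda>x. p x - mean p K) + nK K (\<lambda>x. \<rho> K)"
        unfolding \<rho>_def by (simp only: n2_minus_commute[of _ "\<lambda>x. mean p K"])
    qed simp
    also have "\<dots> \<le> L2_set (\<lambda>K. nK K (\<lambda>x. p x - mean p K)) T + L2_set (\<lambda>K. nK K (\<lambda>x. \<rho> K)) T"
      by (rule L2_set_triangle_ineq)
    also have "L2_set (\<lambda>K. nK K (\<lambda>x. p x - mean p K)) T \<le> E"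
    proof -
      have "L2_set (\<lambda>K. nK K (\<lambda>x. p x - mean p K)) T \<le> 4 * h * \<theta>" by (rule Poincare_mesh_H1[OF H1p \<theta>b])
      also have "\<dots> \<le> 4 * h * (V + \<theta>)" using h0 V0 by (simp add: mult_left_mono)
      also have "\<dots> \<le> E" using \<kappa> by (intro Eb) simp
      finally show ?thesis .
    qed
    finally show ?thesis using r2 unfolding pw_n2 by (simp add: algebra_simps)
  qed
  have "err_grad \<Omega> T u uh0 uhb + err_p T p ph \<le> (4 + 4 * B) * E" using 1 2 by (simp add: algebra_simps)
  then show ?thesis by (simp only: E_def V_def \<theta>_def mult.assoc)
qed

end

theorem theorem3p2:
  fixes \<Omega> :: "pt set" and \<sigma> :: real
  assumes "convex_polygon \<Omega>"
  shows "\<exists>C. \<forall>T f u p uh0 uhb ph.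
     conf_triangulation \<Omega> T \<and> shape_regular \<sigma> T
     \<and> (\<forall>j. L2 \<Omega> (vcomp f j))
     \<and> stokes_solution \<Omega> f u p
     \<and> in_Vh \<Omega> T uh0 uhb \<and> in_Mh T ph
     \<and> wg_scheme \<Omega> T f uh0 uhb ph
     \<longrightarrow> err_grad \<Omega> T u uh0 uhb + err_p T p ph
           \<le> C * meshsize T * (vH2norm \<Omega> u + H1norm \<Omega> p)"
proof -
  obtain P x0 where P: "finite P" "\<Omega> = interior (convex hull P)" and x0: "x0 \<in> \<Omega>"
    using assms unfolding convex_polygon_def by blast
  have op: "open \<Omega>" using P(2) by simp
  obtain r where r: "r > 0" "cball x0 r \<subseteq> \<Omega>" using op x0 open_contains_cball by blast
  have "bounded \<Omega>" unfolding P(2)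
    using compact_imp_bounded[OF finite_imp_compact_convex_hull[OF P(1)]] interior_subset by (rule bounded_subset)
  moreover have "convex \<Omega>" unfolding P(2) by (intro convex_interior convex_convex_hull)
  ultimately interpret conv_poly \<Omega> x0 r by unfold_locales (use op r assms in auto)
  \<comment> \<open>\<open>B\<close> depends on the domain only and is fixed before any mesh is
    introduced, which makes the final constant uniform in the mesh size.\<close>
  obtain B where B: "0 \<le> B" "\<And>q S. sq_int M q \<Longrightarrow> integral\<^sup>L M q = 0 \<Longrightarrow> 0 \<le> S
      \<Longrightarrow> (\<And>v. vtest v \<Longrightarrow> \<bar>\<integral>x. q x * dv v x \<partial>M\<bar> \<le> S * gnm (gr v)) \<Longrightarrow> n2 M q \<le> B * S" using inf_sup by blast
  show ?thesis
  proof (intro exI[of _ "(4 + 4 * B) * (8 * (72 * \<sigma>\<^sup>2 + 2) + 24)"] allI impI, elim conjE)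
    fix T f u p uh0 uhb ph
    assume T: "conf_triangulation \<Omega> T" and sh: "shape_regular \<sigma> T" and f: "\<forall>j. L2 \<Omega> (vcomp f j)"
      and st: "stokes_solution \<Omega> f u p" and uh: "in_Vh \<Omega> T uh0 uhb" and ph: "in_Mh T ph"
      and scheme: "wg_scheme \<Omega> T f uh0 uhb ph"
    have "(diameter K)\<^sup>2 \<le> \<sigma>\<^sup>2 * (2 * measure lebesgue K)" if K: "K \<in> T" for K
    proof -
      have "is_triangle K" using T K by (auto simp: conf_triangulation_def)
      then obtain a b c where "ccw K a b c" using is_triangle_ccw by blast
      then have Kc: "compact K" by (rule ccw_compact)
      have "(diameter K)\<^sup>2 \<le> (\<sigma> * inradius K)\<^sup>2"
        using sh K diameter_ge_0[OF compact_imp_bounded[OF Kc]] by (intro power_mono) (auto simp: shape_regular_def)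
      also have "\<dots> \<le> \<sigma>\<^sup>2 * (2 * measure lebesgue K)"
        unfolding power_mult_distrib using inradius_bound(2)[OF compact_lmeasurable[OF Kc]]
        by (intro mult_left_mono) (auto intro: order_trans)
      finally show ?thesis .
    qed
    then interpret m: mesh \<Omega> x0 r T "\<sigma>\<^sup>2" by unfold_locales (use T in auto)
    show "err_grad \<Omega> T u uh0 uhb + err_p T p ph
        \<le> (4 + 4 * B) * (8 * (72 * \<sigma>\<^sup>2 + 2) + 24) * meshsize T * (vH2norm \<Omega> u + H1norm \<Omega> p)"
      by (rule m.mesh_error[OF _ st uh ph scheme B]) (use f in auto)
  qed
qed

end
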